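(* Let $\Omega\subset\mathbb{R}^3$ be a bounded domain with sufficiently smooth boundary, $0<\alpha<1$, $r>0$, and let $Y_{\frac12}:=C([-r,0];D(A^{\frac12}))$ with the sup-norm $\|\varphi\|_{Y_{1/2}}=\sup_{-r\le\theta\le 0}\|A^{\frac12}\varphi(\theta)\|$. Assume that $Pf:[0,\infty)\times Y_{\frac12}\to L^2_\sigma(\Omega)$ is such that (i) $\|Pf(t,\varphi)\|\le \omega(t)\,\|\varphi\|_{Y_{1/2}}$ for all $t\ge 0$, $\varphi\in Y_{\frac12}$, and for some $\omega\in L^p_{loc}[0,\infty)$, where $p>\frac{2}{\alpha}$; (ii) $\|Pf(t,\varphi)-Pf(t,\psi)\|\le L_f\|\varphi-\psi\|_{Y_{1/2}}$ for all $t\ge 0$, $\varphi,\psi\in Y_{\frac12}$, and for some constant $L_f>0$. Then for every $\phi\in Y_{\frac12}$ the problem $${}^cD^\alpha_t u+Au=Fu+Pf(t,u_t)\ (t>0),\qquad u(t)=\phi(t)\ (-r\le t\le 0)$$ has a unique mild solution on a maximal interval of existence $[-r,t_{max})$. Moreover, if $t_{max}<\infty$, then $\limsup_{t\to t_{max}}\|u(t)\|_{D(A^{1/2})}=\infty$.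
   Context: Function spaces. $C^\infty_{0,\sigma}(\Omega)=\{u\in C_0^\infty(\Omega)^3:\nabla\cdot u=0\}$; $L^2_\sigma(\Omega)$ is its closure in $L^2(\Omega)^3$, a Hilbert space with the $L^2(\Omega)^3$ inner product $\langle\cdot,\cdot\rangle$; its norm (and the operator norm on it) is $\|\cdot\|$. $P:L^2(\Omega)^3\to L^2_\sigma(\Omega)$ is the projection associated with the Helmholtz decomposition $L^2(\Omega)^3=L^2_\sigma(\Omega)\oplus G(\Omega)$, $G(\Omega)=\{g\in L^2(\Omega)^3: g=\nabla p \text{ for some } p\in L^2(\Omega)\}$. Stokes operator. $A$ is the operator on $L^2_\sigma(\Omega)$ associated with the form $a(u,v)=\langle\nabla u,\nabla v\rangle$ on the closure of $C^\infty_{0,\sigma}(\Omega)$ in $H^1(\Omega)$; i.e. $A=-P\Delta$, $D(A)=L^2_\sigma(\Omega)\cap H^1_0(\Omega)\cap H^2(\Omega)$. $-A$ generates an analytic semigroup of contractions $T(t)$ and $0\in\rho(A)$. For $\beta>0$, $A^{-\beta}=\frac1{\Gamma(\beta)}\int_0^\infty t^{\beta-1}T(t)\,dt$, $A^\beta=(A^{-\beta})^{-1}$, $D(A^\beta)=R(A^{-\beta})$ with norm $\|x\|_{D(A^\beta)}=\|A^\beta x\|$. Solution operators. For $t>0$, $$S_\alpha(t)=\frac1{2\pi i}\int_{\Gamma_{\varrho,\eta}}e^{\lambda t}\lambda^{\alpha-1}(\lambda^\alpha+A)^{-1}d\lambda,\qquad T_\alpha(t)=\frac1{2\pi i}\int_{\Gamma_{\varrho,\eta}}e^{\lambda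 t}(\lambda^\alpha+A)^{-1}d\lambda,$$ where $\Gamma_{\varrho,\eta}$ ($\varrho>0$, $\frac\pi2<\eta<\pi$) consists of the rays $\{|\arg\lambda|=\eta,|\lambda|\ge\varrho\}$ and the arc $\{|\lambda|=\varrho,|\arg\lambda|\le\eta\}$, oriented with increasing imaginary part along the rays. Nonlinearity. $Fu=-P(u\cdot\nabla)u$. For $u\in D(A^{1/2})$ this is understood through $A^{-1/4}Fu\in L^2_\sigma(\Omega)$, the element determined by $\langle A^{-1/4}Fu,w\rangle=-\int_\Omega ((u\cdot\nabla)u)\cdot A^{-1/4}w\,dx$ for all $w\in L^2_\sigma(\Omega)$, and $T_\alpha(t)Fu:=A^{1/4}T_\alpha(t)A^{-1/4}Fu$. Delay. $u_t(\theta)=u(t+\theta)$ for $-r\le\theta\le0$. $Pf$ denotes the composition of the external force $f$ with $P$. ${}^cD^\alpha_t$ is the Caputo derivative of order $\alpha$ with base point $0$. Mild solution. For $0<T<\infty$, a function $u:[-r,T]\to D(A^{1/2})$ is a (local) mild solution if $u|_{[0,T]}\in C([0,T];D(A^{1/2}))$, $u(t)=\phi(t)$ for $-r\le t\le0$, and for $t\in(0,T]$ $$u(t)=S_\alpha(t)\phi(0)+\int_0^tT_\alpha(t-s)Fu(s)\,ds+\int_0^tT_\alpha(t-s)Pf(s,u_s)\,ds.$$ A mild solution on $[-r,t_{max})$, $0<t_{max}\le\infty$, is a function whose restriction to $[-r,T]$ is a mild solution for every $0<T<t_{max}$; the interval is maximal if the solution cannot be extended to a mild solution on a strictly larger inte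rval.
   Formalization: Adds the assumption that t ↦ Pf(t,φ) is (strongly Lebesgue) measurable for each fixed φ in Y_{1/2}; without it the integral defining a mild solution need not exist, e.g. Pf(t,φ)=c(t)φ(0) with c bounded and non-measurable. *)

theory Defs
  imports "HOL-Analysis.Analysis"
begin

section \<open>The Hilbert space of square-integrable vector fields\<close>

definition sq_integrable :: "(real^3 \<Rightarrow> real^3) \<Rightarrow> bool" where
  "sq_integrable f \<longleftrightarrow> f \<in> borel_measurable borel \<and> integrable lborel (\<lambda>x. (norm (f x))\<^sup>2)"

lemma sq_integrable_zero: "sq_integrable (\<lambda>x. 0)"
  by (simp add: sq_integrable_def)

lemma sq_integrable_measurable [measurable_dest]:
  "sq_integrable f \<Longrightarrow> f \<in> borel_measurable borel"
  by (simp add: sq_integrable_def)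

lemma sq_integrable_bound:
  assumes [measurable]: "f \<in> borel_measurable borel" and g: "integrable lborel g"
    and le: "\<And>x. (norm (f x))\<^sup>2 \<le> g x"
  shows "sq_integrable f"
  unfolding sq_integrable_def
proof
  show "integrable lborel (\<lambda>x. (norm (f x))\<^sup>2)"
    by (rule Bochner_Integration.integrable_bound[OF g])
      (auto intro!: AE_I2 order_trans[OF le])
qed fact

lemma sq_integrable_add:
  assumes f: "sq_integrable f" and g: "sq_integrable g"
  shows "sq_integrable (\<lambda>x. f x + g x)"
proof (rule sq_integrable_bound)
  show "(\<lambda>x. f x + g x) \<in> borel_measurable borel"
    using f g by measurable
  show "integrable lborel (\<lambda>x. 2 * (norm (f x))\<^sup>2 + 2 * (norm (g x))\<^sup>2)"
    using f g by (auto simp: sq_integrable_def)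
  fix x
  have "(norm (f x + g x))\<^sup>2 \<le> (norm (f x) + norm (g x))\<^sup>2"
    by (simp add: norm_triangle_ineq power_mono)
  also have "\<dots> \<le> 2 * (norm (f x))\<^sup>2 + 2 * (norm (g x))\<^sup>2"
    using sum_squares_bound[of "norm (f x)" "norm (g x)"] by (simp add: power2_sum)
  finally show "(norm (f x + g x))\<^sup>2 \<le> 2 * (norm (f x))\<^sup>2 + 2 * (norm (g x))\<^sup>2" .
qed

lemma sq_integrable_scaleR:
  assumes f: "sq_integrable f"
  shows "sq_integrable (\<lambda>x. c *\<^sub>R f x)"
  using f unfolding sq_integrable_def by (auto simp: power_mult_distrib)

lemma sq_integrable_uminus: "sq_integrable f \<Longrightarrow> sq_integrable (\<lambda>x. - f x)"
  using sq_integrable_scaleR[of f "-1"] by simp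

lemma sq_integrable_diff:
  "sq_integrable f \<Longrightarrow> sq_integrable g \<Longrightarrow> sq_integrable (\<lambda>x. f x - g x)"
  using sq_integrable_add[OF _ sq_integrable_uminus, of f g] by simp

lemma sq_integrable_inner:
  assumes f: "sq_integrable f" and g: "sq_integrable g"
  shows "integrable lborel (\<lambda>x. inner (f x) (g x))"
proof (rule Bochner_Integration.integrable_bound)
  show "integrable lborel (\<lambda>x. (norm (f x))\<^sup>2 + (norm (g x))\<^sup>2)"
    using f g by (auto simp: sq_integrable_def)
  show "(\<lambda>x. inner (f x) (g x)) \<in> borel_measurable lborel"
    using f g by measurable
  show "AE x in lborel. norm (inner (f x) (g x)) \<le> norm ((norm (f x))\<^sup>2 + (norm (g x))\<^sup>2)"
  proof (rule AE_I2)
    fix x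
    have "\<bar>inner (f x) (g x)\<bar> \<le> norm (f x) * norm (g x)"
      by (rule Cauchy_Schwarz_ineq2)
    also have "\<dots> \<le> (norm (f x))\<^sup>2 + (norm (g x))\<^sup>2"
    proof -
      have "0 \<le> norm (f x) * norm (g x)" by simp
      with sum_squares_bound[of "norm (f x)" "norm (g x)"] show ?thesis
        unfolding mult.assoc by linarith
    qed
    finally show "norm (inner (f x) (g x)) \<le> norm ((norm (f x))\<^sup>2 + (norm (g x))\<^sup>2)"
      by simp
  qed
qed

text \<open>Classes, modulo equality almost everywhere, of square-integrable fields on the whole space.
  For an open set \<open>\<Omega>\<close> the space \<open>L\<^sup>2(\<Omega>)\<^sup>3\<close> is realised below as the subspace of
  fields that vanish almost everywhere outside \<open>\<Omega>\<close> (extension by zero).\<close>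

quotient_type l2 = "real^3 \<Rightarrow> real^3" / partial:
  "\<lambda>f g. sq_integrable f \<and> sq_integrable g \<and> (AE x in lborel. f x = g x)"
proof (rule part_equivpI)
  show "\<exists>f. sq_integrable f \<and> sq_integrable f \<and> (AE x in lborel. f x = f x)"
    using sq_integrable_zero by auto
  show "symp (\<lambda>f g. sq_integrable f \<and> sq_integrable g \<and> (AE x in lborel. f x = g x))"
    by (auto intro!: sympI elim: eventually_mono)
  show "transp (\<lambda>f g. sq_integrable f \<and> sq_integrable g \<and> (AE x in lborel. f x = g x))"
    by (rule transpI) (auto elim: eventually_elim2)
qed

instantiation l2 :: real_inner
begin

lift_definition zero_l2 :: l2 is "\<lambda>x. 0"
  by (simp add: sq_integrable_zero)

lift_definition plus_l2 :: "l2 \<Rightarrow> l2 \<Rightarrow> l2" is "\<lambda>f g x. f x + g x"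
  by (auto simp: sq_integrable_add elim: eventually_elim2)

lift_definition uminus_l2 :: "l2 \<Rightarrow> l2" is "\<lambda>f x. - f x"
  by (auto simp: sq_integrable_uminus elim: eventually_mono)

lift_definition minus_l2 :: "l2 \<Rightarrow> l2 \<Rightarrow> l2" is "\<lambda>f g x. f x - g x"
  by (auto simp: sq_integrable_diff elim: eventually_elim2)

lift_definition scaleR_l2 :: "real \<Rightarrow> l2 \<Rightarrow> l2" is "\<lambda>c f x. c *\<^sub>R f x"
  by (auto simp: sq_integrable_scaleR elim: eventually_mono)

lift_definition inner_l2 :: "l2 \<Rightarrow> l2 \<Rightarrow> real" is "\<lambda>f g. LINT x|lborel. inner (f x) (g x)"
proof -
  fix f f' g g' :: "real^3 \<Rightarrow> real^3"
  assume f: "sq_integrable f \<and> sq_integrable f' \<and> (AE x in lborel. f x = f' x)"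
    and g: "sq_integrable g \<and> sq_integrable g' \<and> (AE x in lborel. g x = g' x)"
  have [measurable]: "f \<in> borel_measurable borel" "f' \<in> borel_measurable borel"
    "g \<in> borel_measurable borel" "g' \<in> borel_measurable borel"
    using f g by auto
  show "(LINT x|lborel. inner (f x) (g x)) = (LINT x|lborel. inner (f' x) (g' x))"
  proof (rule integral_cong_AE)
    show "AE x in lborel. inner (f x) (g x) = inner (f' x) (g' x)"
      using conjunct2[OF conjunct2[OF f]] conjunct2[OF conjunct2[OF g]] by eventually_elim simp
  qed measurable
qed

definition norm_l2 :: "l2 \<Rightarrow> real" where "norm_l2 u = sqrt (inner u u)"
definition dist_l2 :: "l2 \<Rightarrow> l2 \<Rightarrow> real" where "dist_l2 u v = norm (u - v)"
definition sgn_l2 :: "l2 \<Rightarrow> l2" where "sgn_l2 u = inverse (norm u) *\<^sub>R u"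
definition uniformity_l2 :: "(l2 \<times> l2) filter" where
  "uniformity_l2 = (INF e\<in>{0<..}. principal {(u, v). dist u v < e})"
definition open_l2 :: "l2 set \<Rightarrow> bool" where
  "open_l2 U \<longleftrightarrow> (\<forall>u\<in>U. eventually (\<lambda>(u', v). u' = u \<longrightarrow> v \<in> U) uniformity)"

instance
proof
  fix u v w :: l2 and a b :: real
  show "dist u v = norm (u - v)" by (rule dist_l2_def)
  show "sgn u = inverse (norm u) *\<^sub>R u" by (rule sgn_l2_def)
  show "uniformity = (INF e\<in>{0<..}. principal {(u::l2, v). dist u v < e})"
    by (rule uniformity_l2_def)
  show "open U \<longleftrightarrow> (\<forall>u\<in>U. eventually (\<lambda>(u', v). u' = u \<longrightarrow> v \<in> U) uniformity)" for U :: "l2 set"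
    by (rule open_l2_def)
  show "norm u = sqrt (inner u u)" by (rule norm_l2_def)
  show "u + v + w = u + (v + w)"
    by transfer (auto simp: sq_integrable_add add.assoc)
  show "u + v = v + u"
    by transfer (auto simp: sq_integrable_add add.commute)
  show "0 + u = u" by transfer auto
  show "- u + u = 0" by transfer (auto simp: sq_integrable_zero)
  show "u - v = u + - v" by transfer (auto simp: sq_integrable_diff)
  show "a *\<^sub>R (u + v) = a *\<^sub>R u + a *\<^sub>R v"
    by transfer (auto simp: sq_integrable_add sq_integrable_scaleR scaleR_add_right)
  show "(a + b) *\<^sub>R u = a *\<^sub>R u + b *\<^sub>R u"
    by transfer (auto simp: sq_integrable_add sq_integrable_scaleR scaleR_add_left)
  show "a *\<^sub>R b *\<^sub>R u = (a * b) *\<^sub>R u"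
    by transfer (auto simp: sq_integrable_scaleR)
  show "1 *\<^sub>R u = u" by transfer auto
  show "inner u v = inner v u" by transfer (simp add: inner_commute)
  show "inner (u + v) w = inner u w + inner v w"
    by transfer (simp add: inner_add_left sq_integrable_inner)
  show "inner (a *\<^sub>R u) v = a * inner u v"
    by transfer simp
  show "0 \<le> inner u u" by transfer simp
  show "inner u u = 0 \<longleftrightarrow> u = 0"
  proof transfer
    fix f :: "real^3 \<Rightarrow> real^3"
    assume "sq_integrable f \<and> sq_integrable f \<and> (AE x in lborel. f x = f x)"
    then have f: "sq_integrable f" by simp
    have "(LINT x|lborel. inner (f x) (f x)) = 0 \<longleftrightarrow> (AE x in lborel. inner (f x) (f x) = 0)"
      by (rule integral_nonneg_eq_0_iff_AE) (auto simp: sq_integrable_inner[OF f f])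
    then show "((LINT x|lborel. inner (f x) (f x)) = 0) =
       (sq_integrable f \<and> sq_integrable (\<lambda>x. 0) \<and> (AE x in lborel. f x = 0))"
      using f sq_integrable_zero by simp
  qed
qed

end

lemma sq_integrable_rep_l2: "sq_integrable (rep_l2 u)"
  using Quotient_rep_reflp[OF Quotient_l2, of u] by simp

lemma abs_rep_l2: "abs_l2 (rep_l2 u) = u"
  by (rule Quotient_abs_rep[OF Quotient_l2])

lemma rep_abs_l2: "sq_integrable f \<Longrightarrow> AE x in lborel. rep_l2 (abs_l2 f) x = f x"
  using Quotient_rep_abs[OF Quotient_l2, of f] by simp

lemma abs_l2_diff:
  "sq_integrable f \<Longrightarrow> sq_integrable g \<Longrightarrow> abs_l2 f - abs_l2 g = abs_l2 (\<lambda>x. f x - g x)"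
  by (rule minus_l2.abs_eq) auto

lemma abs_l2_add:
  "sq_integrable f \<Longrightarrow> sq_integrable g \<Longrightarrow> abs_l2 f + abs_l2 g = abs_l2 (\<lambda>x. f x + g x)"
  by (rule plus_l2.abs_eq) auto

lemma abs_l2_scaleR:
  "sq_integrable f \<Longrightarrow> c *\<^sub>R abs_l2 f = abs_l2 (\<lambda>x. c *\<^sub>R f x)"
  by (rule scaleR_l2.abs_eq) auto

lemma norm_abs_l2:
  assumes "sq_integrable f"
  shows "(norm (abs_l2 f))\<^sup>2 = (LINT x|lborel. (norm (f x))\<^sup>2)"
proof -
  have "(norm (abs_l2 f))\<^sup>2 = inner (abs_l2 f) (abs_l2 f)"
    by (rule power2_norm_eq_inner)
  also have "\<dots> = (LINT x|lborel. inner (f x) (f x))"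
    by (rule inner_l2.abs_eq) (use assms in auto)
  finally show ?thesis
    by (simp only: power2_norm_eq_inner)
qed


lemma nn_integral_sq:
  assumes "sq_integrable f"
  shows "(\<integral>\<^sup>+x. ennreal ((norm (f x))\<^sup>2) \<partial>lborel) = ennreal ((norm (abs_l2 f))\<^sup>2)"
  unfolding norm_abs_l2[OF assms]
  by (rule nn_integral_eq_integral) (use assms in \<open>auto simp: sq_integrable_def\<close>)

instance l2 :: banach
proof
  fix X :: "nat \<Rightarrow> l2"
  assume X: "Cauchy X"
  have "\<forall>n. \<exists>N. \<forall>m\<ge>N. \<forall>k\<ge>N. dist (X m) (X k) < (1/2)^n"
    by (intro allI metric_CauchyD[OF X]) simp
  then obtain N where "\<forall>n. \<forall>m\<ge>N n. \<forall>k\<ge>N n. dist (X m) (X k) < (1/2)^n"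
    by (rule choice[THEN exE])
  then have N: "dist (X m) (X k) < (1/2)^n" if "N n \<le> m" "N n \<le> k" for n m k
    using that by blast
  define r where "r n = (\<Sum>k\<le>n. N k) + n" for n
  have mono: "strict_mono r"
    by (rule strict_monoI_Suc) (simp add: r_def)
  have rN: "N n \<le> r m" if "n \<le> m" for n m
    using member_le_sum[of n "{..m}" N] that by (simp add: r_def trans_le_add1)
  define f where "f n = rep_l2 (X (r n))" for n
  have f: "sq_integrable (f n)" for n
    by (simp add: f_def sq_integrable_rep_l2)
  have [measurable]: "f n \<in> borel_measurable borel" for n
    using f by (rule sq_integrable_measurable)
  have dist: "(\<integral>\<^sup>+x. ennreal ((norm (f n x - f m x))\<^sup>2) \<partial>lborel) = ennreal ((dist (X (r n)) (X (r m)))\<^sup>2)"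
    for n m
    using nn_integral_sq[OF sq_integrable_diff[OF f f], of n m] abs_l2_diff[OF f f, of n m]
    by (simp add: f_def abs_rep_l2 dist_norm)
  have "AE x in lborel. (\<Sum>n. ennreal (2^n * (norm (f (Suc n) x - f n x))\<^sup>2)) \<noteq> \<infinity>"
  proof (rule nn_integral_noteq_infinite)
    have "(\<integral>\<^sup>+x. (\<Sum>n. ennreal (2^n * (norm (f (Suc n) x - f n x))\<^sup>2)) \<partial>lborel)
        = (\<Sum>n. \<integral>\<^sup>+x. ennreal (2^n * (norm (f (Suc n) x - f n x))\<^sup>2) \<partial>lborel)"
      by (rule nn_integral_suminf) measurable
    also have "\<dots> \<le> (\<Sum>n. ennreal ((1/2)^n))"
    proof (rule suminf_le)
      fix n
      have d: "dist (X (r (Suc n))) (X (r n)) \<le> (1/2)^n"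
        using N[OF rN rN, of n "Suc n" n] by simp
      have "(\<integral>\<^sup>+x. ennreal (2^n * (norm (f (Suc n) x - f n x))\<^sup>2) \<partial>lborel)
          = ennreal (2^n) * (\<integral>\<^sup>+x. ennreal ((norm (f (Suc n) x - f n x))\<^sup>2) \<partial>lborel)"
        by (subst nn_integral_cmult[symmetric]) (auto simp: ennreal_mult)
      also have "\<dots> = ennreal (2^n * (dist (X (r (Suc n))) (X (r n)))\<^sup>2)"
        by (simp add: dist ennreal_mult)
      also have "\<dots> \<le> ennreal (2^n * ((1/2)^n)\<^sup>2)"
        by (intro ennreal_leI mult_left_mono power_mono d) auto
      also have "2^n * ((1/2)^n)\<^sup>2 = (1/2::real)^n"
        by (simp add: power_divide power2_eq_square)
      finally show "(\<integral>\<^sup>+x. ennreal (2^n * (norm (f (Suc n) x - f n x))\<^sup>2) \<partial>lborel) \<le> ennreal ((1/2)^n)" .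
    qed auto
    also have "\<dots> < \<infinity>"
      by (subst suminf_ennreal2) (auto simp: summable_geometric)
    finally show "(\<integral>\<^sup>+x. (\<Sum>n. ennreal (2^n * (norm (f (Suc n) x - f n x))\<^sup>2)) \<partial>lborel) \<noteq> \<infinity>"
      by simp
  qed measurable
  then have lim: "AE x in lborel. (\<lambda>n. f n x) \<longlonglongrightarrow> lim (\<lambda>n. f n x)"
  proof eventually_elim
    fix x
    let ?g = "\<lambda>n. norm (f (Suc n) x - f n x)"
    assume "(\<Sum>n. ennreal (2^n * (?g n)\<^sup>2)) \<noteq> \<infinity>"
    then have "summable (\<lambda>n. 2^n * (?g n)\<^sup>2)"
      by (intro summable_suminf_not_top) auto
    then have "Bseq (\<lambda>n. 2^n * (?g n)\<^sup>2)"
      by (intro convergent_imp_Bseq) (auto intro: summable_LIMSEQ_zero simp: convergent_def)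
    then obtain K where K: "K > 0" "\<And>n. norm (2^n * (?g n)\<^sup>2) \<le> K"
      by (auto elim: BseqE)
    have g: "?g n \<le> sqrt K * (1 / sqrt 2)^n" for n
    proof (rule power2_le_imp_le)
      have "2^n * (?g n)\<^sup>2 \<le> K" using K(2)[of n] by simp
      then have "(?g n)\<^sup>2 \<le> K * (1/2)^n"
        by (simp add: field_simps power_one_over)
      also have "\<dots> = (sqrt K * (1 / sqrt 2)^n)\<^sup>2"
      proof -
        have "((1 / sqrt 2)^n)\<^sup>2 = ((1 / sqrt 2)\<^sup>2)^n"
          by (simp only: power_mult[symmetric] mult.commute)
        also have "(1 / sqrt 2)\<^sup>2 = (1/2::real)"
          by (simp add: power_divide)
        finally show ?thesis
          using K(1) by (simp only: power_mult_distrib) simp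
      qed
      finally show "(?g n)\<^sup>2 \<le> (sqrt K * (1 / sqrt 2)^n)\<^sup>2" .
    qed (use K in auto)
    have "summable (\<lambda>n. sqrt K * (1 / sqrt 2)^n)"
      by (intro summable_mult summable_geometric) auto
    then have "summable (\<lambda>n. f (Suc n) x - f n x)"
      by (rule summable_comparison_test') (use g in auto)
    then have "convergent (\<lambda>n. \<Sum>k<n. f (Suc k) x - f k x)"
      by (simp only: summable_iff_convergent)
    then have "convergent (\<lambda>n. (f n x - f 0 x) + f 0 x)"
      by (intro convergent_add convergent_const) (simp only: sum_lessThan_telescope[of "\<lambda>k. f k x"])
    then show "(\<lambda>n. f n x) \<longlonglongrightarrow> lim (\<lambda>n. f n x)"
      by (simp add: convergent_LIMSEQ_iff)
  qed
  define F where "F x = lim (\<lambda>n. f n x)" for x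
  have [measurable]: "F \<in> borel_measurable borel"
    unfolding F_def[abs_def] by measurable
  have le: "(\<integral>\<^sup>+x. ennreal ((norm (F x - f n x))\<^sup>2) \<partial>lborel) \<le> ennreal (((1/2)^n)\<^sup>2)" for n
  proof -
    have "(\<integral>\<^sup>+x. ennreal ((norm (F x - f n x))\<^sup>2) \<partial>lborel)
        = (\<integral>\<^sup>+x. liminf (\<lambda>m. ennreal ((norm (f m x - f n x))\<^sup>2)) \<partial>lborel)"
    proof (rule nn_integral_cong_AE, use lim in eventually_elim)
      fix x
      assume "(\<lambda>n. f n x) \<longlonglongrightarrow> lim (\<lambda>n. f n x)"
      then have "(\<lambda>m. ennreal ((norm (f m x - f n x))\<^sup>2)) \<longlonglongrightarrow> ennreal ((norm (F x - f n x))\<^sup>2)"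
        unfolding F_def by (intro tendsto_intros tendsto_ennrealI)
      then show "ennreal ((norm (F x - f n x))\<^sup>2) = liminf (\<lambda>m. ennreal ((norm (f m x - f n x))\<^sup>2))"
        by (intro lim_imp_Liminf[symmetric]) simp_all
    qed
    also have "\<dots> \<le> liminf (\<lambda>m. \<integral>\<^sup>+x. ennreal ((norm (f m x - f n x))\<^sup>2) \<partial>lborel)"
      by (rule nn_integral_liminf) measurable
    also have "\<dots> \<le> limsup (\<lambda>m. \<integral>\<^sup>+x. ennreal ((norm (f m x - f n x))\<^sup>2) \<partial>lborel)"
      by (rule Liminf_le_Limsup) simp
    also have "\<dots> \<le> ennreal (((1/2)^n)\<^sup>2)"
    proof (rule Limsup_bounded, rule eventually_sequentiallyI[of n])
      fix m assume "n \<le> m"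
      then have "dist (X (r m)) (X (r n)) \<le> (1/2)^n"
        using N[OF rN rN, of n m n] by simp
      then show "(\<integral>\<^sup>+x. ennreal ((norm (f m x - f n x))\<^sup>2) \<partial>lborel) \<le> ennreal (((1/2)^n)\<^sup>2)"
        unfolding dist by (intro ennreal_leI power_mono) auto
    qed
    finally show ?thesis .
  qed
  have sqd: "sq_integrable (\<lambda>x. F x - f n x)" for n
  proof -
    have "(\<integral>\<^sup>+x. ennreal ((norm (F x - f n x))\<^sup>2) \<partial>lborel) < \<infinity>"
      using le[of n] by (rule order_le_less_trans) simp
    then show ?thesis
      unfolding sq_integrable_def by (auto simp: integrable_iff_bounded)
  qed
  have sqF: "sq_integrable F"
    using sq_integrable_add[OF sqd[of 0] f[of 0]] by simp
  have "norm (abs_l2 F - X (r n)) \<le> (1/2)^n" for n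
  proof (rule power2_le_imp_le)
    have "abs_l2 F - X (r n) = abs_l2 (\<lambda>x. F x - f n x)"
      using abs_l2_diff[OF sqF f[of n]] by (simp add: f_def abs_rep_l2)
    then show "(norm (abs_l2 F - X (r n)))\<^sup>2 \<le> ((1/2)^n)\<^sup>2"
      using le[of n] nn_integral_sq[OF sqd[of n]] by simp
  qed simp
  then have "(\<lambda>n. (X \<circ> r) n - abs_l2 F) \<longlonglongrightarrow> 0"
    by (intro Lim_null_comparison[OF _ LIMSEQ_realpow_zero[of "1/2"]] always_eventually)
      (auto simp: norm_minus_commute)
  then have "(X \<circ> r) \<longlonglongrightarrow> abs_l2 F"
    by (rule LIM_zero_cancel)
  with X mono have "X \<longlonglongrightarrow> abs_l2 F"
    by (rule Cauchy_converges_subseq)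
  then show "convergent X"
    by (rule convergentI)
qed


lemma abs_l2_dominated_convergence:
  assumes f: "sq_integrable f" and [measurable]: "\<And>n. s n \<in> borel_measurable borel"
    and le: "\<And>n x. norm (s n x) \<le> c * norm (f x)"
    and lim: "\<And>x. (\<lambda>n. s n x) \<longlonglongrightarrow> f x"
  shows "sq_integrable (s n)" and "(\<lambda>n. abs_l2 (s n)) \<longlonglongrightarrow> abs_l2 f"
proof -
  have [measurable]: "f \<in> borel_measurable borel"
    using f by (rule sq_integrable_measurable)
  have int: "integrable lborel (\<lambda>x. (c * norm (f x))\<^sup>2)" for c
    using f by (auto simp: sq_integrable_def power_mult_distrib)
  show s: "sq_integrable (s n)" for n
    by (rule sq_integrable_bound[OF _ int[of c]]) (auto intro!: power_mono le)
  have "(\<lambda>n. LINT x|lborel. (norm (s n x - f x))\<^sup>2) \<longlonglongrightarrow> (LINT x::real^3|lborel. 0)"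
  proof (rule integral_dominated_convergence[where w = "\<lambda>x. ((c + 1) * norm (f x))\<^sup>2"])
    show "integrable lborel (\<lambda>x. ((c + 1) * norm (f x))\<^sup>2)"
      by (rule int)
    show "AE x in lborel. (\<lambda>n. (norm (s n x - f x))\<^sup>2) \<longlonglongrightarrow> 0"
    proof (rule AE_I2)
      fix x
      have "(\<lambda>n. (norm (s n x - f x))\<^sup>2) \<longlonglongrightarrow> (norm (f x - f x))\<^sup>2"
        by (intro tendsto_intros lim)
      then show "(\<lambda>n. (norm (s n x - f x))\<^sup>2) \<longlonglongrightarrow> 0" by simp
    qed
    show "AE x in lborel. norm ((norm (s n x - f x))\<^sup>2) \<le> ((c + 1) * norm (f x))\<^sup>2" for n
    proof (rule AE_I2)
      fix x
      have "norm (s n x - f x) \<le> norm (s n x) + norm (f x)"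
        by (rule norm_triangle_ineq4)
      also have "\<dots> \<le> (c + 1) * norm (f x)"
        using le[of n x] by (simp add: algebra_simps)
      finally show "norm ((norm (s n x - f x))\<^sup>2) \<le> ((c + 1) * norm (f x))\<^sup>2"
        by (simp add: power_mono)
    qed
  qed auto
  then have "(\<lambda>n. (norm (abs_l2 (s n) - abs_l2 f))\<^sup>2) \<longlonglongrightarrow> 0"
    by (simp add: abs_l2_diff[OF s f] norm_abs_l2[OF sq_integrable_diff[OF s f]])
  then have "(\<lambda>n. norm (abs_l2 (s n) - abs_l2 f)) \<longlonglongrightarrow> 0"
    using tendsto_real_sqrt by fastforce
  then show "(\<lambda>n. abs_l2 (s n)) \<longlonglongrightarrow> abs_l2 f"
    by (simp add: tendsto_norm_zero_iff LIM_zero_iff)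
qed

lemma abs_l2_sum:
  assumes "finite I" "\<And>i. i \<in> I \<Longrightarrow> sq_integrable (f i)"
  shows "sq_integrable (\<lambda>x. \<Sum>i\<in>I. f i x) \<and> abs_l2 (\<lambda>x. \<Sum>i\<in>I. f i x) = (\<Sum>i\<in>I. abs_l2 (f i))"
  using assms
proof (induction I rule: finite_induct)
  case empty
  then show ?case
    by (simp add: sq_integrable_zero zero_l2_def)
next
  case (insert i I)
  then have "sq_integrable (f i)" "sq_integrable (\<lambda>x. \<Sum>i\<in>I. f i x)"
    "abs_l2 (\<lambda>x. \<Sum>i\<in>I. f i x) = (\<Sum>i\<in>I. abs_l2 (f i))"
    by auto
  then show ?case
    using insert.hyps by (simp add: sq_integrable_add flip: abs_l2_add)
qed

lemma countable_span_closure: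
  fixes S :: "'a::real_normed_vector set"
  assumes "countable S"
  obtains D where "countable D" "S \<subseteq> D" "subspace (closure D)"
proof
  define comb where "comb l = (\<Sum>(q, s)\<leftarrow>l. of_rat q *\<^sub>R s)" for l :: "(rat \<times> 'a) list"
  define D where "D = comb ` lists (UNIV \<times> S)"
  show "countable D"
    unfolding D_def using assms by (intro countable_image countable_lists countable_SIGMA) auto
  show "S \<subseteq> D"
  proof
    fix s assume "s \<in> S"
    then have "comb [(1, s)] \<in> D"
      unfolding D_def by (intro imageI) auto
    then show "s \<in> D" by (simp add: comb_def)
  qed
  have add: "x + y \<in> D" if x: "x \<in> D" and y: "y \<in> D" for x y
  proof -
    obtain k where "x = comb k" "k \<in> lists (UNIV \<times> S)"
      using x unfolding D_def by (rule imageE)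
    moreover obtain l where "y = comb l" "l \<in> lists (UNIV \<times> S)"
      using y unfolding D_def by (rule imageE)
    ultimately have "x + y = comb (k @ l)" "k @ l \<in> lists (UNIV \<times> S)"
      by (simp_all add: comb_def)
    then show ?thesis unfolding D_def by (rule image_eqI)
  qed
  have scale: "of_rat q *\<^sub>R x \<in> D" if x: "x \<in> D" for x q
  proof -
    obtain l where l: "x = comb l" "l \<in> lists (UNIV \<times> S)"
      using x unfolding D_def by (rule imageE)
    have "of_rat q *\<^sub>R comb l = comb (map (\<lambda>(q', s). (q * q', s)) l)" for l
      by (induction l) (auto simp: comb_def scaleR_add_right of_rat_mult)
    moreover have "map (\<lambda>(q', s). (q * q', s)) l \<in> lists (UNIV \<times> S)"
      using l(2) by (induction l) auto
    ultimately show ?thesis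
      unfolding D_def l(1) by (rule image_eqI)
  qed
  show "subspace (closure D)"
  proof (rule subspaceI)
    have "comb [] \<in> D" unfolding D_def by (intro imageI) auto
    then show "0 \<in> closure D"
      using closure_subset by (fastforce simp: comb_def)
    show "x + y \<in> closure D" if "x \<in> closure D" "y \<in> closure D" for x y
    proof -
      from that obtain a b where "\<forall>n. a n \<in> D" "a \<longlonglongrightarrow> x" "\<forall>n. b n \<in> D" "b \<longlonglongrightarrow> y"
        unfolding closure_sequential by blast
      then have "\<forall>n. a n + b n \<in> D" "(\<lambda>n. a n + b n) \<longlonglongrightarrow> x + y"
        by (auto intro: add tendsto_add)
      then show ?thesis
        unfolding closure_sequential by (intro exI[of _ "\<lambda>n. a n + b n"]) simp
    qed
    show "c *\<^sub>R x \<in> closure D" if "x \<in> closure D" for c x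
    proof -
      from that obtain a where a: "\<forall>n. a n \<in> D" "a \<longlonglongrightarrow> x"
        unfolding closure_sequential by blast
      have "c \<in> closure (\<rat> :: real set)" by (simp add: Rats_closure_real)
      then obtain q where q: "\<forall>n. q n \<in> \<rat>" "q \<longlonglongrightarrow> c"
        unfolding closure_sequential by blast
      have "q n *\<^sub>R a n \<in> D" for n
        using q(1) a(1) scale by (metis Rats_cases)
      moreover have "(\<lambda>n. q n *\<^sub>R a n) \<longlonglongrightarrow> c *\<^sub>R x"
        using q a by (intro tendsto_scaleR) auto
      ultimately show ?thesis
        unfolding closure_sequential by (intro exI[of _ "\<lambda>n. q n *\<^sub>R a n"]) simp
    qed
  qed
qed

lemma countable_dense_l2: "\<exists>D :: l2 set. countable D \<and> closure D = UNIV"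
proof -
  obtain B :: "(real^3) set set" where B: "countable B" "topological_basis B"
    using ex_countable_basis by blast
  define G where "G = Inter ` {F. finite F \<and> F \<subseteq> B}"
  have cG: "countable G"
    unfolding G_def by (intro countable_image countable_Collect_finite_subset B)
  have openG: "open U" if "U \<in> G" for U
    using that topological_basis_open[OF B(2)] unfolding G_def by (auto intro!: open_Inter)
  have stable: "Int_stable G"
  proof (rule Int_stableI)
    fix U V assume "U \<in> G" "V \<in> G"
    then obtain E F where "U = \<Inter>E" "V = \<Inter>F" "finite E" "finite F" "E \<subseteq> B" "F \<subseteq> B"
      unfolding G_def by blast
    then have "U \<inter> V = \<Inter>(E \<union> F)" "finite (E \<union> F)" "E \<union> F \<subseteq> B"
      by auto
    then show "U \<inter> V \<in> G"
      unfolding G_def by blast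
  qed
  have UNIV_G: "UNIV \<in> G"
    unfolding G_def by (intro image_eqI[of _ _ "{}"]) auto
  have "topological_basis G"
  proof (rule topological_basisI[OF openG])
    fix U :: "(real^3) set" and x assume "open U" "x \<in> U"
    then obtain V where "V \<in> B" "x \<in> V" "V \<subseteq> U"
      using topological_basisE[OF B(2)] by blast
    moreover from this have "V \<in> G"
      unfolding G_def by (intro image_eqI[of _ _ "{V}"]) auto
    ultimately show "\<exists>B'\<in>G. x \<in> B' \<and> B' \<subseteq> U" by blast
  qed
  then have "sets borel = sets (sigma UNIV G)"
    using borel_eq_countable_basis[OF cG] by simp
  also have "\<dots> = sigma_sets UNIV G"
    by (rule sets_measure_of) simp
  finally have borel_G: "sets borel = sigma_sets UNIV G" .
  define I where "I A n e = (\<lambda>x::real^3. indicator (A \<inter> ball 0 (real n)) x *\<^sub>R (e::real^3))" for A n e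
  define S where "S = (\<lambda>(U, n, e). abs_l2 (I U n e)) ` (G \<times> UNIV \<times> Basis)"
  have "countable S"
    unfolding S_def by (intro countable_image countable_SIGMA cG) (auto intro: countable_finite)
  then obtain D where D: "countable D" "S \<subseteq> D" "subspace (closure D)"
    by (rule countable_span_closure)
  have measI: "I A n e \<in> borel_measurable borel" if "A \<in> sets borel" for A n e
    unfolding I_def using that
    by (intro borel_measurable_scaleR borel_measurable_indicator sets.Int borel_measurable_const) auto
  have sqI: "sq_integrable (I A n e)" if A: "A \<in> sets borel" for A n e
  proof (rule sq_integrable_bound)
    show "I A n e \<in> borel_measurable borel"
      using A by (rule measI)
    show "integrable lborel (\<lambda>x::real^3. (norm e)\<^sup>2 * indicator (ball 0 (real n)) x)"
      by (intro integrable_mult_right integrable_real_indicator)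
        (use emeasure_lborel_ball_finite[of "0::real^3" "real n"] in auto)
  qed (auto simp: I_def indicator_def)
  have seq_closed: "l \<in> closure D" if "\<And>n. a n \<in> closure D" "a \<longlonglongrightarrow> l" for a :: "nat \<Rightarrow> l2" and l
    using that closed_sequentially[OF closed_closure, of a D l] by auto
  have basis: "abs_l2 (I A n e) \<in> closure D" if A: "A \<in> sets borel" and e: "e \<in> Basis" for A n e
  proof -
    have *: "G \<subseteq> Pow UNIV" by simp
    from stable * A[unfolded borel_G] show ?thesis
    proof (induction rule: sigma_sets_induct_disjoint)
      case (basic A)
      then have "abs_l2 (I A n e) \<in> S"
        unfolding S_def using e by (intro image_eqI[of _ _ "(A, n, e)"]) auto
      then show ?case using D(2) closure_subset by blast
    next
      case empty
      have "abs_l2 (I {} n e) = 0"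
        by (simp add: I_def zero_l2_def)
      then show ?case using D(3) by (simp add: subspace_0)
    next
      case (compl A)
      then have A: "A \<in> sets borel" by (simp add: borel_G)
      have "I (UNIV - A) n e = (\<lambda>x. I UNIV n e x - I A n e x)"
        by (auto simp: I_def indicator_def fun_eq_iff)
      then have eq: "abs_l2 (I (UNIV - A) n e) = abs_l2 (I UNIV n e) - abs_l2 (I A n e)"
        using A by (simp add: abs_l2_diff sqI)
      have "abs_l2 (I UNIV n e) \<in> S"
        unfolding S_def using e UNIV_G by (intro image_eqI[of _ _ "(UNIV, n, e)"]) auto
      then have "abs_l2 (I UNIV n e) \<in> closure D" using D(2) closure_subset by blast
      then show ?case
        unfolding eq using compl.IH by (rule subspace_diff[OF D(3)])
    next
      case (union A)
      then have A [measurable]: "A i \<in> sets borel" for i by (auto simp: borel_G)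
      have fin: "I (\<Union>i<m. A i) n e = (\<lambda>x. \<Sum>i<m. I (A i) n e x)" for m
      proof
        fix x
        have "disjoint_family_on A {..<m}"
          using union(1) by (rule disjoint_family_on_mono[rotated]) simp
        then have "indicator (\<Union>i<m. A i) x = (\<Sum>i<m. indicator (A i) x :: real)"
          by (simp add: indicator_UN_disjoint)
        then show "I (\<Union>i<m. A i) n e x = (\<Sum>i<m. I (A i) n e x)"
          by (simp only: I_def indicator_inter_arith sum_distrib_right scaleR_sum_left)
      qed
      have "abs_l2 (I (\<Union>i<m. A i) n e) \<in> closure D" for m
        unfolding fin using abs_l2_sum[of "{..<m}" "\<lambda>i. I (A i) n e"]
        by (auto simp: sqI A intro!: subspace_sum[OF D(3)] union)
      moreover have "(\<lambda>m. abs_l2 (I (\<Union>i<m. A i) n e)) \<longlonglongrightarrow> abs_l2 (I (\<Union>i. A i) n e)"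
      proof (rule abs_l2_dominated_convergence(2))
        show "sq_integrable (I (\<Union>i. A i) n e)" by (rule sqI) measurable
        show "I (\<Union>i<m. A i) n e \<in> borel_measurable borel" for m
          by (rule measI) measurable
        show "norm (I (\<Union>i<m. A i) n e x) \<le> 1 * norm (I (\<Union>i. A i) n e x)" for m x
          by (auto simp: I_def indicator_def)
        show "(\<lambda>m. I (\<Union>i<m. A i) n e x) \<longlonglongrightarrow> I (\<Union>i. A i) n e x" for x
        proof (cases "x \<in> (\<Union>i. A i)")
          case True
          then obtain k where k: "x \<in> A k" by blast
          have "I (\<Union>i<m. A i) n e x = I (\<Union>i. A i) n e x" if "m > k" for m
            using k that by (auto simp: I_def indicator_def)
          then have "\<forall>\<^sub>F m in sequentially. I (\<Union>i<m. A i) n e x = I (\<Union>i. A i) n e x"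
            by (intro eventually_sequentiallyI[of "Suc k"]) simp
          then show ?thesis by (rule tendsto_eventually)
        next
          case False
          then have "I (\<Union>i<m. A i) n e x = I (\<Union>i. A i) n e x" for m
            by (auto simp: I_def indicator_def)
          then show ?thesis by simp
        qed
      qed
      ultimately show ?case by (rule seq_closed)
    qed
  qed
  have const: "abs_l2 (\<lambda>x. indicator A x *\<^sub>R y) \<in> closure D"
    if A [measurable]: "A \<in> sets borel" and sq: "sq_integrable (\<lambda>x. indicator A x *\<^sub>R y)" for A y
  proof -
    have "abs_l2 (I A n y) \<in> closure D" for n
    proof -
      have "I A n y = (\<lambda>x. \<Sum>e\<in>Basis. inner y e *\<^sub>R I A n e x)"
      proof
        fix x
        have "(\<Sum>e\<in>Basis. inner y e *\<^sub>R I A n e x)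
            = indicator (A \<inter> ball 0 (real n)) x *\<^sub>R (\<Sum>e\<in>Basis. inner y e *\<^sub>R e)"
          by (simp add: I_def scaleR_sum_right mult.commute)
        then show "I A n y x = (\<Sum>e\<in>Basis. inner y e *\<^sub>R I A n e x)"
          by (simp only: euclidean_representation I_def)
      qed
      then have "abs_l2 (I A n y) = (\<Sum>e\<in>Basis. inner y e *\<^sub>R abs_l2 (I A n e))"
        using abs_l2_sum[of Basis "\<lambda>e x. inner y e *\<^sub>R I A n e x"]
        by (simp add: sqI A sq_integrable_scaleR abs_l2_scaleR)
      then show ?thesis
        by (auto intro!: subspace_sum[OF D(3)] subspace_scale[OF D(3)] basis A)
    qed
    moreover have "(\<lambda>n. abs_l2 (I A n y)) \<longlonglongrightarrow> abs_l2 (\<lambda>x. indicator A x *\<^sub>R y)"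
    proof (rule abs_l2_dominated_convergence(2)[OF sq])
      show "I A n y \<in> borel_measurable borel" for n
        using A by (rule measI)
      show "norm (I A n y x) \<le> 1 * norm (indicator A x *\<^sub>R y)" for n x
        by (auto simp: I_def indicator_def)
      show "(\<lambda>n. I A n y x) \<longlonglongrightarrow> indicator A x *\<^sub>R y" for x
      proof (rule tendsto_eventually)
        obtain k where "norm x < real k" using reals_Archimedean2 by blast
        then show "\<forall>\<^sub>F n in sequentially. I A n y x = indicator A x *\<^sub>R y"
          by (intro eventually_sequentiallyI[of k]) (auto simp: I_def indicator_def)
      qed
    qed
    ultimately show ?thesis by (rule seq_closed)
  qed
  have "abs_l2 f \<in> closure D" if f: "sq_integrable f" for f
  proof -
    have "f \<in> borel_measurable lborel"
      using f by (simp add: sq_integrable_def)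
    from borel_measurable_implies_sequence_metric[OF this, of 0]
    obtain s where s: "\<And>n. simple_function lborel (s n)" "\<And>x. (\<lambda>n. s n x) \<longlonglongrightarrow> f x"
      and le: "\<And>n x. norm (s n x) \<le> 2 * norm (f x)"
      by auto
    have [measurable]: "s n \<in> borel_measurable borel" for n
      using borel_measurable_simple_function[OF s(1)] by simp
    note conv = abs_l2_dominated_convergence[OF f _ le s(2)]
    have "abs_l2 (s n) \<in> closure D" for n
    proof -
      have fin: "finite (range (s n))"
        using simple_functionD(1)[OF s(1)] by simp
      have A [measurable]: "s n -` {y} \<in> sets borel" for y
        using simple_functionD(2)[OF s(1), of n "{y}"] by simp
      have sq: "sq_integrable (\<lambda>x. indicator (s n -` {y}) x *\<^sub>R y)" for y
      proof (rule sq_integrable_bound)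
        show "integrable lborel (\<lambda>x. (norm (s n x))\<^sup>2)"
          using conv(1)[of n] by (simp add: sq_integrable_def)
      qed (measurable, auto simp: indicator_def)
      have "s n = (\<lambda>x. \<Sum>y\<in>range (s n). indicator (s n -` {y}) x *\<^sub>R y)"
      proof
        fix x
        have "(\<Sum>y\<in>range (s n). indicator (s n -` {y}) x *\<^sub>R y) = (\<Sum>y\<in>range (s n). if y = s n x then y else 0)"
          by (intro sum.cong) (auto simp: indicator_def)
        then show "s n x = (\<Sum>y\<in>range (s n). indicator (s n -` {y}) x *\<^sub>R y)"
          using fin by simp
      qed
      then have "abs_l2 (s n) = abs_l2 (\<lambda>x. \<Sum>y\<in>range (s n). indicator (s n -` {y}) x *\<^sub>R y)"
        by (rule arg_cong)
      also have "\<dots> = (\<Sum>y\<in>range (s n). abs_l2 (\<lambda>x. indicator (s n -` {y}) x *\<^sub>R y))"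
        using abs_l2_sum[OF fin, of "\<lambda>y x. indicator (s n -` {y}) x *\<^sub>R y"] sq by blast
      finally have "abs_l2 (s n) = (\<Sum>y\<in>range (s n). abs_l2 (\<lambda>x. indicator (s n -` {y}) x *\<^sub>R y))" .
      then show ?thesis
        by (auto intro!: subspace_sum[OF D(3)] const sq A)
    qed
    then show ?thesis
      by (rule seq_closed) (rule conv(2), simp)
  qed
  then have "u \<in> closure D" for u
    using abs_rep_l2[of u] sq_integrable_rep_l2[of u] by metis
  with D(1) show ?thesis by blast
qed

instance l2 :: second_countable_topology
proof
  obtain D :: "l2 set" where D: "countable D" "closure D = UNIV"
    using countable_dense_l2 by blast
  define B where "B = (\<lambda>(d, n). ball d (inverse (real (Suc n)))) ` (D \<times> UNIV)"
  have "countable B"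
    unfolding B_def by (intro countable_image countable_SIGMA D) auto
  moreover have "topological_basis B"
  proof (rule topological_basisI)
    show "open U" if "U \<in> B" for U
      using that by (auto simp: B_def)
    fix U :: "l2 set" and x assume "open U" "x \<in> U"
    then obtain e where e: "e > 0" "ball x e \<subseteq> U"
      using open_contains_ball by blast
    obtain n where n: "inverse (real (Suc n)) < e / 2"
      using reals_Archimedean[of "e / 2"] e(1) by auto
    have "x \<in> closure D" by (simp add: D)
    then obtain d where d: "d \<in> D" "dist d x < inverse (real (Suc n))"
      unfolding closure_approachable by (meson inverse_positive_iff_positive of_nat_0_less_iff zero_less_Suc)
    have "ball d (inverse (real (Suc n))) \<subseteq> ball x e"
    proof
      fix y assume "y \<in> ball d (inverse (real (Suc n)))"
      then have "dist d y < inverse (real (Suc n))" by simp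
      then show "y \<in> ball x e"
        using d(2) n dist_triangle[of x y d] by (simp add: dist_commute)
    qed
    then show "\<exists>B'\<in>B. x \<in> B' \<and> B' \<subseteq> U"
      using d e(2) by (intro bexI[of _ "ball d (inverse (real (Suc n)))"])
        (auto simp: B_def)
  qed
  ultimately show "\<exists>B::l2 set set. countable B \<and> open = generate_topology B"
    using topological_basis_imp_subbasis by blast
qed


section \<open>Function spaces\<close>

definition partial_deriv :: "3 \<Rightarrow> (real^3 \<Rightarrow> 'b::real_normed_vector) \<Rightarrow> real^3 \<Rightarrow> 'b" where
  "partial_deriv j f x = frechet_derivative f (at x) (axis j 1)"

text \<open>\<open>k\<close> times continuously differentiable on the open set \<open>U\<close>.\<close>

primrec C_k :: "nat \<Rightarrow> (real^3) set \<Rightarrow> (real^3 \<Rightarrow> 'b::real_normed_vector) \<Rightarrow> bool" where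
  "C_k 0 U f \<longleftrightarrow> continuous_on U f"
| "C_k (Suc k) U f \<longleftrightarrow> (\<forall>x\<in>U. f differentiable (at x)) \<and> (\<forall>j. C_k k U (partial_deriv j f))"

text \<open>Near every boundary point the domain is a strict sublevel set of a \<open>C\<^sup>2\<close> function with
  nonvanishing gradient.\<close>

definition C2_domain :: "(real^3) set \<Rightarrow> bool" where
  "C2_domain \<Omega> \<longleftrightarrow> open \<Omega> \<and> connected \<Omega> \<and> \<Omega> \<noteq> {} \<and>
    (\<forall>x\<in>frontier \<Omega>. \<exists>U (\<psi> :: real^3 \<Rightarrow> real). open U \<and> x \<in> U \<and> C_k 2 U \<psi> \<and>
      (\<forall>y\<in>U. \<exists>j. partial_deriv j \<psi> y \<noteq> 0) \<and> \<Omega> \<inter> U = {y\<in>U. \<psi> y < 0})"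

definition test_functions :: "(real^3) set \<Rightarrow> (real^3 \<Rightarrow> 'b::real_normed_vector) set" where
  "test_functions \<Omega> = {\<phi>. (\<forall>k. C_k k UNIV \<phi>) \<and>
     compact (closure {x. \<phi> x \<noteq> 0}) \<and> closure {x. \<phi> x \<noteq> 0} \<subseteq> \<Omega>}"

definition divergence :: "(real^3 \<Rightarrow> real^3) \<Rightarrow> real^3 \<Rightarrow> real" where
  "divergence u x = (\<Sum>j\<in>UNIV. partial_deriv j u x $ j)"

definition solenoidal_tests :: "(real^3) set \<Rightarrow> (real^3 \<Rightarrow> real^3) set" where
  "solenoidal_tests \<Omega> = {u \<in> test_functions \<Omega>. \<forall>x. divergence u x = 0}"

definition L2_on :: "(real^3) set \<Rightarrow> l2 set" where
  "L2_on \<Omega> = {u. AE x in lborel. x \<notin> \<Omega> \<longrightarrow> rep_l2 u x = 0}"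

definition L2_sigma :: "(real^3) set \<Rightarrow> l2 set" where
  "L2_sigma \<Omega> = closure (abs_l2 ` solenoidal_tests \<Omega>)"

text \<open>\<open>k\<close> is the weak partial derivative \<open>\<partial>\<^sub>j h\<close> on \<open>\<Omega>\<close>.\<close>

definition weak_partial ::
  "(real^3) set \<Rightarrow> 3 \<Rightarrow> (real^3 \<Rightarrow> 'b::{banach, second_countable_topology}) \<Rightarrow> (real^3 \<Rightarrow> 'b) \<Rightarrow> bool" where
  "weak_partial \<Omega> j h k \<longleftrightarrow> (\<forall>\<phi> \<in> test_functions \<Omega>.
     (LINT x:\<Omega>|lborel. partial_deriv j \<phi> x *\<^sub>R h x) = - (LINT x:\<Omega>|lborel. \<phi> x *\<^sub>R k x))"

definition gradient_fields :: "(real^3) set \<Rightarrow> l2 set" where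
  "gradient_fields \<Omega> = {g \<in> L2_on \<Omega>. \<exists>q :: real^3 \<Rightarrow> real.
     q \<in> borel_measurable borel \<and> set_integrable lborel \<Omega> (\<lambda>x. (q x)\<^sup>2) \<and>
     (\<forall>j. weak_partial \<Omega> j q (\<lambda>x. rep_l2 g x $ j))}"

definition helmholtz_proj :: "(real^3) set \<Rightarrow> l2 \<Rightarrow> l2" where
  "helmholtz_proj \<Omega> u = (THE v. v \<in> L2_sigma \<Omega> \<and> u - v \<in> gradient_fields \<Omega>)"

definition H1 :: "(real^3) set \<Rightarrow> l2 set" where
  "H1 \<Omega> = {u \<in> L2_on \<Omega>. \<forall>j. \<exists>d \<in> L2_on \<Omega>. weak_partial \<Omega> j (rep_l2 u) (rep_l2 d)}"

definition D_weak :: "(real^3) set \<Rightarrow> 3 \<Rightarrow> l2 \<Rightarrow> l2" where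
  "D_weak \<Omega> j u = (THE d. d \<in> L2_on \<Omega> \<and> weak_partial \<Omega> j (rep_l2 u) (rep_l2 d))"

definition H1_norm :: "(real^3) set \<Rightarrow> l2 \<Rightarrow> real" where
  "H1_norm \<Omega> u = sqrt ((norm u)\<^sup>2 + (\<Sum>j\<in>UNIV. (norm (D_weak \<Omega> j u))\<^sup>2))"


section \<open>The Stokes operator, its semigroup and its fractional powers\<close>

text \<open>Closure of the solenoidal test fields in \<open>H\<^sup>1(\<Omega>)\<close>.\<close>

definition form_domain :: "(real^3) set \<Rightarrow> l2 set" where
  "form_domain \<Omega> = {u \<in> H1 \<Omega>. \<forall>e>0. \<exists>w \<in> solenoidal_tests \<Omega>. H1_norm \<Omega> (u - abs_l2 w) < e}"

definition stokes_form :: "(real^3) set \<Rightarrow> l2 \<Rightarrow> l2 \<Rightarrow> real" where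
  "stokes_form \<Omega> u v = (\<Sum>j\<in>UNIV. inner (D_weak \<Omega> j u) (D_weak \<Omega> j v))"

definition stokes_domain :: "(real^3) set \<Rightarrow> l2 set" where
  "stokes_domain \<Omega> = {u \<in> form_domain \<Omega>.
     \<exists>g \<in> L2_sigma \<Omega>. \<forall>v \<in> form_domain \<Omega>. stokes_form \<Omega> u v = inner g v}"

definition stokes :: "(real^3) set \<Rightarrow> l2 \<Rightarrow> l2" where
  "stokes \<Omega> u = (THE g. g \<in> L2_sigma \<Omega> \<and> (\<forall>v \<in> form_domain \<Omega>. stokes_form \<Omega> u v = inner g v))"

text \<open>Strongly continuous semigroups of bounded operators on a closed subspace \<open>H\<close>, and
  the graph of the infinitesimal generator.\<close>

definition c0_semigroup_on :: "'a::real_normed_vector set \<Rightarrow> (real \<Rightarrow> 'a \<Rightarrow> 'a) \<Rightarrow> bool" where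
  "c0_semigroup_on H S \<longleftrightarrow>
     (\<forall>t\<ge>0. (\<forall>x\<in>H. S t x \<in> H) \<and>
        (\<forall>x\<in>H. \<forall>y\<in>H. S t (x + y) = S t x + S t y) \<and>
        (\<forall>x\<in>H. \<forall>c. S t (c *\<^sub>R x) = c *\<^sub>R S t x) \<and>
        (\<exists>M. \<forall>x\<in>H. norm (S t x) \<le> M * norm x)) \<and>
     (\<forall>x\<in>H. S 0 x = x) \<and>
     (\<forall>s\<ge>0. \<forall>t\<ge>0. \<forall>x\<in>H. S (s + t) x = S s (S t x)) \<and>
     (\<forall>x\<in>H. ((\<lambda>t. S t x) \<longlongrightarrow> x) (at_right 0))"

definition generator_on :: "'a::real_normed_vector set \<Rightarrow> (real \<Rightarrow> 'a \<Rightarrow> 'a) \<Rightarrow> ('a \<times> 'a) set" where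
  "generator_on H S = {(x, y). x \<in> H \<and> ((\<lambda>t. (1 / t) *\<^sub>R (S t x - x)) \<longlongrightarrow> y) (at_right 0)}"

text \<open>A semigroup is determined on \<open>L\<^sup>2\<^sub>\<sigma>(\<Omega>)\<close> by its generator, so the choice made here
  affects only values at fields outside that space or at negative times.\<close>

definition stokes_semigroup :: "(real^3) set \<Rightarrow> real \<Rightarrow> l2 \<Rightarrow> l2" where
  "stokes_semigroup \<Omega> = (SOME S. c0_semigroup_on (L2_sigma \<Omega>) S \<and>
     generator_on (L2_sigma \<Omega>) S = (\<lambda>u. (u, - stokes \<Omega> u)) ` stokes_domain \<Omega>)"

text \<open>\<open>neg_pow \<Omega> \<beta>\<close> is \<open>A\<^sup>-\<^sup>\<beta>\<close> and \<open>frac_pow \<Omega> \<beta>\<close> is \<open>A\<^sup>\<beta>\<close>, with domain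
  \<open>frac_domain \<Omega> \<beta>\<close>; all for \<open>\<beta> > 0\<close>.\<close>

definition neg_pow :: "(real^3) set \<Rightarrow> real \<Rightarrow> l2 \<Rightarrow> l2" where
  "neg_pow \<Omega> \<beta> x =
     (1 / Gamma \<beta>) *\<^sub>R (LINT t:{0<..}|lborel. (t powr (\<beta> - 1)) *\<^sub>R stokes_semigroup \<Omega> t x)"

definition frac_domain :: "(real^3) set \<Rightarrow> real \<Rightarrow> l2 set" where
  "frac_domain \<Omega> \<beta> = neg_pow \<Omega> \<beta> ` L2_sigma \<Omega>"

definition frac_pow :: "(real^3) set \<Rightarrow> real \<Rightarrow> l2 \<Rightarrow> l2" where
  "frac_pow \<Omega> \<beta> = inv_into (L2_sigma \<Omega>) (neg_pow \<Omega> \<beta>)"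

definition frac_norm :: "(real^3) set \<Rightarrow> real \<Rightarrow> l2 \<Rightarrow> real" where
  "frac_norm \<Omega> \<beta> x = norm (frac_pow \<Omega> \<beta> x)"


section \<open>The solution operators\<close>

text \<open>The fields are real-valued, whereas the resolvents \<open>(\<lambda>\<^sup>\<alpha> + A)\<^sup>-\<^sup>1\<close> on the contour are complex.
  They are taken on the complexification, whose element \<open>v + i w\<close> is the pair \<open>(v, w)\<close> and on
  which \<open>A\<close> acts componentwise.\<close>

definition cscale :: "complex \<Rightarrow> 'a::real_vector \<times> 'a \<Rightarrow> 'a \<times> 'a" where
  "cscale c z = (Re c *\<^sub>R fst z - Im c *\<^sub>R snd z, Re c *\<^sub>R snd z + Im c *\<^sub>R fst z)"

text \<open>\<open>stokes_resolvent \<Omega> \<mu>\<close> is \<open>(\<mu> + A)\<^sup>-\<^sup>1\<close>.\<close>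

definition stokes_resolvent :: "(real^3) set \<Rightarrow> complex \<Rightarrow> l2 \<times> l2 \<Rightarrow> l2 \<times> l2" where
  "stokes_resolvent \<Omega> \<mu> = inv_into (stokes_domain \<Omega> \<times> stokes_domain \<Omega>)
     (\<lambda>z. cscale \<mu> z + map_prod (stokes \<Omega>) (stokes \<Omega>) z)"

text \<open>Arc, upper ray and (traversed towards the arc) lower ray of \<open>\<Gamma>\<^bsub>\<rho>,\<eta>\<^esub>\<close>.\<close>

definition contour_int :: "real \<Rightarrow> real \<Rightarrow> (complex \<Rightarrow> l2 \<times> l2) \<Rightarrow> l2 \<times> l2" where
  "contour_int \<rho> \<eta> g =
     (LINT \<theta>:{-\<eta>..\<eta>}|lborel. cscale (\<i> * rcis \<rho> \<theta>) (g (rcis \<rho> \<theta>)))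
   + (LINT s:{\<rho>..}|lborel. cscale (cis \<eta>) (g (rcis s \<eta>)))
   - (LINT s:{\<rho>..}|lborel. cscale (cis (-\<eta>)) (g (rcis s (-\<eta>))))"

text \<open>The contour is symmetric about the real axis, so both operators map real fields to real
  fields and the imaginary component discarded by \<open>fst\<close> is zero.\<close>

definition S_op :: "(real^3) set \<Rightarrow> real \<Rightarrow> real \<Rightarrow> real \<Rightarrow> real \<Rightarrow> l2 \<Rightarrow> l2" where
  "S_op \<Omega> \<rho> \<eta> \<alpha> t x = fst (cscale (1 / (2 * of_real pi * \<i>)) (contour_int \<rho> \<eta>
     (\<lambda>l. cscale (exp (l * of_real t) * l powr of_real (\<alpha> - 1))
            (stokes_resolvent \<Omega> (l powr of_real \<alpha>) (x, 0)))))"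

definition T_op :: "(real^3) set \<Rightarrow> real \<Rightarrow> real \<Rightarrow> real \<Rightarrow> real \<Rightarrow> l2 \<Rightarrow> l2" where
  "T_op \<Omega> \<rho> \<eta> \<alpha> t x = fst (cscale (1 / (2 * of_real pi * \<i>)) (contour_int \<rho> \<eta>
     (\<lambda>l. cscale (exp (l * of_real t)) (stokes_resolvent \<Omega> (l powr of_real \<alpha>) (x, 0)))))"


section \<open>Nonlinearity, delay and mild solutions\<close>

text \<open>\<open>(u \<cdot> \<nabla>) u\<close>\<close>

definition convection :: "(real^3) set \<Rightarrow> l2 \<Rightarrow> real^3 \<Rightarrow> real^3" where
  "convection \<Omega> u x = (\<Sum>j\<in>UNIV. (rep_l2 u x $ j) *\<^sub>R rep_l2 (D_weak \<Omega> j u) x)"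

text \<open>\<open>A_quarter_F \<Omega> u\<close> is \<open>A\<^sup>-\<^sup>1\<^sup>/\<^sup>4 F u\<close>, and \<open>T_op_F\<close> is \<open>T\<^sub>\<alpha>(t) F u\<close>.\<close>

definition A_quarter_F :: "(real^3) set \<Rightarrow> l2 \<Rightarrow> l2" where
  "A_quarter_F \<Omega> u = (THE z. z \<in> L2_sigma \<Omega> \<and> (\<forall>w \<in> L2_sigma \<Omega>.
     inner z w = - (LINT x:\<Omega>|lborel. inner (convection \<Omega> u x) (rep_l2 (neg_pow \<Omega> (1/4) w) x))))"

definition T_op_F :: "(real^3) set \<Rightarrow> real \<Rightarrow> real \<Rightarrow> real \<Rightarrow> real \<Rightarrow> l2 \<Rightarrow> l2" where
  "T_op_F \<Omega> \<rho> \<eta> \<alpha> t u = frac_pow \<Omega> (1/4) (T_op \<Omega> \<rho> \<eta> \<alpha> t (A_quarter_F \<Omega> u))"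

text \<open>\<open>u \<in> C(I; D(A\<^sup>1\<^sup>/\<^sup>2))\<close>\<close>

definition continuous_half :: "(real^3) set \<Rightarrow> real set \<Rightarrow> (real \<Rightarrow> l2) \<Rightarrow> bool" where
  "continuous_half \<Omega> I u \<longleftrightarrow> (\<forall>t\<in>I. u t \<in> frac_domain \<Omega> (1/2)) \<and>
     (\<forall>t\<in>I. ((\<lambda>s. frac_norm \<Omega> (1/2) (u s - u t)) \<longlongrightarrow> 0) (at t within I))"

definition Y_half :: "(real^3) set \<Rightarrow> real \<Rightarrow> (real \<Rightarrow> l2) set" where
  "Y_half \<Omega> r = {\<phi> \<in> extensional {-r..0}. continuous_half \<Omega> {-r..0} \<phi>}"

definition Y_norm :: "(real^3) set \<Rightarrow> real \<Rightarrow> (real \<Rightarrow> l2) \<Rightarrow> real" where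
  "Y_norm \<Omega> r \<phi> = (SUP \<theta>\<in>{-r..0}. frac_norm \<Omega> (1/2) (\<phi> \<theta>))"

definition history :: "real \<Rightarrow> (real \<Rightarrow> l2) \<Rightarrow> real \<Rightarrow> real \<Rightarrow> l2" where
  "history r u t = restrict (\<lambda>\<theta>. u (t + \<theta>)) {-r..0}"

definition Lp_loc :: "real \<Rightarrow> (real \<Rightarrow> real) \<Rightarrow> bool" where
  "Lp_loc p \<omega> \<longleftrightarrow> \<omega> \<in> borel_measurable (lebesgue_on {0..}) \<and>
     (\<forall>b>0. set_integrable lebesgue {0..b} (\<lambda>t. \<bar>\<omega> t\<bar> powr p))"

text \<open>Mild solution on \<open>[-r, T]\<close>. Both integrals are Bochner integrals in \<open>L\<^sup>2\<^sub>\<sigma>(\<Omega>)\<close>; their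
  existence is part of the definition.\<close>

definition mild_solution :: "(real^3) set \<Rightarrow> real \<Rightarrow> real \<Rightarrow> real \<Rightarrow> real \<Rightarrow>
    (real \<Rightarrow> (real \<Rightarrow> l2) \<Rightarrow> l2) \<Rightarrow> (real \<Rightarrow> l2) \<Rightarrow> real \<Rightarrow> (real \<Rightarrow> l2) \<Rightarrow> bool" where
  "mild_solution \<Omega> \<rho> \<eta> \<alpha> r f \<phi> T u \<longleftrightarrow>
     continuous_half \<Omega> {0..T} u \<and> (\<forall>t\<in>{-r..0}. u t = \<phi> t) \<and>
     (\<forall>t\<in>{0<..T}.
        set_integrable lebesgue {0..t} (\<lambda>s. T_op_F \<Omega> \<rho> \<eta> \<alpha> (t - s) (u s)) \<and>
        set_integrable lebesgue {0..t}
          (\<lambda>s. T_op \<Omega> \<rho> \<eta> \<alpha> (t - s) (helmholtz_proj \<Omega> (f s (history r u s)))) \<and>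
        u t = S_op \<Omega> \<rho> \<eta> \<alpha> t (\<phi> 0)
          + (LINT s:{0..t}|lebesgue. T_op_F \<Omega> \<rho> \<eta> \<alpha> (t - s) (u s))
          + (LINT s:{0..t}|lebesgue.
               T_op \<Omega> \<rho> \<eta> \<alpha> (t - s) (helmholtz_proj \<Omega> (f s (history r u s)))))"

text \<open>Mild solution on \<open>[-r, tm)\<close>.\<close>

definition mild_solution_upto :: "(real^3) set \<Rightarrow> real \<Rightarrow> real \<Rightarrow> real \<Rightarrow> real \<Rightarrow>
    (real \<Rightarrow> (real \<Rightarrow> l2) \<Rightarrow> l2) \<Rightarrow> (real \<Rightarrow> l2) \<Rightarrow> ereal \<Rightarrow> (real \<Rightarrow> l2) \<Rightarrow> bool" where
  "mild_solution_upto \<Omega> \<rho> \<eta> \<alpha> r f \<phi> tm u \<longleftrightarrow> 0 < tm \<and>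
     (\<forall>T>0. ereal T < tm \<longrightarrow> mild_solution \<Omega> \<rho> \<eta> \<alpha> r f \<phi> T u)"

text \<open>Every strictly larger interval contains a closed one \<open>[-r, T]\<close> with \<open>tm \<le> T\<close>, so it suffices
  to exclude extensions to these.\<close>

definition maximal_mild_solution :: "(real^3) set \<Rightarrow> real \<Rightarrow> real \<Rightarrow> real \<Rightarrow> real \<Rightarrow>
    (real \<Rightarrow> (real \<Rightarrow> l2) \<Rightarrow> l2) \<Rightarrow> (real \<Rightarrow> l2) \<Rightarrow> ereal \<Rightarrow> (real \<Rightarrow> l2) \<Rightarrow> bool" where
  "maximal_mild_solution \<Omega> \<rho> \<eta> \<alpha> r f \<phi> tm u \<longleftrightarrow>
     mild_solution_upto \<Omega> \<rho> \<eta> \<alpha> r f \<phi> tm u \<and>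
     \<not> (\<exists>T v. tm \<le> ereal T \<and> mild_solution \<Omega> \<rho> \<eta> \<alpha> r f \<phi> T v \<and>
            (\<forall>t\<ge>-r. ereal t < tm \<longrightarrow> v t = u t))"

end

theory Submission
  imports Defs "HOL-Complex_Analysis.Cauchy_Integral_Theorem"
begin

text \<open>A multiple \<open>B\<close> of \<open>A\<^sup>-\<^sup>1\<close> is symmetric with \<open>0 \<le> B \<le> 1\<close>, and Bernstein polynomials give a continuous
  functional calculus for it. The Stokes semigroup, the fractional powers and, via scalar contour
  integrals, \<open>S\<^sub>\<alpha>(t)\<close> and \<open>T\<^sub>\<alpha>(t)\<close> are functions of \<open>B\<close>, so that \<open>A\<^sup>\<gamma> T\<^sub>\<alpha>(t)\<close> is bounded by a multiple
  of \<open>t\<close> to the power \<open>\<alpha> (1 - \<gamma>) - 1\<close>. The Sobolev inequality and a dyadic decomposition bound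
  \<open>A\<^sup>-\<^sup>1\<^sup>/\<^sup>4 w\<close> in \<open>L\<^sup>3\<close>, which makes \<open>x \<mapsto> A\<^sup>-\<^sup>1\<^sup>/\<^sup>4 F A\<^sup>-\<^sup>1\<^sup>/\<^sup>2 x\<close> locally Lipschitz. For \<open>x = A\<^sup>1\<^sup>/\<^sup>2 u\<close> the equation is
  a Volterra equation with two weakly singular kernels. Truncating the nonlinearity turns it into a
  contraction in an exponentially weighted norm, and local solutions are glued to a maximal one. A
  solution that stays bounded up to a finite \<open>t\<^sub>m\<^sub>a\<^sub>x\<close> solves a truncated equation, hence can be continued.\<close>

section \<open>Functional calculus of a positive contraction\<close>

text \<open>With \<open>B\<close> = \<open>gap\<close> A^(-1), a spectral value k of
  \<open>B\<close> in [0,1] stands for the value \<open>gap\<close> / k of A, so the unbounded end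
  of A sits at k = 0. Everything is arranged to have a symbol that is continuous there: exp(-t
  \<open>gap\<close> / k), (k / \<open>gap\<close>)^\<beta>, k / (\<mu> k + \<open>gap\<close>), and
  k^(1-\<gamma>) times a scalar contour integral for A^\<gamma> T_\<alpha>(t) with \<gamma> < 1.
  Limits that are not uniform near k = 0 are recovered strongly, because the range of
  \<open>B\<close> is dense in L^2_sigma. The exponent 1/4 fits Hoelder's inequality: u lies in L^6
  and its gradient in L^2, so the tested field must lie in L^3, and L^3 is the midpoint between L^2
  and the L^6 that A^(-1/2) reaches. Moving A^(1/4) across and applying A^(1/2) leaves A^(3/4)
  T_\<alpha>(t) against the convective term and A^(1/2) T_\<alpha>(t) against the force, with the
  integrable singularities t^(\<alpha>/4 - 1) and t^(\<alpha>/2 - 1).\<close>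

definition bern_poly :: "nat => nat => real poly" where
  "bern_poly n i = smult (of_nat (n choose i)) ([:0, 1:] ^ i * [:1, -1:] ^ (n - i))"

lemma poly_bern_poly: "poly (bern_poly n i) x = Bernstein n i x"
  by (simp add: bern_poly_def Bernstein_def poly_power algebra_simps)

lemma sum_bern_poly: "(\<Sum>i\<le>n. bern_poly n i) = 1"
  by (rule poly_eq_poly_eq_iff[THEN iffD1, OF ext]) (simp add: poly_sum poly_bern_poly)

text \<open>The identity (n choose i)(i choose m) = (n choose m)(n-m choose i-m) pulls out x^m and
  leaves the Bernstein polynomials of degree n - m, which sum to 1. The coefficients are compared
  with the samples (i/n)^m in \<open>choose_ratio_bound\<close>.\<close>

lemma monomial_bern_poly:
  assumes "m \<le> n"
  shows "[:0, 1:] ^ m = (\<Sum>i\<le>n. smult (of_nat (i choose m) / of_nat (n choose m)) (bern_poly n i))"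
proof (rule poly_eq_poly_eq_iff[THEN iffD1, OF ext])
  fix x :: real
  have nz: "real (n choose m) \<noteq> 0" using assms by simp
  have "(\<Sum>i\<le>n. real (i choose m) * Bernstein n i x) = (\<Sum>i\<in>{m..n}. real (i choose m) * Bernstein n i x)"
    by (rule sum.mono_neutral_right) (auto simp: binomial_eq_0)
  also have "\<dots> = (\<Sum>i\<in>{m..n}. real (n choose m) * x ^ m * Bernstein (n - m) (i - m) x)"
  proof (rule sum.cong[OF refl])
    fix i assume "i \<in> {m..n}"
    then have i: "m \<le> i" "i \<le> n" by auto
    have "real (n choose i) * real (i choose m) = real (n choose m) * real ((n - m) choose (i - m))"
      using choose_mult[OF i] by (metis of_nat_mult)
    moreover have "x ^ i = x ^ m * x ^ (i - m)" "n - i = n - m - (i - m)"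
      using i by (simp_all flip: power_add)
    ultimately show "real (i choose m) * Bernstein n i x
        = real (n choose m) * x ^ m * Bernstein (n - m) (i - m) x"
      by (simp add: Bernstein_def) (metis mult.assoc mult.commute)
  qed
  also have "\<dots> = real (n choose m) * x ^ m * (\<Sum>j\<le>n - m. Bernstein (n - m) j x)"
    unfolding sum_distrib_left
    by (rule sum.reindex_bij_witness[of _ "%j. j + m" "%i. i - m"]) (use assms in auto)
  finally show "poly ([:0, 1:] ^ m) x
      = poly (\<Sum>i\<le>n. smult (real (i choose m) / real (n choose m)) (bern_poly n i)) x"
    using nz by (simp add: poly_power poly_sum poly_bern_poly flip: sum_divide_distrib)
qed

text \<open>Both numbers are products of m factors of modulus at most 1, so they differ by at most
  the sum of the m differences of factors, each at most m / (n - m). The condition 2 m < n keeps (i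
  - j) / (n - j) above -1 when i < j.\<close>

lemma choose_ratio_bound:
  assumes "i \<le> n" "2 * m < n"
  shows "\<bar>of_nat (i choose m) / of_nat (n choose m) - (real i / real n) ^ m\<bar> \<le> real m * (real m / (real n - real m))"
proof -
  have n: "real n > 0" "real n - real m > 0" using assms by auto
  have ch: "real (k choose m) = (\<Prod>j<m. real k - real j) / fact m" for k
    by (simp add: binomial_gbinomial gbinomial_prod_rev atLeast0LessThan)
  have "real (i choose m) / real (n choose m) = (\<Prod>j<m. (real i - real j) / (real n - real j))"
    by (simp add: ch prod_dividef)
  moreover have "(real i / real n) ^ m = (\<Prod>j<m. real i / real n)" by simp
  moreover have "norm ((\<Prod>j<m. (real i - real j) / (real n - real j)) - (\<Prod>j<m. real i / real n))
      \<le> (\<Sum>j<m. norm ((real i - real j) / (real n - real j) - real i / real n))"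
  proof (rule norm_prod_diff)
    fix j assume "j \<in> {..<m}"
    then show "norm ((real i - real j) / (real n - real j)) \<le> 1" "norm (real i / real n) \<le> 1"
      using assms by (auto simp: abs_le_iff)
  qed
  moreover have "(\<Sum>j<m. norm ((real i - real j) / (real n - real j) - real i / real n))
      \<le> (\<Sum>j<m. real m / (real n - real m))"
  proof (rule sum_mono)
    fix j assume "j \<in> {..<m}"
    then have j: "real j < real m" by simp
    have "(real i - real j) / (real n - real j) - real i / real n
        = - (real j / (real n - real j) * ((real n - real i) / real n))"
      using n j by (simp add: field_simps)
    then have "norm ((real i - real j) / (real n - real j) - real i / real n)
        = real j / (real n - real j) * ((real n - real i) / real n)"
      using n j assms by (simp add: abs_mult)
    also have "\<dots> \<le> real j / (real n - real j) * 1"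
      using n j assms by (intro mult_left_mono) auto
    also have "\<dots> \<le> real m / (real n - real m)"
      using n j by (simp, intro frac_le) auto
    finally show "norm ((real i - real j) / (real n - real j) - real i / real n)
        \<le> real m / (real n - real m)" .
  qed
  ultimately show ?thesis by simp
qed

lemma subspace_closure:
  fixes S :: "'a::real_normed_vector set"
  assumes s: "subspace S"
  shows "subspace (closure S)"
proof (rule subspaceI)
  show "0 \<in> closure S" by (rule subsetD[OF closure_subset subspace_0[OF s]])
  fix x y c assume x: "x \<in> closure S"
  then obtain u where u: "\<And>n. u n \<in> S" "u \<longlonglongrightarrow> x" unfolding closure_sequential by blast
  show "c *\<^sub>R x \<in> closure S"
    unfolding closure_sequential
    using subspace_scale[OF s u(1)] tendsto_scaleR[OF tendsto_const u(2), of c]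
    by (intro exI[of _ "%n. c *\<^sub>R u n"]) simp
  assume "y \<in> closure S"
  then obtain v where v: "\<And>n. v n \<in> S" "v \<longlonglongrightarrow> y" unfolding closure_sequential by blast
  show "x + y \<in> closure S"
    unfolding closure_sequential
    using subspace_add[OF s u(1) v(1)] tendsto_add[OF u(2) v(2)]
    by (intro exI[of _ "%n. u n + v n"]) simp
qed

section \<open>Polynomials in a positive contraction\<close>

locale positive_contraction =
  fixes B :: "'a::{real_inner, banach, second_countable_topology} => 'a"
  assumes lin: "linear B"
    and sym: "inner (B x) y = inner x (B y)"
    and nonneg: "0 \<le> inner (B x) x"
    and le_one: "inner (B x) x \<le> inner x x"
begin

definition op_poly :: "real poly => 'a => 'a" where
  "op_poly p x = (\<Sum>i\<le>degree p. coeff p i *\<^sub>R (B ^^ i) x)"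

lemma op_poly_eq: "degree p \<le> n ==> op_poly p x = (\<Sum>i\<le>n. coeff p i *\<^sub>R (B ^^ i) x)"
  unfolding op_poly_def by (rule sum.mono_neutral_left) (auto simp: coeff_eq_0)

lemma op_poly_0 [simp]: "op_poly 0 x = 0"
  by (simp add: op_poly_def)

lemma op_poly_add: "op_poly (p + q) x = op_poly p x + op_poly q x"
proof -
  let ?n = "max (degree p) (degree q)"
  show ?thesis
    by (simp add: op_poly_eq[of "p + q" ?n] op_poly_eq[of p ?n] op_poly_eq[of q ?n]
        degree_add_le scaleR_add_left sum.distrib)
qed

lemma op_poly_smult: "op_poly (smult c p) x = c *\<^sub>R op_poly p x"
  by (simp add: op_poly_eq[of "smult c p" "degree p"] op_poly_def scaleR_sum_right)

lemma op_poly_sum: "op_poly (\<Sum>i\<in>I. p i) x = (\<Sum>i\<in>I. op_poly (p i) x)"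
  by (induction I rule: infinite_finite_induct) (auto simp: op_poly_add)

lemma op_poly_diff: "op_poly (p - q) x = op_poly p x - op_poly q x"
proof -
  have "p - q = p + smult (-1) q" by simp
  then show ?thesis by (simp only: op_poly_add op_poly_smult) simp
qed

lemma op_poly_pCons: "op_poly (pCons a p) x = a *\<^sub>R x + B (op_poly p x)"
proof -
  have "op_poly (pCons a p) x = (\<Sum>i\<le>Suc (degree p). coeff (pCons a p) i *\<^sub>R (B ^^ i) x)"
    by (rule op_poly_eq) (simp add: degree_pCons_le)
  also have "\<dots> = a *\<^sub>R x + (\<Sum>i\<le>degree p. coeff p i *\<^sub>R B ((B ^^ i) x))"
    by (simp only: sum.atMost_Suc_shift) simp
  also have "\<dots> = a *\<^sub>R x + B (op_poly p x)"
    by (simp add: op_poly_def linear_sum[OF lin] linear_scale[OF lin])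
  finally show ?thesis .
qed

lemma op_poly_1 [simp]: "op_poly 1 x = x"
  unfolding one_pCons by (simp add: op_poly_pCons linear_0[OF lin])

lemma linear_op_poly: "linear (op_poly p)"
proof (induction p)
  case (pCons a p)
  have "op_poly (pCons a p) = (%x. a *\<^sub>R x + (B \<circ> op_poly p) x)"
    by (auto simp: op_poly_pCons)
  moreover have "linear (%x. a *\<^sub>R x + (B \<circ> op_poly p) x)"
    by (intro linear_compose_add linear_compose lin pCons) (auto intro: linearI simp: algebra_simps)
  ultimately show ?case by simp
qed (auto intro: linearI)

lemma op_poly_mult: "op_poly (p * q) x = op_poly p (op_poly q x)"
  by (induction p) (auto simp: op_poly_add op_poly_smult op_poly_pCons linear_0[OF lin])

lemma op_poly_B: "op_poly p (B x) = B (op_poly p x)"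
  by (induction p) (auto simp: op_poly_pCons linear_0[OF lin] linear_add[OF lin] linear_scale[OF lin])

lemma op_poly_sym: "inner (op_poly p x) y = inner x (op_poly p y)"
proof (induction p arbitrary: y)
  case (pCons a p)
  show ?case
    by (simp add: op_poly_pCons inner_add_left inner_add_right sym pCons.IH op_poly_B)
qed simp

lemma op_poly_X: "op_poly [:0, 1:] x = B x"
  by (simp add: op_poly_pCons linear_0[OF lin])

lemma op_poly_1_minus_X: "op_poly [:1, -1:] x = x - B x"
  by (simp add: op_poly_pCons linear_0[OF lin] linear_neg[OF lin])

lemma op_poly_square: "inner (op_poly (r * (p * p)) x) x = inner (op_poly r (op_poly p x)) (op_poly p x)"
proof -
  have "r * (p * p) = p * (r * p)" by (simp add: ac_simps)
  then show ?thesis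
    by (simp only: op_poly_mult) (rule op_poly_sym)
qed

text \<open>Splitting off even powers leaves a square, which symmetry distributes over both sides of
  the inner product. The remaining factor is 1, X, 1 - X or X (1 - X). The last one is reduced to
  the others by X + (1 - X) = 1, which rewrites it as (1 - X) X^2 + X (1 - X)^2.\<close>

lemma op_poly_basic_nonneg: "0 \<le> inner (op_poly ([:0, 1:] ^ i * [:1, -1:] ^ j) x) x"
proof -
  let ?X = "[:0, 1:] :: real poly" and ?Y = "[:1, -1:] :: real poly"
  define a where "a = i div 2"
  define b where "b = j div 2"
  define q where "q = ?X ^ a * ?Y ^ b"
  have pos_X: "0 \<le> inner (op_poly (?X * (p * p)) x) x" for p
    unfolding op_poly_square op_poly_X by (rule nonneg)
  have pos_Y: "0 \<le> inner (op_poly (?Y * (p * p)) x) x" for p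
    unfolding op_poly_square op_poly_1_minus_X using le_one by (simp add: inner_diff_left)
  have "i = 2 * a \<or> i = Suc (2 * a)" "j = 2 * b \<or> j = Suc (2 * b)"
    unfolding a_def b_def by presburger+
  then consider "i = 2 * a" "j = 2 * b" | "i = Suc (2 * a)" "j = 2 * b"
    | "i = 2 * a" "j = Suc (2 * b)" | "i = Suc (2 * a)" "j = Suc (2 * b)"
    by blast
  then show ?thesis
  proof cases
    case 1
    then have eq: "?X ^ i * ?Y ^ j = 1 * (q * q)"
      by (simp only: q_def mult_2 power_add) (simp only: ac_simps mult_1_left)
    show ?thesis unfolding eq op_poly_square by simp
  next
    case 2
    then have "?X ^ i * ?Y ^ j = ?X * (q * q)"
      by (simp only: q_def mult_2 power_add power_Suc) (simp only: ac_simps)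
    then show ?thesis using pos_X by metis
  next
    case 3
    then have "?X ^ i * ?Y ^ j = ?Y * (q * q)"
      by (simp only: q_def mult_2 power_add power_Suc) (simp only: ac_simps)
    then show ?thesis using pos_Y by metis
  next
    case 4
    have one: "?X + ?Y = 1" by (simp add: one_pCons)
    have "?X ^ i * ?Y ^ j = 1 * (?X * ?Y * (q * q))"
      by (simp only: 4 q_def mult_2 power_add power_Suc) (simp only: ac_simps mult_1_left)
    also have "\<dots> = ?X * (?X * ?Y * (q * q)) + ?Y * (?X * ?Y * (q * q))"
      by (simp only: one[symmetric] distrib_right)
    also have "\<dots> = ?Y * ((?X * q) * (?X * q)) + ?X * ((?Y * q) * (?Y * q))"
      by (simp only: ac_simps)
    finally have eq: "?X ^ i * ?Y ^ j = ?Y * ((?X * q) * (?X * q)) + ?X * ((?Y * q) * (?Y * q))" .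
    show ?thesis unfolding eq
      using pos_X[of "?Y * q"] pos_Y[of "?X * q"] by (simp only: op_poly_add inner_add_left)
  qed
qed

lemma op_bern_nonneg: "0 \<le> inner (op_poly (bern_poly n i) x) x"
  unfolding bern_poly_def op_poly_smult by (simp add: op_poly_basic_nonneg)

lemma sum_op_bern: "(\<Sum>i\<le>n. op_poly (bern_poly n i) x) = x"
  by (simp only: op_poly_sum[symmetric] sum_bern_poly op_poly_1)

text \<open>The operators of the Bernstein basis are nonnegative and add up to the identity, so they
  act as a partition of unity.\<close>

lemma op_bern_sum_bound:
  assumes "\<And>i. i \<le> n ==> \<bar>c i\<bar> \<le> e"
  shows "\<bar>inner (\<Sum>i\<le>n. c i *\<^sub>R op_poly (bern_poly n i) x) x\<bar> \<le> e * (norm x)\<^sup>2"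
proof -
  have "\<bar>inner (\<Sum>i\<le>n. c i *\<^sub>R op_poly (bern_poly n i) x) x\<bar>
      = \<bar>\<Sum>i\<le>n. c i * inner (op_poly (bern_poly n i) x) x\<bar>"
    by (simp add: inner_sum_left)
  also have "\<dots> \<le> (\<Sum>i\<le>n. e * inner (op_poly (bern_poly n i) x) x)"
    by (rule order_trans[OF sum_abs sum_mono])
      (auto simp: abs_mult op_bern_nonneg intro!: mult_right_mono assms)
  also have "\<dots> = e * inner (\<Sum>i\<le>n. op_poly (bern_poly n i) x) x"
    by (simp add: inner_sum_left sum_distrib_left)
  finally show ?thesis
    by (simp add: sum_op_bern power2_norm_eq_inner)
qed

definition bern_sum :: "nat => (real => real) => real poly" where
  "bern_sum n f = (\<Sum>i\<le>n. smult (f (real i / real n)) (bern_poly n i))"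

lemma op_bern_sum: "op_poly (bern_sum n f) x = (\<Sum>i\<le>n. f (real i / real n) *\<^sub>R op_poly (bern_poly n i) x)"
  by (simp add: bern_sum_def op_poly_sum op_poly_smult)

text \<open>The exact coefficients of X^m in the Bernstein basis and those of its Bernstein sum
  differ by O(1/n) uniformly in i, and \<open>op_bern_sum_bound\<close> carries this over to
  quadratic forms.\<close>

lemma op_bern_sum_monomial:
  "(%n. inner (op_poly (bern_sum n (%t. t ^ m)) x) x) \<longlonglongrightarrow> inner (op_poly ([:0, 1:] ^ m) x) x"
proof (rule LIM_zero_cancel, rule Lim_null_comparison)
  let ?e = "%n. real m * (real m / (real n - real m)) * (norm x)\<^sup>2"
  show "\<forall>\<^sub>F n in sequentially. norm (inner (op_poly (bern_sum n (%t. t ^ m)) x) x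
      - inner (op_poly ([:0, 1:] ^ m) x) x) \<le> ?e n"
  proof (rule eventually_sequentiallyI[of "Suc (2 * m)"])
    fix n assume n: "Suc (2 * m) \<le> n"
    have "op_poly (bern_sum n (%t. t ^ m)) x - op_poly ([:0, 1:] ^ m) x
        = - (\<Sum>i\<le>n. (real (i choose m) / real (n choose m) - (real i / real n) ^ m) *\<^sub>R op_poly (bern_poly n i) x)"
      using n by (subst monomial_bern_poly[of m n])
        (auto simp: op_bern_sum op_poly_sum op_poly_smult scaleR_diff_left sum_subtractf)
    then have "norm (inner (op_poly (bern_sum n (%t. t ^ m)) x) x - inner (op_poly ([:0, 1:] ^ m) x) x)
        = \<bar>inner (\<Sum>i\<le>n. (real (i choose m) / real (n choose m) - (real i / real n) ^ m) *\<^sub>R op_poly (bern_poly n i) x) x\<bar>"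
      by (simp flip: inner_diff_left)
    also have "\<dots> \<le> ?e n"
      by (rule op_bern_sum_bound) (use n choose_ratio_bound in auto)
    finally show "norm (inner (op_poly (bern_sum n (%t. t ^ m)) x) x - inner (op_poly ([:0, 1:] ^ m) x) x) \<le> ?e n" .
  qed
  have "filterlim (%n. real n - real m) at_top sequentially"
    by (rule filterlim_at_top_mono[OF filterlim_real_sequentially[THEN filterlim_tendsto_add_at_top[OF tendsto_const, of _ _ "- real m"]]]) auto
  then have "(%n. real m / (real n - real m)) \<longlonglongrightarrow> 0"
    by (intro tendsto_divide_0[OF tendsto_const] filterlim_at_top_imp_at_infinity)
  from tendsto_mult_left[OF tendsto_mult_right[OF this, of "(norm x)\<^sup>2"], of "real m"]
  show "?e \<longlonglongrightarrow> 0"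
    by (simp add: mult.assoc)
qed

text \<open>A Bernstein sum of \<open>p\<close> has the samples of \<open>p\<close> on [0,1] as
  coefficients of nonnegative operators, so its form is nonnegative. As n grows the form tends to
  that of \<open>p\<close>, monomial by monomial.\<close>

lemma op_poly_nonneg:
  assumes "\<And>t. 0 \<le> t ==> t \<le> 1 ==> 0 \<le> poly p t"
  shows "0 \<le> inner (op_poly p x) x"
proof (rule tendsto_lowerbound)
  have "(%n. \<Sum>m\<le>degree p. coeff p m * inner (op_poly (bern_sum n (%t. t ^ m)) x) x)
      \<longlonglongrightarrow> (\<Sum>m\<le>degree p. coeff p m * inner (op_poly ([:0, 1:] ^ m) x) x)"
    by (intro tendsto_sum tendsto_mult_left op_bern_sum_monomial)
  moreover have "(\<Sum>m\<le>degree p. coeff p m * inner (op_poly (bern_sum n (%t. t ^ m)) x) x)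
      = inner (op_poly (bern_sum n (poly p)) x) x" for n
    unfolding op_bern_sum poly_altdef inner_sum_left sum_distrib_left scaleR_sum_left
    by (subst sum.swap) (simp add: mult.assoc)
  moreover have "(\<Sum>m\<le>degree p. coeff p m * inner (op_poly ([:0, 1:] ^ m) x) x) = inner (op_poly p x) x"
  proof -
    have "p = (\<Sum>m\<le>degree p. smult (coeff p m) ([:0, 1:] ^ m))"
      by (subst (1) poly_as_sum_of_monoms[symmetric]) (simp add: monom_altdef)
    then have "op_poly p x = op_poly (\<Sum>m\<le>degree p. smult (coeff p m) ([:0, 1:] ^ m)) x"
      by (rule arg_cong)
    then show ?thesis
      by (simp only: op_poly_sum op_poly_smult inner_sum_left inner_scaleR_left)
  qed
  ultimately show "(%n. inner (op_poly (bern_sum n (poly p)) x) x) \<longlonglongrightarrow> inner (op_poly p x) x"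
    by simp
  show "\<forall>\<^sub>F n in sequentially. 0 \<le> inner (op_poly (bern_sum n (poly p)) x) x"
  proof (rule always_eventually, rule allI)
    fix n
    have "0 \<le> poly p (real i / real n)" if "i \<le> n" for i
      using that by (intro assms) (auto simp: divide_le_eq)
    then show "0 \<le> inner (op_poly (bern_sum n (poly p)) x) x"
      unfolding op_bern_sum inner_sum_left by (auto intro!: sum_nonneg mult_nonneg_nonneg op_bern_nonneg)
  qed
qed simp

text \<open>The polynomial c^2 - p^2 is nonnegative on [0,1], hence so is its form, and this is the
  squared norm bound. For p = X it shows that \<open>B\<close> is continuous.\<close>

lemma norm_op_poly_le:
  assumes "\<And>t. 0 \<le> t ==> t \<le> 1 ==> \<bar>poly p t\<bar> \<le> c"
  shows "norm (op_poly p x) \<le> c * norm x"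
proof (rule power2_le_imp_le)
  have c: "0 \<le> c" using assms[of 0] by simp
  have "0 \<le> inner (op_poly (smult (c\<^sup>2) 1 - p * p) x) x"
  proof (rule op_poly_nonneg)
    fix t :: real assume "0 \<le> t" "t \<le> 1"
    then have "\<bar>poly p t\<bar>\<^sup>2 \<le> c\<^sup>2" by (intro power_mono assms) auto
    then show "0 \<le> poly (smult (c\<^sup>2) 1 - p * p) t" by (simp add: power2_eq_square)
  qed
  also have "\<dots> = c\<^sup>2 * (norm x)\<^sup>2 - (norm (op_poly p x))\<^sup>2"
    by (simp only: op_poly_diff op_poly_smult op_poly_mult inner_diff_left op_poly_sym power2_norm_eq_inner
        op_poly_1 inner_scaleR_left inner_scaleR_right)
  finally show "(norm (op_poly p x))\<^sup>2 \<le> (c * norm x)\<^sup>2" by (simp add: power_mult_distrib)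
  show "0 \<le> c * norm x" using c by simp
qed

section \<open>The continuous functional calculus\<close>

definition Phi :: "(real => real) => 'a => 'a" where
  "Phi f x = lim (%n. op_poly (bern_sum n f) x)"

lemma Phi_cong: "(\<And>t. 0 \<le> t ==> t \<le> 1 ==> f t = g t) ==> Phi f x = Phi g x"
proof -
  assume *: "\<And>t. 0 \<le> t ==> t \<le> 1 ==> f t = g t"
  have "bern_sum n f = bern_sum n g" for n
    unfolding bern_sum_def by (intro sum.cong refl arg_cong2[where f = smult] *) (auto simp: divide_le_eq)
  then show ?thesis by (simp add: Phi_def)
qed

lemma uniform_limit_bern_sum:
  assumes "continuous_on {0..1} f"
  shows "uniform_limit {0..1} (%n. poly (bern_sum n f)) f sequentially"
proof (rule uniform_limitI)
  fix e :: real assume "e > 0"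
  from Bernstein_Weierstrass[OF assms this] obtain N where
    "\<And>n x. N \<le> n ==> x \<in> {0..1} ==> \<bar>f x - (\<Sum>k\<le>n. f (k/n) * Bernstein n k x)\<bar> < e" by blast
  then show "\<forall>\<^sub>F n in sequentially. \<forall>x\<in>{0..1}. dist (poly (bern_sum n f) x) (f x) < e"
    by (intro eventually_sequentiallyI[of N])
      (auto simp: bern_sum_def poly_sum poly_bern_poly dist_real_def abs_minus_commute)
qed

text \<open>By \<open>norm_op_poly_le\<close>, polynomials that are uniformly close on [0,1] give
  close operators, so the limit depends on f alone and not on the approximating sequence. This
  identifies limits of products of Bernstein sums, which are not Bernstein sums themselves.\<close>

lemma op_poly_uniform_limit:
  assumes f: "continuous_on {0..1} f" and P: "uniform_limit {0..1} (%n. poly (P n)) f sequentially"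
  shows "(%n. op_poly (P n) x) \<longlonglongrightarrow> Phi f x"
proof -
  note Q = uniform_limit_bern_sum[OF f]
  have close: "\<exists>N. \<forall>m\<ge>N. \<forall>n\<ge>N. norm (op_poly (P1 m) x - op_poly (P2 n) x) < e"
    if "uniform_limit {0..1} (%n. poly (P1 n)) f sequentially"
      "uniform_limit {0..1} (%n. poly (P2 n)) f sequentially" "e > 0" for P1 P2 e
  proof -
    define d where "d = e / (2 * (norm x + 1))"
    have nx: "norm x + 1 > 0" by (simp add: add_nonneg_pos)
    have d: "d > 0" using \<open>e > 0\<close> nx by (simp add: d_def)
    from uniform_limitD[OF that(1) d] uniform_limitD[OF that(2) d]
    have "\<forall>\<^sub>F n in sequentially. (\<forall>t\<in>{0..1}. dist (poly (P1 n) t) (f t) < d) \<and> (\<forall>t\<in>{0..1}. dist (poly (P2 n) t) (f t) < d)"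
      by eventually_elim auto
    then obtain N where N: "\<And>n t. N \<le> n ==> t \<in> {0..1} ==> dist (poly (P1 n) t) (f t) < d \<and> dist (poly (P2 n) t) (f t) < d"
      unfolding eventually_sequentially by blast
    show ?thesis
    proof (intro exI allI impI)
      fix m n assume mn: "N \<le> m" "N \<le> n"
      have "norm (op_poly (P1 m - P2 n) x) \<le> (2 * d) * norm x"
      proof (rule norm_op_poly_le)
        fix t :: real assume "0 \<le> t" "t \<le> 1"
        then have "dist (poly (P1 m) t) (f t) < d" "dist (poly (P2 n) t) (f t) < d"
          using N mn by auto
        then show "\<bar>poly (P1 m - P2 n) t\<bar> \<le> 2 * d" by (simp add: dist_real_def)
      qed
      also have "\<dots> < (2 * d) * (norm x + 1)" using d by simp
      also have "\<dots> = e" using nx by (simp add: d_def field_simps)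
      finally show "norm (op_poly (P1 m) x - op_poly (P2 n) x) < e" by (simp add: op_poly_diff)
    qed
  qed
  have "Cauchy (%n. op_poly (bern_sum n f) x)"
    by (rule CauchyI) (use close[OF Q Q] in blast)
  then have lim: "(%n. op_poly (bern_sum n f) x) \<longlonglongrightarrow> Phi f x"
    unfolding Phi_def by (simp add: Cauchy_convergent_iff convergent_LIMSEQ_iff)
  have "(%n. op_poly (P n) x - op_poly (bern_sum n f) x) \<longlonglongrightarrow> 0"
    by (rule LIMSEQ_I) (use close[OF P Q] in fastforce)
  from tendsto_add[OF this lim] show ?thesis by simp
qed

lemma op_bern_sum_tendsto:
  "continuous_on {0..1} f ==> (%n. op_poly (bern_sum n f) x) \<longlonglongrightarrow> Phi f x"
  by (intro op_poly_uniform_limit uniform_limit_bern_sum)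

lemma Phi_poly: "Phi (poly p) x = op_poly p x"
proof -
  have "(%n. op_poly p x) \<longlonglongrightarrow> Phi (poly p) x"
    by (rule op_poly_uniform_limit) (auto intro!: continuous_intros uniform_limit_const)
  then show ?thesis by (simp add: LIMSEQ_const_iff)
qed

lemma Phi_ident: "Phi (%t. t) x = B x"
proof -
  have "poly [:0, 1:] = (%t::real. t)" by (simp add: fun_eq_iff)
  then show ?thesis using Phi_poly[of "[:0, 1:]" x] by (simp only: op_poly_X)
qed

lemma Phi_1: "Phi (%t. 1) x = x"
proof -
  have "poly 1 = (%t::real. 1)" by (simp add: fun_eq_iff)
  then show ?thesis using Phi_poly[of 1 x] by (simp only: op_poly_1)
qed

lemma Phi_0: "Phi (%t. 0) x = 0"
proof -
  have "poly 0 = (%t::real. 0)" by (simp add: fun_eq_iff)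
  then show ?thesis using Phi_poly[of 0 x] by (simp only: op_poly_0)
qed

lemma norm_Phi_le:
  assumes f: "continuous_on {0..1} f" and le: "\<And>t. 0 \<le> t ==> t \<le> 1 ==> \<bar>f t\<bar> \<le> c"
  shows "norm (Phi f x) \<le> c * norm x"
proof (rule tendsto_upperbound[OF tendsto_norm[OF op_bern_sum_tendsto[OF f]]])
  show "\<forall>\<^sub>F n in sequentially. norm (op_poly (bern_sum n f) x) \<le> c * norm x"
  proof (intro always_eventually allI norm_op_poly_le)
    fix n and t :: real assume t: "0 \<le> t" "t \<le> 1"
    have "\<bar>poly (bern_sum n f) t\<bar> \<le> (\<Sum>i\<le>n. \<bar>f (real i / real n) * Bernstein n i t\<bar>)"
      unfolding bern_sum_def poly_sum poly_smult poly_bern_poly by (rule sum_abs)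
    also have "\<dots> \<le> (\<Sum>i\<le>n. c * Bernstein n i t)"
      using t by (intro sum_mono) (auto simp: abs_mult Bernstein_nonneg divide_le_eq intro!: mult_right_mono le)
    also have "\<dots> = c" by (simp flip: sum_distrib_left)
    finally show "\<bar>poly (bern_sum n f) t\<bar> \<le> c" .
  qed
qed simp

text \<open>A bound for all Bernstein sums at once, which is the domination needed to integrate the
  calculus over a parameter.\<close>

lemma op_bern_sum_norm_le:
  assumes "\<And>i. i \<le> n ==> \<bar>f (real i / real n)\<bar> \<le> c"
  shows "norm (op_poly (bern_sum n f) x) \<le> c * norm x"
proof (rule norm_op_poly_le)
  fix t :: real assume t: "0 \<le> t" "t \<le> 1"
  have "\<bar>poly (bern_sum n f) t\<bar> \<le> (\<Sum>i\<le>n. \<bar>f (real i / real n) * Bernstein n i t\<bar>)"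
    unfolding bern_sum_def poly_sum poly_smult poly_bern_poly by (rule sum_abs)
  also have "\<dots> \<le> (\<Sum>i\<le>n. c * Bernstein n i t)"
    using t by (intro sum_mono) (auto simp: abs_mult Bernstein_nonneg intro!: mult_right_mono assms)
  also have "\<dots> = c" by (simp flip: sum_distrib_left)
  finally show "\<bar>poly (bern_sum n f) t\<bar> \<le> c" .
qed

lemma Phi_linear:
  assumes f: "continuous_on {0..1} f"
  shows "linear (Phi f)"
proof (rule linearI)
  note l = op_bern_sum_tendsto[OF f]
  show "Phi f (x + y) = Phi f x + Phi f y" for x y
    using LIMSEQ_unique[OF l[of "x + y"] tendsto_add[OF l l, of x y, folded linear_add[OF linear_op_poly]]] .
  show "Phi f (c *\<^sub>R x) = c *\<^sub>R Phi f x" for c x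
    using LIMSEQ_unique[OF l[of "c *\<^sub>R x"] tendsto_scaleR[OF tendsto_const l, of c x, folded linear_scale[OF linear_op_poly]]] .
qed

lemma continuous_bounded_01:
  assumes f: "continuous_on {0..1::real} (f :: real => real)"
  obtains c where "c > 0" "\<And>t. 0 \<le> t ==> t \<le> 1 ==> \<bar>f t\<bar> \<le> c"
proof -
  have "bounded (f ` {0..1})" by (intro compact_imp_bounded compact_continuous_image f compact_Icc)
  then obtain c where "c > 0" "\<forall>x\<in>f ` {0..1}. norm x \<le> c" unfolding bounded_pos by blast
  then show ?thesis by (intro that[of c]) auto
qed

lemma Phi_bounded_linear:
  assumes f: "continuous_on {0..1} f"
  shows "bounded_linear (Phi f)"
proof -
  obtain c where "\<And>t. 0 \<le> t ==> t \<le> 1 ==> \<bar>f t\<bar> \<le> c" by (rule continuous_bounded_01[OF f]) blast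
  then have "norm (Phi f x) \<le> norm x * c" for x using norm_Phi_le[OF f] by (simp add: mult.commute)
  then show ?thesis using Phi_linear[OF f]
    by (intro bounded_linear_intro) (auto simp: linear_add linear_scale)
qed

lemma Phi_sym:
  assumes f: "continuous_on {0..1} f"
  shows "inner (Phi f x) y = inner x (Phi f y)"
  using LIMSEQ_unique[OF tendsto_inner[OF op_bern_sum_tendsto[OF f] tendsto_const, of x y, unfolded op_poly_sym]
    tendsto_inner[OF tendsto_const op_bern_sum_tendsto[OF f]]] .

lemma Phi_add:
  assumes f: "continuous_on {0..1} f" and g: "continuous_on {0..1} g"
  shows "Phi (%t. f t + g t) x = Phi f x + Phi g x"
proof -
  have "bern_sum n (%t. f t + g t) = bern_sum n f + bern_sum n g" for n
    by (simp add: bern_sum_def smult_add_left sum.distrib)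
  moreover have "continuous_on {0..1} (%t. f t + g t)" by (intro continuous_intros f g)
  ultimately show ?thesis
    using op_bern_sum_tendsto[of "%t. f t + g t" x] tendsto_add[OF op_bern_sum_tendsto[OF f] op_bern_sum_tendsto[OF g], of x x]
    by (simp add: op_poly_add LIMSEQ_unique)
qed

lemma Phi_scale:
  assumes f: "continuous_on {0..1} f"
  shows "Phi (%t. c * f t) x = c *\<^sub>R Phi f x"
proof -
  have "bern_sum n (%t. c * f t) = smult c (bern_sum n f)" for n
    by (rule poly_eq_poly_eq_iff[THEN iffD1, OF ext]) (simp add: bern_sum_def poly_sum sum_distrib_left mult.assoc)
  moreover have "continuous_on {0..1} (%t. c * f t)" by (intro continuous_intros f)
  ultimately show ?thesis
    using op_bern_sum_tendsto[of "%t. c * f t" x] tendsto_scaleR[OF tendsto_const op_bern_sum_tendsto[OF f], of c x]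
    by (simp add: op_poly_smult LIMSEQ_unique)
qed

lemma Phi_diff:
  assumes f: "continuous_on {0..1} f" and g: "continuous_on {0..1} g"
  shows "Phi (%t. f t - g t) x = Phi f x - Phi g x"
  using Phi_add[OF f continuous_on_mult[OF continuous_on_const[of _ "-1"] g], of x] Phi_scale[OF g, of "-1" x] by simp

lemma Phi_sum:
  assumes "finite I" "\<And>i. i \<in> I ==> continuous_on {0..1} (f i)"
  shows "Phi (%t. \<Sum>i\<in>I. f i t) x = (\<Sum>i\<in>I. Phi (f i) x)"
  using assms by (induction I rule: finite_induct) (auto simp: Phi_0 Phi_add continuous_on_sum)

text \<open>The product of the two Bernstein sums converges uniformly to f g. Against a fixed y one
  factor is moved to the other side, so that each side of the inner product converges strongly on
  its own.\<close>

lemma Phi_mult: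
  assumes f: "continuous_on {0..1} f" and g: "continuous_on {0..1} g"
  shows "Phi (%t. f t * g t) x = Phi f (Phi g x)"
proof -
  have fg: "continuous_on {0..1} (%t. f t * g t)" by (intro continuous_intros f g)
  have bdd: "bounded (h ` {0..1})" if "continuous_on {0..1} h" for h :: "real => real"
    using that by (intro compact_imp_bounded compact_continuous_image compact_Icc)
  have "uniform_limit {0..1} (%n t. poly (bern_sum n f) t * poly (bern_sum n g) t) (%t. f t * g t) sequentially"
    by (intro uniform_lim_mult uniform_limit_bern_sum f g bdd)
  then have lim: "(%n. op_poly (bern_sum n f * bern_sum n g) x) \<longlonglongrightarrow> Phi (%t. f t * g t) x"
    by (intro op_poly_uniform_limit fg) (simp only: poly_mult[abs_def] poly_mult)
  have "inner (Phi (%t. f t * g t) x) y = inner (Phi f (Phi g x)) y" for y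
  proof (rule LIMSEQ_unique[OF tendsto_inner[OF lim tendsto_const]])
    show "(%n. inner (op_poly (bern_sum n f * bern_sum n g) x) y) \<longlonglongrightarrow> inner (Phi f (Phi g x)) y"
      unfolding op_poly_mult op_poly_sym[of "bern_sum _ f"] Phi_sym[OF f]
      by (intro tendsto_inner op_bern_sum_tendsto f g)
  qed
  then show ?thesis by (metis vector_eq_rdot)
qed

lemma Phi_commute:
  assumes f: "continuous_on {0..1} f" and g: "continuous_on {0..1} g"
  shows "Phi f (Phi g x) = Phi g (Phi f x)"
  using Phi_mult[OF f g, of x] Phi_mult[OF g f, of x] by (simp add: mult.commute)

text \<open>For each n the Bernstein sum is a finite linear combination with scalar coefficients g s
  (i/n), so integration passes through it; \<open>w\<close> dominates uniformly in n, and the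
  identity survives the limit. The semigroup and contour integrals are reduced to scalar integrals
  in this way.\<close>

lemma Phi_integral:
  assumes g: "\<And>s. s \<in> space M ==> continuous_on {0..1} (g s)"
    and int: "\<And>t. 0 \<le> t ==> t \<le> 1 ==> (%s. g s t) \<in> borel_measurable M"
    and w: "integrable M w" "\<And>s t. s \<in> space M ==> 0 \<le> t ==> t \<le> 1 ==> \<bar>g s t\<bar> \<le> w s"
  shows "continuous_on {0..1} (%t. integral\<^sup>L M (%s. g s t))"
    and "integrable M (%s. Phi (g s) x)"
    and "integral\<^sup>L M (%s. Phi (g s) x) = Phi (%t. integral\<^sup>L M (%s. g s t)) x"
proof -
  show cont: "continuous_on {0..1} (%t. integral\<^sup>L M (%s. g s t))"
    unfolding continuous_on_sequentially
  proof (intro ballI allI impI, elim conjE)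
    fix t and u :: "nat => real"
    assume t: "t \<in> {0..1}" and u: "\<forall>n. u n \<in> {0..1}" "u \<longlonglongrightarrow> t"
    have "(%n. integral\<^sup>L M (%s. g s (u n))) \<longlonglongrightarrow> integral\<^sup>L M (%s. g s t)"
    proof (rule integral_dominated_convergence[OF _ _ w(1)])
      show "AE s in M. (%n. g s (u n)) \<longlonglongrightarrow> g s t"
        using g t u unfolding continuous_on_sequentially by (auto simp: o_def)
    qed (use t u int w(2) in auto)
    then show "((%t. integral\<^sup>L M (%s. g s t)) \<circ> u) \<longlonglongrightarrow> integral\<^sup>L M (%s. g s t)"
      by (simp add: o_def)
  qed
  have int: "integrable M (%s. g s t)" if "0 \<le> t" "t \<le> 1" for t
    by (rule Bochner_Integration.integrable_bound[OF w(1) int[OF that]])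
      (use w(2) that in force)
  have 01: "0 \<le> real i / real n" "real i / real n \<le> 1" if "i \<le> n" for i n
    using that by (auto simp: divide_le_eq)
  have op_int: "integrable M (%s. op_poly (bern_sum n (g s)) x)" for n
    unfolding op_bern_sum using 01 by (intro Bochner_Integration.integrable_sum integrable_scaleR_left int) auto
  have meas: "(%s. Phi (g s) x) \<in> borel_measurable M"
    by (rule borel_measurable_LIMSEQ_metric[of "%n s. op_poly (bern_sum n (g s)) x"])
      (use op_int in \<open>auto intro!: op_bern_sum_tendsto g\<close>)
  note dom = integral_dominated_convergence[of "%s. Phi (g s) x" M "%n s. op_poly (bern_sum n (g s)) x" "%s. w s * norm x"]
    integrable_dominated_convergence[of "%s. Phi (g s) x" M "%n s. op_poly (bern_sum n (g s)) x" "%s. w s * norm x"]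
  have bnd: "norm (op_poly (bern_sum n (g s)) x) \<le> w s * norm x" if "s \<in> space M" for n s
    using that 01 by (intro op_bern_sum_norm_le w(2)) auto
  show "integrable M (%s. Phi (g s) x)"
    by (rule dom(2)) (use op_int meas w(1) in \<open>auto intro!: op_bern_sum_tendsto g bnd\<close>)
  have "(%n. integral\<^sup>L M (%s. op_poly (bern_sum n (g s)) x)) \<longlonglongrightarrow> integral\<^sup>L M (%s. Phi (g s) x)"
    by (rule dom(1)) (use op_int meas w(1) in \<open>auto intro!: op_bern_sum_tendsto g bnd\<close>)
  moreover have "integral\<^sup>L M (%s. op_poly (bern_sum n (g s)) x) = op_poly (bern_sum n (%t. integral\<^sup>L M (%s. g s t))) x" for n
    unfolding op_bern_sum using 01 by (subst Bochner_Integration.integral_sum) (auto intro!: int sum.cong integrable_scaleR_left integral_scaleR_left)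
  ultimately show "integral\<^sup>L M (%s. Phi (g s) x) = Phi (%t. integral\<^sup>L M (%s. g s t)) x"
    using op_bern_sum_tendsto[OF cont, of x] by (simp add: LIMSEQ_unique)
qed

section \<open>The closed range and strong limits\<close>

definition H :: "'a set" where "H = closure (range B)"

lemma subspace_H: "subspace H"
  unfolding H_def by (intro subspace_closure linear_subspace_image lin subspace_UNIV)

lemma closed_H: "closed H"
  by (simp add: H_def)

lemma B_in_H: "B x \<in> H"
  unfolding H_def by (rule subsetD[OF closure_subset rangeI])

lemma Phi_in_H:
  assumes f: "continuous_on {0..1} f" and x: "x \<in> H"
  shows "Phi f x \<in> H"
proof -
  have "op_poly p x \<in> H" for p
  proof (induction p)
    case (pCons a p)
    show ?case
      unfolding op_poly_pCons by (rule subspace_add[OF subspace_H subspace_scale[OF subspace_H x] B_in_H])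
  qed (simp add: subspace_0[OF subspace_H])
  then show ?thesis
    by (intro closed_sequentially[OF closed_H _ op_bern_sum_tendsto[OF f]])
qed

text \<open>The symbols need converge only after multiplication by t, so nothing is asked of the
  limit near 0 beyond the bound. On the range of \<open>B\<close> the factor t is available, and the
  uniform bound c carries strong convergence to the closure \<open>H\<close>.\<close>

lemma Phi_tendsto:
  assumes x: "x \<in> H" and F: "\<forall>\<^sub>F i in F. continuous_on {0..1} (f i) \<and> (\<forall>t\<in>{0..1}. \<bar>f i t\<bar> \<le> c \<and> t * \<bar>f i t - g t\<bar> \<le> e i)"
    and e: "(e \<longlongrightarrow> 0) F" and g: "continuous_on {0..1} g"
  shows "((%i. Phi (f i) x) \<longlongrightarrow> Phi g x) F"
proof (rule tendstoI)
  fix \<epsilon> :: real assume \<epsilon>: "\<epsilon> > 0"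
  obtain c' where c': "c' > 0" "\<And>t. 0 \<le> t ==> t \<le> 1 ==> \<bar>g t\<bar> \<le> c'"
    by (rule continuous_bounded_01[OF g]) (assumption | rule that)+
  define C where "C = \<bar>c\<bar> + c'"
  have C: "C > 0" using c' by (simp add: C_def)
  from x have "\<exists>y\<in>range B. dist y x < \<epsilon> / (2 * C)"
    unfolding H_def closure_approachable using \<epsilon> C by simp
  then obtain z where z: "norm (x - B z) < \<epsilon> / (2 * C)" by (auto simp: dist_norm norm_minus_commute)
  have "((%i. e i * norm z) \<longlongrightarrow> 0) F" using tendsto_mult_left_zero[OF e] by simp
  then have "\<forall>\<^sub>F i in F. e i * norm z < \<epsilon> / 2" using \<epsilon> by (intro order_tendstoD(2)[of _ 0]) auto
  with F show "\<forall>\<^sub>F i in F. dist (Phi (f i) x) (Phi g x) < \<epsilon>"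
  proof eventually_elim
    fix i assume i: "continuous_on {0..1} (f i) \<and> (\<forall>t\<in>{0..1}. \<bar>f i t\<bar> \<le> c \<and> t * \<bar>f i t - g t\<bar> \<le> e i)"
      and ez: "e i * norm z < \<epsilon> / 2"
    let ?d = "%t. f i t - g t"
    have d: "continuous_on {0..1} ?d" by (intro continuous_intros g) (use i in auto)
    have "Phi (f i) x - Phi g x = Phi ?d (x - B z) + Phi ?d (B z)"
      using i by (simp add: Phi_diff[OF _ g, symmetric] linear_diff[OF Phi_linear[OF d]])
    also have "Phi ?d (B z) = Phi (%t. ?d t * t) z"
      by (subst Phi_mult[OF d]) (auto simp: Phi_ident continuous_on_id)
    finally have "norm (Phi (f i) x - Phi g x) \<le> norm (Phi ?d (x - B z)) + norm (Phi (%t. ?d t * t) z)"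
      by (simp add: norm_triangle_ineq)
    also have "norm (Phi ?d (x - B z)) \<le> C * norm (x - B z)"
    proof (rule norm_Phi_le[OF d])
      fix t :: real assume "0 \<le> t" "t \<le> 1"
      then have "\<bar>f i t\<bar> \<le> c" "\<bar>g t\<bar> \<le> c'" using i c' by auto
      then show "\<bar>?d t\<bar> \<le> C" unfolding C_def by linarith
    qed
    also have "norm (Phi (%t. ?d t * t) z) \<le> e i * norm z"
      by (rule norm_Phi_le) (use i in \<open>auto intro!: continuous_intros d simp: abs_mult mult.commute\<close>)
    also have "C * norm (x - B z) + e i * norm z < \<epsilon>"
      using z ez C by (simp add: field_simps)
    finally show "dist (Phi (f i) x) (Phi g x) < \<epsilon>" by (simp add: dist_norm)
  qed
qed

lemma B_inj: "x \<in> H ==> B x = 0 ==> x = 0"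
proof -
  assume x: "x \<in> H" "B x = 0"
  have "H \<subseteq> {y. inner x y = 0}"
    unfolding H_def
  proof (rule closure_minimal)
    show "range B \<subseteq> {y. inner x y = 0}" using x(2) by (auto simp flip: sym)
    show "closed {y. inner x y = 0}" by (intro closed_Collect_eq continuous_intros)
  qed
  with x(1) show "x = 0" by auto
qed

text \<open>From t = t^(1-b) t^b, the kernel of the power lies in the kernel of \<open>B\<close>.
  The case b = 1 is separate because 0 powr 0 = 0 makes the exponent 0 discontinuous at the
  origin.\<close>

lemma Phi_powr_inj:
  assumes x: "x \<in> H" and "0 < b" "b \<le> 1" and "Phi (%t. t powr b) x = 0"
  shows "x = 0"
proof (cases "b = 1")
  case False
  have c: "continuous_on {0..1} (%t::real. t powr a)" if "a > 0" for a
    using that by (intro continuous_on_powr' continuous_intros) auto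
  have b: "1 - b > 0" using assms False by simp
  have "B x = Phi (%t. t) x" by (simp only: Phi_ident)
  also have "\<dots> = Phi (%t. t powr (1 - b) * t powr b) x"
    by (rule Phi_cong) (auto simp flip: powr_add)
  also have "\<dots> = 0"
    unfolding Phi_mult[OF c[OF b] c[OF \<open>0 < b\<close>]] assms(4) by (rule linear_0[OF Phi_linear[OF c[OF b]]])
  finally show ?thesis by (rule B_inj[OF x])
next
  case True
  have "Phi (%t. t powr b) x = Phi (%t. t) x"
    by (rule Phi_cong) (simp add: True)
  then have "Phi (%t. t powr b) x = B x" by (simp only: Phi_ident)
  with assms B_inj show ?thesis by simp
qed

end

section \<open>Test functions and weak derivatives\<close>

lemma partial_derivI: "(f has_derivative f') (at x) ==> partial_deriv j f x = f' (axis j 1)"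
  unfolding partial_deriv_def using frechet_derivative_at by metis

text \<open>Functions p(1/t) exp(-c/t), extended by 0 to t \<le> 0, are closed under
  differentiation: in s = 1/t the polynomial p becomes s^2 (c p - p'). They yield the bumps of this
  section, and \<open>flat 1 c\<close> is later the symbol of the semigroup.\<close>

definition flat :: "real poly => real => real => real" where
  "flat p c t = (if 0 < t then poly p (1 / t) * exp (- (c / t)) else 0)"

lemma poly_exp_tendsto_0:
  assumes "c > 0"
  shows "((%s. poly p s * exp (- (c * s))) \<longlongrightarrow> (0::real)) at_top"
proof -
  have mono: "((%s. s ^ i * exp (- (c * s))) \<longlongrightarrow> (0::real)) at_top" for i
  proof -
    have "filterlim (%s. c * s) at_top at_top"
      using assms by (intro filterlim_tendsto_pos_mult_at_top[OF tendsto_const] filterlim_ident) auto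
    from filterlim_compose[OF tendsto_power_div_exp_0[of i] this]
    have "((%s. (1 / c ^ i) * ((c * s) ^ i / exp (c * s))) \<longlongrightarrow> (1 / c ^ i) * 0) at_top"
      by (rule tendsto_mult_left)
    then show ?thesis
      using assms by (simp add: exp_minus field_simps)
  qed
  have "((%s. \<Sum>i\<le>degree p. coeff p i * (s ^ i * exp (- (c * s)))) \<longlongrightarrow> (\<Sum>i\<le>degree p. coeff p i * 0)) at_top"
    by (intro tendsto_sum tendsto_mult_left mono)
  then show ?thesis
    by (simp add: poly_altdef sum_distrib_right mult.assoc)
qed

lemma flat_has_derivative:
  assumes c: "c > 0"
  shows "(flat p c has_real_derivative flat ([:0, 0, 1:] * (smult c p - pderiv p)) c t) (at t)"
proof -
  let ?q = "[:0, 0, 1:] * (smult c p - pderiv p)"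
  consider "t > 0" | "t < 0" | "t = 0" by linarith
  then show ?thesis
  proof cases
    case 1
    have "((%t. poly p (1 / t) * exp (- (c / t))) has_real_derivative flat ?q c t) (at t)"
      using 1 by (auto intro!: derivative_eq_intros simp: flat_def field_simps power2_eq_square)
    then show ?thesis
      by (rule has_field_derivative_transform_within_open[of _ _ _ "{0<..}"]) (use 1 in \<open>auto simp: flat_def\<close>)
  next
    case 2
    have "((%t. 0) has_real_derivative flat ?q c t) (at t)" using 2 by (simp add: flat_def)
    then show ?thesis
      by (rule has_field_derivative_transform_within_open[of _ _ _ "{..<0}"]) (use 2 in \<open>auto simp: flat_def\<close>)
  next
    case 3
    have "((%h. flat p c h / h) \<longlongrightarrow> 0) (at_right 0)"
    proof -
      have "((%h::real. poly (pCons 0 p) (inverse h) * exp (- (c * inverse h))) \<longlongrightarrow> 0) (at_right 0)"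
        by (rule filterlim_compose[OF poly_exp_tendsto_0[OF c] filterlim_inverse_at_top_right])
      then show ?thesis
        by (rule Lim_transform_eventually)
          (auto intro!: eventually_at_rightI[of 0 1] simp: flat_def field_simps)
    qed
    moreover have "((%h. flat p c h / h) \<longlongrightarrow> 0) (at_left 0)"
      by (rule tendsto_eventually) (auto intro!: eventually_at_leftI[of "-1"] simp: flat_def)
    ultimately have "((%h. flat p c h / h) \<longlongrightarrow> 0) (at 0)"
      by (simp add: filterlim_split_at)
    then show ?thesis using 3 by (simp add: DERIV_def flat_def)
  qed
qed

text \<open>The products of shifted flat functions of single coordinates generate an algebra that is
  closed under partial differentiation, so its elements are smooth.\<close>

inductive flat_algebra :: "(real^3 => real) => bool" where
  atom: "c > 0 ==> flat_algebra (%x. flat p c (s * x $ i + b))"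
| add: "flat_algebra f ==> flat_algebra g ==> flat_algebra (%x. f x + g x)"
| mult: "flat_algebra f ==> flat_algebra g ==> flat_algebra (%x. f x * g x)"

lemma flat_algebra_deriv:
  assumes "flat_algebra f"
  shows "(\<forall>x. f differentiable (at x)) \<and> (\<forall>j. flat_algebra (partial_deriv j f))"
  using assms
proof induction
  case (atom c p s i b)
  let ?q = "[:0, 0, 1:] * (smult c p - pderiv p)"
  have d: "((%x::real^3. flat p c (s * x $ i + b)) has_derivative (%h. flat ?q c (s * x $ i + b) * (s * h $ i))) (at x)" for x
  proof -
    have "((%x::real^3. s * x $ i + b) has_derivative (%h. s * h $ i)) (at x)"
      by (auto intro!: derivative_eq_intros bounded_linear.has_derivative[OF bounded_linear_vec_nth])
    from has_derivative_compose[OF this flat_has_derivative[OF atom, of p, THEN has_field_derivative_imp_has_derivative]]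
    show ?thesis by simp
  qed
  have "flat_algebra (partial_deriv j (%x::real^3. flat p c (s * x $ i + b)))" for j
  proof -
    have "partial_deriv j (%x::real^3. flat p c (s * x $ i + b))
        = (%x. flat (smult (s * axis j 1 $ i) ?q) c (s * x $ i + b))"
      by (rule ext, subst partial_derivI[OF d]) (simp add: flat_def)
    then show ?thesis using atom by (simp only: flat_algebra.atom)
  qed
  then show ?case using d unfolding differentiable_def by blast
next
  case (add f g)
  have "partial_deriv j (%x. f x + g x) = (%x. partial_deriv j f x + partial_deriv j g x)" for j
    using add.IH by (intro ext partial_derivI[THEN trans] has_derivative_add)
      (auto simp: partial_deriv_def frechet_derivative_works)
  then show ?case using add by (auto intro!: flat_algebra.add)
next
  case (mult f g)
  have "partial_deriv j (%x. f x * g x) = (%x. f x * partial_deriv j g x + partial_deriv j f x * g x)" for j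
    using mult.IH by (intro ext partial_derivI[THEN trans] has_derivative_mult)
      (auto simp: partial_deriv_def frechet_derivative_works)
  then show ?case using mult by (auto intro!: flat_algebra.add flat_algebra.mult differentiable_mult)
qed

lemma flat_algebra_C_k: "flat_algebra f ==> C_k k UNIV f"
proof (induction k arbitrary: f)
  case 0
  then show ?case
    using flat_algebra_deriv by (auto intro!: continuous_at_imp_continuous_on differentiable_imp_continuous_within)
next
  case (Suc k)
  then show ?case using flat_algebra_deriv by auto
qed

text \<open>One factor per face, so the product is nonzero exactly on the open box. As n grows the
  constants 1 / (n + 1) vanish and the bumps tend pointwise to the indicator of the box, staying
  below 1.\<close>

definition box_bump :: "nat => real^3 => real^3 => real^3 => real" where
  "box_bump n a b x = (\<Prod>i\<in>{1, 2, 3}. flat 1 (1 / Suc n) (x $ i - a $ i) * flat 1 (1 / Suc n) (b $ i - x $ i))"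

lemma box_bump_algebra: "flat_algebra (box_bump n a b)"
proof -
  have "flat_algebra (%x. flat 1 (1 / Suc n) (x $ i - a $ i) * flat 1 (1 / Suc n) (b $ i - x $ i))" for i
    using flat_algebra.mult[OF flat_algebra.atom[of "1 / Suc n" 1 1 i "- a $ i"] flat_algebra.atom[of "1 / Suc n" 1 "-1" i "b $ i"]]
    by simp
  from flat_algebra.mult[OF this[of 1] flat_algebra.mult[OF this[of 2] this[of 3]]]
  show ?thesis by (simp add: box_bump_def[abs_def])
qed

lemma mem_box_3: "x \<in> box a b \<longleftrightarrow> (\<forall>i\<in>{1, 2, 3}. a $ i < x $ i \<and> x $ i < b $ i)" for x :: "real^3"
  by (simp add: mem_box_cart forall_3)

lemma box_bump_nonzero: "box_bump n a b x \<noteq> 0 \<longleftrightarrow> x \<in> box a b"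
  by (auto simp: mem_box_3 box_bump_def flat_def)

lemma box_bump_bounds: "0 \<le> box_bump n a b x" "box_bump n a b x \<le> 1"
  unfolding box_bump_def by (auto intro!: prod_nonneg prod_le_1 mult_le_one simp: flat_def)

lemma box_bump_test:
  assumes "cbox a b \<subseteq> \<Omega>"
  shows "box_bump n a b \<in> test_functions \<Omega>"
proof -
  have "{x. box_bump n a b x \<noteq> 0} = box a b" by (simp add: box_bump_nonzero)
  moreover have "closure (box a b) \<subseteq> cbox a b" by (intro closure_minimal box_subset_cbox closed_cbox)
  ultimately show ?thesis
    unfolding test_functions_def using assms flat_algebra_C_k[OF box_bump_algebra]
    by (auto simp: compact_closure intro!: bounded_box)
qed

lemma box_bump_tendsto: "(%n. box_bump n a b x) \<longlonglongrightarrow> indicator (box a b) x"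
proof (cases "x \<in> box a b")
  case True
  have "(%n. flat 1 (1 / Suc n) t) \<longlonglongrightarrow> 1" if "t > 0" for t
  proof -
    have "(%n. exp (- (1 / t * inverse (real (Suc n))))) \<longlonglongrightarrow> exp (- (1 / t * 0))"
      by (intro tendsto_intros LIMSEQ_inverse_real_of_nat)
    then show ?thesis using that by (simp add: flat_def field_simps)
  qed
  then have "(%n. box_bump n a b x) \<longlonglongrightarrow> (\<Prod>i\<in>{1::3, 2, 3}. 1 * 1)"
    unfolding box_bump_def using True by (intro tendsto_prod tendsto_mult) (auto simp: mem_box_3)
  then show ?thesis using True by simp
next
  case False
  then have "box_bump n a b x = 0" for n using box_bump_nonzero by metis
  then show ?thesis using False by simp
qed

section \<open>Test functions and integration by parts\<close>

lemma test_functionD: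
  assumes "\<phi> \<in> test_functions \<Omega>"
  shows test_differentiable: "\<phi> differentiable (at x)"
    and test_continuous: "continuous_on UNIV \<phi>"
    and test_partial_continuous: "continuous_on UNIV (partial_deriv j \<phi>)"
    and test_partial_smooth: "C_k k UNIV (partial_deriv j \<phi>)"
proof -
  have C: "C_k (Suc k) UNIV \<phi>" for k using assms by (auto simp: test_functions_def simp del: C_k.simps)
  then show "\<phi> differentiable (at x)" by simp
  from assms have "C_k 0 UNIV \<phi>" unfolding test_functions_def by blast
  then show "continuous_on UNIV \<phi>" by simp
  show "C_k k UNIV (partial_deriv j \<phi>)" for k using C[of k] by simp
  from this[of 0] show "continuous_on UNIV (partial_deriv j \<phi>)" by simp
qed

lemma partial_deriv_zero_outside:
  assumes "x \<notin> closure {x. \<phi> x \<noteq> 0}"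
  shows "partial_deriv j \<phi> x = 0"
proof -
  have "((%x. 0) has_derivative (%h. 0)) (at x)" by (rule has_derivative_const)
  then have "(\<phi> has_derivative (%h. 0)) (at x)"
    by (rule has_derivative_transform_within_open[of _ _ _ _ "- closure {x. \<phi> x \<noteq> 0}"])
      (use assms closure_subset[of "{x. \<phi> x \<noteq> 0}"] in \<open>auto simp: open_Compl\<close>)
  from partial_derivI[OF this] show ?thesis .
qed

lemma test_partial:
  assumes "\<phi> \<in> test_functions \<Omega>"
  shows "partial_deriv j \<phi> \<in> test_functions \<Omega>"
proof -
  have sub: "closure {x. partial_deriv j \<phi> x \<noteq> 0} \<subseteq> closure {x. \<phi> x \<noteq> 0}"
    by (rule closure_minimal) (use partial_deriv_zero_outside in auto)
  have *: "compact (closure {x. \<phi> x \<noteq> 0})" "closure {x. \<phi> x \<noteq> 0} \<subseteq> \<Omega>"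
    using assms by (simp_all add: test_functions_def del: compact_closure)
  have "compact (closure {x. \<phi> x \<noteq> 0} \<inter> closure {x. partial_deriv j \<phi> x \<noteq> 0})"
    by (intro compact_Int_closed * closed_closure)
  with sub have "compact (closure {x. partial_deriv j \<phi> x \<noteq> 0})"
    by (simp only: inf.absorb2)
  then show ?thesis
    unfolding test_functions_def using test_partial_smooth[OF assms] order_trans[OF sub *(2)] by blast
qed

lemma test_zero_outside: "\<phi> \<in> test_functions \<Omega> ==> x \<notin> \<Omega> ==> \<phi> x = 0"
  using closure_subset[of "{x. \<phi> x \<noteq> 0}"] by (auto simp: test_functions_def)

lemma compact_support_bound:
  fixes f :: "'a::metric_space => 'b::real_normed_vector"
  assumes "continuous_on UNIV f" "compact K" "\<And>x. x \<notin> K ==> f x = 0"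
  obtains M where "0 \<le> M" "\<And>x. norm (f x) \<le> M * indicator K x"
proof -
  have "compact (f ` K)" using assms by (intro compact_continuous_image) (auto intro: continuous_on_subset)
  then obtain M where M: "0 < M" "\<forall>y\<in>f ` K. norm y \<le> M"
    using compact_imp_bounded bounded_pos by metis
  show ?thesis by (rule that[of M]) (use M assms(3) in \<open>auto simp: indicator_def\<close>)
qed

lemma compact_support_sq_integrable:
  assumes "continuous_on UNIV f" "compact K" "\<And>x. x \<notin> K ==> f x = 0"
  shows "sq_integrable f"
proof -
  obtain M where M: "0 \<le> M" "\<And>x. norm (f x) \<le> M * indicator K x"
    using compact_support_bound[OF assms] by blast
  show ?thesis
  proof (rule sq_integrable_bound)
    show "f \<in> borel_measurable borel" by (rule borel_measurable_continuous_onI[OF assms(1)])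
    show "integrable lborel (%x. M\<^sup>2 * indicator K x)"
      using assms(2) by (intro integrable_mult_right integrable_real_indicator)
        (use emeasure_compact_finite[of K] in \<open>auto simp: borel_compact\<close>)
    show "(norm (f x))\<^sup>2 \<le> M\<^sup>2 * indicator K x" for x
      using power_mono[OF M(2)[of x], of 2] by (cases "x \<in> K") auto
  qed
qed

lemma test_support:
  assumes "\<phi> \<in> test_functions \<Omega>"
  obtains K where "compact K" "K \<subseteq> \<Omega>" "\<And>x. x \<notin> K ==> \<phi> x = 0"
  using assms closure_subset[of "{x. \<phi> x \<noteq> 0}"]
  by (intro that[of "closure {x. \<phi> x \<noteq> 0}"]) (auto simp: test_functions_def)

lemma test_sq_integrable:
  fixes \<phi> :: "real^3 => real^3"
  assumes "\<phi> \<in> test_functions \<Omega>"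
  shows "sq_integrable \<phi>"
  by (rule test_support[OF assms]) (auto intro: compact_support_sq_integrable test_continuous[OF assms])

lemma scalar_test_sq_integrable:
  fixes \<phi> :: "real^3 => real"
  assumes "\<phi> \<in> test_functions \<Omega>"
  shows "sq_integrable (%x. \<phi> x *\<^sub>R e)"
proof (rule test_support[OF assms])
  fix K assume "compact K" "K \<subseteq> \<Omega>" "\<And>x. x \<notin> K ==> \<phi> x = 0"
  then show ?thesis
    by (intro compact_support_sq_integrable[of _ K] continuous_intros test_continuous[OF assms]) auto
qed

lemma line_derivative:
  fixes g :: "real^3 => 'b::real_normed_vector"
  assumes "\<And>x. g differentiable (at x)"
  shows "((%s. g (x + s *\<^sub>R axis j 1)) has_vector_derivative partial_deriv j g (x + s *\<^sub>R axis j 1)) (at s within S)"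
proof -
  let ?p = "%s. x + s *\<^sub>R axis j 1"
  have g: "(g has_derivative frechet_derivative g (at x)) (at x)" for x
    using assms by (simp add: frechet_derivative_works)
  have "(?p has_derivative (%h. h *\<^sub>R axis j 1)) (at s within S)" by (auto intro!: derivative_eq_intros)
  from has_derivative_compose[OF this g] show ?thesis
    unfolding has_vector_derivative_def partial_deriv_def by (simp add: linear_scale[OF has_derivative_linear[OF g]])
qed

text \<open>Integrate \<open>g (x + v) - g x = \<integral>\<^sub>0\<^sup>1 \<partial>\<^sub>j g (x + s v) ds\<close> over \<open>x\<close> and use translation invariance.\<close>

lemma integral_partial_deriv_eq_0:
  fixes g :: "real^3 => 'b::euclidean_space"
  assumes diff: "\<And>x. g differentiable (at x)" and cont: "continuous_on UNIV (partial_deriv j g)"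
    and K: "compact K" "\<And>x. x \<notin> K ==> g x = 0"
  shows "(LINT x|lborel. partial_deriv j g x) = 0"
proof -
  define v :: "real^3" where "v = axis j 1"
  let ?d = "partial_deriv j g" and ?I = "%s. indicator {0..1::real} s"
  have g_cont: "continuous_on UNIV g"
    using diff by (auto intro!: continuous_at_imp_continuous_on differentiable_imp_continuous_within)
  note [measurable] = borel_measurable_continuous_onI[OF g_cont] borel_measurable_continuous_onI[OF cont]
  have K': "x \<notin> K ==> ?d x = 0" for x
  proof -
    assume "x \<notin> K"
    moreover have "closure {x. g x \<noteq> 0} \<subseteq> K"
      using K by (intro closure_minimal compact_imp_closed) auto
    ultimately show ?thesis by (intro partial_deriv_zero_outside) auto
  qed
  obtain M where M: "0 \<le> M" "\<And>x. norm (?d x) \<le> M * indicator K x"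
    by (rule compact_support_bound[OF cont K(1) K']) (auto intro: that)
  obtain N where N: "0 \<le> N" "\<And>x. norm (g x) \<le> N * indicator K x"
    by (rule compact_support_bound[OF g_cont K]) (auto intro: that)
  obtain R where R: "\<And>x. x \<in> K ==> norm x \<le> R"
    using compact_imp_bounded[OF K(1)] by (auto simp: bounded_iff)
  have gi: "integrable lborel g"
    by (rule Bochner_Integration.integrable_bound[of _ "%x. N * indicator K x"])
      (use K(1) N in \<open>auto intro!: integrable_real_indicator emeasure_bounded_finite compact_imp_bounded simp: borel_compact\<close>)
  have tr: "(LINT x|lborel. f (x + a)) = (LINT x|lborel. f x)" "integrable lborel f ==> integrable lborel (%x. f (x + a))"
    if "f \<in> borel_measurable borel" for f :: "real^3 => 'b" and a
    using integrable_distr_eq[of "(+) a" lborel borel f] integral_distr[of "(+) a" lborel borel f] that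
    by (simp_all add: lborel_distr_plus add.commute)
  \<comment> \<open>Shifting by s v with s in [0,1] moves the support, which lies in the ball of
    radius R, by at most 1. A product set of finite measure therefore carries the integrand.\<close>
  have F: "integrable (lborel \<Otimes>\<^sub>M lborel) (%(s, x). ?I s *\<^sub>R ?d (x + s *\<^sub>R v))"
  proof (rule Bochner_Integration.integrable_bound)
    show "integrable (lborel \<Otimes>\<^sub>M lborel) (%p. M * indicator ({0..1::real} \<times> cball (0::real^3) (R + 1)) p)"
      using emeasure_lborel_cball_finite[of "0::real^3" "R + 1"]
      by (intro integrable_mult_right integrable_real_indicator) (auto simp: lborel.emeasure_pair_measure_Times ennreal_mult_less_top)
    show "(%(s, x). ?I s *\<^sub>R ?d (x + s *\<^sub>R v)) \<in> borel_measurable (lborel \<Otimes>\<^sub>M lborel)" by measurable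
    have "norm (?I s *\<^sub>R ?d (x + s *\<^sub>R v)) \<le> M * indicator ({0..1} \<times> cball 0 (R + 1)) (s, x)" for s x
    proof (cases "s \<in> {0..1} \<and> x + s *\<^sub>R v \<in> K")
      case True
      have "norm x \<le> norm (x + s *\<^sub>R v) + norm (s *\<^sub>R v)" by (metis add_diff_cancel_right' norm_triangle_ineq4)
      then have "norm x \<le> R + 1" using True R[of "x + s *\<^sub>R v"] by (simp add: v_def norm_axis_1)
      then show ?thesis using True M(2)[of "x + s *\<^sub>R v"] by simp
    qed (use K' M(1) in \<open>auto simp: indicator_def\<close>)
    then show "AE p in lborel \<Otimes>\<^sub>M lborel. norm (case p of (s, x) => ?I s *\<^sub>R ?d (x + s *\<^sub>R v))
        \<le> norm (M * indicator ({0..1} \<times> cball 0 (R + 1)) p)"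
      using M(1) by (intro AE_I2) (auto simp: split_beta)
  qed
  have "(LINT s|lborel. ?I s *\<^sub>R ?d (x + s *\<^sub>R v)) = g (x + v) - g x" for x
  proof -
    have "(LINT s|lborel. ?I s *\<^sub>R ?d (x + s *\<^sub>R v)) = g (x + 1 *\<^sub>R v) - g (x + 0 *\<^sub>R v)"
      unfolding v_def by (rule integral_FTC_Icc)
        (auto intro!: line_derivative diff continuous_on_compose2[OF cont] continuous_intros)
    then show ?thesis by simp
  qed
  then have "(LINT x|lborel. LINT s|lborel. ?I s *\<^sub>R ?d (x + s *\<^sub>R v)) = (LINT x|lborel. g (x + v)) - (LINT x|lborel. g x)"
    using tr(2)[OF _ gi, of v] gi by simp
  also have "\<dots> = 0" by (simp add: tr(1))
  also have "(LINT x|lborel. LINT s|lborel. ?I s *\<^sub>R ?d (x + s *\<^sub>R v)) = (LINT s|lborel. LINT x|lborel. ?I s *\<^sub>R ?d (x + s *\<^sub>R v))"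
    by (rule lborel_pair.Fubini_integral[OF F])
  also have "\<dots> = (LINT x|lborel. ?d x)" by (simp add: tr(1)[of ?d])
  finally show ?thesis .
qed
lemma partial_deriv_scaleR:
  fixes \<phi> :: "real^3 => real" and w :: "real^3 => 'b::real_normed_vector"
  assumes "\<phi> differentiable (at x)" "w differentiable (at x)"
  shows "(%x. \<phi> x *\<^sub>R w x) differentiable (at x)"
    and "partial_deriv j (%x. \<phi> x *\<^sub>R w x) x = \<phi> x *\<^sub>R partial_deriv j w x + partial_deriv j \<phi> x *\<^sub>R w x"
proof -
  have "((%x. \<phi> x *\<^sub>R w x) has_derivative
      (%h. \<phi> x *\<^sub>R frechet_derivative w (at x) h + frechet_derivative \<phi> (at x) h *\<^sub>R w x)) (at x)"
    using assms by (intro has_derivative_scaleR) (auto simp: frechet_derivative_works)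
  then show "(%x. \<phi> x *\<^sub>R w x) differentiable (at x)"
    "partial_deriv j (%x. \<phi> x *\<^sub>R w x) x = \<phi> x *\<^sub>R partial_deriv j w x + partial_deriv j \<phi> x *\<^sub>R w x"
    by (auto simp: differentiable_def partial_deriv_def dest: frechet_derivative_at[symmetric])
qed

text \<open>The product \<phi> w has compact support, so its partial derivative integrates to 0;
  pairing with the constant e gives the identity. It will show that the weak derivative of a test
  field is the classical one.\<close>

lemma integration_by_parts:
  fixes \<phi> :: "real^3 => real" and w :: "real^3 => real^3"
  assumes \<phi>: "\<phi> \<in> test_functions \<Omega>" and w: "w \<in> test_functions \<Omega>'"
  shows "(LINT x|lborel. inner (partial_deriv j \<phi> x *\<^sub>R e) (w x)) = - (LINT x|lborel. inner (\<phi> x *\<^sub>R e) (partial_deriv j w x))"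
proof -
  note p = partial_deriv_scaleR[OF test_differentiable[OF \<phi>] test_differentiable[OF w]]
  have sq: "sq_integrable (%x. \<phi> x *\<^sub>R e)" "sq_integrable (%x. partial_deriv j \<phi> x *\<^sub>R e)"
    "sq_integrable w" "sq_integrable (partial_deriv j w)" for e
    using \<phi> w by (auto intro: scalar_test_sq_integrable test_sq_integrable test_partial)
  obtain K where K: "compact K" "\<And>x. x \<notin> K ==> \<phi> x = 0" by (rule test_support[OF \<phi>]) (rule that)
  have 0: "(LINT x|lborel. partial_deriv j (%x. \<phi> x *\<^sub>R w x) x) = 0"
  proof (rule integral_partial_deriv_eq_0[OF p(1) _ K(1)])
    show "continuous_on UNIV (partial_deriv j (%x. \<phi> x *\<^sub>R w x))"
      unfolding p(2)[abs_def] by (intro continuous_intros test_continuous[OF \<phi>] test_continuous[OF w]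
        test_partial_continuous[OF \<phi>] test_partial_continuous[OF w])
  qed (simp add: K)
  have c: "continuous_on UNIV (partial_deriv j (%x. \<phi> x *\<^sub>R w x))"
    unfolding p(2)[abs_def] by (intro continuous_intros test_continuous[OF \<phi>] test_continuous[OF w]
        test_partial_continuous[OF \<phi>] test_partial_continuous[OF w])
  have int: "integrable lborel (partial_deriv j (%x. \<phi> x *\<^sub>R w x))"
  proof -
    have "x \<notin> K ==> partial_deriv j (%x. \<phi> x *\<^sub>R w x) x = 0" for x
    proof -
      assume "x \<notin> K"
      moreover have "closure {x. \<phi> x *\<^sub>R w x \<noteq> 0} \<subseteq> K"
        using K by (intro closure_minimal compact_imp_closed) auto
      ultimately show ?thesis by (intro partial_deriv_zero_outside) auto
    qed
    from compact_support_bound[OF c K(1) this] obtain M where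
      M: "0 \<le> M" "\<And>x. norm (partial_deriv j (%x. \<phi> x *\<^sub>R w x) x) \<le> M * indicator K x" by blast
    show ?thesis
      by (rule Bochner_Integration.integrable_bound[of _ "%x. M * indicator K x"])
        (use K(1) M borel_measurable_continuous_onI[OF c] in \<open>auto intro!: integrable_real_indicator
          emeasure_bounded_finite compact_imp_bounded simp: borel_compact\<close>)
  qed
  have "0 = (LINT x|lborel. inner (partial_deriv j (%x. \<phi> x *\<^sub>R w x) x) e)"
    using 0 int by (simp add: integral_inner_left)
  also have "\<dots> = (LINT x|lborel. inner (\<phi> x *\<^sub>R e) (partial_deriv j w x) + inner (partial_deriv j \<phi> x *\<^sub>R e) (w x))"
    unfolding p(2) by (intro Bochner_Integration.integral_cong) (auto simp: inner_add_left inner_add_right inner_commute)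
  also have "\<dots> = (LINT x|lborel. inner (\<phi> x *\<^sub>R e) (partial_deriv j w x)) + (LINT x|lborel. inner (partial_deriv j \<phi> x *\<^sub>R e) (w x))"
    by (rule Bochner_Integration.integral_add) (intro sq_integrable_inner sq)+
  finally show ?thesis by simp
qed

section \<open>Riesz representation in a closed subspace\<close>

lemma closest_to_0:
  fixes S :: "'a::{real_inner, complete_space} set"
  assumes S: "closed S" "convex S" "S \<noteq> {}"
  obtains m where "m \<in> S" "\<And>x. x \<in> S ==> norm m \<le> norm x"
proof -
  define d where "d = (INF x\<in>S. norm x)"
  have bdd: "bdd_below (norm ` S)" by (rule bdd_belowI[of _ 0]) auto
  have d: "d \<le> norm x" if "x \<in> S" for x unfolding d_def using that bdd by (rule cINF_lower[rotated])
  have d0: "0 \<le> d" unfolding d_def using S by (intro cINF_greatest) auto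
  have "\<exists>x\<in>S. norm x < d + inverse (real (Suc n))" for n
  proof (rule ccontr)
    assume "\<not> ?thesis"
    then have "d + inverse (real (Suc n)) \<le> d" unfolding d_def using S by (intro cINF_greatest) (auto simp: not_less)
    then show False by simp
  qed
  then obtain x where x: "\<And>n. x n \<in> S" "\<And>n. norm (x n) < d + inverse (real (Suc n))" by metis
  have inv: "(%n. inverse (real (Suc n))) \<longlonglongrightarrow> 0" by (rule LIMSEQ_inverse_real_of_nat)
  \<comment> \<open>Parallelogram law: the midpoint of x m and x n lies in S, so its norm is at
    least d, which bounds the distance between two nearly minimal elements.\<close>
  have close: "(norm (x m - x n))\<^sup>2 \<le> 2 * ((d + inverse (real (Suc m)))\<^sup>2 - d\<^sup>2) + 2 * ((d + inverse (real (Suc n)))\<^sup>2 - d\<^sup>2)" for m n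
  proof -
    have "(1/2) *\<^sub>R x m + (1/2) *\<^sub>R x n \<in> S"
      by (rule convexD[OF S(2) x(1) x(1)]) auto
    then have "d \<le> norm ((1/2) *\<^sub>R (x m + x n))" using d by (simp add: scaleR_add_right)
    then have "(2 * d)\<^sup>2 \<le> (norm (x m + x n))\<^sup>2" using d0 by (intro power_mono) auto
    then have "4 * d\<^sup>2 \<le> (norm (x m + x n))\<^sup>2" by (simp add: power_mult_distrib)
    moreover have "(norm (x m + x n))\<^sup>2 + (norm (x m - x n))\<^sup>2 = 2 * (norm (x m))\<^sup>2 + 2 * (norm (x n))\<^sup>2"
      by (simp add: power2_norm_eq_inner inner_add_left inner_add_right inner_diff_left inner_diff_right inner_commute)
    moreover have le: "(norm (x k))\<^sup>2 \<le> (d + inverse (real (Suc k)))\<^sup>2" for k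
      using x(2)[of k] by (intro power_mono) auto
    ultimately show ?thesis
      using le[of m] le[of n] unfolding right_diff_distrib by linarith
  qed
  have "Cauchy x"
  proof (rule metric_CauchyI)
    fix e :: real assume e: "e > 0"
    have "(%n. (d + inverse (real (Suc n)))\<^sup>2 - d\<^sup>2) \<longlonglongrightarrow> (d + 0)\<^sup>2 - d\<^sup>2"
      by (intro tendsto_intros inv)
    then have "\<forall>\<^sub>F n in sequentially. (d + inverse (real (Suc n)))\<^sup>2 - d\<^sup>2 < e\<^sup>2 / 4"
      using e by (intro order_tendstoD(2)[of _ 0]) auto
    then obtain N where N: "\<And>n. n \<ge> N ==> (d + inverse (real (Suc n)))\<^sup>2 - d\<^sup>2 < e\<^sup>2 / 4"
      by (auto simp: eventually_sequentially)
    have "dist (x m) (x n) < e" if "m \<ge> N" "n \<ge> N" for m n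
    proof -
      have "(dist (x m) (x n))\<^sup>2 < e\<^sup>2" using close[of m n] N[OF that(1)] N[OF that(2)] by (simp add: dist_norm)
      then show ?thesis using e by (simp add: power2_less_imp_less)
    qed
    then show "\<exists>M. \<forall>m\<ge>M. \<forall>n\<ge>M. dist (x m) (x n) < e" by blast
  qed
  then obtain m where m: "x \<longlonglongrightarrow> m" by (auto simp: Cauchy_convergent_iff convergent_def)
  have "m \<in> S" using S(1) x(1) m by (rule closed_sequentially)
  moreover have "norm m \<le> d"
  proof (rule tendsto_le[OF _ _ tendsto_norm[OF m]])
    show "(%n. d + inverse (real (Suc n))) \<longlonglongrightarrow> d" using tendsto_add[OF tendsto_const inv] by simp
    show "\<forall>\<^sub>F n in sequentially. norm (x n) \<le> d + inverse (real (Suc n))" using x(2) less_imp_le by (intro always_eventually) blast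
  qed simp
  ultimately show ?thesis using that d by fastforce
qed

text \<open>The element of least norm on the hyperplane \<phi> = 1 is orthogonal to the kernel of
  \<phi>. The functional is described only on \<open>S\<close>, so it may be a map with no useful
  meaning elsewhere, such as one built from an inverse of the gradient.\<close>

lemma riesz_representation:
  fixes S :: "'a::{real_inner, complete_space} set" and \<phi> :: "'a => real"
  assumes S: "closed S" "subspace S"
    and add: "\<And>x y. x \<in> S ==> y \<in> S ==> \<phi> (x + y) = \<phi> x + \<phi> y"
    and scale: "\<And>c x. x \<in> S ==> \<phi> (c *\<^sub>R x) = c * \<phi> x"
    and bound: "\<And>x. x \<in> S ==> \<bar>\<phi> x\<bar> \<le> C * norm x"
  shows "\<exists>h\<in>S. \<forall>x\<in>S. \<phi> x = inner h x"
proof (cases "\<forall>x\<in>S. \<phi> x = 0")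
  case True
  then show ?thesis using subspace_0[OF S(2)] by (intro bexI[of _ 0]) auto
next
  case False
  then obtain x0 where x0: "x0 \<in> S" "\<phi> x0 \<noteq> 0" by blast
  define K where "K = {x \<in> S. \<phi> x = 1}"
  have diff: "\<phi> (x - y) = \<phi> x - \<phi> y" if "x \<in> S" "y \<in> S" for x y
    using add[OF that(1) subspace_scale[OF S(2) that(2), of "-1"]] scale[OF that(2), of "-1"] by simp
  have "closed K"
  proof (unfold closed_sequential_limits, intro allI impI, elim conjE)
    fix x l assume x: "\<forall>n. x n \<in> K" "x \<longlonglongrightarrow> l"
    then have l: "l \<in> S" using closed_sequentially[OF S(1), of x l] by (auto simp: K_def)
    have "(%n. \<phi> l - \<phi> (x n)) \<longlonglongrightarrow> 0"
    proof (rule Lim_null_comparison)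
      show "\<forall>\<^sub>F n in sequentially. norm (\<phi> l - \<phi> (x n)) \<le> C * norm (l - x n)"
      proof (intro always_eventually allI)
        fix n
        have "x n \<in> S" using x by (simp add: K_def)
        then show "norm (\<phi> l - \<phi> (x n)) \<le> C * norm (l - x n)"
          using bound[OF subspace_diff[OF S(2) l], of "x n"] diff[OF l, of "x n"] by simp
      qed
      have "(%n. C * norm (l - x n)) \<longlonglongrightarrow> C * norm (l - l)" by (intro tendsto_intros x)
      then show "(%n. C * norm (l - x n)) \<longlonglongrightarrow> 0" by simp
    qed
    moreover have "(%n. \<phi> l - \<phi> (x n)) = (%n. \<phi> l - 1)" using x by (auto simp: K_def)
    ultimately show "l \<in> K" using l by (simp add: K_def LIMSEQ_const_iff)
  qed
  moreover have "convex K"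
  proof (rule convexI)
    fix x y :: 'a and u v :: real assume "x \<in> K" "y \<in> K" "0 \<le> u" "0 \<le> v" "u + v = 1"
    then show "u *\<^sub>R x + v *\<^sub>R y \<in> K"
      by (auto simp: K_def add scale subspace_add[OF S(2)] subspace_scale[OF S(2)])
  qed
  moreover have "(1 / \<phi> x0) *\<^sub>R x0 \<in> K" using x0 by (simp add: K_def scale subspace_scale[OF S(2)])
  ultimately obtain m where m: "m \<in> K" "\<And>x. x \<in> K ==> norm m \<le> norm x"
    using closest_to_0[of K] by blast
  have mS: "m \<in> S" "\<phi> m = 1" using m by (auto simp: K_def)
  have "m \<noteq> 0" using mS scale[OF mS(1), of 0] by auto
  have orth: "inner m y = 0" if y: "y \<in> S" "\<phi> y = 0" for y
  proof (rule ccontr)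
    assume ne: "inner m y \<noteq> 0"
    then have yy: "inner y y > 0" by auto
    \<comment> \<open>This t minimises the norm of m + t y, which stays on the hyperplane.\<close>
    define t where "t = - inner m y / inner y y"
    have "m + t *\<^sub>R y \<in> K" using mS y by (auto simp: K_def add scale subspace_add[OF S(2)] subspace_scale[OF S(2)])
    then have "(norm m)\<^sup>2 \<le> (norm (m + t *\<^sub>R y))\<^sup>2" using m by (intro power_mono) auto
    then have "0 \<le> 2 * t * inner m y + t * t * inner y y"
      by (simp add: power2_norm_eq_inner inner_add_left inner_add_right inner_commute)
    also have "\<dots> = - (inner m y)\<^sup>2 / inner y y"
      using yy by (simp add: t_def field_simps power2_eq_square)
    finally show False using ne yy by (simp add: divide_le_0_iff zero_le_divide_iff)
  qed
  show ?thesis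
  proof (intro bexI ballI)
    show "(1 / inner m m) *\<^sub>R m \<in> S" by (rule subspace_scale[OF S(2) mS(1)])
    fix x assume x: "x \<in> S"
    have "inner m (x - \<phi> x *\<^sub>R m) = 0"
      using x mS by (intro orth) (auto simp: diff scale subspace_diff[OF S(2)] subspace_scale[OF S(2)])
    then show "\<phi> x = inner ((1 / inner m m) *\<^sub>R m) x"
      using \<open>m \<noteq> 0\<close> by (simp add: inner_diff_right field_simps)
  qed
qed

lemma orthogonal_projection:
  fixes S :: "'b::{real_inner, complete_space} set"
  assumes "closed S" "subspace S"
  shows "\<exists>p\<in>S. \<forall>y\<in>S. inner (x - p) y = 0"
proof -
  have "\<exists>p\<in>S. \<forall>y\<in>S. inner x y = inner p y"
    by (rule riesz_representation[OF assms, where C = "norm x"]) (auto simp: inner_add_right Cauchy_Schwarz_ineq2)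
  then show ?thesis by (auto simp: inner_diff_left)
qed

section \<open>Classes of fields and weak derivatives\<close>

lemma inner_abs_l2: "sq_integrable f ==> inner (abs_l2 f) u = (LINT x|lborel. inner (f x) (rep_l2 u x))"
  by (subst (1) abs_rep_l2[of u, symmetric], rule inner_l2.abs_eq) (auto simp: sq_integrable_rep_l2)

lemma abs_l2_cong: "sq_integrable f ==> sq_integrable g ==> AE x in lborel. f x = g x ==> abs_l2 f = abs_l2 g"
  by (rule Quotient_rel_abs[OF Quotient_l2]) simp

lemma rep_l2_eq_0: "AE x in lborel. rep_l2 u x = 0 ==> u = 0"
  using abs_l2_cong[OF sq_integrable_rep_l2 sq_integrable_zero, of u] by (simp add: abs_rep_l2 zero_l2_def)

text \<open>As an intersection of kernels of inner products the space is visibly closed and linear,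
  with no need to handle representatives that are known only almost everywhere.\<close>

lemma L2_on_iff:
  assumes [measurable]: "\<Omega> \<in> sets borel"
  shows "u \<in> L2_on \<Omega> \<longleftrightarrow> (\<forall>f. sq_integrable f \<and> (\<forall>x\<in>\<Omega>. f x = 0) \<longrightarrow> inner (abs_l2 f) u = 0)"
proof
  assume "u \<in> L2_on \<Omega>"
  then have ae: "AE x in lborel. x \<notin> \<Omega> \<longrightarrow> rep_l2 u x = 0" by (simp add: L2_on_def)
  have "inner (abs_l2 f) u = 0" if f: "sq_integrable f" "\<forall>x\<in>\<Omega>. f x = 0" for f
    unfolding inner_abs_l2[OF f(1)]
  proof (rule integral_eq_zero_AE)
    show "AE x in lborel. inner (f x) (rep_l2 u x) = 0"
      using ae by eventually_elim (use f(2) in auto)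
  qed
  then show "\<forall>f. sq_integrable f \<and> (\<forall>x\<in>\<Omega>. f x = 0) \<longrightarrow> inner (abs_l2 f) u = 0" by blast
next
  assume *: "\<forall>f. sq_integrable f \<and> (\<forall>x\<in>\<Omega>. f x = 0) \<longrightarrow> inner (abs_l2 f) u = 0"
  let ?f = "%x. indicator (- \<Omega>) x *\<^sub>R rep_l2 u x"
  note [measurable] = sq_integrable_measurable[OF sq_integrable_rep_l2]
  have f: "sq_integrable ?f"
  proof (rule sq_integrable_bound)
    show "integrable lborel (%x. (norm (rep_l2 u x))\<^sup>2)" using sq_integrable_rep_l2 by (simp add: sq_integrable_def)
    show "(norm (?f x))\<^sup>2 \<le> (norm (rep_l2 u x))\<^sup>2" for x by (auto simp: indicator_def)
  qed measurable
  have "(LINT x|lborel. inner (?f x) (?f x)) = (LINT x|lborel. inner (?f x) (rep_l2 u x))"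
    by (intro Bochner_Integration.integral_cong) (auto simp: indicator_def)
  also have "\<dots> = inner (abs_l2 ?f) u" by (rule inner_abs_l2[OF f, symmetric])
  also have "\<dots> = 0" using * f by auto
  finally have "AE x in lborel. inner (?f x) (?f x) = 0"
    by (intro integral_nonneg_eq_0_iff_AE[OF sq_integrable_inner[OF f f], THEN iffD1] AE_I2 inner_ge_zero)
  then have "AE x in lborel. x \<notin> \<Omega> \<longrightarrow> rep_l2 u x = 0" by eventually_elim (auto simp: indicator_def)
  then show "u \<in> L2_on \<Omega>" by (simp add: L2_on_def)
qed

lemma L2_on_closed_subspace:
  assumes "\<Omega> \<in> sets borel"
  shows "closed (L2_on \<Omega>)" "subspace (L2_on \<Omega>)"
proof -
  have eq: "L2_on \<Omega> = (\<Inter>f\<in>{f. sq_integrable f \<and> (\<forall>x\<in>\<Omega>. f x = 0)}. {u. inner (abs_l2 f) u = 0})"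
    using L2_on_iff[OF assms] by auto
  show "closed (L2_on \<Omega>)" unfolding eq by (intro closed_INT ballI closed_Collect_eq continuous_intros)
  show "subspace (L2_on \<Omega>)" unfolding eq by (auto intro!: subspaceI simp: inner_add_right)
qed

lemma abs_l2_L2_on:
  assumes "sq_integrable f" "\<And>x. x \<notin> \<Omega> ==> f x = 0"
  shows "abs_l2 f \<in> L2_on \<Omega>"
  unfolding L2_on_def using rep_abs_l2[OF assms(1)] assms(2) by (auto elim: eventually_mono)

text \<open>Testing each coordinate turns the identity between vector integrals into inner products
  in \<open>l2\<close>, which pass to limits and linear combinations without reference to
  representatives.\<close>

lemma weak_partial_iff:
  assumes [measurable]: "\<Omega> \<in> sets borel"
  shows "weak_partial \<Omega> j (rep_l2 u) (rep_l2 d) \<longleftrightarrow> (\<forall>\<phi>\<in>test_functions \<Omega>. \<forall>e\<in>Basis.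
     inner (abs_l2 (%x. partial_deriv j \<phi> x *\<^sub>R e)) u = - inner (abs_l2 (%x. \<phi> x *\<^sub>R e)) d)"
proof -
  have i: "integrable lborel (%x. \<phi> x *\<^sub>R rep_l2 u x)" if "\<phi> \<in> test_functions \<Omega>" for \<phi> :: "real^3 => real" and u
  proof -
    have "integrable lborel (%x. \<Sum>e\<in>Basis. inner (\<phi> x *\<^sub>R e) (rep_l2 u x) *\<^sub>R e)"
      by (intro Bochner_Integration.integrable_sum integrable_scaleR_left
          sq_integrable_inner scalar_test_sq_integrable[OF that] sq_integrable_rep_l2)
    moreover have "(\<Sum>e\<in>Basis. inner (\<phi> x *\<^sub>R e) (rep_l2 u x) *\<^sub>R e) = \<phi> x *\<^sub>R rep_l2 u x" for x
      by (simp add: inner_commute[of _ "rep_l2 u x"] euclidean_representation flip: scaleR_scaleR scaleR_sum_right)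
    ultimately show ?thesis by simp
  qed
  have e: "inner (LINT x:\<Omega>|lborel. \<phi> x *\<^sub>R rep_l2 u x) e = inner (abs_l2 (%x. \<phi> x *\<^sub>R e)) u"
    if \<phi>: "\<phi> \<in> test_functions \<Omega>" for \<phi> :: "real^3 => real" and u e
  proof -
    have "(LINT x:\<Omega>|lborel. \<phi> x *\<^sub>R rep_l2 u x) = (LINT x|lborel. \<phi> x *\<^sub>R rep_l2 u x)"
      unfolding set_lebesgue_integral_def
      by (intro Bochner_Integration.integral_cong) (use test_zero_outside[OF \<phi>] in \<open>auto simp: indicator_def\<close>)
    also have "inner \<dots> e = (LINT x|lborel. inner (\<phi> x *\<^sub>R rep_l2 u x) e)"
      using i[OF \<phi>] by (simp only: integral_inner_left)
    finally show ?thesis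
      by (simp only: inner_abs_l2[OF scalar_test_sq_integrable[OF \<phi>]]) (simp add: inner_commute)
  qed
  show ?thesis
    unfolding weak_partial_def euclidean_eq_iff[where 'a = "real^3"] inner_minus_left
    by (intro ball_cong refl) (simp add: e test_partial)
qed

text \<open>Fundamental lemma of the calculus of variations. Bumps tend to indicators of boxes
  inside \<Omega>; boxes form an intersection-stable generator, so the integral vanishes over every
  Borel part of such a box; countably many closed boxes cover \<Omega>.\<close>

lemma box_bumps_separate:
  assumes \<Omega>: "open \<Omega>" and d: "d \<in> L2_on \<Omega>"
    and 0: "\<And>\<phi> e. \<phi> \<in> test_functions \<Omega> ==> e \<in> Basis ==> inner (abs_l2 (%x. \<phi> x *\<^sub>R e)) d = 0"
  shows "d = 0"
proof -
  have [measurable]: "\<Omega> \<in> sets borel" using \<Omega> by simp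
  note [measurable] = sq_integrable_measurable[OF sq_integrable_rep_l2]
  let ?D = "%e x. inner e (rep_l2 d x)"
  have D_int: "integrable lborel (%x. indicator (box a b) x * ?D e x)" for a b e
  proof -
    have "sq_integrable (%x. indicator (box a b) x *\<^sub>R e)"
    proof (rule sq_integrable_bound)
      show "integrable lborel (%x. (norm e)\<^sup>2 * indicator (box a b) x)"
        using emeasure_lborel_box_finite[of a b] by (intro integrable_mult_right integrable_real_indicator) auto
    qed (auto simp: indicator_def)
    from sq_integrable_inner[OF this sq_integrable_rep_l2] show ?thesis by simp
  qed
  have box0: "(LINT x|lborel. indicator (box a b) x * ?D e x) = 0" if ab: "cbox a b \<subseteq> \<Omega>" and e: "e \<in> Basis" for a b e
  proof -
    have "(%n. LINT x|lborel. box_bump n a b x * ?D e x) \<longlonglongrightarrow> (LINT x|lborel. indicator (box a b) x * ?D e x)"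
    proof (rule integral_dominated_convergence)
      show "integrable lborel (%x. \<bar>indicator (box a b) x * ?D e x\<bar>)" using D_int by auto
      show "AE x in lborel. (%n. box_bump n a b x * ?D e x) \<longlonglongrightarrow> indicator (box a b) x * ?D e x"
        by (intro AE_I2 tendsto_mult_right box_bump_tendsto)
      have "box_bump n a b \<in> borel_measurable borel" for n
        by (rule borel_measurable_continuous_onI[OF test_continuous[OF box_bump_test[OF ab]]])
      then show "(%x. box_bump n a b x * ?D e x) \<in> borel_measurable lborel" for n by measurable
      show "AE x in lborel. norm (box_bump n a b x * ?D e x) \<le> \<bar>indicator (box a b) x * ?D e x\<bar>" for n
      proof (rule AE_I2)
        fix x
        show "norm (box_bump n a b x * ?D e x) \<le> \<bar>indicator (box a b) x * ?D e x\<bar>"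
          using box_bump_bounds[of n a b x] box_bump_nonzero[of n a b x]
          by (cases "x \<in> box a b") (auto simp: abs_mult intro!: mult_left_le_one_le)
      qed
    qed (use borel_measurable_integrable[OF D_int] in auto)
    moreover have "(LINT x|lborel. box_bump n a b x * ?D e x) = 0" for n
      using 0[OF box_bump_test[OF ab, of n] e] by (simp add: inner_abs_l2 scalar_test_sq_integrable[OF box_bump_test[OF ab]])
    ultimately show ?thesis by (simp add: LIMSEQ_const_iff)
  qed
  have AE_box: "AE x in lborel. x \<in> box a b \<longrightarrow> ?D e x = 0" if ab: "cbox a b \<subseteq> \<Omega>" and e: "e \<in> Basis" for a b e
  proof -
    let ?f = "%x. indicator (box a b) x * ?D e x"
    let ?E = "range (%(l, u). box l u :: (real^3) set)"
    have fi: "set_integrable lborel X ?f" if "X \<in> sets borel" for X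
      unfolding set_integrable_def using that by (intro integrable_mult_indicator D_int) auto
    have "(LINT x:X|lborel. ?f x) = 0" if "X \<in> sets borel" for X
    proof -
      have "Int_stable ?E" by (auto simp: Int_stable_def Int_interval box_Int_box)
      moreover have "?E \<subseteq> Pow UNIV" by simp
      moreover have B: "sets borel = sigma_sets UNIV ?E" by (simp add: borel_eq_box)
      then have "X \<in> sigma_sets UNIV ?E" using that by simp
      ultimately show ?thesis
      proof (induction rule: sigma_sets_induct_disjoint)
        case (basic X)
        then obtain l u where X: "X = box l u" by auto
        obtain a' b' where *: "box a b \<inter> X = box a' b'" unfolding X using box_Int_box by blast
        have "(LINT x:X|lborel. ?f x) = (LINT x|lborel. indicator (box a' b') x * ?D e x)"
          unfolding set_lebesgue_integral_def *[symmetric] by (intro Bochner_Integration.integral_cong) (auto simp: indicator_def)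
        also have "\<dots> = 0"
        proof (cases "box a' b' = {}")
          case False
          have "box a' b' \<subseteq> cbox a b" using * box_subset_cbox[of a b] by blast
          then have "closure (box a' b') \<subseteq> cbox a b" by (intro closure_minimal closed_cbox)
          then show ?thesis using False ab e by (intro box0) (auto simp: closure_box)
        qed simp
        finally show ?case .
      next
        case (compl X)
        then have X: "X \<in> sets borel" unfolding B by simp
        from sets.compl_sets[OF this] have "UNIV - X \<in> sets borel" by simp
        note X = X this
        have "(LINT x:UNIV|lborel. ?f x) = (LINT x:X \<union> (UNIV - X)|lborel. ?f x)" by simp
        also have "\<dots> = (LINT x:X|lborel. ?f x) + (LINT x:UNIV - X|lborel. ?f x)"
          by (rule set_integral_Un) (use fi X in auto)
        also have "(LINT x:UNIV|lborel. ?f x) = 0" using box0[OF ab e] by (simp add: set_lebesgue_integral_def)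
        finally show ?case using compl.IH by simp
      next
        case (union A)
        have "A i \<in> sets borel" for i unfolding B using union(2) by blast
        then have "(LINT x:(\<Union>i. A i)|lborel. ?f x) = (\<Sum>i. LINT x:A i|lborel. ?f x)"
          using union(1) by (intro lebesgue_integral_countable_add fi) (auto simp: disjoint_family_on_def)
        then show ?case using union by simp
      qed (simp add: set_lebesgue_integral_def)
    qed
    then have "AE x in lborel. ?f x = 0"
      using D_int by (intro density_unique_real) (auto simp: set_lebesgue_integral_def)
    then show ?thesis by eventually_elim (auto simp: indicator_def)
  qed
  have "AE x in lborel. \<forall>e\<in>Basis. x \<in> \<Omega> \<longrightarrow> ?D e x = 0"
    unfolding AE_ball_countable[OF countable_finite[OF finite_Basis]]
  proof
    fix e :: "real^3" assume e: "e \<in> Basis"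
    obtain \<C> where D: "countable \<C>" "\<C> \<subseteq> Pow \<Omega>" "\<And>X. X \<in> \<C> ==> \<exists>a b. X = cbox a b" "\<Union>\<C> = \<Omega>"
      by (rule open_countable_Union_open_cbox[OF \<Omega>]) (rule that)
    have "AE x in lborel. \<forall>X\<in>\<C>. x \<in> X \<longrightarrow> ?D e x = 0"
      unfolding AE_ball_countable[OF D(1)]
    proof
      fix X assume X: "X \<in> \<C>"
      obtain a b where ab: "X = cbox a b" using D(3)[OF X] by blast
      \<comment> \<open>The faces have measure zero, so the open box, on which the statement is
        known, suffices.\<close>
      have "cbox a b - box a b \<in> null_sets lebesgue"
        using negligible_frontier_interval[of a b] by (simp only: negligible_iff_null_sets)
      then have "AE x in lebesgue. x \<notin> cbox a b - box a b" by (rule AE_not_in)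
      then have "AE x in lborel. x \<notin> cbox a b - box a b" by (simp only: AE_completion_iff)
      moreover have "AE x in lborel. x \<in> box a b \<longrightarrow> ?D e x = 0" using AE_box[of a b e] e X D(2) ab by blast
      ultimately show "AE x in lborel. x \<in> X \<longrightarrow> ?D e x = 0" by eventually_elim (auto simp: ab)
    qed
    then show "AE x in lborel. x \<in> \<Omega> \<longrightarrow> ?D e x = 0" by eventually_elim (use D(4) in auto)
  qed
  moreover have "AE x in lborel. x \<notin> \<Omega> \<longrightarrow> rep_l2 d x = 0" using d by (simp add: L2_on_def)
  ultimately have "AE x in lborel. rep_l2 d x = 0"
    by eventually_elim (auto simp: euclidean_eq_iff[where 'a = "real^3"] inner_commute)
  then show ?thesis by (rule rep_l2_eq_0)
qed

section \<open>Volterra equations with weakly singular kernels\<close>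

lemma AE_lebesgue_neq: "AE s in lebesgue. s \<noteq> (c::real)"
  by (rule AE_completion[OF AE_lborel_singleton])

text \<open>The factor l^(-b) is the gain of the exponentially weighted norm: it makes a kernel with
  singularity t^(b-1) contractive for large l.\<close>

lemma Gamma_exp_integral:
  assumes "b > 0" "l > (0::real)"
  shows "has_bochner_integral lborel (%t. indicator {0..} t * (t powr (b - 1) * exp (- (l * t)))) (Gamma b * l powr (- b))"
proof -
  let ?f = "%t::real. indicator {0..} t * (t powr (b - 1) * exp (- t)) :: real"
  have "((%t. t powr (b - 1) / exp t) has_integral Gamma b) {0..}"
    by (rule Gamma_integral_real[OF assms(1)])
  then have "((%t. t powr (b - 1) * exp (- t)) has_integral Gamma b) {0..}"
    by (simp add: exp_minus field_simps)
  then have hi: "(?f has_integral Gamma b) UNIV"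
    by (subst (asm) has_integral_restrict_UNIV[symmetric])
      (erule has_integral_eq[rotated], auto simp: indicator_def)
  have meas: "?f \<in> borel_measurable borel" by measurable
  have "(\<integral>\<^sup>+t. ennreal (?f t) \<partial>lborel) = ennreal (Gamma b)"
    by (rule nn_integral_has_integral_lborel[OF meas _ hi]) auto
  then have "has_bochner_integral lborel ?f (Gamma b)"
    by (intro has_bochner_integral_nn_integral) (auto intro: Gamma_real_nonneg assms order.strict_implies_order)
  from lborel_has_bochner_integral_real_affine_iff[of l ?f "Gamma b" 0] this assms
  have "has_bochner_integral lborel (%t. ?f (l * t)) (Gamma b / l)" by (simp add: field_simps)
  then have "has_bochner_integral lborel (%t. l powr (1 - b) * ?f (l * t)) (l powr (1 - b) * (Gamma b / l))"
    by (rule has_bochner_integral_mult_right)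
  moreover have "l powr (1 - b) * ?f (l * t) = indicator {0..} t * (t powr (b - 1) * exp (- (l * t)))" for t
    using assms by (auto simp: indicator_def zero_le_mult_iff powr_mult powr_minus_divide powr_diff field_simps)
  moreover have "l powr (1 - b) * (Gamma b / l) = Gamma b * l powr (- b)"
    using assms by (simp add: powr_diff powr_minus field_simps)
  ultimately show ?thesis by simp
qed

text \<open>At s = t the kernel is evaluated at time 0, where nothing is known about it; this single
  point does not affect the integral.\<close>

definition conv :: "(real => 'a => 'a) => (real => 'a) => real => 'a::{banach, second_countable_topology}" where
  "conv R g t = (LINT s:{0..t}|lebesgue. R (t - s) (g s))"

lemma conv_0: "conv K g 0 = 0"
  unfolding conv_def set_lebesgue_integral_def
proof (rule integral_eq_zero_AE)
  show "AE s in lebesgue. indicator {0..0} s *\<^sub>R K (0 - s) (g s) = 0"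
    using AE_lebesgue_neq[of 0] by eventually_elim (simp add: indicator_def)
qed

text \<open>The exponent b > 0 makes t^(b-1) integrable at 0. Joint continuity in (t, x) makes the
  integrand measurable even when g is merely measurable, as the delayed force is.\<close>

locale singular_kernel =
  fixes R :: "real => 'a => 'a::{banach, second_countable_topology}" and b C T :: real
  assumes b: "0 < b" and C: "0 \<le> C"
    and lin: "\<And>t. 0 < t ==> linear (R t)"
    and bound: "\<And>t x. 0 < t ==> t \<le> T ==> norm (R t x) \<le> C * t powr (b - 1) * norm x"
    and cont: "continuous_on ({0<..} \<times> UNIV) (%(t, x). R t x)"
begin

lemma measurable_conv_integrand:
  assumes g: "g \<in> borel_measurable (lebesgue_on {0..T})" and t: "t \<le> T"
  shows "(%s. indicator {0..<t} s *\<^sub>R R (t - s) (g s)) \<in> borel_measurable lebesgue"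
proof -
  let ?R = "%z. if z \<in> {0<..} \<times> UNIV then (case z of (t, x) => R t x) else 0"
  have R: "?R \<in> borel_measurable borel"
    by (rule borel_measurable_continuous_on_if) (auto intro!: cont continuous_intros open_Times borel_open)
  have g': "(%s. indicator {0..T} s *\<^sub>R g s) \<in> borel_measurable lebesgue"
    using g by (subst borel_measurable_restrict_space_iff[symmetric]) auto
  have "(%s. (t - s, indicator {0..T} s *\<^sub>R g s)) \<in> lebesgue \<rightarrow>\<^sub>M borel"
    unfolding borel_prod[symmetric] using g' by (intro measurable_Pair) (auto intro: measurable_completion)
  from measurable_comp[OF this R]
  have "(%s. indicator {0..} s *\<^sub>R ?R (t - s, indicator {0..T} s *\<^sub>R g s)) \<in> borel_measurable lebesgue"
    by (intro borel_measurable_scaleR borel_measurable_indicator) (auto simp: o_def)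
  also have "(%s. indicator {0..} s *\<^sub>R ?R (t - s, indicator {0..T} s *\<^sub>R g s)) = (%s. indicator {0..<t} s *\<^sub>R R (t - s) (g s))"
    using t by (auto simp: indicator_def fun_eq_iff)
  finally show ?thesis .
qed

lemma set_measurable_conv_integrand:
  assumes g: "g \<in> borel_measurable (lebesgue_on {0..T})" and t: "t \<le> T"
  shows "set_borel_measurable lebesgue {0..t} (%s. R (t - s) (g s))"
proof -
  have "(%s. indicator {0..<t} s *\<^sub>R R (t - s) (g s) + indicator ({t} \<inter> {0..}) s *\<^sub>R R 0 (g t)) \<in> borel_measurable lebesgue"
    by (intro borel_measurable_add measurable_conv_integrand g t borel_measurable_scaleR borel_measurable_indicator) auto
  also have "(%s. indicator {0..<t} s *\<^sub>R R (t - s) (g s) + indicator ({t} \<inter> {0..}) s *\<^sub>R R 0 (g t))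
      = (%s. indicator {0..t} s *\<^sub>R R (t - s) (g s))"
    by (auto simp: indicator_def fun_eq_iff)
  finally show ?thesis by (simp add: set_borel_measurable_def)
qed

lemma weighted_majorant:
  assumes l: "l > 0"
  shows "has_bochner_integral lebesgue (%s. exp (l * t) * (indicator {0..} (t - s) * ((t - s) powr (b - 1) * exp (- (l * (t - s))))))
    (exp (l * t) * (Gamma b * l powr (- b)))"
proof -
  have "has_bochner_integral lborel (%s. indicator {0..} (t - s) * ((t - s) powr (b - 1) * exp (- (l * (t - s))))) (Gamma b * l powr (- b))"
    using lborel_has_bochner_integral_real_affine_iff[of "-1" "%t. indicator {0..} t * (t powr (b - 1) * exp (- (l * t)))" "Gamma b * l powr (- b)" t]
      Gamma_exp_integral[OF b l] by simp
  then show ?thesis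
    by (intro has_bochner_integral_mult_right)
      (auto simp: has_bochner_integral_iff integral_completion intro: integrable_completion[THEN iffD2])
qed

text \<open>Writing exp(l s) = exp(l t) exp(-l (t - s)) leaves the Laplace transform of t^(b-1) at
  l, which is \<open>Gamma b\<close> times l^(-b).\<close>

lemma conv_weighted:
  assumes g: "g \<in> borel_measurable (lebesgue_on {0..T})" and t: "0 \<le> t" "t \<le> T" and l: "l > 0" and D0: "0 \<le> D"
    and D: "\<And>s. 0 \<le> s ==> s \<le> t ==> norm (g s) \<le> D * exp (l * s)"
  shows conv_integrable_weighted: "set_integrable lebesgue {0..t} (%s. R (t - s) (g s))"
    and conv_norm_weighted: "norm (conv R g t) \<le> C * D * Gamma b * l powr (- b) * exp (l * t)"
proof -
  let ?w = "%s. exp (l * t) * (indicator {0..} (t - s) * ((t - s) powr (b - 1) * exp (- (l * (t - s)))))"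
  note w = weighted_majorant[OF l, of t]
  have le: "norm (indicator {0..t} s *\<^sub>R R (t - s) (g s)) \<le> C * D * ?w s" if "s \<noteq> t" for s
  proof (cases "0 \<le> s \<and> s < t")
    case True
    have "norm (R (t - s) (g s)) \<le> C * (t - s) powr (b - 1) * (D * exp (l * s))"
      using True t C by (intro order_trans[OF bound] mult_left_mono D) auto
    also have "\<dots> = C * D * ?w s"
      using True by (simp add: algebra_simps flip: exp_add)
    finally show ?thesis using True by simp
  next
    case False
    then have s: "s < 0 \<or> t < s" using that by auto
    then show ?thesis using C D0 by (auto simp: indicator_def intro!: mult_nonneg_nonneg)
  qed
  have AE: "AE s in lebesgue. norm (indicator {0..t} s *\<^sub>R R (t - s) (g s)) \<le> C * D * ?w s"
  proof -
    have "AE s in lborel. s \<noteq> t" by (rule AE_lborel_singleton)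
    then have "AE s in lebesgue. s \<noteq> t" by (rule AE_completion)
    then show ?thesis by eventually_elim (rule le)
  qed
  have iw: "integrable lebesgue (%s. C * D * ?w s)"
    by (intro integrable_mult_right integrable.intros[OF w])
  show i: "set_integrable lebesgue {0..t} (%s. R (t - s) (g s))"
    unfolding set_integrable_def
    by (rule Bochner_Integration.integrable_bound[OF iw])
      (use set_measurable_conv_integrand[OF g t(2)] AE in \<open>auto simp: set_borel_measurable_def elim: eventually_mono\<close>)
  have "norm (conv R g t) \<le> (LINT s|lebesgue. norm (indicator {0..t} s *\<^sub>R R (t - s) (g s)))"
    unfolding conv_def set_lebesgue_integral_def by (rule integral_norm_bound)
  also have "\<dots> \<le> (LINT s|lebesgue. C * D * ?w s)"
    by (rule integral_mono_AE[OF integrable_norm iw AE]) (use i in \<open>simp add: set_integrable_def\<close>)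
  also have "\<dots> = C * D * (exp (l * t) * (Gamma b * l powr (- b)))"
    using w by (simp add: has_bochner_integral_iff)
  finally show "norm (conv R g t) \<le> C * D * Gamma b * l powr (- b) * exp (l * t)"
    by (simp add: ac_simps)
qed

lemma conv_integrable:
  assumes g: "g \<in> borel_measurable (lebesgue_on {0..T})" and t: "0 \<le> t" "t \<le> T"
    and M: "\<And>s. 0 \<le> s ==> s \<le> t ==> norm (g s) \<le> M"
  shows "set_integrable lebesgue {0..t} (%s. R (t - s) (g s))"
proof (rule conv_integrable_weighted[OF g t zero_less_one])
  show M0: "0 \<le> M" using M[of 0] t by (auto intro: order_trans[OF norm_ge_zero])
  show "norm (g s) \<le> M * exp (1 * s)" if "0 \<le> s" "s \<le> t" for s
    using mult_left_mono[of 1 "exp s" M] M[OF that] M0 that by simp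
qed

lemma conv_diff:
  assumes g: "g \<in> borel_measurable (lebesgue_on {0..T})" and h: "h \<in> borel_measurable (lebesgue_on {0..T})"
    and t: "0 \<le> t" "t \<le> T"
    and M: "\<And>s. 0 \<le> s ==> s \<le> t ==> norm (g s) \<le> M" "\<And>s. 0 \<le> s ==> s \<le> t ==> norm (h s) \<le> N"
  shows "conv R g t - conv R h t = conv R (%s. g s - h s) t"
proof -
  let ?d = "%s. indicator {0..t} s *\<^sub>R R (t - s) (g s) - indicator {0..t} s *\<^sub>R R (t - s) (h s)"
  have gi: "set_integrable lebesgue {0..t} (%s. R (t - s) (g s))" by (rule conv_integrable[OF g t M(1)])
  have hi: "set_integrable lebesgue {0..t} (%s. R (t - s) (h s))" by (rule conv_integrable[OF h t M(2)])
  have gh: "set_integrable lebesgue {0..t} (%s. R (t - s) (g s - h s))"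
  proof (rule conv_integrable[OF _ t])
    show "(%s. g s - h s) \<in> borel_measurable (lebesgue_on {0..T})" using g h by measurable
    show "norm (g s - h s) \<le> M + N" if "0 \<le> s" "s \<le> t" for s
      using norm_triangle_ineq4[of "g s" "h s"] M(1)[OF that] M(2)[OF that] by linarith
  qed
  have "conv R g t - conv R h t = (LINT s|lebesgue. ?d s)"
    using gi hi unfolding conv_def set_lebesgue_integral_def set_integrable_def by simp
  also have "\<dots> = (LINT s|lebesgue. indicator {0..t} s *\<^sub>R R (t - s) (g s - h s))"
  proof (rule integral_cong_AE)
    have "AE s in lborel. s \<noteq> t" by (rule AE_lborel_singleton)
    then have "AE s in lebesgue. s \<noteq> t" by (rule AE_completion)
    then show "AE s in lebesgue. ?d s = indicator {0..t} s *\<^sub>R R (t - s) (g s - h s)"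
      by eventually_elim (auto simp: indicator_def linear_diff[OF lin])
  qed (use gi hi gh in \<open>auto simp: set_integrable_def\<close>)
  finally show ?thesis by (simp add: conv_def set_lebesgue_integral_def)
qed

text \<open>The integral over s < t - e avoids the singularity and depends continuously on t by
  dominated convergence. The discarded part is O(e^b) uniformly in t, so continuity survives the
  limit e -> 0.\<close>

lemma conv_continuous:
  assumes g: "g \<in> borel_measurable (lebesgue_on {0..T})"
    and M: "\<And>s. 0 \<le> s ==> s \<le> T ==> norm (g s) \<le> M"
  shows "continuous_on {0..T} (conv R g)"
proof (cases "0 \<le> T")
  case T: True
  have M0: "0 \<le> M" using M[of 0] T by (auto intro: order_trans[OF norm_ge_zero])
  define J where "J e t s = indicator {0..<t - e} s *\<^sub>R R (t - s) (g s)" for e t s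
  define K where "K e = C * (e powr (b - 1) + T powr (b - 1)) * M" for e
  have K0: "0 \<le> K e" for e unfolding K_def using C M0 by simp
  have J_meas: "J e t \<in> borel_measurable lebesgue" if "0 < e" "t \<le> T" for e t
  proof -
    have "(%s. indicator {..<t - e} s *\<^sub>R (indicator {0..<t} s *\<^sub>R R (t - s) (g s))) \<in> borel_measurable lebesgue"
      by (intro borel_measurable_scaleR borel_measurable_indicator measurable_conv_integrand g that) auto
    also have "(%s. indicator {..<t - e} s *\<^sub>R (indicator {0..<t} s *\<^sub>R R (t - s) (g s))) = J e t"
      using that by (auto simp: J_def indicator_def)
    finally show ?thesis .
  qed
  have J_bound: "norm (J e t s) \<le> K e * indicator {0..T} s" if "0 < e" "0 \<le> t" "t \<le> T" for e t s
  proof (cases "s \<in> {0..<t - e}")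
    case True
    have "(t - s) powr (b - 1) \<le> e powr (b - 1) + T powr (b - 1)"
      using True that powr_mono2[of "b - 1" "t - s" T] powr_mono2'[of "b - 1" e "t - s"]
      by (cases "b \<ge> 1") (auto intro: add_increasing add_increasing2)
    moreover have "norm (R (t - s) (g s)) \<le> C * (t - s) powr (b - 1) * norm (g s)" using True that by (intro bound) auto
    ultimately show ?thesis
      using True that C M0 M[of s] unfolding J_def K_def
      by (auto intro!: order_trans[OF \<open>norm _ \<le> _\<close>] mult_mono)
  qed (use K0 in \<open>simp add: J_def\<close>)
  have int_w: "integrable lebesgue (%s. K e * indicator {0..T} s)" for e
    by (intro integrable_mult_right integrable_real_indicator) (auto simp: emeasure_lborel_Icc_eq)
  have c_cont: "continuous_on {0..T} (%t. LINT s|lebesgue. J e t s)" if e: "e > 0" for e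
    unfolding continuous_on_sequentially
  proof (intro ballI allI impI, elim conjE)
    fix t and u :: "nat => real"
    assume t: "t \<in> {0..T}" and u: "\<forall>n. u n \<in> {0..T}" "u \<longlonglongrightarrow> t"
    have "(%n. LINT s|lebesgue. J e (u n) s) \<longlonglongrightarrow> (LINT s|lebesgue. J e t s)"
    proof (rule integral_dominated_convergence[OF _ _ int_w[of e]])
      show "J e t \<in> borel_measurable lebesgue" "\<And>n. J e (u n) \<in> borel_measurable lebesgue"
        using J_meas e t u by auto
      show "AE s in lebesgue. norm (J e (u n) s) \<le> K e * indicator {0..T} s" for n
        using J_bound e u(1) by (intro AE_I2) auto
      show "AE s in lebesgue. (%n. J e (u n) s) \<longlonglongrightarrow> J e t s"
        using AE_completion[OF AE_lborel_singleton[of "t - e"]]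
      proof eventually_elim
        fix s assume "s \<noteq> t - e"
        then consider "t < s + e" | "s + e < t" by linarith
        then show "(%n. J e (u n) s) \<longlonglongrightarrow> J e t s"
        proof cases
          case 1
          have "\<forall>\<^sub>F n in sequentially. J e (u n) s = J e t s"
            using order_tendstoD(2)[OF u(2) 1] by eventually_elim (use 1 in \<open>simp add: J_def\<close>)
          then show ?thesis by (rule tendsto_eventually)
        next
          case 2
          have "(%n. (u n - s, g s)) \<longlonglongrightarrow> (t - s, g s)" by (intro tendsto_intros u)
          moreover have "isCont (%(t, x). R t x) (t - s, g s)"
            using cont 2 e by (subst (asm) continuous_on_eq_continuous_at) (auto intro!: open_Times)
          ultimately have "(%n. indicator {0..<t - e} s *\<^sub>R R (u n - s) (g s)) \<longlonglongrightarrow> J e t s"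
            unfolding J_def by (intro tendsto_scaleR tendsto_const) (use isCont_tendsto_compose in fastforce)
          then show ?thesis
            by (rule Lim_transform_eventually)
              (use order_tendstoD(1)[OF u(2) 2] 2 in \<open>auto simp: J_def indicator_def elim!: eventually_mono\<close>)
        qed
      qed
    qed
    then show "((%t. LINT s|lebesgue. J e t s) \<circ> u) \<longlonglongrightarrow> (LINT s|lebesgue. J e t s)" by (simp add: o_def)
  qed
  have close: "norm (conv R g t - (LINT s|lebesgue. J e t s)) \<le> C * (M * exp 1) * Gamma b * e powr b"
    if e: "e > 0" and t: "t \<in> {0..T}" for e t
  proof -
    define h where "h s = indicator {..<t - e} s *\<^sub>R g s" for s
    have h: "h \<in> borel_measurable (lebesgue_on {0..T})"
      unfolding h_def by (intro borel_measurable_scaleR g measurable_restrict_space1 borel_measurable_indicator) auto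
    have "conv R g t - conv R h t = conv R (%s. g s - h s) t"
      by (rule conv_diff[OF g h, where M = M and N = M]) (use t M M0 in \<open>auto simp: h_def indicator_def\<close>)
    \<comment> \<open>The weighted estimate is used with l = 1 / e: the discarded part lives on s
      \<ge> t - e, where exp(1 - t/e + s/e) \<ge> 1, so the bound M may be replaced by a multiple of
      exp(s/e). The exponentials in t then cancel.\<close>
    moreover have "norm (conv R (%s. g s - h s) t) \<le> C * (M * exp (1 - t / e)) * Gamma b * (1 / e) powr (- b) * exp ((1 / e) * t)"
    proof (rule conv_norm_weighted)
      show "norm (g s - h s) \<le> M * exp (1 - t / e) * exp ((1 / e) * s)" if s: "0 \<le> s" "s \<le> t" for s
      proof (cases "s < t - e")
        case False
        then have "1 \<le> exp (1 - t / e + (1 / e) * s)" using e by (simp add: field_simps)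
        then have "M * 1 \<le> M * exp (1 - t / e + (1 / e) * s)" using M0 by (intro mult_left_mono)
        then show ?thesis using False M[of s] s t by (simp add: h_def exp_add)
      qed (use M0 in \<open>simp add: h_def\<close>)
    qed (use g h e t M0 in auto)
    moreover have "conv R h t = (LINT s|lebesgue. J e t s)"
      unfolding conv_def set_lebesgue_integral_def
    proof (rule integral_cong_AE)
      show "AE s in lebesgue. indicator {0..t} s *\<^sub>R R (t - s) (h s) = J e t s"
        using AE_completion[OF AE_lborel_singleton[of t]]
        by eventually_elim (use e linear_0[OF lin] in \<open>auto simp: h_def J_def indicator_def\<close>)
    qed (use set_measurable_conv_integrand[OF h, of t] J_meas e t in \<open>auto simp: set_borel_measurable_def\<close>)
    moreover have "exp (1 - t / e) * ((1 / e) powr (- b) * exp ((1 / e) * t)) = exp 1 * e powr b"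
      using e by (simp add: powr_minus powr_divide exp_diff)
    ultimately show ?thesis by (simp add: mult.assoc mult.left_commute)
  qed
  have "uniform_limit {0..T} (%e t. LINT s|lebesgue. J e t s) (conv R g) (at_right 0)"
  proof (rule uniform_limitI)
    fix d :: real assume "d > 0"
    have "((%e::real. e powr b) \<longlongrightarrow> 0) (at_right 0)"
      by (intro tendsto_zero_powrI[OF _ tendsto_const _ b]) (auto intro!: eventually_at_rightI[of 0 1])
    from tendsto_mult_right_zero[OF this, of "C * (M * exp 1) * Gamma b"] \<open>d > 0\<close>
    have "\<forall>\<^sub>F e in at_right 0. C * (M * exp 1) * Gamma b * e powr b < d" by (rule order_tendstoD)
    moreover have "\<forall>\<^sub>F e in at_right 0. (0::real) < e" by (rule eventually_at_right_less)
    ultimately show "\<forall>\<^sub>F e in at_right 0. \<forall>t\<in>{0..T}. dist (LINT s|lebesgue. J e t s) (conv R g t) < d"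
      by eventually_elim (use close in \<open>force simp: dist_norm norm_minus_commute\<close>)
  qed
  then show ?thesis
    by (rule uniform_limit_theorem[rotated]) (auto intro!: eventually_at_rightI[of 0 1] c_cont)
qed simp

end

section \<open>The fixed point equation\<close>

lemma exists_small_weight:
  fixes b c :: real
  assumes "0 < b" "0 < b'"
  obtains l where "l > 0" "c * l powr (- b) + c' * l powr (- b') \<le> 1 / 2"
proof -
  have "((%l. c * l powr (- b) + c' * l powr (- b')) \<longlongrightarrow> c * 0 + c' * 0) at_top"
    by (intro tendsto_add tendsto_mult_left tendsto_neg_powr filterlim_ident) (use assms in auto)
  then have "\<forall>\<^sub>F l in at_top. c * l powr (- b) + c' * l powr (- b') < 1 / 2"
    by (intro order_tendstoD) auto
  moreover have "\<forall>\<^sub>F l in at_top. (0::real) < l" by (rule eventually_gt_at_top)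
  ultimately have "\<forall>\<^sub>F l in at_top. 0 < l \<and> c * l powr (- b) + c' * l powr (- b') < 1 / 2"
    by eventually_elim auto
  then obtain l where "0 < l" "c * l powr (- b) + c' * l powr (- b') < 1 / 2"
    by (auto simp: eventually_at_top_linorder)
  then show ?thesis by (intro that) auto
qed

locale volterra =
  k1: singular_kernel R1 b1 C1 T + k2: singular_kernel R2 b2 C2 T
  for R1 R2 :: "real => 'a => 'a::{real_inner, banach, second_countable_topology}" and b1 C1 b2 C2 T :: real +
  fixes H :: "'a set" and r L :: real and \<psi> U :: "real => 'a" and N1 N2 :: "real => (real => 'a) => 'a"
  assumes T: "0 \<le> T" and r: "0 \<le> r" and L: "0 \<le> L"
    and H: "closed H" "subspace H"
    and R_H: "\<And>t x. 0 < t ==> x \<in> H ==> R1 t x \<in> H" "\<And>t x. 0 < t ==> x \<in> H ==> R2 t x \<in> H"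
    and \<psi>: "continuous_on {-r..0} \<psi>" "\<And>t. -r \<le> t ==> t \<le> 0 ==> \<psi> t \<in> H"
    and U: "continuous_on {0..T} U" "\<And>t. 0 \<le> t ==> t \<le> T ==> U t \<in> H" "U 0 = \<psi> 0"
begin

definition adm :: "real => (real => 'a) set" where
  "adm t = {X. continuous_on {-r..t} X \<and> (\<forall>s\<in>{-r..t}. X s \<in> H) \<and> (\<forall>s\<in>{-r..0}. X s = \<psi> s)}"

text \<open>Causality is built into the Lipschitz clause: at time s only the values on [-r, s] enter
  the distance. Measurability and boundedness are asked along each admissible path, since the force
  need not be continuous in time.\<close>

definition good :: "(real => (real => 'a) => 'a) => bool" where
  "good N \<longleftrightarrow> (\<forall>t\<in>{0..T}. \<forall>X\<in>adm t.
     (%s. N s X) \<in> borel_measurable (lebesgue_on {0..t}) \<and> (\<exists>M. \<forall>s\<in>{0..t}. norm (N s X) \<le> M) \<and>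
     (\<forall>s\<in>{0..t}. N s X \<in> H) \<and>
     (\<forall>Y\<in>adm t. \<forall>s\<in>{0..t}. \<forall>d. (\<forall>\<tau>\<in>{-r..s}. norm (X \<tau> - Y \<tau>) \<le> d) \<longrightarrow> norm (N s X - N s Y) \<le> L * d))"

definition rhs :: "(real => 'a) => real => 'a" where
  "rhs X t = U t + conv R1 (%s. N1 s X) t + conv R2 (%s. N2 s X) t"

end

locale lipschitz_volterra = volterra +
  assumes good: "good N1" "good N2"
begin

lemma good_props:
  assumes "X \<in> adm t" "0 \<le> t" "t \<le> T" and N: "N = N1 \<or> N = N2"
  shows good_measurable: "(%s. N s X) \<in> borel_measurable (lebesgue_on {0..t})"
    and good_bounded: "\<exists>M. \<forall>s\<in>{0..t}. norm (N s X) \<le> M"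
    and good_H: "0 \<le> s ==> s \<le> t ==> N s X \<in> H"
    and good_lipschitz: "Y \<in> adm t ==> 0 \<le> s ==> s \<le> t ==>
      (\<And>\<tau>. -r \<le> \<tau> ==> \<tau> \<le> s ==> norm (X \<tau> - Y \<tau>) \<le> d) ==> norm (N s X - N s Y) \<le> L * d"
  using good N assms(1-3) unfolding good_def by (auto 0 3)

lemma kernel_restrict:
  assumes "t \<le> T"
  shows "singular_kernel R1 b1 C1 t" "singular_kernel R2 b2 C2 t"
  using k1.singular_kernel_axioms k2.singular_kernel_axioms assms unfolding singular_kernel_def by auto

text \<open>Two admissible paths share their history and the weight exp(l s) increases, so a
  weighted bound on [0, s] controls the delayed difference at time s with the same weight.\<close>

lemma rhs_diff:
  assumes X: "X \<in> adm t" and Y: "Y \<in> adm t" and t: "0 \<le> t" "t \<le> T" and l: "l > 0" and d: "0 \<le> d"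
    and le: "\<And>s. 0 \<le> s ==> s \<le> t ==> norm (X s - Y s) \<le> d * exp (l * s)"
  shows "norm (rhs X t - rhs Y t)
    \<le> (C1 * L * Gamma b1 * l powr (- b1) + C2 * L * Gamma b2 * l powr (- b2)) * d * exp (l * t)"
proof -
  have Nd: "norm (N s X - N s Y) \<le> (L * d) * exp (l * s)"
    if s: "0 \<le> s" "s \<le> t" and N: "N = N1 \<or> N = N2" for s N
  proof -
    have "norm (N s X - N s Y) \<le> L * (d * exp (l * s))"
    proof (rule good_lipschitz[OF X t N Y s])
      fix \<tau> assume \<tau>: "-r \<le> \<tau>" "\<tau> \<le> s"
      show "norm (X \<tau> - Y \<tau>) \<le> d * exp (l * s)"
      proof (cases "\<tau> \<le> 0")
        case True
        then have "X \<tau> = Y \<tau>" using X Y \<tau> by (simp add: adm_def)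
        then show ?thesis using d by simp
      next
        case False
        then have "norm (X \<tau> - Y \<tau>) \<le> d * exp (l * \<tau>)" using \<tau> s by (intro le) auto
        also have "\<dots> \<le> d * exp (l * s)" using \<tau> l d by (intro mult_left_mono) auto
        finally show ?thesis .
      qed
    qed
    then show ?thesis by (simp add: mult.assoc)
  qed
  have est: "norm (conv R (%s. N s X) t - conv R (%s. N s Y) t) \<le> C * (L * d) * Gamma b * l powr (- b) * exp (l * t)"
    if sk: "singular_kernel R b C t" and N: "N = N1 \<or> N = N2" for R b C N
  proof -
    interpret singular_kernel R b C t by (rule sk)
    obtain M where M: "\<forall>s\<in>{0..t}. norm (N s X) \<le> M" using good_bounded[OF X t N] by blast
    obtain M' where M': "\<forall>s\<in>{0..t}. norm (N s Y) \<le> M'" using good_bounded[OF Y t N] by blast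
    have "conv R (%s. N s X) t - conv R (%s. N s Y) t = conv R (%s. N s X - N s Y) t"
      using M M' t by (intro conv_diff[where M = M and N = M'] good_measurable X Y N) auto
    moreover have "norm (conv R (%s. N s X - N s Y) t) \<le> C * (L * d) * Gamma b * l powr (- b) * exp (l * t)"
      using t L d by (intro conv_norm_weighted l Nd N borel_measurable_diff good_measurable X Y) auto
    ultimately show ?thesis by simp
  qed
  have "norm (rhs X t - rhs Y t)
      = norm ((conv R1 (%s. N1 s X) t - conv R1 (%s. N1 s Y) t) + (conv R2 (%s. N2 s X) t - conv R2 (%s. N2 s Y) t))"
    by (simp add: rhs_def algebra_simps)
  also have "\<dots> \<le> norm (conv R1 (%s. N1 s X) t - conv R1 (%s. N1 s Y) t)
      + norm (conv R2 (%s. N2 s X) t - conv R2 (%s. N2 s Y) t)" by (rule norm_triangle_ineq)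
  also have "\<dots> \<le> C1 * (L * d) * Gamma b1 * l powr (- b1) * exp (l * t) + C2 * (L * d) * Gamma b2 * l powr (- b2) * exp (l * t)"
    using est[OF kernel_restrict(1)] est[OF kernel_restrict(2)] t by (intro add_mono) auto
  finally show ?thesis by (simp add: algebra_simps)
qed

lemma exists_weight:
  obtains l where "l > 0" "C1 * L * Gamma b1 * l powr (- b1) + C2 * L * Gamma b2 * l powr (- b2) \<le> 1 / 2"
  using exists_small_weight[OF k1.b k2.b, of "C1 * L * Gamma b1" "C2 * L * Gamma b2"] by blast

text \<open>The weighted difference is continuous and attains its maximum; there it is at most half
  of itself by the choice of l.\<close>

lemma unique:
  assumes X: "X \<in> adm t" and Y: "Y \<in> adm t" and t: "0 \<le> t" "t \<le> T"
    and eq: "\<And>s. 0 < s ==> s \<le> t ==> X s = rhs X s" "\<And>s. 0 < s ==> s \<le> t ==> Y s = rhs Y s"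
    and s: "-r \<le> s" "s \<le> t"
  shows "X s = Y s"
proof -
  obtain l where l: "l > 0" "C1 * L * Gamma b1 * l powr (- b1) + C2 * L * Gamma b2 * l powr (- b2) \<le> 1 / 2"
    by (rule exists_weight)
  have mono: "Z \<in> adm s" if "Z \<in> adm t" "s \<le> t" for Z s
    using that by (auto simp: adm_def intro: continuous_on_subset)
  define D where "D s = exp (- (l * s)) * norm (X s - Y s)" for s
  have "continuous_on {0..t} D"
    unfolding D_def using X Y r by (auto simp: adm_def intro!: continuous_intros intro: continuous_on_subset)
  then obtain m where m: "m \<in> {0..t}" "\<And>s. s \<in> {0..t} ==> D s \<le> D m"
    using continuous_attains_sup[of "{0..t}" D] t by auto
  have D0: "0 \<le> D s" for s by (simp add: D_def)
  have XY: "norm (X s - Y s) = D s * exp (l * s)" for s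
    by (simp add: D_def mult.commute flip: exp_add mult.assoc)
  have "D m \<le> 0"
  proof (cases "m = 0")
    case True
    then show ?thesis using X Y r by (simp add: D_def adm_def)
  next
    case False
    then have "norm (X m - Y m) = norm (rhs X m - rhs Y m)" using m eq by simp
    also have "\<dots> \<le> (C1 * L * Gamma b1 * l powr (- b1) + C2 * L * Gamma b2 * l powr (- b2)) * D m * exp (l * m)"
      using m t D0 by (intro rhs_diff mono[OF X] mono[OF Y] l) (auto simp: XY intro!: mult_right_mono)
    also have "\<dots> \<le> 1 / 2 * D m * exp (l * m)"
      using l D0 by (intro mult_right_mono) auto
    finally have "D m * exp (l * m) \<le> (1 / 2 * D m) * exp (l * m)" by (simp only: XY)
    then have "D m \<le> 1 / 2 * D m" by (simp only: mult_le_cancel_right_pos exp_gt_zero)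
    then show ?thesis by simp
  qed
  then have "D s \<le> 0" if "s \<in> {0..t}" for s using m(2)[OF that] by simp
  then have D: "norm (X s - Y s) = 0" if "s \<in> {0..t}" for s using that D0[of s] by (force simp: XY)
  show ?thesis
  proof (cases "s \<le> 0")
    case True
    then show ?thesis using X Y s by (simp add: adm_def)
  qed (use D s in auto)
qed

text \<open>The component of the integral orthogonal to \<open>H\<close> is tested against the
  integrand, whose values lie in \<open>H\<close> for almost every s, and so it vanishes.\<close>

lemma conv_in_H:
  assumes "\<And>t x. 0 < t ==> x \<in> H ==> R t x \<in> H" and "\<And>s. 0 \<le> s ==> s \<le> t ==> g s \<in> H"
    and "set_integrable lebesgue {0..t} (%s. R (t - s) (g s))"
  shows "conv R g t \<in> H"
proof -
  have i: "integrable lebesgue (%s. indicator {0..t} s *\<^sub>R R (t - s) (g s))"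
    using assms(3) by (simp add: set_integrable_def)
  obtain p where p: "p \<in> H" "\<forall>y\<in>H. inner (conv R g t - p) y = 0" using orthogonal_projection[OF H] by blast
  have "inner (conv R g t - p) (conv R g t) = (LINT s|lebesgue. inner (conv R g t - p) (indicator {0..t} s *\<^sub>R R (t - s) (g s)))"
    unfolding conv_def[of R g t] set_lebesgue_integral_def by (rule integral_inner_right[symmetric]) (rule i)
  also have "\<dots> = 0"
  proof (rule integral_eq_zero_AE)
    show "AE s in lebesgue. inner (conv R g t - p) (indicator {0..t} s *\<^sub>R R (t - s) (g s)) = 0"
      using AE_lebesgue_neq[of t] by eventually_elim (use assms(1,2) p(2) in \<open>auto simp: indicator_def\<close>)
  qed
  finally have "inner (conv R g t - p) (conv R g t - p) = 0" using p by (simp add: inner_diff_right)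
  then show ?thesis using p(1) by simp
qed

lemma rhs_continuous:
  assumes X: "X \<in> adm T"
  shows "continuous_on {0..T} (rhs X)" "\<And>t. 0 \<le> t ==> t \<le> T ==> rhs X t \<in> H"
proof -
  obtain M1 where M1: "\<forall>s\<in>{0..T}. norm (N1 s X) \<le> M1" using good_bounded[OF X T] by blast
  obtain M2 where M2: "\<forall>s\<in>{0..T}. norm (N2 s X) \<le> M2" using good_bounded[OF X T] by blast
  have m: "(%s. N1 s X) \<in> borel_measurable (lebesgue_on {0..T})" "(%s. N2 s X) \<in> borel_measurable (lebesgue_on {0..T})"
    using good_measurable[OF X T] by auto
  show "continuous_on {0..T} (rhs X)"
    unfolding rhs_def using M1 M2
    by (intro continuous_on_add U k1.conv_continuous[OF m(1), of M1] k2.conv_continuous[OF m(2), of M2]) auto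
  fix t assume t: "0 \<le> t" "t \<le> T"
  have "conv R1 (%s. N1 s X) t \<in> H"
    using M1 t by (intro conv_in_H R_H good_H[OF X T order_refl, of N1] k1.conv_integrable[OF m(1), of _ M1]) auto
  moreover have "conv R2 (%s. N2 s X) t \<in> H"
    using M2 t by (intro conv_in_H R_H good_H[OF X T order_refl, of N2] k2.conv_integrable[OF m(2), of _ M2]) auto
  ultimately show "rhs X t \<in> H"
    unfolding rhs_def using U t by (intro subspace_add[OF H(2)]) auto
qed

text \<open>The contraction acts on Y with X t = exp(l t) Y t for t > 0: the plain supremum norm of
  Y is the weighted norm of X, and Y ranges over a closed subset of the complete space of bounded
  continuous functions.\<close>

lemma existence: "\<exists>X \<in> adm T. \<forall>t\<in>{0..T}. X t = rhs X t"
proof -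
  obtain l where l: "l > 0" "C1 * L * Gamma b1 * l powr (- b1) + C2 * L * Gamma b2 * l powr (- b2) \<le> 1 / 2"
    by (rule exists_weight)
  \<comment> \<open>The functions live on the whole line; fixing them to \<open>\<psi> 0\<close> for
    t \<le> 0 makes the path continuous where it joins the history.\<close>
  define S where "S = {Y :: real \<Rightarrow>\<^sub>C 'a. (\<forall>t. Y t \<in> H) \<and> (\<forall>t\<le>0. Y t = \<psi> 0)}"
  define X where "X Y t = (if t \<le> 0 then \<psi> t else exp (l * t) *\<^sub>R apply_bcontfun Y t)" for Y and t :: real
  \<comment> \<open>Clamping time to [0, T] extends the right-hand side to a bounded continuous
    function on the line.\<close>
  define c where "c t = max 0 (min t T)" for t
  have c: "0 \<le> c t" "c t \<le> T" for t using T by (auto simp: c_def)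
  have X_adm: "X Y \<in> adm T" if Y: "Y \<in> S" for Y
  proof -
    have "continuous_on ({-r..0} \<union> {0..T}) (%t. if t \<le> 0 then \<psi> t else exp (l * t) *\<^sub>R apply_bcontfun Y t)"
      by (rule continuous_on_cases) (use Y \<psi> in \<open>auto simp: S_def intro!: continuous_intros\<close>)
    moreover have "{-r..0} \<union> {0..T} = {-r..T}" using r T by auto
    ultimately show ?thesis
      using Y \<psi> unfolding adm_def X_def[abs_def] S_def by (auto intro!: subspace_scale[OF H(2)])
  qed
  define \<Psi> where "\<Psi> Y t = exp (- (l * c t)) *\<^sub>R rhs (X Y) (c t)" for Y t
  have \<Psi>_bc: "\<Psi> Y \<in> bcontfun" if Y: "Y \<in> S" for Y
  proof -
    let ?h = "%t. exp (- (l * t)) *\<^sub>R rhs (X Y) t"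
    have h: "continuous_on {0..T} ?h"
      by (intro continuous_intros rhs_continuous X_adm Y)
    have "continuous_on UNIV (%t. ?h (c t))"
      by (rule continuous_on_compose2[OF h]) (use c in \<open>auto simp: c_def intro!: continuous_intros\<close>)
    then have "continuous_on UNIV (\<Psi> Y)" by (simp add: \<Psi>_def[abs_def])
    obtain K where "\<forall>x\<in>?h ` {0..T}. norm x \<le> K"
      using compact_imp_bounded[OF compact_continuous_image[OF h]] by (auto simp: bounded_iff)
    then have "\<forall>t. norm (\<Psi> Y t) \<le> K" using c by (auto simp: \<Psi>_def)
    with \<open>continuous_on UNIV (\<Psi> Y)\<close> show ?thesis by (intro bcontfun_normI) auto
  qed
  note \<Psi>_apply = Bcontfun_inverse[OF \<Psi>_bc]
  have rhs0: "rhs Z 0 = \<psi> 0" for Z using U by (simp add: rhs_def conv_0)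
  have maps: "Bcontfun (\<Psi> Y) \<in> S" if Y: "Y \<in> S" for Y
  proof -
    have "\<Psi> Y t \<in> H" for t
      unfolding \<Psi>_def by (intro subspace_scale[OF H(2)] rhs_continuous X_adm Y c)
    moreover have "\<Psi> Y t = \<psi> 0" if "t \<le> 0" for t
      using that T by (simp add: \<Psi>_def c_def rhs0)
    ultimately show ?thesis by (simp add: S_def \<Psi>_apply[OF Y])
  qed
  have contr: "dist (Bcontfun (\<Psi> Y)) (Bcontfun (\<Psi> Z)) \<le> 1 / 2 * dist Y Z" if Y: "Y \<in> S" and Z: "Z \<in> S" for Y Z
  proof (rule dist_bound)
    fix t
    have "norm (rhs (X Y) (c t) - rhs (X Z) (c t))
        \<le> (C1 * L * Gamma b1 * l powr (- b1) + C2 * L * Gamma b2 * l powr (- b2)) * dist Y Z * exp (l * c t)"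
    proof (rule rhs_diff)
      show "X Y \<in> adm (c t)" "X Z \<in> adm (c t)"
        using X_adm[OF Y] X_adm[OF Z] c[of t] by (auto simp: adm_def intro: continuous_on_subset)
      show "norm (X Y s - X Z s) \<le> dist Y Z * exp (l * s)" if "0 \<le> s" "s \<le> c t" for s
      proof (cases "s = 0")
        case False
        then have "norm (X Y s - X Z s) = exp (l * s) * dist (apply_bcontfun Y s) (apply_bcontfun Z s)"
          using that by (simp add: X_def dist_norm flip: scaleR_diff_right)
        also have "\<dots> \<le> exp (l * s) * dist Y Z"
          by (intro mult_left_mono dist_bounded) auto
        finally show ?thesis by (simp add: mult.commute)
      qed (simp add: X_def)
    qed (use c l in auto)
    also have "\<dots> \<le> 1 / 2 * dist Y Z * exp (l * c t)"
      using l by (intro mult_right_mono) auto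
    finally have "exp (- (l * c t)) * norm (rhs (X Y) (c t) - rhs (X Z) (c t)) \<le> 1 / 2 * dist Y Z"
      by (simp add: exp_minus field_simps)
    then show "dist (Bcontfun (\<Psi> Y) t) (Bcontfun (\<Psi> Z) t) \<le> 1 / 2 * dist Y Z"
      unfolding \<Psi>_apply[OF Y] \<Psi>_apply[OF Z] by (simp add: \<Psi>_def dist_norm flip: scaleR_diff_right)
  qed
  have "\<psi> 0 \<in> H" using \<psi> r by simp
  then have ne: "const_bcontfun (\<psi> 0) \<in> S" by (simp add: S_def)
  have "S = PiC UNIV (%t. if t \<le> 0 then {\<psi> 0} else H)"
    using \<open>\<psi> 0 \<in> H\<close> by (auto simp: S_def mem_PiC_iff Pi_iff split: if_splits) (metis linorder_not_le)
  then have "closed S"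
    using H(1) by (simp add: closed_PiC)
  then have "\<exists>!Y. Y \<in> S \<and> Bcontfun (\<Psi> Y) = Y"
    using ne maps contr by (intro Banach_fix[where c = "1/2"]) (auto simp: complete_eq_closed)
  then obtain Y where Y: "Y \<in> S" "Bcontfun (\<Psi> Y) = Y" by blast
  have "X Y t = rhs (X Y) t" if t: "t \<in> {0..T}" for t
  proof (cases "t = 0")
    case False
    have "apply_bcontfun Y t = \<Psi> Y t" using \<Psi>_apply[OF Y(1)] Y(2) by simp
    then show ?thesis using t False by (simp add: X_def \<Psi>_def c_def flip: exp_add)
  qed (simp add: X_def rhs0)
  with X_adm[OF Y(1)] show ?thesis by blast
qed

end

section \<open>The Sobolev inequality\<close>

abbreviation lborel2 :: "(real \<times> real) measure" where "lborel2 \<equiv> lborel \<Otimes>\<^sub>M lborel"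
abbreviation lborel3 :: "(real \<times> real \<times> real) measure" where "lborel3 \<equiv> lborel \<Otimes>\<^sub>M lborel2"

definition vec3 :: "real \<times> real \<times> real => real^3" where
  "vec3 = (%(x, y, z). vector [x, y, z])"

lemma vec3_nth [simp]: "vec3 (x, y, z) $ 1 = x" "vec3 (x, y, z) $ 2 = y" "vec3 (x, y, z) $ 3 = z"
  by (simp_all add: vec3_def)

lemma vec3_eq: "vec3 p = fst p *\<^sub>R axis 1 1 + fst (snd p) *\<^sub>R axis 2 1 + snd (snd p) *\<^sub>R axis 3 1"
  by (cases p) (auto simp: vec_eq_iff forall_3 axis_def)

lemma vec3_measurable [measurable]: "vec3 \<in> borel_measurable borel"
  unfolding vec3_eq[abs_def] by (intro borel_measurable_continuous_onI continuous_intros)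

lemma Basis_real3: "(Basis :: (real^3) set) = {axis 1 1, axis 2 1, axis 3 1}"
  by (auto simp: Basis_vec_def UNIV_3)

lemma sigma_finite_lborel2: "sigma_finite_measure (lborel \<Otimes>\<^sub>M (lborel :: real measure))"
  by (simp add: lborel_prod sigma_finite_lborel)

lemma pair_sigma_finite_lborel3: "pair_sigma_finite (lborel :: real measure) (lborel \<Otimes>\<^sub>M (lborel :: real measure))"
  by (simp add: pair_sigma_finite_def sigma_finite_lborel2 sigma_finite_lborel)

text \<open>Carries Lebesgue measure from the iterated product, where Tonelli's theorem applies one
  coordinate at a time, to the vector space.\<close>

lemma lborel_vec3: "distr lborel3 borel vec3 = lborel"
proof (rule lborel_eqI[symmetric])
  fix l u :: "real^3" assume lu: "\<And>b. b \<in> Basis ==> l \<bullet> b \<le> u \<bullet> b"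
  have m: "vec3 \<in> lborel3 \<rightarrow>\<^sub>M borel"
    using vec3_measurable by (simp add: borel_prod lborel_prod)
  have pre: "vec3 -` box l u \<inter> space lborel3
      = {l $ 1<..<u $ 1} \<times> {l $ 2<..<u $ 2} \<times> {l $ 3<..<u $ 3}"
    by (auto simp: mem_box_3 space_pair_measure)
  have le: "l $ i \<le> u $ i" for i using lu[of "axis i 1"] by (simp add: inner_axis)
  have "emeasure (distr lborel3 borel vec3) (box l u)
      = emeasure lborel3 ({l $ 1<..<u $ 1} \<times> {l $ 2<..<u $ 2} \<times> {l $ 3<..<u $ 3})"
    by (subst emeasure_distr[OF m]) (auto simp: pre)
  also have "\<dots> = ennreal (u $ 1 - l $ 1) * (ennreal (u $ 2 - l $ 2) * ennreal (u $ 3 - l $ 3))"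
    by (simp add: sigma_finite_measure.emeasure_pair_measure_Times[OF sigma_finite_lborel2] lborel.emeasure_pair_measure_Times le)
  also have "\<dots> = ennreal ((u $ 1 - l $ 1) * ((u $ 2 - l $ 2) * (u $ 3 - l $ 3)))"
    using le by (simp add: ennreal_mult)
  also have "(u $ 1 - l $ 1) * ((u $ 2 - l $ 2) * (u $ 3 - l $ 3)) = (\<Prod>b\<in>Basis. (u - l) \<bullet> b)"
    by (simp add: Basis_real3 axis_eq_axis inner_axis)
  finally show "emeasure (distr lborel3 borel vec3) (box l u) = ennreal (\<Prod>b\<in>Basis. (u - l) \<bullet> b)"
    by simp
qed simp

text \<open>With a square root on the extended nonnegative reals, the squared form of Cauchy-Schwarz
  can be iterated before any integral is known to be finite.\<close>

definition esqrt :: "ennreal => ennreal" where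
  "esqrt u = (if u = top then top else ennreal (sqrt (enn2real u)))"

lemma esqrt_measurable [measurable]: "esqrt \<in> borel_measurable borel"
  unfolding esqrt_def[abs_def] by measurable

lemma esqrt_power2: "(esqrt u)\<^sup>2 = u"
  by (cases u) (auto simp: esqrt_def ennreal_power)

lemma le_esqrt: "t\<^sup>2 \<le> u ==> t \<le> esqrt u"
proof (cases "u = top")
  case False
  assume le: "t\<^sup>2 \<le> u"
  then have "t \<noteq> top" using False by (auto simp: top_unique power2_eq_square)
  then obtain q where q: "t = ennreal q" "0 \<le> q" by (cases t) auto
  from False obtain s where s: "u = ennreal s" "0 \<le> s" by (cases u) auto
  have "q\<^sup>2 \<le> s" using le by (simp add: q s ennreal_power)
  then show ?thesis using q s by (auto simp: esqrt_def intro!: ennreal_leI real_le_rsqrt)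
qed (simp add: esqrt_def)

lemma esqrt_of_power2: "esqrt (p\<^sup>2) = p"
proof (cases p)
  case (real r)
  then show ?thesis by (simp add: esqrt_def ennreal_power)
next
  case top
  then show ?thesis by (simp add: esqrt_def power2_eq_square)
qed

lemma power2_le_imp_le_ennreal: "x\<^sup>2 \<le> y\<^sup>2 ==> x \<le> (y::ennreal)"
  using le_esqrt[of x "y\<^sup>2"] by (simp add: esqrt_of_power2)

lemma power2_mono_ennreal: "x \<le> y ==> x\<^sup>2 \<le> (y::ennreal)\<^sup>2"
  by (simp add: power2_eq_square mult_mono)

text \<open>Cauchy-Schwarz in x for the two factors that contain x, then Cauchy-Schwarz in (y, z)
  against a. The square of the remaining factor is a function of y times a function of z, so its
  integral splits.\<close>

lemma loomis_whitney:
  fixes a b c :: "real \<times> real => ennreal"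
  assumes [measurable]: "a \<in> borel_measurable borel" "b \<in> borel_measurable borel" "c \<in> borel_measurable borel"
  shows "(\<integral>\<^sup>+p. (case p of (x, y, z) => a (y, z) * b (x, z) * c (x, y)) \<partial>lborel3)\<^sup>2
    \<le> (\<integral>\<^sup>+q. (a q)\<^sup>2 \<partial>lborel2) * (\<integral>\<^sup>+q. (b q)\<^sup>2 \<partial>lborel2) * (\<integral>\<^sup>+q. (c q)\<^sup>2 \<partial>lborel2)"
proof -
  have [measurable]: "a \<in> borel_measurable (borel \<Otimes>\<^sub>M borel)" "b \<in> borel_measurable (borel \<Otimes>\<^sub>M borel)" "c \<in> borel_measurable (borel \<Otimes>\<^sub>M borel)"
    using assms by (simp_all add: borel_prod)
  define \<beta> where "\<beta> z = (\<integral>\<^sup>+x. (b (x, z))\<^sup>2 \<partial>lborel)" for z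
  define \<gamma> where "\<gamma> y = (\<integral>\<^sup>+x. (c (x, y))\<^sup>2 \<partial>lborel)" for y
  have [measurable]: "\<beta> \<in> borel_measurable borel" "\<gamma> \<in> borel_measurable borel"
    unfolding \<beta>_def[abs_def] \<gamma>_def[abs_def] by measurable
  have "(\<integral>\<^sup>+p. (case p of (x, y, z) => a (y, z) * b (x, z) * c (x, y)) \<partial>lborel3)
      = (\<integral>\<^sup>+yz. \<integral>\<^sup>+x. (case (x, yz) of (x, y, z) => a (y, z) * b (x, z) * c (x, y)) \<partial>lborel \<partial>lborel2)"
    by (rule pair_sigma_finite.nn_integral_snd[OF pair_sigma_finite_lborel3, symmetric]) measurable
  also have "\<dots> \<le> (\<integral>\<^sup>+yz. a yz * (esqrt (\<gamma> (fst yz)) * esqrt (\<beta> (snd yz))) \<partial>lborel2)"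
  proof (rule nn_integral_mono)
    fix yz :: "real \<times> real"
    obtain y z where yz: "yz = (y, z)" by (cases yz)
    have "(\<integral>\<^sup>+x. a (y, z) * b (x, z) * c (x, y) \<partial>lborel) = a (y, z) * (\<integral>\<^sup>+x. c (x, y) * b (x, z) \<partial>lborel)"
      by (subst nn_integral_cmult[symmetric]) (auto simp: ac_simps)
    also have "(\<integral>\<^sup>+x. c (x, y) * b (x, z) \<partial>lborel) \<le> esqrt (\<gamma> y) * esqrt (\<beta> z)"
    proof (rule power2_le_imp_le_ennreal)
      have "(\<integral>\<^sup>+x. c (x, y) * b (x, z) \<partial>lborel)\<^sup>2 \<le> \<gamma> y * \<beta> z"
        unfolding \<beta>_def \<gamma>_def by (rule Cauchy_Schwarz_nn_integral) measurable
      then show "(\<integral>\<^sup>+x. c (x, y) * b (x, z) \<partial>lborel)\<^sup>2 \<le> (esqrt (\<gamma> y) * esqrt (\<beta> z))\<^sup>2"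
        by (simp add: power_mult_distrib esqrt_power2)
    qed
    finally show "(\<integral>\<^sup>+x. (case (x, yz) of (x, y, z) => a (y, z) * b (x, z) * c (x, y)) \<partial>lborel)
        \<le> a yz * (esqrt (\<gamma> (fst yz)) * esqrt (\<beta> (snd yz)))"
      by (simp add: mult_left_mono yz)
  qed
  finally have "(\<integral>\<^sup>+p. (case p of (x, y, z) => a (y, z) * b (x, z) * c (x, y)) \<partial>lborel3)\<^sup>2
      \<le> (\<integral>\<^sup>+yz. a yz * (esqrt (\<gamma> (fst yz)) * esqrt (\<beta> (snd yz))) \<partial>lborel2)\<^sup>2"
    by (rule power2_mono_ennreal)
  also have "\<dots> \<le> (\<integral>\<^sup>+q. (a q)\<^sup>2 \<partial>lborel2) * (\<integral>\<^sup>+yz. (esqrt (\<gamma> (fst yz)) * esqrt (\<beta> (snd yz)))\<^sup>2 \<partial>lborel2)"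
    by (rule Cauchy_Schwarz_nn_integral) measurable
  also have "(\<integral>\<^sup>+yz. (esqrt (\<gamma> (fst yz)) * esqrt (\<beta> (snd yz)))\<^sup>2 \<partial>lborel2) = (\<integral>\<^sup>+y. \<integral>\<^sup>+z. \<gamma> y * \<beta> z \<partial>lborel \<partial>lborel)"
    unfolding power_mult_distrib esqrt_power2 by (subst lborel.nn_integral_fst[symmetric]) auto
  also have "\<dots> = (\<integral>\<^sup>+z. \<beta> z \<partial>lborel) * (\<integral>\<^sup>+y. \<gamma> y \<partial>lborel)"
    by (simp add: nn_integral_cmult nn_integral_multc mult.commute)
  also have "(\<integral>\<^sup>+z. \<beta> z \<partial>lborel) = (\<integral>\<^sup>+q. (b q)\<^sup>2 \<partial>lborel2)"
    unfolding \<beta>_def by (rule lborel_pair.nn_integral_snd[of "%q. (b q)\<^sup>2"]) measurable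
  also have "(\<integral>\<^sup>+y. \<gamma> y \<partial>lborel) = (\<integral>\<^sup>+q. (c q)\<^sup>2 \<partial>lborel2)"
    unfolding \<gamma>_def by (rule lborel_pair.nn_integral_snd[of "%q. (c q)\<^sup>2"]) measurable
  finally show ?thesis by (simp add: ac_simps)
qed

lemma nn_integral_vec3:
  assumes [measurable]: "f \<in> borel_measurable borel"
  shows "(\<integral>\<^sup>+x. f x \<partial>lborel) = (\<integral>\<^sup>+p. f (vec3 p) \<partial>lborel3)"
proof -
  have m: "vec3 \<in> lborel3 \<rightarrow>\<^sub>M borel"
    using vec3_measurable by (simp add: borel_prod lborel_prod)
  show ?thesis
    by (subst lborel_vec3[symmetric], rule nn_integral_distr[OF m]) simp
qed

lemma line_bound:
  fixes v :: "real^3 => real"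
  assumes diff: "\<And>x. v differentiable (at x)" and cont: "continuous_on UNIV (partial_deriv j v)"
    and K: "compact K" "\<And>x. x \<notin> K ==> v x = 0"
  shows "ennreal \<bar>v x\<bar> \<le> (\<integral>\<^sup>+s. ennreal \<bar>partial_deriv j v (x + (s - x $ j) *\<^sub>R axis j 1)\<bar> \<partial>lborel)"
proof -
  let ?p = "%s. x + (s - x $ j) *\<^sub>R axis j 1"
  have line: "((%s. v (?p s)) has_vector_derivative partial_deriv j v (?p s)) (at s within S)" for s S
    using line_derivative[OF diff, of "x - (x $ j) *\<^sub>R axis j 1" j s S] by (simp add: algebra_simps)
  obtain R where R: "\<And>x. x \<in> K ==> norm x \<le> R"
    using compact_imp_bounded[OF K(1)] by (auto simp: bounded_iff)
  \<comment> \<open>The line starts at a point whose j-th coordinate is below -R, hence outside the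
    support.\<close>
  define a where "a = min (x $ j) (- R - 1)"
  have "\<bar>?p a $ j\<bar> > R" by (simp add: a_def)
  then have "norm (?p a) > R" using component_le_norm_cart[of "?p a" j] by linarith
  then have 0: "v (?p a) = 0" using R K(2) by force
  have c: "continuous_on {a..x $ j} (%s. partial_deriv j v (?p s))"
    by (rule continuous_on_compose2[OF cont]) (auto intro!: continuous_intros)
  have "v (?p (x $ j)) - v (?p a) = (LINT s|lborel. indicator {a..x $ j} s *\<^sub>R partial_deriv j v (?p s))"
    by (rule integral_FTC_Icc[symmetric]) (use line c in \<open>auto simp: a_def\<close>)
  then have eq: "v x = (LINT s|lborel. indicator {a..x $ j} s *\<^sub>R partial_deriv j v (?p s))"
    by (simp add: 0)
  have "ennreal (norm (v x)) \<le> (\<integral>\<^sup>+s. ennreal (norm (indicator {a..x $ j} s *\<^sub>R partial_deriv j v (?p s))) \<partial>lborel)"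
    unfolding eq
    by (rule integral_norm_bound_ennreal) (use borel_integrable_atLeastAtMost'[OF c] in \<open>simp add: set_integrable_def\<close>)
  also have "\<dots> \<le> (\<integral>\<^sup>+s. ennreal \<bar>partial_deriv j v (?p s)\<bar> \<partial>lborel)"
    by (intro nn_integral_mono) (auto simp: indicator_def)
  finally show ?thesis by simp
qed

text \<open>Here \<open>f\<close> stands for |v|^(3/2) without fractional powers. Each line integral
  bounds |v| by a function independent of one coordinate; the product of their square roots
  dominates \<open>f\<close>, and the Loomis-Whitney inequality separates the three.\<close>

lemma gagliardo_nirenberg:
  fixes v :: "real^3 => real"
  assumes diff: "\<And>x. v differentiable (at x)" and cont: "\<And>j. continuous_on UNIV (partial_deriv j v)"
    and K: "compact K" "\<And>x. x \<notin> K ==> v x = 0"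
    and f [measurable]: "f \<in> borel_measurable borel" and le: "\<And>x. (f x)\<^sup>2 \<le> ennreal \<bar>v x\<bar> ^ 3"
  shows "(\<integral>\<^sup>+x. f x \<partial>lborel)\<^sup>2 \<le> (\<Prod>j\<in>{1, 2, 3}. \<integral>\<^sup>+x. ennreal \<bar>partial_deriv j v x\<bar> \<partial>lborel)"
proof -
  have pd [measurable]: "partial_deriv j v \<in> borel_measurable borel" for j
    by (rule borel_measurable_continuous_onI[OF cont])
  let ?d = "%j p. ennreal \<bar>partial_deriv j v (vec3 p)\<bar>"
  have v3 [measurable]: "vec3 \<in> (borel \<Otimes>\<^sub>M borel \<Otimes>\<^sub>M borel) \<rightarrow>\<^sub>M borel"
    using vec3_measurable by (simp add: borel_prod)
  define A where "A = (%(y, z). \<integral>\<^sup>+s. ?d 1 (s, y, z) \<partial>lborel)"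
  define B where "B = (%(x, z). \<integral>\<^sup>+s. ?d 2 (x, s, z) \<partial>lborel)"
  define C where "C = (%(x, y). \<integral>\<^sup>+s. ?d 3 (x, y, s) \<partial>lborel)"
  have m: "A \<in> borel_measurable (borel \<Otimes>\<^sub>M borel)" "B \<in> borel_measurable (borel \<Otimes>\<^sub>M borel)" "C \<in> borel_measurable (borel \<Otimes>\<^sub>M borel)"
    unfolding A_def B_def C_def by measurable
  then have mb: "A \<in> borel_measurable borel" "B \<in> borel_measurable borel" "C \<in> borel_measurable borel"
    by (simp_all add: borel_prod)
  have bound: "f (vec3 (x, y, z)) \<le> esqrt (A (y, z)) * esqrt (B (x, z)) * esqrt (C (x, y))" for x y z
  proof (rule power2_le_imp_le_ennreal)
    note lb = line_bound[OF diff cont K]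
    have ax: "vec3 (x, y, z) + (s - x) *\<^sub>R axis 1 1 = vec3 (s, y, z)"
      "vec3 (x, y, z) + (s - y) *\<^sub>R axis 2 1 = vec3 (x, s, z)"
      "vec3 (x, y, z) + (s - z) *\<^sub>R axis 3 1 = vec3 (x, y, s)" for s
      by (auto simp: vec_eq_iff forall_3 axis_def)
    have "ennreal \<bar>v (vec3 (x, y, z))\<bar> \<le> A (y, z)" "ennreal \<bar>v (vec3 (x, y, z))\<bar> \<le> B (x, z)" "ennreal \<bar>v (vec3 (x, y, z))\<bar> \<le> C (x, y)"
      using lb[of "vec3 (x, y, z)" 1] lb[of "vec3 (x, y, z)" 2] lb[of "vec3 (x, y, z)" 3]
      by (simp_all add: ax A_def B_def C_def)
    then have "ennreal \<bar>v (vec3 (x, y, z))\<bar> ^ 3 \<le> A (y, z) * B (x, z) * C (x, y)"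
      unfolding power3_eq_cube by (intro mult_mono) auto
    with le[of "vec3 (x, y, z)"] show "(f (vec3 (x, y, z)))\<^sup>2 \<le> (esqrt (A (y, z)) * esqrt (B (x, z)) * esqrt (C (x, y)))\<^sup>2"
      by (simp add: power_mult_distrib esqrt_power2)
  qed
  have "(\<integral>\<^sup>+x. f x \<partial>lborel) = (\<integral>\<^sup>+p. f (vec3 p) \<partial>lborel3)"
    by (rule nn_integral_vec3) measurable
  also have "\<dots> \<le> (\<integral>\<^sup>+p. (case p of (x, y, z) => esqrt (A (y, z)) * esqrt (B (x, z)) * esqrt (C (x, y))) \<partial>lborel3)"
    using bound by (intro nn_integral_mono) auto
  finally have "(\<integral>\<^sup>+x. f x \<partial>lborel)\<^sup>2 \<le> (\<integral>\<^sup>+p. (case p of (x, y, z) => esqrt (A (y, z)) * esqrt (B (x, z)) * esqrt (C (x, y))) \<partial>lborel3)\<^sup>2"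
    by (rule power2_mono_ennreal)
  also have "\<dots> \<le> (\<integral>\<^sup>+q. (esqrt (A q))\<^sup>2 \<partial>lborel2) * (\<integral>\<^sup>+q. (esqrt (B q))\<^sup>2 \<partial>lborel2) * (\<integral>\<^sup>+q. (esqrt (C q))\<^sup>2 \<partial>lborel2)"
    by (rule loomis_whitney) (use mb in measurable)
  also have "\<dots> = (\<integral>\<^sup>+q. A q \<partial>lborel2) * (\<integral>\<^sup>+q. B q \<partial>lborel2) * (\<integral>\<^sup>+q. C q \<partial>lborel2)"
    by (simp add: esqrt_power2)
  also have "(\<integral>\<^sup>+q. A q \<partial>lborel2) = (\<integral>\<^sup>+x. ennreal \<bar>partial_deriv 1 v x\<bar> \<partial>lborel)"
  proof -
    have "(\<integral>\<^sup>+q. A q \<partial>lborel2) = (\<integral>\<^sup>+q. \<integral>\<^sup>+s. ?d 1 (s, q) \<partial>lborel \<partial>lborel2)"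
      by (intro nn_integral_cong) (auto simp: A_def)
    also have "\<dots> = (\<integral>\<^sup>+p. ?d 1 p \<partial>lborel3)"
      by (rule pair_sigma_finite.nn_integral_snd[OF pair_sigma_finite_lborel3]) measurable
    finally show ?thesis by (subst nn_integral_vec3) auto
  qed
  also have "(\<integral>\<^sup>+q. B q \<partial>lborel2) = (\<integral>\<^sup>+x. ennreal \<bar>partial_deriv 2 v x\<bar> \<partial>lborel)"
  proof -
    have "(\<integral>\<^sup>+q. B q \<partial>lborel2) = (\<integral>\<^sup>+x. \<integral>\<^sup>+z. B (x, z) \<partial>lborel \<partial>lborel)"
      by (rule lborel.nn_integral_fst[symmetric]) (use m in measurable)
    also have "\<dots> = (\<integral>\<^sup>+x. \<integral>\<^sup>+z. \<integral>\<^sup>+s. ?d 2 (x, s, z) \<partial>lborel \<partial>lborel \<partial>lborel)"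
      by (simp add: B_def)
    also have "\<dots> = (\<integral>\<^sup>+x. \<integral>\<^sup>+q. ?d 2 (x, q) \<partial>lborel2 \<partial>lborel)"
    proof (rule nn_integral_cong)
      fix x :: real
      show "(\<integral>\<^sup>+z. \<integral>\<^sup>+s. ?d 2 (x, s, z) \<partial>lborel \<partial>lborel) = (\<integral>\<^sup>+q. ?d 2 (x, q) \<partial>lborel2)"
        by (rule lborel_pair.nn_integral_snd[of "%q. ?d 2 (x, q)"]) measurable
    qed
    also have "\<dots> = (\<integral>\<^sup>+p. ?d 2 p \<partial>lborel3)"
      by (rule sigma_finite_measure.nn_integral_fst[OF sigma_finite_lborel2]) measurable
    finally show ?thesis by (subst nn_integral_vec3) auto
  qed
  also have "(\<integral>\<^sup>+q. C q \<partial>lborel2) = (\<integral>\<^sup>+x. ennreal \<bar>partial_deriv 3 v x\<bar> \<partial>lborel)"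
  proof -
    have "(\<integral>\<^sup>+q. C q \<partial>lborel2) = (\<integral>\<^sup>+x. \<integral>\<^sup>+y. C (x, y) \<partial>lborel \<partial>lborel)"
      by (rule lborel.nn_integral_fst[symmetric]) (use m in measurable)
    also have "\<dots> = (\<integral>\<^sup>+x. \<integral>\<^sup>+y. \<integral>\<^sup>+s. ?d 3 (x, y, s) \<partial>lborel \<partial>lborel \<partial>lborel)"
      by (simp add: C_def)
    also have "\<dots> = (\<integral>\<^sup>+x. \<integral>\<^sup>+q. ?d 3 (x, q) \<partial>lborel2 \<partial>lborel)"
    proof (rule nn_integral_cong)
      fix x :: real
      show "(\<integral>\<^sup>+y. \<integral>\<^sup>+s. ?d 3 (x, y, s) \<partial>lborel \<partial>lborel) = (\<integral>\<^sup>+q. ?d 3 (x, q) \<partial>lborel2)"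
        by (rule lborel.nn_integral_fst[of "%q. ?d 3 (x, q)"]) measurable
    qed
    also have "\<dots> = (\<integral>\<^sup>+p. ?d 3 p \<partial>lborel3)"
      by (rule sigma_finite_measure.nn_integral_fst[OF sigma_finite_lborel2]) measurable
    finally show ?thesis by (subst nn_integral_vec3) auto
  qed
  finally show ?thesis by (simp add: mult.assoc)
qed

text \<open>Applied to v = |w|^4, for which |v|^(3/2) = |w|^6 and each partial derivative of v is at
  most 4 |w|^3 times that of w. With N the integral of |w|^6 and g_j the squared L^2 norms of the
  derivatives, Cauchy-Schwarz gives N^4 \<le> 16^3 N^3 g_1 g_2 g_3. Compact support makes N finite,
  so N^3 cancels and 4096 = 16^3 remains.\<close>

lemma sobolev_test:
  fixes w :: "real^3 => real^3"
  assumes w: "w \<in> test_functions \<Omega>"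
  shows "(\<integral>\<^sup>+x. ennreal (norm (w x) ^ 6) \<partial>lborel)
    \<le> ennreal (4096 * (\<Sum>j\<in>UNIV. (norm (abs_l2 (partial_deriv j w)))\<^sup>2) ^ 3)"
proof -
  obtain K where K: "compact K" "\<And>x. x \<notin> K ==> w x = 0" by (rule test_support[OF w]) (rule that)
  have wc: "continuous_on UNIV w" and wpc: "continuous_on UNIV (partial_deriv j w)" for j
    by (rule test_continuous[OF w], rule test_partial_continuous[OF w])
  note [measurable] = borel_measurable_continuous_onI[OF wc] borel_measurable_continuous_onI[OF wpc]
  define v where "v x = (norm (w x)) ^ 4" for x
  have v_eq: "v = (%x. (inner (w x) (w x))\<^sup>2)"
    by (auto simp: v_def fun_eq_iff dot_square_norm power_mult[symmetric])
  have vd: "(v has_derivative (%h. 4 * (norm (w x))\<^sup>2 * inner (w x) (frechet_derivative w (at x) h))) (at x)" for x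
  proof -
    have "(w has_derivative frechet_derivative w (at x)) (at x)"
      using test_differentiable[OF w] by (simp add: frechet_derivative_works)
    from has_derivative_power[OF has_derivative_inner[OF this this], of 2]
    show ?thesis
      unfolding v_eq by (rule has_derivative_eq_rhs) (auto simp: fun_eq_iff inner_commute simp flip: power2_norm_eq_inner)
  qed
  have vp: "partial_deriv j v x = 4 * (norm (w x))\<^sup>2 * inner (w x) (partial_deriv j w x)" for j x
    using partial_derivI[OF vd] by (simp add: partial_deriv_def)
  define N where "N = (\<integral>\<^sup>+x. ennreal (norm (w x) ^ 6) \<partial>lborel)"
  define g where "g j = ennreal ((norm (abs_l2 (partial_deriv j w)))\<^sup>2)" for j
  have g: "(\<integral>\<^sup>+x. ennreal ((norm (partial_deriv j w x))\<^sup>2) \<partial>lborel) = g j" for j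
    unfolding g_def by (rule nn_integral_sq[OF test_sq_integrable[OF test_partial[OF w]]])
  have est: "(\<integral>\<^sup>+x. ennreal \<bar>partial_deriv j v x\<bar> \<partial>lborel)\<^sup>2 \<le> 16 * N * g j" for j
  proof -
    have "(\<integral>\<^sup>+x. ennreal \<bar>partial_deriv j v x\<bar> \<partial>lborel)
        \<le> (\<integral>\<^sup>+x. ennreal (4 * norm (w x) ^ 3) * ennreal (norm (partial_deriv j w x)) \<partial>lborel)"
    proof (intro nn_integral_mono)
      fix x
      have "\<bar>partial_deriv j v x\<bar> \<le> 4 * (norm (w x))\<^sup>2 * (norm (w x) * norm (partial_deriv j w x))"
        unfolding vp by (auto simp: abs_mult intro!: mult_left_mono Cauchy_Schwarz_ineq2)
      also have "\<dots> = 4 * norm (w x) ^ 3 * norm (partial_deriv j w x)"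
        by (simp add: power2_eq_square power3_eq_cube)
      finally show "ennreal \<bar>partial_deriv j v x\<bar> \<le> ennreal (4 * norm (w x) ^ 3) * ennreal (norm (partial_deriv j w x))"
        by (simp add: ennreal_leI flip: ennreal_mult)
    qed
    then have "(\<integral>\<^sup>+x. ennreal \<bar>partial_deriv j v x\<bar> \<partial>lborel)\<^sup>2
        \<le> (\<integral>\<^sup>+x. ennreal (4 * norm (w x) ^ 3) * ennreal (norm (partial_deriv j w x)) \<partial>lborel)\<^sup>2"
      by (rule power2_mono_ennreal)
    also have "\<dots> \<le> (\<integral>\<^sup>+x. (ennreal (4 * norm (w x) ^ 3))\<^sup>2 \<partial>lborel) * (\<integral>\<^sup>+x. (ennreal (norm (partial_deriv j w x)))\<^sup>2 \<partial>lborel)"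
      by (rule Cauchy_Schwarz_nn_integral) measurable
    also have "(\<integral>\<^sup>+x. (ennreal (norm (partial_deriv j w x)))\<^sup>2 \<partial>lborel) = g j"
      by (simp add: ennreal_power g)
    also have "(\<integral>\<^sup>+x. (ennreal (4 * norm (w x) ^ 3))\<^sup>2 \<partial>lborel) = 16 * N"
    proof -
      have "(ennreal (4 * norm (w x) ^ 3))\<^sup>2 = 16 * ennreal (norm (w x) ^ 6)" for x
      proof -
        have "(4 * norm (w x) ^ 3)\<^sup>2 = 16 * norm (w x) ^ 6" by (simp add: power_mult_distrib flip: power_mult)
        then show ?thesis by (simp add: ennreal_power ennreal_mult)
      qed
      then show ?thesis by (simp add: N_def nn_integral_cmult)
    qed
    finally show ?thesis .
  qed
  have gn: "N\<^sup>2 \<le> (\<Prod>j\<in>{1, 2, 3}. \<integral>\<^sup>+x. ennreal \<bar>partial_deriv j v x\<bar> \<partial>lborel)"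
    unfolding N_def
  proof (rule gagliardo_nirenberg[OF _ _ K(1)])
    show "v differentiable (at x)" for x using vd unfolding differentiable_def by blast
    show "continuous_on UNIV (partial_deriv j v)" for j
      unfolding vp[abs_def] by (intro continuous_intros wc wpc)
    show "v x = 0" if "x \<notin> K" for x using K(2)[OF that] by (simp add: v_def)
    show "(ennreal (norm (w x) ^ 6))\<^sup>2 \<le> ennreal \<bar>v x\<bar> ^ 3" for x
      by (simp add: v_def ennreal_power flip: power_mult)
  qed measurable
  have "N ^ 4 = (N\<^sup>2)\<^sup>2" by (simp flip: power_mult)
  also have "\<dots> \<le> (\<Prod>j\<in>{1, 2, 3}. \<integral>\<^sup>+x. ennreal \<bar>partial_deriv j v x\<bar> \<partial>lborel)\<^sup>2"
    by (rule power2_mono_ennreal[OF gn])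
  also have "\<dots> = (\<Prod>j\<in>{1, 2, 3}. (\<integral>\<^sup>+x. ennreal \<bar>partial_deriv j v x\<bar> \<partial>lborel)\<^sup>2)"
    by (rule prod_power_distrib)
  also have "\<dots> \<le> (\<Prod>j\<in>{1::3, 2, 3}. 16 * N * g j)"
    using mult_mono[OF est[of 1] mult_mono[OF est[of 2] est[of 3]]] by simp
  finally have main: "N ^ 4 \<le> (\<Prod>j\<in>{1::3, 2, 3}. 16 * N * g j)" .
  have "N < top"
  proof -
    obtain M where M: "0 \<le> M" "\<And>x. norm (norm (w x) ^ 6) \<le> M * indicator K x"
      by (rule compact_support_bound[of "%x. norm (w x) ^ 6" K]) (use K wc in \<open>auto intro!: continuous_intros that\<close>)
    have "N \<le> (\<integral>\<^sup>+x. ennreal M * indicator K x \<partial>lborel)"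
      unfolding N_def
    proof (rule nn_integral_mono)
      fix x
      show "ennreal (norm (w x) ^ 6) \<le> ennreal M * indicator K x"
        using M(2)[of x] by (cases "x \<in> K") (auto intro: ennreal_leI)
    qed
    also have "\<dots> = ennreal M * emeasure lborel K"
      using K(1) by (subst nn_integral_cmult_indicator) (auto simp: borel_compact)
    also have "\<dots> < top" using emeasure_compact_finite[OF K(1)] by (simp add: ennreal_mult_less_top)
    finally show ?thesis .
  qed
  then obtain n where n: "N = ennreal n" "0 \<le> n" by (cases N) auto
  define h where "h j = (norm (abs_l2 (partial_deriv j w)))\<^sup>2" for j
  have h0: "0 \<le> h j" for j by (simp add: h_def)
  have "n ^ 4 \<le> (16 * n * h 1) * ((16 * n * h 2) * (16 * n * h 3))"
    using main n h0 unfolding n g_def h_def[symmetric]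
    by (simp add: ennreal_power mult.assoc ennreal_numeral[symmetric] flip: ennreal_mult del: ennreal_numeral)
  also have "\<dots> = n ^ 3 * (4096 * (h 1 * (h 2 * h 3)))" by (simp add: power3_eq_cube)
  finally have le: "n ^ 3 * n \<le> n ^ 3 * (4096 * (h 1 * (h 2 * h 3)))" by (simp add: power_numeral_reduce)
  define s where "s = (\<Sum>j\<in>UNIV. h j)"
  have hs: "h j \<le> s" for j unfolding s_def using h0 by (intro member_le_sum) auto
  have s0: "0 \<le> s" unfolding s_def using h0 by (intro sum_nonneg) auto
  have "n \<le> 4096 * (h 1 * (h 2 * h 3))"
  proof (cases "n = 0")
    case False
    then show ?thesis using le n by (simp add: mult_le_cancel_left_pos)
  qed (use h0 in simp)
  also have "\<dots> \<le> 4096 * (s * (s * s))"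
    using hs h0 s0 by (intro mult_left_mono mult_mono) auto
  finally have "n \<le> 4096 * s ^ 3" by (simp add: power3_eq_cube)
  then show ?thesis
    unfolding N_def[symmetric] n by (intro ennreal_leI) (simp add: s_def h_def)
qed

section \<open>The Stokes operator\<close>

lemma C_k_add: "C_k k UNIV f ==> C_k k UNIV g ==> C_k k UNIV (%x. f x + g x)"
proof (induction k arbitrary: f g)
  case (Suc k)
  have "partial_deriv j (%x. f x + g x) = (%x. partial_deriv j f x + partial_deriv j g x)" for j
    using Suc.prems by (intro ext partial_derivI[THEN trans] has_derivative_add)
      (auto simp: partial_deriv_def frechet_derivative_works)
  then show ?case using Suc by auto
qed (auto intro: continuous_intros)

lemma C_k_scaleR: "C_k k UNIV f ==> C_k k UNIV (%x. c *\<^sub>R f x)"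
proof (induction k arbitrary: f)
  case (Suc k)
  have "partial_deriv j (%x. c *\<^sub>R f x) = (%x. c *\<^sub>R partial_deriv j f x)" for j
  proof
    fix x
    have "(f has_derivative frechet_derivative f (at x)) (at x)"
      using Suc.prems by (simp add: frechet_derivative_works)
    from partial_derivI[OF has_derivative_scaleR_right[OF this]]
    show "partial_deriv j (%x. c *\<^sub>R f x) x = c *\<^sub>R partial_deriv j f x" by (simp add: partial_deriv_def)
  qed
  then show ?case using Suc by auto
qed (auto intro: continuous_intros)

lemma compact_support_subset:
  fixes K :: "'a::t2_space set"
  assumes "compact K" "K \<subseteq> \<Omega>" "\<And>x. x \<notin> K ==> f x = 0"
  shows "compact (closure {x. f x \<noteq> 0})" "closure {x. f x \<noteq> 0} \<subseteq> \<Omega>"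
proof -
  have "closure {x. f x \<noteq> 0} \<subseteq> K"
    using assms(3) by (intro closure_minimal compact_imp_closed[OF assms(1)]) auto
  moreover from this have "compact (K \<inter> closure {x. f x \<noteq> 0})"
    by (intro compact_Int_closed assms closed_closure)
  ultimately show "compact (closure {x. f x \<noteq> 0})" "closure {x. f x \<noteq> 0} \<subseteq> \<Omega>"
    using assms(2) by (simp_all only: inf.absorb2)
qed

lemma solenoidal_add:
  assumes f: "f \<in> solenoidal_tests \<Omega>" and g: "g \<in> solenoidal_tests \<Omega>"
  shows "(%x. f x + g x) \<in> solenoidal_tests \<Omega>"
proof -
  have ft: "f \<in> test_functions \<Omega>" and gt: "g \<in> test_functions \<Omega>" using f g by (simp_all add: solenoidal_tests_def)
  obtain K where K: "compact K" "K \<subseteq> \<Omega>" "\<And>x. x \<notin> K ==> f x = 0" by (rule test_support[OF ft]) (rule that)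
  obtain L where L: "compact L" "L \<subseteq> \<Omega>" "\<And>x. x \<notin> L ==> g x = 0" by (rule test_support[OF gt]) (rule that)
  have "\<forall>k. C_k k UNIV (%x. f x + g x)" using ft gt unfolding test_functions_def by (blast intro: C_k_add)
  moreover have "compact (closure {x. f x + g x \<noteq> 0})" "closure {x. f x + g x \<noteq> 0} \<subseteq> \<Omega>"
    using K L by (intro compact_support_subset[of "K \<union> L"]; auto)+
  moreover have "partial_deriv j (%x. f x + g x) x = partial_deriv j f x + partial_deriv j g x" for j x
    using test_differentiable[OF ft] test_differentiable[OF gt]
    by (intro partial_derivI[THEN trans] has_derivative_add) (auto simp: partial_deriv_def frechet_derivative_works)
  ultimately show ?thesis
    using f g unfolding solenoidal_tests_def test_functions_def divergence_def by (simp add: sum.distrib)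
qed

lemma solenoidal_scaleR:
  assumes f: "f \<in> solenoidal_tests \<Omega>"
  shows "(%x. c *\<^sub>R f x) \<in> solenoidal_tests \<Omega>"
proof -
  have ft: "f \<in> test_functions \<Omega>" using f by (simp add: solenoidal_tests_def)
  obtain K where K: "compact K" "K \<subseteq> \<Omega>" "\<And>x. x \<notin> K ==> f x = 0" by (rule test_support[OF ft]) (rule that)
  have "\<forall>k. C_k k UNIV (%x. c *\<^sub>R f x)" using ft unfolding test_functions_def by (blast intro: C_k_scaleR)
  moreover have "compact (closure {x. c *\<^sub>R f x \<noteq> 0})" "closure {x. c *\<^sub>R f x \<noteq> 0} \<subseteq> \<Omega>"
    using K by (intro compact_support_subset[of K]; auto)+
  moreover have "partial_deriv j (%x. c *\<^sub>R f x) x = c *\<^sub>R partial_deriv j f x" for j x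
  proof -
    have "(f has_derivative frechet_derivative f (at x)) (at x)"
      using test_differentiable[OF ft] by (simp add: frechet_derivative_works)
    from partial_derivI[OF has_derivative_scaleR_right[OF this]] show ?thesis by (simp add: partial_deriv_def)
  qed
  ultimately show ?thesis
    using f unfolding solenoidal_tests_def test_functions_def divergence_def by (simp flip: sum_distrib_left)
qed

lemma solenoidal_zero: "(%x. 0) \<in> solenoidal_tests \<Omega>"
proof -
  have p: "partial_deriv j (%x. 0) = (%x. 0 :: real^3)" for j by (rule ext, rule partial_derivI) (rule has_derivative_const)
  have "C_k k UNIV (%x. 0 :: real^3)" for k by (induction k) (simp_all add: p)
  then show ?thesis by (simp add: solenoidal_tests_def test_functions_def divergence_def p)
qed

lemma solenoidal_sq_integrable: "w \<in> solenoidal_tests \<Omega> ==> sq_integrable w"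
  by (auto simp: solenoidal_tests_def intro: test_sq_integrable)

lemma subspace_solenoidal: "subspace (abs_l2 ` solenoidal_tests \<Omega>)"
proof (rule subspaceI)
  show "0 \<in> abs_l2 ` solenoidal_tests \<Omega>" using solenoidal_zero by (auto simp: zero_l2_def)
  fix x y c assume "x \<in> abs_l2 ` solenoidal_tests \<Omega>"
  then obtain f where f: "f \<in> solenoidal_tests \<Omega>" "x = abs_l2 f" by blast
  show "c *\<^sub>R x \<in> abs_l2 ` solenoidal_tests \<Omega>"
    using f solenoidal_scaleR[OF f(1)] by (simp add: abs_l2_scaleR solenoidal_sq_integrable)
  assume "y \<in> abs_l2 ` solenoidal_tests \<Omega>"
  then obtain g where g: "g \<in> solenoidal_tests \<Omega>" "y = abs_l2 g" by blast
  show "x + y \<in> abs_l2 ` solenoidal_tests \<Omega>"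
    using f g solenoidal_add[OF f(1) g(1)] by (simp add: abs_l2_add solenoidal_sq_integrable)
qed

lemma subspace_L2_sigma: "subspace (L2_sigma \<Omega>)"
  unfolding L2_sigma_def by (intro subspace_closure subspace_solenoidal)

lemma closed_L2_sigma: "closed (L2_sigma \<Omega>)"
  by (simp add: L2_sigma_def)

section \<open>Lower semicontinuity under L^2 convergence\<close>

lemma l2_AE_subseq:
  assumes "u \<longlonglongrightarrow> (v :: l2)"
  shows "\<exists>r::nat => nat. strict_mono r \<and> (AE x in lborel. (%n. rep_l2 (u (r n)) x) \<longlonglongrightarrow> rep_l2 v x)"
proof -
  let ?g = "%n x. (norm (rep_l2 (u n) x - rep_l2 v x))\<^sup>2"
  have sq: "sq_integrable (%x. rep_l2 (u n) x - rep_l2 v x)" for n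
    by (intro sq_integrable_diff sq_integrable_rep_l2)
  have "(LINT x|lborel. norm (?g n x)) = (norm (u n - v))\<^sup>2" for n
    using norm_abs_l2[OF sq, of n] by (simp add: abs_rep_l2 flip: abs_l2_diff[OF sq_integrable_rep_l2 sq_integrable_rep_l2])
  moreover have "(%n. (norm (u n - v))\<^sup>2) \<longlonglongrightarrow> (norm (v - v))\<^sup>2" by (intro tendsto_intros assms)
  ultimately have "(%n. LINT x|lborel. norm (?g n x)) \<longlonglongrightarrow> 0" by simp
  from tendsto_L1_AE_subseq[OF _ this] sq obtain r where
    r: "strict_mono r" "AE x in lborel. (%n. ?g (r n) x) \<longlonglongrightarrow> 0" by (auto simp: sq_integrable_def)
  from r(2) have "AE x in lborel. (%n. rep_l2 (u (r n)) x) \<longlonglongrightarrow> rep_l2 v x"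
  proof eventually_elim
    fix x assume "(%n. ?g (r n) x) \<longlonglongrightarrow> 0"
    then have "(%n. sqrt (?g (r n) x)) \<longlonglongrightarrow> sqrt 0" by (intro tendsto_intros)
    then show "(%n. rep_l2 (u (r n)) x) \<longlonglongrightarrow> rep_l2 v x" by (simp add: tendsto_norm_zero_iff LIM_zero_iff)
  qed
  with r(1) show ?thesis by blast
qed

text \<open>Integrals of higher powers are not continuous under L^2 convergence, but an almost
  everywhere convergent subsequence and Fatou's lemma transfer an upper bound to the limit.\<close>

lemma nn_integral_power_fatou:
  assumes u: "u \<longlonglongrightarrow> (v :: l2)" and c: "c \<longlonglongrightarrow> C"
    and le: "\<And>n. (\<integral>\<^sup>+x. ennreal (norm (rep_l2 (u n) x) ^ k) \<partial>lborel) \<le> ennreal (c n)"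
  shows "(\<integral>\<^sup>+x. ennreal (norm (rep_l2 v x) ^ k) \<partial>lborel) \<le> ennreal C"
proof -
  note [measurable] = sq_integrable_measurable[OF sq_integrable_rep_l2]
  obtain r where r: "strict_mono r" "AE x in lborel. (%n. rep_l2 (u (r n)) x) \<longlonglongrightarrow> rep_l2 v x"
    using l2_AE_subseq[OF u] by blast
  have "(\<integral>\<^sup>+x. ennreal (norm (rep_l2 v x) ^ k) \<partial>lborel)
      = (\<integral>\<^sup>+x. liminf (%n. ennreal (norm (rep_l2 (u (r n)) x) ^ k)) \<partial>lborel)"
  proof (rule nn_integral_cong_AE, use r(2) in eventually_elim)
    fix x assume "(%n. rep_l2 (u (r n)) x) \<longlonglongrightarrow> rep_l2 v x"
    then have "(%n. ennreal (norm (rep_l2 (u (r n)) x) ^ k)) \<longlonglongrightarrow> ennreal (norm (rep_l2 v x) ^ k)"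
      by (intro tendsto_intros tendsto_ennrealI)
    then show "ennreal (norm (rep_l2 v x) ^ k) = liminf (%n. ennreal (norm (rep_l2 (u (r n)) x) ^ k))"
      by (intro lim_imp_Liminf[symmetric]) simp_all
  qed
  also have "\<dots> \<le> liminf (%n. \<integral>\<^sup>+x. ennreal (norm (rep_l2 (u (r n)) x) ^ k) \<partial>lborel)"
    by (rule nn_integral_liminf) measurable
  also have "\<dots> \<le> liminf (%n. ennreal (c (r n)))"
    by (intro Liminf_mono always_eventually allI le)
  also have "\<dots> = ennreal C"
    using LIMSEQ_subseq_LIMSEQ[OF c r(1)] by (intro lim_imp_Liminf tendsto_ennrealI) (auto simp: o_def)
  finally show ?thesis .
qed

section \<open>Weak gradients\<close>

locale bounded_open_set =
  fixes \<Omega> :: "(real^3) set"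
  assumes open_\<Omega>: "open \<Omega>" and bounded_\<Omega>: "bounded \<Omega>"
begin

lemma borel_\<Omega>: "\<Omega> \<in> sets borel"
  using open_\<Omega> by simp

text \<open>Two candidates differ by a class that all test functions annihilate, so they agree by
  \<open>box_bumps_separate\<close>.\<close>

lemma D_weakI:
  assumes d: "d \<in> L2_on \<Omega>" "weak_partial \<Omega> j (rep_l2 u) (rep_l2 d)"
  shows "D_weak \<Omega> j u = d"
  unfolding D_weak_def
proof (rule the_equality)
  fix d' assume d': "d' \<in> L2_on \<Omega> \<and> weak_partial \<Omega> j (rep_l2 u) (rep_l2 d')"
  have "d' - d = 0"
  proof (rule box_bumps_separate[OF open_\<Omega>])
    show "d' - d \<in> L2_on \<Omega>" using d d' by (intro subspace_diff L2_on_closed_subspace borel_\<Omega>) auto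
    fix \<phi> :: "real^3 => real" and e :: "real^3" assume "\<phi> \<in> test_functions \<Omega>" "e \<in> Basis"
    then show "inner (abs_l2 (%x. \<phi> x *\<^sub>R e)) (d' - d) = 0"
      using d(2) d' unfolding weak_partial_iff[OF borel_\<Omega>] by (simp add: inner_diff_right)
  qed
  then show "d' = d" by simp
qed (use d in simp)

lemma H1_D:
  assumes "u \<in> H1 \<Omega>"
  shows "D_weak \<Omega> j u \<in> L2_on \<Omega>" "weak_partial \<Omega> j (rep_l2 u) (rep_l2 (D_weak \<Omega> j u))"
proof -
  obtain d where "d \<in> L2_on \<Omega>" "weak_partial \<Omega> j (rep_l2 u) (rep_l2 d)"
    using assms by (auto simp: H1_def)
  with D_weakI[OF this] show "D_weak \<Omega> j u \<in> L2_on \<Omega>" "weak_partial \<Omega> j (rep_l2 u) (rep_l2 (D_weak \<Omega> j u))" by simp_all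
qed

lemma H1_I:
  assumes "u \<in> L2_on \<Omega>" "\<And>j. d j \<in> L2_on \<Omega>" "\<And>j. weak_partial \<Omega> j (rep_l2 u) (rep_l2 (d j))"
  shows "u \<in> H1 \<Omega>" "D_weak \<Omega> j u = d j"
  using assms D_weakI by (auto simp: H1_def)

text \<open>Both sides of the tested identity are continuous inner products, so the weak gradient is
  a closed operator.\<close>

lemma H1_closed:
  assumes "\<And>n. u n \<in> H1 \<Omega>" "u \<longlonglongrightarrow> v" "\<And>j. (%n. D_weak \<Omega> j (u n)) \<longlonglongrightarrow> d j"
  shows "v \<in> H1 \<Omega>" "D_weak \<Omega> j v = d j"
proof -
  have v: "v \<in> L2_on \<Omega>"
    by (rule closed_sequentially[OF L2_on_closed_subspace(1)[OF borel_\<Omega>] _ assms(2)]) (use assms(1) in \<open>auto simp: H1_def\<close>)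
  have d: "d j \<in> L2_on \<Omega>" for j
    by (rule closed_sequentially[OF L2_on_closed_subspace(1)[OF borel_\<Omega>] _ assms(3)]) (rule H1_D[OF assms(1)])
  have w: "weak_partial \<Omega> j (rep_l2 v) (rep_l2 (d j))" for j
    unfolding weak_partial_iff[OF borel_\<Omega>]
  proof (intro ballI)
    fix \<phi> :: "real^3 => real" and e :: "real^3" assume \<phi>: "\<phi> \<in> test_functions \<Omega>" "e \<in> Basis"
    have "(%n. inner (abs_l2 (%x. partial_deriv j \<phi> x *\<^sub>R e)) (u n)) \<longlonglongrightarrow> inner (abs_l2 (%x. partial_deriv j \<phi> x *\<^sub>R e)) v"
      by (intro tendsto_intros assms)
    moreover have "inner (abs_l2 (%x. partial_deriv j \<phi> x *\<^sub>R e)) (u n) = - inner (abs_l2 (%x. \<phi> x *\<^sub>R e)) (D_weak \<Omega> j (u n))" for n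
      using H1_D(2)[OF assms(1), of j n] \<phi> unfolding weak_partial_iff[OF borel_\<Omega>] by blast
    moreover have "(%n. - inner (abs_l2 (%x. \<phi> x *\<^sub>R e)) (D_weak \<Omega> j (u n))) \<longlonglongrightarrow> - inner (abs_l2 (%x. \<phi> x *\<^sub>R e)) (d j)"
      by (intro tendsto_intros assms)
    ultimately show "inner (abs_l2 (%x. partial_deriv j \<phi> x *\<^sub>R e)) v = - inner (abs_l2 (%x. \<phi> x *\<^sub>R e)) (d j)"
      by (simp add: LIMSEQ_unique)
  qed
  show "v \<in> H1 \<Omega>" "D_weak \<Omega> j v = d j" using H1_I[of v d, OF v d w] by auto
qed

lemma H1_add:
  assumes u: "u \<in> H1 \<Omega>" and v: "v \<in> H1 \<Omega>"
  shows "u + v \<in> H1 \<Omega>" "D_weak \<Omega> j (u + v) = D_weak \<Omega> j u + D_weak \<Omega> j v"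
proof -
  have "u + v \<in> L2_on \<Omega>" "\<And>j. D_weak \<Omega> j u + D_weak \<Omega> j v \<in> L2_on \<Omega>"
    using u v H1_D(1) by (auto intro!: subspace_add L2_on_closed_subspace borel_\<Omega> simp: H1_def)
  moreover have "weak_partial \<Omega> j (rep_l2 (u + v)) (rep_l2 (D_weak \<Omega> j u + D_weak \<Omega> j v))" for j
    using H1_D(2)[OF u, of j] H1_D(2)[OF v, of j] unfolding weak_partial_iff[OF borel_\<Omega>]
    by (simp add: inner_add_right)
  ultimately show "u + v \<in> H1 \<Omega>" "D_weak \<Omega> j (u + v) = D_weak \<Omega> j u + D_weak \<Omega> j v"
    using H1_I[of "u + v" "%j. D_weak \<Omega> j u + D_weak \<Omega> j v"] by auto
qed

lemma H1_scaleR: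
  assumes u: "u \<in> H1 \<Omega>"
  shows "c *\<^sub>R u \<in> H1 \<Omega>" "D_weak \<Omega> j (c *\<^sub>R u) = c *\<^sub>R D_weak \<Omega> j u"
proof -
  have "c *\<^sub>R u \<in> L2_on \<Omega>" "\<And>j. c *\<^sub>R D_weak \<Omega> j u \<in> L2_on \<Omega>"
    using u H1_D(1) by (auto intro!: subspace_scale L2_on_closed_subspace borel_\<Omega> simp: H1_def)
  moreover have "weak_partial \<Omega> j (rep_l2 (c *\<^sub>R u)) (rep_l2 (c *\<^sub>R D_weak \<Omega> j u))" for j
    using H1_D(2)[OF u, of j] unfolding weak_partial_iff[OF borel_\<Omega>] by simp
  ultimately show "c *\<^sub>R u \<in> H1 \<Omega>" "D_weak \<Omega> j (c *\<^sub>R u) = c *\<^sub>R D_weak \<Omega> j u"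
    using H1_I[of "c *\<^sub>R u" "%j. c *\<^sub>R D_weak \<Omega> j u"] by auto
qed

lemma H1_diff:
  assumes u: "u \<in> H1 \<Omega>" and v: "v \<in> H1 \<Omega>"
  shows "u - v \<in> H1 \<Omega>" "D_weak \<Omega> j (u - v) = D_weak \<Omega> j u - D_weak \<Omega> j v"
  using H1_add[OF u H1_scaleR(1)[OF v, of "-1"]] H1_scaleR(2)[OF v, of j "-1"] by simp_all

lemma test_H1:
  assumes w: "w \<in> test_functions \<Omega>"
  shows "abs_l2 w \<in> H1 \<Omega>" "D_weak \<Omega> j (abs_l2 w) = abs_l2 (partial_deriv j w)"
proof -
  note sq = test_sq_integrable[OF w] test_sq_integrable[OF test_partial[OF w]]
  have L: "abs_l2 w \<in> L2_on \<Omega>" "\<And>j. abs_l2 (partial_deriv j w) \<in> L2_on \<Omega>"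
    using sq test_zero_outside[OF w] test_zero_outside[OF test_partial[OF w]] by (auto intro: abs_l2_L2_on)
  have i: "inner (abs_l2 f) (abs_l2 g) = (LINT x|lborel. inner (f x) (g x))" if "sq_integrable f" "sq_integrable g" for f g
    by (rule inner_l2.abs_eq) (use that in auto)
  have "weak_partial \<Omega> j (rep_l2 (abs_l2 w)) (rep_l2 (abs_l2 (partial_deriv j w)))" for j
    unfolding weak_partial_iff[OF borel_\<Omega>]
  proof (intro ballI)
    fix \<phi> :: "real^3 => real" and e :: "real^3" assume \<phi>: "\<phi> \<in> test_functions \<Omega>"
    show "inner (abs_l2 (%x. partial_deriv j \<phi> x *\<^sub>R e)) (abs_l2 w) = - inner (abs_l2 (%x. \<phi> x *\<^sub>R e)) (abs_l2 (partial_deriv j w))"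
      unfolding i[OF scalar_test_sq_integrable[OF test_partial[OF \<phi>]] sq(1)] i[OF scalar_test_sq_integrable[OF \<phi>] sq(2)]
      by (rule integration_by_parts[OF \<phi> w])
  qed
  with L show "abs_l2 w \<in> H1 \<Omega>" "D_weak \<Omega> j (abs_l2 w) = abs_l2 (partial_deriv j w)"
    using H1_I[of "abs_l2 w" "%j. abs_l2 (partial_deriv j w)"] by auto
qed

text \<open>The three derivatives form one element of a product Hilbert space, whose inner product
  is the Stokes form.\<close>

definition grad :: "l2 => l2 \<times> l2 \<times> l2" where
  "grad u = (D_weak \<Omega> 1 u, D_weak \<Omega> 2 u, D_weak \<Omega> 3 u)"

lemma norm_grad: "(norm (grad u))\<^sup>2 = (\<Sum>j\<in>UNIV. (norm (D_weak \<Omega> j u))\<^sup>2)"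
  by (simp add: grad_def norm_Pair sum_3 add.assoc)

lemma inner_grad: "inner (grad u) (grad v) = stokes_form \<Omega> u v"
  by (simp add: grad_def stokes_form_def sum_3 add.assoc)

lemma grad_linear:
  assumes "u \<in> H1 \<Omega>" "v \<in> H1 \<Omega>"
  shows "grad (u + v) = grad u + grad v" "grad (u - v) = grad u - grad v" "grad (c *\<^sub>R u) = c *\<^sub>R grad u"
  using assms by (simp_all add: grad_def H1_add H1_diff H1_scaleR)

lemma grad_tendsto_iff: "((%n. grad (u n)) \<longlongrightarrow> (d1, d2, d3)) F \<longleftrightarrow>
   ((%n. D_weak \<Omega> 1 (u n)) \<longlongrightarrow> d1) F \<and> ((%n. D_weak \<Omega> 2 (u n)) \<longlongrightarrow> d2) F \<and> ((%n. D_weak \<Omega> 3 (u n)) \<longlongrightarrow> d3) F"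
proof
  assume *: "((%n. grad (u n)) \<longlongrightarrow> (d1, d2, d3)) F"
  from tendsto_fst[OF *] tendsto_fst[OF tendsto_snd[OF *]] tendsto_snd[OF tendsto_snd[OF *]]
  show "((%n. D_weak \<Omega> 1 (u n)) \<longlongrightarrow> d1) F \<and> ((%n. D_weak \<Omega> 2 (u n)) \<longlongrightarrow> d2) F \<and> ((%n. D_weak \<Omega> 3 (u n)) \<longlongrightarrow> d3) F"
    by (simp add: grad_def)
qed (auto simp: grad_def intro!: tendsto_Pair)

lemma H1_closed':
  assumes "\<And>n. u n \<in> H1 \<Omega>" "u \<longlonglongrightarrow> v" "(%n. grad (u n)) \<longlonglongrightarrow> g"
  shows "v \<in> H1 \<Omega>" "grad v = g"
proof -
  obtain d1 d2 d3 where g: "g = (d1, d2, d3)" by (cases g)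
  define d where "d j = (if j = 1 then d1 else if j = 2 then d2 else d3)" for j :: 3
  have "(%n. D_weak \<Omega> j (u n)) \<longlonglongrightarrow> d j" for j
    using assms(3) exhaust_3[of j] unfolding g grad_tendsto_iff d_def by auto
  from H1_closed[OF assms(1,2) this] show "v \<in> H1 \<Omega>" "grad v = g" by (simp_all add: grad_def g d_def)
qed

lemma H1_norm_eq: "(H1_norm \<Omega> u)\<^sup>2 = (norm u)\<^sup>2 + (norm (grad u))\<^sup>2"
  unfolding H1_norm_def norm_grad by (simp add: sum_nonneg)

section \<open>The form domain\<close>

abbreviation V :: "l2 set" where "V \<equiv> form_domain \<Omega>"

abbreviation H :: "l2 set" where "H \<equiv> L2_sigma \<Omega>"

lemma V_H1: "u \<in> V ==> u \<in> H1 \<Omega>"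
  by (simp add: form_domain_def)

lemma solenoidal_H1: "w \<in> solenoidal_tests \<Omega> ==> abs_l2 w \<in> H1 \<Omega>"
  by (auto simp: solenoidal_tests_def intro: test_H1)

lemma V_approx:
  assumes u: "u \<in> V"
  obtains w where "\<And>n. w n \<in> solenoidal_tests \<Omega>" "(%n. abs_l2 (w n)) \<longlonglongrightarrow> u" "(%n. grad (abs_l2 (w n))) \<longlonglongrightarrow> grad u"
proof -
  have "\<exists>w\<in>solenoidal_tests \<Omega>. H1_norm \<Omega> (u - abs_l2 w) < inverse (real (Suc n))" for n
    using u unfolding form_domain_def by simp
  then obtain w where w: "\<And>n. w n \<in> solenoidal_tests \<Omega>" "\<And>n. H1_norm \<Omega> (u - abs_l2 (w n)) < inverse (real (Suc n))"
    by metis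
  have H: "0 \<le> H1_norm \<Omega> v" for v by (simp add: H1_norm_def sum_nonneg)
  have le0: "norm (u - abs_l2 (w n)) \<le> H1_norm \<Omega> (u - abs_l2 (w n))" "norm (grad (u - abs_l2 (w n))) \<le> H1_norm \<Omega> (u - abs_l2 (w n))" for n
    by (rule power2_le_imp_le[OF _ H]; simp add: H1_norm_eq)+
  have le: "norm (abs_l2 (w n) - u) \<le> inverse (real (Suc n))" "norm (grad (abs_l2 (w n)) - grad u) \<le> inverse (real (Suc n))" for n
    using w(2)[of n] le0[of n] unfolding norm_minus_commute[of _ u] norm_minus_commute[of _ "grad u"]
      grad_linear(2)[OF V_H1[OF u] solenoidal_H1[OF w(1)]] by linarith+
  have "(%n. abs_l2 (w n)) \<longlonglongrightarrow> u" "(%n. grad (abs_l2 (w n))) \<longlonglongrightarrow> grad u"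
    by (rule LIM_zero_cancel, rule Lim_null_comparison[OF always_eventually LIMSEQ_inverse_real_of_nat], use le in blast)+
  with w(1) that show ?thesis by blast
qed

text \<open>Converse of \<open>V_approx\<close>: it is enough that the gradients of the test fields
  converge to some g, which closedness then identifies.\<close>

lemma V_limit:
  assumes w: "\<And>n. w n \<in> solenoidal_tests \<Omega>" "(%n. abs_l2 (w n)) \<longlonglongrightarrow> u" "(%n. grad (abs_l2 (w n))) \<longlonglongrightarrow> g"
  shows "u \<in> V" "grad u = g"
proof -
  note H = H1_closed'[OF solenoidal_H1[OF w(1)] w(2,3)]
  show "grad u = g" by (rule H(2))
  have "(%n. sqrt ((norm (u - abs_l2 (w n)))\<^sup>2 + (norm (g - grad (abs_l2 (w n))))\<^sup>2)) \<longlonglongrightarrow> sqrt ((norm (u - u))\<^sup>2 + (norm (g - g))\<^sup>2)"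
    by (intro tendsto_intros w)
  moreover have "sqrt ((norm (u - abs_l2 (w n)))\<^sup>2 + (norm (g - grad (abs_l2 (w n))))\<^sup>2) = H1_norm \<Omega> (u - abs_l2 (w n))" for n
    unfolding H1_norm_def norm_grad[symmetric] grad_linear(2)[OF H(1) solenoidal_H1[OF w(1)]] H(2) ..
  ultimately have lim: "(%n. H1_norm \<Omega> (u - abs_l2 (w n))) \<longlonglongrightarrow> 0" by simp
  have "\<exists>w\<in>solenoidal_tests \<Omega>. H1_norm \<Omega> (u - abs_l2 w) < e" if "e > 0" for e
    using order_tendstoD(2)[OF lim that] w(1) by (auto simp: eventually_sequentially)
  with H(1) show "u \<in> V" by (simp add: form_domain_def)
qed

lemma V_solenoidal: "w \<in> solenoidal_tests \<Omega> ==> abs_l2 w \<in> V"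
  using V_limit(1)[of "%n. w" "abs_l2 w" "grad (abs_l2 w)"] by simp

lemma subspace_V: "subspace V"
proof (rule subspaceI)
  show "0 \<in> V" using V_solenoidal[OF solenoidal_zero] by (simp add: zero_l2_def)
  fix u v c assume u: "u \<in> V"
  obtain w where w: "\<And>n. w n \<in> solenoidal_tests \<Omega>" "(%n. abs_l2 (w n)) \<longlonglongrightarrow> u" "(%n. grad (abs_l2 (w n))) \<longlonglongrightarrow> grad u"
    by (rule V_approx[OF u]) (rule that)
  have "abs_l2 (%x. c *\<^sub>R w n x) = c *\<^sub>R abs_l2 (w n)" for n by (simp add: abs_l2_scaleR solenoidal_sq_integrable[OF w(1)])
  then show "c *\<^sub>R u \<in> V"
    using tendsto_scaleR[OF tendsto_const w(2), of c] tendsto_scaleR[OF tendsto_const w(3), of c]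
    by (intro V_limit(1)[of "%n x. c *\<^sub>R w n x" _ "c *\<^sub>R grad u"] solenoidal_scaleR w(1))
      (simp_all add: grad_linear(3)[OF solenoidal_H1[OF w(1)] solenoidal_H1[OF w(1)]])
  assume v: "v \<in> V"
  obtain z where z: "\<And>n. z n \<in> solenoidal_tests \<Omega>" "(%n. abs_l2 (z n)) \<longlonglongrightarrow> v" "(%n. grad (abs_l2 (z n))) \<longlonglongrightarrow> grad v"
    by (rule V_approx[OF v]) (rule that)
  have "abs_l2 (%x. w n x + z n x) = abs_l2 (w n) + abs_l2 (z n)" for n
    by (simp add: abs_l2_add solenoidal_sq_integrable[OF w(1)] solenoidal_sq_integrable[OF z(1)])
  then show "u + v \<in> V"
    using tendsto_add[OF w(2) z(2)] tendsto_add[OF w(3) z(3)]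
    by (intro V_limit(1)[of "%n x. w n x + z n x" _ "grad u + grad v"] solenoidal_add w(1) z(1))
      (simp_all add: grad_linear(1)[OF solenoidal_H1[OF w(1)] solenoidal_H1[OF z(1)]])
qed

lemma V_L2_sigma: "V \<subseteq> H"
proof
  fix u assume "u \<in> V"
  then obtain w where w: "\<And>n. w n \<in> solenoidal_tests \<Omega>" "(%n. abs_l2 (w n)) \<longlonglongrightarrow> u" by (rule V_approx) (rule that)
  then show "u \<in> H" unfolding L2_sigma_def closure_sequential by (intro exI[of _ "%n. abs_l2 (w n)"]) auto
qed

lemma V_dense: "H \<subseteq> closure V"
  unfolding L2_sigma_def by (intro closure_mono) (auto intro: V_solenoidal)

lemma grad_solenoidal:
  "w \<in> solenoidal_tests \<Omega> ==> (norm (grad (abs_l2 w)))\<^sup>2 = (\<Sum>j\<in>UNIV. (norm (abs_l2 (partial_deriv j w)))\<^sup>2)"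
  by (simp add: norm_grad test_H1 solenoidal_tests_def)

lemma rep_abs_power:
  assumes "sq_integrable w"
  shows "(\<integral>\<^sup>+x. ennreal (norm (rep_l2 (abs_l2 w) x) ^ k) \<partial>lborel) = (\<integral>\<^sup>+x. ennreal (norm (w x) ^ k) \<partial>lborel)"
  by (rule nn_integral_cong_AE) (use rep_abs_l2[OF assms] in eventually_elim, simp)

text \<open>Test fields approximate u together with their gradients, and
  \<open>nn_integral_power_fatou\<close> carries the inequality to the limit.\<close>

lemma V_sobolev:
  assumes u: "u \<in> V"
  shows "(\<integral>\<^sup>+x. ennreal (norm (rep_l2 u x) ^ 6) \<partial>lborel) \<le> ennreal (4096 * norm (grad u) ^ 6)"
proof -
  obtain w where w: "\<And>n. w n \<in> solenoidal_tests \<Omega>" "(%n. abs_l2 (w n)) \<longlonglongrightarrow> u" "(%n. grad (abs_l2 (w n))) \<longlonglongrightarrow> grad u"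
    by (rule V_approx[OF u]) (rule that)
  show ?thesis
  proof (rule nn_integral_power_fatou[OF w(2)])
    show "(%n. 4096 * norm (grad (abs_l2 (w n))) ^ 6) \<longlonglongrightarrow> 4096 * norm (grad u) ^ 6"
      by (intro tendsto_intros w)
    fix n
    have "w n \<in> test_functions \<Omega>" using w(1) by (simp add: solenoidal_tests_def)
    from sobolev_test[OF this] show "(\<integral>\<^sup>+x. ennreal (norm (rep_l2 (abs_l2 (w n)) x) ^ 6) \<partial>lborel) \<le> ennreal (4096 * norm (grad (abs_l2 (w n))) ^ 6)"
      by (simp add: rep_abs_power solenoidal_sq_integrable[OF w(1)] flip: grad_solenoidal[OF w(1)] power_mult)
  qed
qed

text \<open>The elementary inequality \<open>t\<^sup>2 \<le> s\<^sup>2 + t\<^sup>6 / s\<^sup>4\<close> turns the Sobolev inequality into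
  the Poincare inequality on a set of finite measure.\<close>

lemma poincare:
  obtains C where "C > 0" "\<And>u. u \<in> V ==> norm u \<le> C * norm (grad u)"
proof -
  define m where "m = measure lborel \<Omega>"
  have fin: "emeasure lborel \<Omega> = ennreal m"
    unfolding m_def using emeasure_bounded_finite[OF bounded_\<Omega>] by (simp add: emeasure_eq_ennreal_measure)
  have m0: "0 \<le> m" by (simp add: m_def)
  have main: "(norm u)\<^sup>2 \<le> (m + 4096) * (norm (grad u))\<^sup>2" if u: "u \<in> V" for u
  proof (rule field_le_epsilon)
    fix e :: real assume e: "e > 0"
    define G where "G = (norm (grad u))\<^sup>2"
    \<comment> \<open>The added multiple of e keeps \<sigma> positive when the gradient vanishes and
      contributes exactly e after multiplication by m + 4096.\<close>
    define \<sigma> where "\<sigma> = G + e / (m + 4096)"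
    have G0: "0 \<le> G" by (simp add: G_def)
    have \<sigma>: "\<sigma> > 0" "G \<le> \<sigma>" using e m0 G0 by (auto simp: \<sigma>_def intro!: add_nonneg_pos)
    have u2: "AE x in lborel. x \<notin> \<Omega> \<longrightarrow> rep_l2 u x = 0" using V_H1[OF u] by (simp add: H1_def L2_on_def)
    have pw: "t\<^sup>2 \<le> \<sigma> + t ^ 6 / \<sigma>\<^sup>2" for t :: real
    proof (cases "t\<^sup>2 \<le> \<sigma>")
      case False
      then have "\<sigma>\<^sup>2 \<le> (t\<^sup>2)\<^sup>2" using \<sigma> by (intro power_mono) auto
      then have "t\<^sup>2 * \<sigma>\<^sup>2 \<le> t\<^sup>2 * (t\<^sup>2)\<^sup>2" by (intro mult_left_mono) auto
      also have "\<dots> = t ^ 6" by (simp flip: power_mult power_add)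
      finally have "t\<^sup>2 \<le> t ^ 6 / \<sigma>\<^sup>2" using \<sigma> by (simp add: field_simps)
      then show ?thesis using \<sigma> by simp
    qed (use \<sigma> in \<open>auto intro: add_increasing2\<close>)
    have meas: "rep_l2 u \<in> borel_measurable borel" by (rule sq_integrable_measurable[OF sq_integrable_rep_l2])
    have "ennreal ((norm u)\<^sup>2) = (\<integral>\<^sup>+x. ennreal ((norm (rep_l2 u x))\<^sup>2) \<partial>lborel)"
      using nn_integral_sq[OF sq_integrable_rep_l2] by (simp add: abs_rep_l2)
    also have "\<dots> \<le> (\<integral>\<^sup>+x. ennreal \<sigma> * indicator \<Omega> x + ennreal (1 / \<sigma>\<^sup>2) * ennreal (norm (rep_l2 u x) ^ 6) \<partial>lborel)"
    proof (rule nn_integral_mono_AE, use u2 in eventually_elim)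
      fix x assume x: "x \<notin> \<Omega> \<longrightarrow> rep_l2 u x = 0"
      show "ennreal ((norm (rep_l2 u x))\<^sup>2) \<le> ennreal \<sigma> * indicator \<Omega> x + ennreal (1 / \<sigma>\<^sup>2) * ennreal (norm (rep_l2 u x) ^ 6)"
      proof (cases "x \<in> \<Omega>")
        case True
        have "ennreal ((norm (rep_l2 u x))\<^sup>2) \<le> ennreal (\<sigma> + 1 / \<sigma>\<^sup>2 * norm (rep_l2 u x) ^ 6)"
          using pw[of "norm (rep_l2 u x)"] by (intro ennreal_leI) simp
        then show ?thesis using True \<sigma> by (simp add: ennreal_plus[symmetric] ennreal_mult[symmetric] del: ennreal_plus)
      qed (use x in simp)
    qed
    also have "\<dots> = ennreal \<sigma> * ennreal m + ennreal (1 / \<sigma>\<^sup>2) * (\<integral>\<^sup>+x. ennreal (norm (rep_l2 u x) ^ 6) \<partial>lborel)"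
      using borel_\<Omega> meas by (simp add: nn_integral_add nn_integral_cmult nn_integral_cmult_indicator fin)
    also have "\<dots> \<le> ennreal \<sigma> * ennreal m + ennreal (1 / \<sigma>\<^sup>2) * ennreal (4096 * norm (grad u) ^ 6)"
      by (intro add_mono mult_left_mono V_sobolev u order_refl) auto
    also have "\<dots> = ennreal (\<sigma> * m + 1 / \<sigma>\<^sup>2 * (4096 * norm (grad u) ^ 6))"
      using \<sigma> m0 by (simp add: ennreal_plus[symmetric] ennreal_mult[symmetric] del: ennreal_plus)
    finally have "(norm u)\<^sup>2 \<le> \<sigma> * m + 1 / \<sigma>\<^sup>2 * (4096 * norm (grad u) ^ 6)"
      using \<sigma> m0 by (subst (asm) ennreal_le_iff) (auto intro!: add_nonneg_nonneg)
    also have "1 / \<sigma>\<^sup>2 * (4096 * norm (grad u) ^ 6) \<le> 4096 * \<sigma>"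
    proof -
      have "norm (grad u) ^ 6 = G ^ 3" by (simp add: G_def flip: power_mult)
      also have "\<dots> \<le> \<sigma> ^ 3" using G0 \<sigma> by (intro power_mono) auto
      finally show ?thesis using \<sigma> by (simp add: field_simps power3_eq_cube power2_eq_square)
    qed
    finally have "(norm u)\<^sup>2 \<le> (m + 4096) * \<sigma>" by (simp add: algebra_simps)
    also have "\<dots> = (m + 4096) * (norm (grad u))\<^sup>2 + e" using m0 by (simp add: \<sigma>_def G_def distrib_left)
    finally show "(norm u)\<^sup>2 \<le> (m + 4096) * (norm (grad u))\<^sup>2 + e" .
  qed
  show ?thesis
  proof (rule that[of "sqrt (m + 4096)"])
    show "sqrt (m + 4096) > 0" using m0 by simp
    show "norm u \<le> sqrt (m + 4096) * norm (grad u)" if "u \<in> V" for u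
    proof (rule power2_le_imp_le)
      show "(norm u)\<^sup>2 \<le> (sqrt (m + 4096) * norm (grad u))\<^sup>2"
        using main[OF that] m0 by (simp add: power_mult_distrib)
      show "0 \<le> sqrt (m + 4096) * norm (grad u)" using m0 by simp
    qed
  qed
qed

end

section \<open>The inverse of the Stokes operator\<close>

context bounded_open_set
begin

text \<open>By the Poincare inequality, convergence of the gradients forces convergence of the
  fields; replacing each field by a nearby test field lets \<open>V_limit\<close> identify the
  limit.\<close>

lemma closed_grad_V: "closed (grad ` V)"
  unfolding closed_sequential_limits
proof (intro allI impI, elim conjE)
  fix g l assume g: "\<forall>n. g n \<in> grad ` V" and l: "g \<longlonglongrightarrow> l"
  obtain C where C: "C > 0" "\<And>u. u \<in> V ==> norm u \<le> C * norm (grad u)" by (rule poincare) (rule that)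
  from g have "\<forall>n. \<exists>u. u \<in> V \<and> g n = grad u" by blast
  from choice[OF this] obtain u where u: "\<And>n. u n \<in> V" "\<And>n. g n = grad (u n)" by blast
  have "Cauchy u"
  proof (rule CauchyI)
    fix e :: real assume e: "e > 0"
    have "Cauchy g" using l by (rule LIMSEQ_imp_Cauchy)
    from CauchyD[OF this, of "e / C"] e C obtain M where M: "\<And>m n. m \<ge> M ==> n \<ge> M ==> norm (g m - g n) < e / C" by auto
    have "norm (u m - u n) < e" if "m \<ge> M" "n \<ge> M" for m n
    proof -
      have "norm (u m - u n) \<le> C * norm (grad (u m - u n))" by (intro C subspace_diff subspace_V u)
      also have "\<dots> = C * norm (g m - g n)" by (simp add: grad_linear(2) V_H1 u)
      also have "\<dots> < C * (e / C)" using M[OF that] C by (intro mult_strict_left_mono) auto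
      finally show ?thesis using C by simp
    qed
    then show "\<exists>M. \<forall>m\<ge>M. \<forall>n\<ge>M. norm (u m - u n) < e" by blast
  qed
  then obtain v where v: "u \<longlonglongrightarrow> v" by (auto simp: Cauchy_convergent_iff convergent_def)
  have "\<exists>w\<in>solenoidal_tests \<Omega>. H1_norm \<Omega> (u n - abs_l2 w) < inverse (real (Suc n))" for n
    using u(1) unfolding form_domain_def by simp
  then obtain w where w: "\<And>n. w n \<in> solenoidal_tests \<Omega>" "\<And>n. H1_norm \<Omega> (u n - abs_l2 (w n)) < inverse (real (Suc n))"
    by metis
  have H: "0 \<le> H1_norm \<Omega> z" for z by (simp add: H1_norm_def sum_nonneg)
  have le0: "norm (u n - abs_l2 (w n)) \<le> H1_norm \<Omega> (u n - abs_l2 (w n))" "norm (grad (u n - abs_l2 (w n))) \<le> H1_norm \<Omega> (u n - abs_l2 (w n))" for n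
    by (rule power2_le_imp_le[OF _ H]; simp add: H1_norm_eq)+
  have le: "norm (abs_l2 (w n) - u n) \<le> inverse (real (Suc n))" "norm (grad (abs_l2 (w n)) - g n) \<le> inverse (real (Suc n))" for n
    using w(2)[of n] le0[of n] unfolding norm_minus_commute[of _ "u n"] norm_minus_commute[of _ "g n"]
      grad_linear(2)[OF V_H1[OF u(1)] solenoidal_H1[OF w(1)]] u(2)[symmetric] by linarith+
  have "(%n. abs_l2 (w n) - u n) \<longlonglongrightarrow> 0" "(%n. grad (abs_l2 (w n)) - g n) \<longlonglongrightarrow> 0"
    by (rule Lim_null_comparison[OF always_eventually LIMSEQ_inverse_real_of_nat], use le in blast)+
  from tendsto_add[OF this(1) v] tendsto_add[OF this(2) l]
  have "(%n. abs_l2 (w n)) \<longlonglongrightarrow> v" "(%n. grad (abs_l2 (w n))) \<longlonglongrightarrow> l" by simp_all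
  from V_limit[OF w(1) this] show "l \<in> grad ` V" by blast
qed

lemma subspace_grad_V: "subspace (grad ` V)"
proof (rule subspaceI)
  show "0 \<in> grad ` V" using grad_linear(3)[of 0 0 0] subspace_0[OF subspace_V] V_H1 by (intro image_eqI[of _ _ 0]) auto
  fix x y c assume "x \<in> grad ` V"
  then obtain u where u: "u \<in> V" "x = grad u" by blast
  show "c *\<^sub>R x \<in> grad ` V"
    using u subspace_scale[OF subspace_V u(1), of c] grad_linear(3)[OF V_H1[OF u(1)] V_H1[OF u(1)]] by (intro image_eqI[of _ _ "c *\<^sub>R u"]) auto
  assume "y \<in> grad ` V"
  then obtain v where v: "v \<in> V" "y = grad v" by blast
  show "x + y \<in> grad ` V"
    using u v subspace_add[OF subspace_V u(1) v(1)] grad_linear(1)[OF V_H1[OF u(1)] V_H1[OF v(1)]] by (intro image_eqI[of _ _ "u + v"]) auto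
qed

lemma grad_inj: "u \<in> V ==> v \<in> V ==> grad u = grad v ==> u = v"
proof -
  assume u: "u \<in> V" and v: "v \<in> V" and eq: "grad u = grad v"
  obtain C where C: "C > 0" "\<And>u. u \<in> V ==> norm u \<le> C * norm (grad u)" by (rule poincare) (rule that)
  have "norm (u - v) \<le> C * norm (grad (u - v))" by (intro C subspace_diff subspace_V u v)
  then show "u = v" using eq by (simp add: grad_linear(2) V_H1 u v)
qed

text \<open>Riesz representation in the closed space of gradients, where the Poincare inequality
  bounds the functional that sends grad v to inner g v.\<close>

lemma weak_solution_exists: "\<exists>u\<in>V. \<forall>v\<in>V. inner (grad u) (grad v) = inner g v"
proof -
  obtain C where C: "C > 0" "\<And>u. u \<in> V ==> norm u \<le> C * norm (grad u)" by (rule poincare) (rule that)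
  define E where "E = inv_into V grad"
  have inj: "inj_on grad V" using grad_inj by (auto simp: inj_on_def)
  have E: "E (grad u) = u" if "u \<in> V" for u unfolding E_def by (rule inv_into_f_f[OF inj that])
  have "\<exists>h\<in>grad ` V. \<forall>x\<in>grad ` V. inner g (E x) = inner h x"
  proof (rule riesz_representation[where C = "norm g * C"])
    show "closed (grad ` V)" "subspace (grad ` V)" by (rule closed_grad_V, rule subspace_grad_V)
    fix x y and c :: real assume "x \<in> grad ` V"
    then obtain u where u: "u \<in> V" "x = grad u" by blast
    show "inner g (E (c *\<^sub>R x)) = c * inner g (E x)"
      using u E[OF subspace_scale[OF subspace_V u(1)], of c] by (simp add: grad_linear(3)[OF V_H1 V_H1] E)
    show "\<bar>inner g (E x)\<bar> \<le> norm g * C * norm x"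
      using Cauchy_Schwarz_ineq2[of g u] mult_left_mono[OF C(2)[OF u(1)], of "norm g"] u by (simp add: E mult.assoc)
    assume "y \<in> grad ` V"
    then obtain v where v: "v \<in> V" "y = grad v" by blast
    show "inner g (E (x + y)) = inner g (E x) + inner g (E y)"
      using u v E[OF subspace_add[OF subspace_V u(1) v(1)]] by (simp add: grad_linear(1) V_H1 E inner_add_right)
  qed
  then obtain u where "u \<in> V" "\<forall>x\<in>grad ` V. inner g (E x) = inner (grad u) x" by blast
  then show ?thesis using E by (intro bexI[of _ u]) auto
qed

text \<open>This is A^(-1) on L^2_sigma. It is defined on all of \<open>l2\<close> and annihilates
  the orthogonal complement of L^2_sigma, because only the pairing of g with the form domain is
  seen.\<close>

definition solve :: "l2 => l2" where
  "solve g = (SOME u. u \<in> V \<and> (\<forall>v\<in>V. inner (grad u) (grad v) = inner g v))"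

lemma solve: "solve g \<in> V" "v \<in> V ==> inner (grad (solve g)) (grad v) = inner g v"
  using someI_ex[of "%u. u \<in> V \<and> (\<forall>v\<in>V. inner (grad u) (grad v) = inner g v)"] weak_solution_exists[of g]
  unfolding solve_def by blast+

lemma solveI: "u \<in> V ==> (\<And>v. v \<in> V ==> inner (grad u) (grad v) = inner g v) ==> solve g = u"
proof -
  assume u: "u \<in> V" "\<And>v. v \<in> V ==> inner (grad u) (grad v) = inner g v"
  have d: "solve g - u \<in> V" by (intro subspace_diff subspace_V solve u)
  have "inner (grad (solve g - u)) (grad (solve g - u)) = 0"
    using u(2)[OF d] solve(2)[OF d, of g] by (simp add: grad_linear(2) V_H1 u(1) solve(1) inner_diff_left)
  then have "grad (solve g) = grad u" by (simp add: grad_linear(2) V_H1 u(1) solve(1))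
  then show ?thesis by (rule grad_inj[OF solve(1) u(1)])
qed

lemma linear_solve: "linear solve"
proof (rule linearI)
  fix g h :: l2 and c :: real
  show "solve (g + h) = solve g + solve h"
    by (rule solveI) (auto simp: grad_linear(1) V_H1 solve subspace_add[OF subspace_V] inner_add_left)
  show "solve (c *\<^sub>R g) = c *\<^sub>R solve g"
    by (rule solveI) (auto simp: grad_linear(3)[OF V_H1 V_H1] solve subspace_scale[OF subspace_V])
qed

text \<open>A positive lower bound for the spectrum of A, not necessarily the best one, coming from
  the Poincare constant. Scaling A^(-1) by it puts the spectrum into [0,1].\<close>

definition gap :: real where
  "gap = (SOME d. 0 < d \<and> (\<forall>u\<in>V. d * (norm u)\<^sup>2 \<le> (norm (grad u))\<^sup>2))"

lemma gap: "0 < gap" "u \<in> V ==> gap * (norm u)\<^sup>2 \<le> (norm (grad u))\<^sup>2"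
proof -
  obtain C where C: "C > 0" "\<And>u. u \<in> V ==> norm u \<le> C * norm (grad u)" by (rule poincare) (rule that)
  have "(norm u)\<^sup>2 \<le> C\<^sup>2 * (norm (grad u))\<^sup>2" if "u \<in> V" for u
    using power_mono[OF C(2)[OF that] norm_ge_zero, of 2] by (simp add: power_mult_distrib)
  then have "0 < 1 / C\<^sup>2 \<and> (\<forall>u\<in>V. 1 / C\<^sup>2 * (norm u)\<^sup>2 \<le> (norm (grad u))\<^sup>2)"
    using C(1) by (auto simp: field_simps)
  from someI[of "%d. 0 < d \<and> (\<forall>u\<in>V. d * (norm u)\<^sup>2 \<le> (norm (grad u))\<^sup>2)", OF this]
  show "0 < gap" "u \<in> V ==> gap * (norm u)\<^sup>2 \<le> (norm (grad u))\<^sup>2" unfolding gap_def by blast+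
qed

lemma gap_nz: "gap \<noteq> 0" using gap(1) by simp

definition inv_op :: "l2 => l2" where "inv_op g = gap *\<^sub>R solve g"

lemma inner_solve: "inner (solve g) h = inner (grad (solve h)) (grad (solve g))"
  using solve(2)[OF solve(1)[of g], of h] by (simp add: inner_commute)

lemma positive_contraction_inv_op: "positive_contraction inv_op"
proof (rule positive_contraction.intro)
  show "linear inv_op" unfolding inv_op_def[abs_def] by (intro linear_compose_scale_right linear_solve)
  show "inner (inv_op g) h = inner g (inv_op h)" for g h
    using inner_solve[of g h] inner_solve[of h g] by (simp add: inv_op_def inner_commute)
  show "0 \<le> inner (inv_op g) g" for g
    using gap(1) by (simp add: inv_op_def inner_solve)
  show "inner (inv_op g) g \<le> inner g g" for g
  proof -
    \<comment> \<open>The square a^2 = inner (solve g) g is bounded by Cauchy-Schwarz, and the gap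
      inequality turns the norm of \<open>solve g\<close> back into a; dividing by a^2 leaves the
      bound by 1.\<close>
    define a where "a = norm (grad (solve g))"
    have aa: "a\<^sup>2 = inner (solve g) g" by (simp add: a_def inner_solve power2_norm_eq_inner)
    have "a\<^sup>2 \<le> norm (solve g) * norm g" unfolding aa by (rule norm_cauchy_schwarz)
    then have "(a\<^sup>2)\<^sup>2 \<le> (norm (solve g) * norm g)\<^sup>2" by (intro power_mono) auto
    then have "gap * (a\<^sup>2)\<^sup>2 \<le> (gap * (norm (solve g))\<^sup>2) * (norm g)\<^sup>2"
      using gap(1) by (simp add: power_mult_distrib mult.assoc)
    also have "\<dots> \<le> a\<^sup>2 * (norm g)\<^sup>2" using gap(2)[OF solve(1)] by (intro mult_right_mono) (auto simp: a_def)
    finally have "a\<^sup>2 * (gap * a\<^sup>2) \<le> a\<^sup>2 * (norm g)\<^sup>2" by (simp add: power2_eq_square ac_simps)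
    then have "gap * a\<^sup>2 \<le> (norm g)\<^sup>2" by (cases "a = 0") (auto simp: mult_le_cancel_left_pos)
    then show ?thesis by (simp add: inv_op_def aa power2_norm_eq_inner)
  qed
qed

sublocale fc: positive_contraction inv_op
  by (rule positive_contraction_inv_op)

lemma range_inv_op: "range inv_op = range solve"
proof -
  have "inv_op g = solve (gap *\<^sub>R g)" for g by (simp add: inv_op_def linear_scale[OF linear_solve])
  moreover have "solve g = inv_op ((1 / gap) *\<^sub>R g)" for g using gap_nz by (simp add: inv_op_def linear_scale[OF linear_solve])
  ultimately have "inv_op g \<in> range solve" "solve g \<in> range inv_op" for g by blast+
  then show ?thesis by blast
qed

text \<open>A component x - p of L^2_sigma orthogonal to the range of \<open>inv_op\<close> is
  orthogonal to its own solution, whose gradient therefore vanishes. So x - p annihilates the form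
  domain, which is dense in L^2_sigma.\<close>

lemma H_eq: "fc.H = H"
proof
  have "range inv_op \<subseteq> H" unfolding range_inv_op using solve(1) V_L2_sigma by blast
  then show "fc.H \<subseteq> H" unfolding fc.H_def by (intro closure_minimal closed_L2_sigma)
  show "H \<subseteq> fc.H"
  proof
    fix x assume x: "x \<in> H"
    obtain p where p: "p \<in> fc.H" "\<forall>y\<in>fc.H. inner (x - p) y = 0"
      using orthogonal_projection[OF fc.closed_H fc.subspace_H] by blast
    have xp: "x - p \<in> H" using x p \<open>fc.H \<subseteq> H\<close> by (intro subspace_diff subspace_L2_sigma) auto
    have "solve (x - p) \<in> fc.H" using fc.B_in_H[of "(1 / gap) *\<^sub>R (x - p)"] gap_nz by (simp add: inv_op_def linear_scale[OF linear_solve])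
    then have "inner (grad (solve (x - p))) (grad (solve (x - p))) = 0"
      using p(2) solve(2)[OF solve(1)[of "x - p"], of "x - p"] by simp
    then have "grad (solve (x - p)) = 0" by simp
    then have "inner (x - p) v = 0" if "v \<in> V" for v using solve(2)[OF that, of "x - p"] by simp
    then have "V \<subseteq> {v. inner (x - p) v = 0}" by blast
    then have "closure V \<subseteq> {v. inner (x - p) v = 0}"
      by (intro closure_minimal closed_Collect_eq continuous_intros)
    then have "inner (x - p) (x - p) = 0" using xp V_dense by blast
    then show "x \<in> fc.H" using p(1) by simp
  qed
qed

lemma stokes_form_solve: "v \<in> V ==> stokes_form \<Omega> (solve g) v = inner g v"
  using solve(2) by (simp add: inner_grad)

lemma stokes_solve:
  assumes g: "g \<in> H"
  shows "solve g \<in> stokes_domain \<Omega>" "stokes \<Omega> (solve g) = g"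
proof -
  show "solve g \<in> stokes_domain \<Omega>"
    using g solve(1) stokes_form_solve by (auto simp: stokes_domain_def)
  show "stokes \<Omega> (solve g) = g"
    unfolding stokes_def
  proof (rule the_equality)
    fix h assume h: "h \<in> H \<and> (\<forall>v\<in>V. stokes_form \<Omega> (solve g) v = inner h v)"
    have "V \<subseteq> {v. inner (g - h) v = 0}" using h stokes_form_solve[of _ g] by (auto simp: inner_diff_left)
    then have "closure V \<subseteq> {v. inner (g - h) v = 0}"
      by (intro closure_minimal closed_Collect_eq continuous_intros)
    moreover have "g - h \<in> H" using g h by (intro subspace_diff subspace_L2_sigma) auto
    ultimately have "inner (g - h) (g - h) = 0" using V_dense by blast
    then show "h = g" by simp
  qed (use g stokes_form_solve in auto)
qed

lemma stokes_domain_eq: "stokes_domain \<Omega> = solve ` H"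
proof
  show "stokes_domain \<Omega> \<subseteq> solve ` H"
  proof
    fix u assume "u \<in> stokes_domain \<Omega>"
    then obtain g where "u \<in> V" "g \<in> H" "\<forall>v\<in>V. stokes_form \<Omega> u v = inner g v"
      by (auto simp: stokes_domain_def)
    then show "u \<in> solve ` H" using solveI[of u g] by (auto simp: inner_grad)
  qed
qed (use stokes_solve in auto)

end

section \<open>The Stokes semigroup\<close>

locale c0_semigroup =
  fixes H :: "'a::banach set" and S :: "real => 'a => 'a"
  assumes sub: "subspace H" and closed: "closed H" and c0: "c0_semigroup_on H S"
begin

lemma S_H: "0 \<le> t ==> x \<in> H ==> S t x \<in> H"
  and S_add: "0 \<le> t ==> x \<in> H ==> y \<in> H ==> S t (x + y) = S t x + S t y"
  and S_scale: "0 \<le> t ==> x \<in> H ==> S t (c *\<^sub>R x) = c *\<^sub>R S t x"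
  and S_bounded: "0 \<le> t ==> \<exists>M. \<forall>x\<in>H. norm (S t x) \<le> M * norm x"
  and S_0: "x \<in> H ==> S 0 x = x"
  and S_semigroup: "0 \<le> s ==> 0 \<le> t ==> x \<in> H ==> S (s + t) x = S s (S t x)"
  and S_lim: "x \<in> H ==> ((%t. S t x) \<longlongrightarrow> x) (at_right 0)"
  using c0 unfolding c0_semigroup_on_def by blast+

lemma S_diff: "0 \<le> t ==> x \<in> H ==> y \<in> H ==> S t (x - y) = S t x - S t y"
  using S_add[of t x "(-1) *\<^sub>R y"] S_scale[of t y "-1"] subspace_scale[OF sub, of y "-1"] by simp

lemma S_near:
  assumes x: "x \<in> H" and e: "e > 0"
  shows "\<exists>d>0. \<forall>s. 0 \<le> s \<longrightarrow> s < d \<longrightarrow> dist (S s x) x < e"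
proof -
  have "\<forall>\<^sub>F s in at_right 0. dist (S s x) x < e" using S_lim[OF x] e by (rule tendstoD)
  then obtain d where d: "d > 0" "\<And>s. 0 < s ==> s < d ==> dist (S s x) x < e"
    by (auto simp: eventually_at_right[OF zero_less_one])
  have "dist (S s x) x < e" if "0 \<le> s" "s < d" for s
    using d(2)[of s] that e S_0[OF x] by (cases "s = 0") auto
  with d(1) show ?thesis by blast
qed

lemma S_continuous:
  assumes t: "0 \<le> t" and g: "(g \<longlongrightarrow> x) F" "\<forall>\<^sub>F i in F. g i \<in> H" and x: "x \<in> H"
  shows "((%i. S t (g i)) \<longlongrightarrow> S t x) F"
proof -
  obtain M where M: "\<forall>x\<in>H. norm (S t x) \<le> M * norm x" using S_bounded[OF t] by blast
  have "\<forall>\<^sub>F i in F. norm (S t (g i) - S t x) \<le> M * norm (g i - x)"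
    using g(2) by eventually_elim (use M t x subspace_diff[OF sub] in \<open>simp flip: S_diff\<close>)
  moreover have "((%i. M * norm (g i - x)) \<longlongrightarrow> 0) F" using LIM_zero[OF g(1)] by (intro tendsto_mult_right_zero tendsto_norm_zero)
  ultimately show ?thesis by (rule LIM_zero_cancel[OF Lim_null_comparison])
qed

text \<open>Given are boundedness of each single operator and strong continuity at 0. The closed
  sets of x whose orbit has norm at most k on the times [0, 1/(k+1)] exhaust \<open>H\<close>, so by
  Baire's theorem one of them contains a relative ball, and differences with its centre give a
  uniform bound.\<close>

lemma locally_bounded_0:
  obtains \<tau> M where "0 < \<tau>" "0 \<le> M" "\<And>t x. 0 \<le> t ==> t \<le> \<tau> ==> x \<in> H ==> norm (S t x) \<le> M * norm x"
proof -
  define A where "A k = {x \<in> H. \<forall>t\<in>{0..inverse (real (Suc k))}. norm (S t x) \<le> real k}" for k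
  have closed_A: "closed (A k)" for k
    unfolding closed_sequential_limits
  proof (intro allI impI, elim conjE)
    fix x l assume x: "\<forall>n. x n \<in> A k" "x \<longlonglongrightarrow> l"
    have l: "l \<in> H" using closed_sequentially[OF closed _ x(2)] x(1) by (auto simp: A_def)
    have "norm (S t l) \<le> real k" if "t \<in> {0..inverse (real (Suc k))}" for t
      by (rule LIMSEQ_le_const2[OF tendsto_norm[OF S_continuous[OF _ x(2) _ l]]]) (use x(1) that in \<open>auto simp: A_def\<close>)
    with l show "l \<in> A k" by (simp add: A_def)
  qed
  have cover: "\<Union>(range A) = H"
  proof (intro equalityI subsetI)
    fix x assume x: "x \<in> H"
    obtain d where d: "d > 0" "\<And>s. 0 \<le> s ==> s < d ==> dist (S s x) x < 1" using S_near[OF x zero_less_one] by blast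
    obtain k where k: "max (norm x + 1) (1 / d) < real k" using reals_Archimedean2 by blast
    have "inverse (real (Suc k)) < d" using k d(1) by (simp add: field_simps)
    then have "norm (S t x) \<le> real k" if "t \<in> {0..inverse (real (Suc k))}" for t
      using d(2)[of t] that k norm_triangle_ineq2[of "S t x" x] by (simp add: dist_norm)
    then have "x \<in> A k" using x by (simp add: A_def)
    then show "x \<in> \<Union>(range A)" by blast
  qed (auto simp: A_def)
  have "\<exists>k. top_of_set H interior_of A k \<noteq> {}"
  proof (rule ccontr)
    assume "\<not> ?thesis"
    then have "top_of_set H interior_of \<Union>(range A) = {}"
      using completely_metrizable_space_closedin[OF completely_metrizable_space_euclidean, of H] closed closed_A
      by (intro Baire_category_alt) (auto simp: A_def intro!: closed_subset)
    then show False using cover subspace_0[OF sub] by (simp add: interior_of_topspace[of "top_of_set H", simplified])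
  qed
  then obtain k x0 where x0: "x0 \<in> top_of_set H interior_of A k" by blast
  then obtain U where U: "openin (top_of_set H) U" "x0 \<in> U" "U \<subseteq> A k" unfolding interior_of_def by blast
  then obtain r where "r > 0" "ball x0 r \<inter> H \<subseteq> U" unfolding openin_contains_ball by blast
  then have r: "r > 0" "ball x0 r \<inter> H \<subseteq> A k" and x0A: "x0 \<in> A k" using U by auto
  show ?thesis
  proof (rule that[of "inverse (real (Suc k))" "4 * real k / r"])
    fix t x assume t: "0 \<le> t" "t \<le> inverse (real (Suc k))" and x: "x \<in> H"
    show "norm (S t x) \<le> 4 * real k / r * norm x"
    proof (cases "x = 0")
      case False
      define s where "s = r / (2 * norm x)"
      have s: "s > 0" using r False by (simp add: s_def)
      have H: "x0 \<in> H" "s *\<^sub>R x \<in> H" using x0A x by (auto simp: A_def subspace_scale[OF sub])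
      have "x0 + s *\<^sub>R x \<in> A k" using r False H by (auto intro!: subsetD[OF r(2)] subspace_add[OF sub] simp: dist_norm s_def)
      then have "norm (S t (x0 + s *\<^sub>R x)) \<le> k" "norm (S t x0) \<le> k" using x0A t by (auto simp: A_def)
      moreover have "S t (x0 + s *\<^sub>R x) = S t x0 + s *\<^sub>R S t x" using S_scale[OF t(1) x] S_add[OF t(1) H] by simp
      ultimately have "norm (s *\<^sub>R S t x) \<le> 2 * real k" using norm_triangle_ineq4[of "S t x0 + s *\<^sub>R S t x" "S t x0"] by simp
      then show ?thesis using s r False by (simp add: s_def field_simps)
    qed (use S_scale[of t 0 0] t x in simp)
  qed (use r in auto)
qed

text \<open>Every time near t is one fixed time plus a remainder of length at most \<tau>, which the
  bound near 0 covers.\<close>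

lemma locally_bounded:
  assumes t: "0 \<le> t"
  obtains M d where "0 < d" "\<And>s x. 0 \<le> s ==> \<bar>s - t\<bar> < d ==> x \<in> H ==> norm (S s x) \<le> M * norm x"
proof -
  obtain \<tau> M where \<tau>: "0 < \<tau>" "0 \<le> M" and M: "\<And>t x. 0 \<le> t ==> t \<le> \<tau> ==> x \<in> H ==> norm (S t x) \<le> M * norm x"
    by (rule locally_bounded_0) blast
  let ?s = "max 0 (t - \<tau> / 2)"
  obtain N where N: "\<forall>x\<in>H. norm (S ?s x) \<le> N * norm x" using S_bounded[of ?s] by auto
  show ?thesis
  proof (rule that[of "\<tau> / 2" "M * N"])
    fix s x assume s: "0 \<le> s" "\<bar>s - t\<bar> < \<tau> / 2" and x: "x \<in> H"
    then have "s - t < \<tau> / 2" "t - s < \<tau> / 2" by linarith+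
    then have *: "0 \<le> s - ?s" "s - ?s \<le> \<tau>" using s(1) by (auto simp: max_def)
    have "norm (S s x) \<le> M * norm (S ?s x)"
      using S_semigroup[OF *(1), of ?s x] M[OF * S_H[of ?s x]] x by simp
    also have "\<dots> \<le> M * (N * norm x)" using N x \<tau> by (intro mult_left_mono) auto
    finally show "norm (S s x) \<le> M * N * norm x" by simp
  qed (use \<tau> in simp)
qed

text \<open>With the smaller of two times in front, S(s)x - S(t)x is, up to sign, an operator
  applied to S(|s-t|)x - x. The local bound thus reduces joint continuity to strong continuity at
  0.\<close>

lemma joint_tendsto:
  assumes f: "(f \<longlongrightarrow> t) F" "\<forall>\<^sub>F i in F. 0 \<le> f i" and t: "0 \<le> t" and g: "(g \<longlongrightarrow> x) F" "\<forall>\<^sub>F i in F. g i \<in> H" and x: "x \<in> H"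
  shows "((%i. S (f i) (g i)) \<longlongrightarrow> S t x) F"
proof (rule LIM_zero_cancel)
  obtain M a where a: "0 < a" and M: "\<And>s y. 0 \<le> s ==> \<bar>s - t\<bar> < a ==> y \<in> H ==> norm (S s y) \<le> M * norm y"
    using t by (rule locally_bounded) blast
  have abs0: "filterlim (%i. \<bar>f i - t\<bar>) (nhds 0) F" using tendsto_rabs[OF LIM_zero[OF f(1)]] by simp
  have f1: "\<forall>\<^sub>F i in F. \<bar>f i - t\<bar> < a" using abs0 a by (rule order_tendstoD)
  have Sx: "((%i. S \<bar>f i - t\<bar> x) \<longlongrightarrow> x) F"
  proof (rule tendstoI)
    fix e :: real assume "e > 0"
    then obtain d where d: "d > 0" "\<And>s. 0 \<le> s ==> s < d ==> dist (S s x) x < e" using S_near[OF x] by blast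
    have "\<forall>\<^sub>F i in F. \<bar>f i - t\<bar> < d" using abs0 d(1) by (rule order_tendstoD)
    then show "\<forall>\<^sub>F i in F. dist (S \<bar>f i - t\<bar> x) x < e" by eventually_elim (simp add: d)
  qed
  have est: "\<forall>\<^sub>F i in F. norm (S (f i) (g i) - S t x) \<le> M * norm (g i - x) + M * norm (S \<bar>f i - t\<bar> x - x)"
    using f1 f(2) g(2)
  proof eventually_elim
    fix i assume i: "\<bar>f i - t\<bar> < a" "0 \<le> f i" "g i \<in> H"
    have "S (f i) (g i) - S t x = S (f i) (g i - x) + (S (f i) x - S t x)" using i x by (simp add: S_diff)
    also have "norm \<dots> \<le> norm (S (f i) (g i - x)) + norm (S (f i) x - S t x)" by (rule norm_triangle_ineq)
    also have "norm (S (f i) (g i - x)) \<le> M * norm (g i - x)" using i x by (intro M subspace_diff[OF sub]) auto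
    also have "norm (S (f i) x - S t x) \<le> M * norm (S \<bar>f i - t\<bar> x - x)"
    proof (cases "f i \<ge> t")
      case True
      then have "S (f i) x - S t x = S t (S (f i - t) x - x)"
        using S_semigroup[of t "f i - t" x] t x by (simp add: S_diff S_H)
      then show ?thesis using True t x a by (auto intro!: M subspace_diff[OF sub] S_H)
    next
      case False
      then have "S t x - S (f i) x = S (f i) (S (t - f i) x - x)"
        using S_semigroup[of "f i" "t - f i" x] i x by (simp add: S_diff S_H)
      then have "norm (S (f i) x - S t x) = norm (S (f i) (S (t - f i) x - x))" by (metis norm_minus_commute)
      then show ?thesis using False i x by (auto intro!: M subspace_diff[OF sub] S_H)
    qed
    finally show "norm (S (f i) (g i) - S t x) \<le> M * norm (g i - x) + M * norm (S \<bar>f i - t\<bar> x - x)" by simp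
  qed
  have "((%i. M * norm (g i - x) + M * norm (S \<bar>f i - t\<bar> x - x)) \<longlongrightarrow> M * norm (x - x) + M * norm (x - x)) F"
    by (intro tendsto_intros g Sx)
  then show "((%i. S (f i) (g i) - S t x) \<longlongrightarrow> 0) F"
    by (intro Lim_null_comparison[OF est]) simp
qed

lemma generator_H: "(x, y) \<in> generator_on H S ==> x \<in> H"
  by (simp add: generator_on_def)

lemma generator_invariant:
  assumes xy: "(x, y) \<in> generator_on H S" and y: "y \<in> H" and t: "0 \<le> t"
  shows "(S t x, S t y) \<in> generator_on H S"
proof -
  have x: "x \<in> H" by (rule generator_H[OF xy])
  have "((%h. S t ((1 / h) *\<^sub>R (S h x - x))) \<longlongrightarrow> S t y) (at_right 0)"
    using xy by (intro S_continuous t y) (auto simp: generator_on_def x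
        intro!: eventually_at_rightI[of 0 1] subspace_scale[OF sub] subspace_diff[OF sub] S_H)
  moreover have "\<forall>\<^sub>F h in at_right 0. S t ((1 / h) *\<^sub>R (S h x - x)) = (1 / h) *\<^sub>R (S h (S t x) - S t x)"
  proof (rule eventually_at_rightI[of 0 1])
    fix h :: real assume h: "h \<in> {0<..<1}"
    have "S t (S h x) = S h (S t x)" using S_semigroup[of t h x] S_semigroup[of h t x] h t x by (simp add: add.commute)
    then show "S t ((1 / h) *\<^sub>R (S h x - x)) = (1 / h) *\<^sub>R (S h (S t x) - S t x)"
      using h t x by (simp add: S_scale S_diff S_H subspace_diff[OF sub])
  qed simp
  ultimately have "((%h. (1 / h) *\<^sub>R (S h (S t x) - S t x)) \<longlongrightarrow> S t y) (at_right 0)"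
    by (rule Lim_transform_eventually)
  then show ?thesis using x t by (simp add: generator_on_def S_H)
qed

text \<open>The right-hand limit that defines the generator gives the derivative from both sides,
  because the difference quotient between s and t is S(min s t) applied to the quotient at 0 of
  length |s - t|.\<close>

lemma orbit_derivative:
  assumes xy: "(x, y) \<in> generator_on H S" and y: "y \<in> H" and t: "0 \<le> t"
  shows "((%s. S s x) has_vector_derivative S t y) (at t within {0..})"
  unfolding has_vector_derivative_def has_derivative_within
proof (intro conjI bounded_linear_scaleR_left)
  have x: "x \<in> H" by (rule generator_H[OF xy])
  let ?F = "at t within {0..}" and ?q = "%h. (1 / h) *\<^sub>R (S h x - x)"
  have m: "((%s. min s t) \<longlongrightarrow> t) ?F" using tendsto_min[OF tendsto_ident_at[of t "{0..}"] tendsto_const[of t]] by simp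
  have h: "filterlim (%s. \<bar>s - t\<bar>) (at_right 0) ?F"
    unfolding filterlim_at
  proof
    have "((%s. \<bar>s - t\<bar>) \<longlongrightarrow> \<bar>t - t\<bar>) ?F" by (intro tendsto_intros)
    then show "((%s. \<bar>s - t\<bar>) \<longlongrightarrow> 0) ?F" by simp
    show "\<forall>\<^sub>F s in ?F. \<bar>s - t\<bar> \<in> {0<..} \<and> \<bar>s - t\<bar> \<noteq> 0" by (auto simp: eventually_at_filter)
  qed
  have gen: "(?q \<longlongrightarrow> y) (at_right 0)" using xy by (simp add: generator_on_def)
  have "((%s. S (min s t) (?q \<bar>s - t\<bar>)) \<longlongrightarrow> S t y) ?F"
    using t x by (intro joint_tendsto m t y filterlim_compose[OF gen h])
      (auto simp: eventually_at_filter intro!: always_eventually subspace_scale[OF sub] subspace_diff[OF sub] S_H)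
  then have lim: "((%s. norm (S (min s t) (?q \<bar>s - t\<bar>) - S t y)) \<longlongrightarrow> 0) ?F" by (intro tendsto_norm_zero LIM_zero)
  have eq: "S s x - S t x = (s - t) *\<^sub>R S (min s t) (?q \<bar>s - t\<bar>)" if "s \<noteq> t" "0 \<le> s" for s
  proof (cases "s > t")
    case True
    then show ?thesis using S_semigroup[of t "s - t" x] t x
      by (simp add: S_scale S_diff S_H subspace_diff[OF sub] min_absorb2)
  next
    case False
    then have "S t x - S s x = (t - s) *\<^sub>R S (min s t) (?q \<bar>s - t\<bar>)"
      using that S_semigroup[of s "t - s" x] x by (simp add: S_scale S_diff S_H subspace_diff[OF sub] min_absorb1)
    moreover have "(s - t) *\<^sub>R v = - ((t - s) *\<^sub>R v)" for v :: 'a by (simp flip: scaleR_minus_left)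
    ultimately show ?thesis by (simp add: minus_diff_eq[of "S t x", symmetric] del: minus_diff_eq)
  qed
  show "((%s. (1 / norm (s - t)) *\<^sub>R (S s x - (S t x + (s - t) *\<^sub>R S t y))) \<longlongrightarrow> 0) ?F"
  proof (rule Lim_null_comparison[OF _ lim])
    have "norm ((1 / norm (s - t)) *\<^sub>R (S s x - (S t x + (s - t) *\<^sub>R S t y))) \<le> norm (S (min s t) (?q \<bar>s - t\<bar>) - S t y)"
      if "s \<noteq> t" "0 \<le> s" for s
      unfolding diff_diff_eq[symmetric] eq[OF that] scaleR_diff_right[symmetric] using that by simp
    then show "\<forall>\<^sub>F s in ?F. norm ((1 / norm (s - t)) *\<^sub>R (S s x - (S t x + (s - t) *\<^sub>R S t y))) \<le> norm (S (min s t) (?q \<bar>s - t\<bar>) - S t y)"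
      by (simp add: eventually_at_filter)
  qed
qed

end

section \<open>The semigroup as a function of the contraction\<close>

context positive_contraction
begin

text \<open>The symbol is exp(-t d / k), so d = \<open>gap\<close> gives exp(-tA). Time 0 is
  separate because \<open>flat 1 0\<close> jumps at k = 0.\<close>

definition semi :: "real => real => 'a => 'a" where
  "semi d t x = (if t = 0 then x else Phi (flat 1 (t * d)) x)"

lemma flat_continuous: "c > 0 ==> continuous_on A (flat p c)"
  using flat_has_derivative by (auto intro!: continuous_at_imp_continuous_on DERIV_isCont)

lemma flat_1_bounds: "c \<ge> 0 ==> \<bar>flat 1 c k\<bar> \<le> 1"
  by (simp add: flat_def)

lemma flat_1_near:
  assumes "0 < k" "0 \<le> c"
  shows "\<bar>flat 1 c k - 1\<bar> \<le> c / k"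
proof -
  have "1 + - (c / k) \<le> exp (- (c / k))" by (rule exp_ge_add_one_self)
  moreover have "exp (- (c / k)) \<le> 1" using assms by simp
  ultimately show ?thesis using assms by (simp add: flat_def)
qed

text \<open>Near k = 0 the symbols do not tend to 1 uniformly, but k |exp(-td/k) - 1| \<le> t d,
  which is the weighted convergence that \<open>Phi_tendsto\<close> asks for.\<close>

lemma semi_c0:
  assumes d: "d > 0"
  shows "c0_semigroup_on H (semi d)"
proof -
  have fc: "continuous_on {0..1} (flat 1 (t * d))" if "t > 0" for t using flat_continuous that d by simp
  have fb: "norm (Phi (flat 1 (t * d)) x) \<le> 1 * norm x" if "t > 0" for t x
    by (rule norm_Phi_le[OF fc[OF that]]) (use that d flat_1_bounds in auto)
  have sg: "semi d (s + t) x = semi d s (semi d t x)" if st: "0 \<le> s" "0 \<le> t" for s t x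
  proof (cases "s = 0 \<or> t = 0")
    case False
    then have p: "s > 0" "t > 0" using st by auto
    have "Phi (flat 1 ((s + t) * d)) x = Phi (%k. flat 1 (s * d) k * flat 1 (t * d) k) x"
      by (rule Phi_cong) (simp add: flat_def ring_distribs add_divide_distrib flip: exp_add)
    then show ?thesis using p by (simp add: semi_def Phi_mult[OF fc[OF p(1)] fc[OF p(2)]])
  qed (auto simp: semi_def)
  have lim: "((%t. semi d t x) \<longlongrightarrow> x) (at_right 0)" if x: "x \<in> H" for x
  proof -
    have "((%t. Phi (flat 1 (t * d)) x) \<longlongrightarrow> Phi (%k. 1) x) (at_right 0)"
    proof (rule Phi_tendsto[OF x, where c = 1 and e = "%t. t * d"])
      show "\<forall>\<^sub>F t in at_right 0. continuous_on {0..1} (flat 1 (t * d)) \<and> (\<forall>k\<in>{0..1}. \<bar>flat 1 (t * d) k\<bar> \<le> 1 \<and> k * \<bar>flat 1 (t * d) k - 1\<bar> \<le> t * d)"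
      proof (rule eventually_at_rightI[of 0 1], intro conjI ballI)
        fix t :: real assume t: "t \<in> {0<..<1}"
        show "continuous_on {0..1} (flat 1 (t * d))" using fc t by simp
        fix k :: real assume k: "k \<in> {0..1}"
        show "\<bar>flat 1 (t * d) k\<bar> \<le> 1" using flat_1_bounds t d by simp
        show "k * \<bar>flat 1 (t * d) k - 1\<bar> \<le> t * d"
        proof (cases "k = 0")
          case False
          then have k0: "k > 0" using k by simp
          then show ?thesis using flat_1_near[OF k0, of "t * d"] t d by (simp add: field_simps)
        qed (use t d in simp)
      qed simp
      show "((%t. t * d) \<longlongrightarrow> 0) (at_right 0)" by (auto intro!: tendsto_eq_intros)
    qed (intro continuous_intros)
    moreover have "\<forall>\<^sub>F t in at_right 0. Phi (flat 1 (t * d)) x = semi d t x"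
      by (rule eventually_at_rightI[of 0 1]) (auto simp: semi_def)
    ultimately show ?thesis unfolding Phi_1 by (rule Lim_transform_eventually)
  qed
  show ?thesis
    unfolding c0_semigroup_on_def
  proof (intro conjI allI impI ballI)
    fix t :: real and x y :: 'a and c :: real assume t: "0 \<le> t"
    show "semi d t x \<in> H" if "x \<in> H" using that t fc by (auto simp: semi_def intro: Phi_in_H)
    show "semi d t (x + y) = semi d t x + semi d t y"
      using t fc by (auto simp: semi_def linear_add[OF Phi_linear])
    show "semi d t (c *\<^sub>R x) = c *\<^sub>R semi d t x"
      using t fc by (auto simp: semi_def linear_scale[OF Phi_linear])
    show "\<exists>M. \<forall>x\<in>H. norm (semi d t x) \<le> M * norm x"
      using t fb by (intro exI[of _ 1]) (auto simp: semi_def)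
  qed (use sg lim in \<open>auto simp: semi_def\<close>)
qed

text \<open>On \<open>B g\<close> the difference quotient has the symbol (exp(-td/k) - 1) k / t,
  which tends to -d in the weighted sense. Conversely, the quotient at x is hit with
  \<open>B\<close>, which commutes with the semigroup; comparing the two limits shows that x is
  \<open>B\<close> of an element of \<open>H\<close>.\<close>

lemma semi_generator:
  assumes d: "d > 0"
  shows "generator_on H (semi d) = (%g. (B g, - (d *\<^sub>R g))) ` H"
proof -
  have fc: "continuous_on {0..1} (flat 1 (t * d))" if "t > 0" for t using flat_continuous that d by simp
  let ?f = "%t k. (flat 1 (t * d) k - 1) * k / t"
  have B_gen: "((%t. (1 / t) *\<^sub>R (semi d t (B g) - B g)) \<longlongrightarrow> - (d *\<^sub>R g)) (at_right 0)" if g: "g \<in> H" for g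
  proof -
  have "((%t. Phi (?f t) g) \<longlongrightarrow> Phi (%k. - d) g) (at_right 0)"
  proof (rule Phi_tendsto[OF g, where c = d and e = "%t. d * (t * d)"])
    show "\<forall>\<^sub>F t in at_right 0. continuous_on {0..1} (?f t) \<and> (\<forall>k\<in>{0..1}. \<bar>?f t k\<bar> \<le> d \<and> k * \<bar>?f t k - - d\<bar> \<le> d * (t * d))"
    proof (rule eventually_at_rightI[of 0 1], intro conjI ballI)
      fix t :: real assume t: "t \<in> {0<..<1}"
      show "continuous_on {0..1} (?f t)" using fc t by (intro continuous_intros) auto
      fix k :: real assume k: "k \<in> {0..1}"
      show "\<bar>?f t k\<bar> \<le> d"
      proof (cases "k = 0")
        case False
        then have k0: "k > 0" using k by simp
        have "\<bar>flat 1 (t * d) k - 1\<bar> * (k / t) \<le> t * d / k * (k / t)"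
          using k0 t d by (intro mult_right_mono flat_1_near) auto
        then show ?thesis using k0 t by (simp add: abs_mult)
      qed (use d in simp)
      show "k * \<bar>?f t k - - d\<bar> \<le> d * (t * d)"
      proof (cases "k = 0")
        case False
        then have k0: "k > 0" using k by simp
        define z where "z = t * d / k"
        have z: "z > 0" using t d k0 by (simp add: z_def)
        have "1 + - z \<le> exp (- z)" by (rule exp_ge_add_one_self)
        moreover have "exp (- z) \<le> 1 - z + z * z"
        proof -
          have "exp (- z) \<le> 1 / (1 + z)"
            using exp_ge_add_one_self[of z] z by (simp add: exp_minus field_simps)
          also have "\<dots> \<le> 1 - z + z * z" using z by (simp add: field_simps)
          finally show ?thesis .
        qed
        ultimately have "\<bar>exp (- z) - 1 + z\<bar> \<le> z * z" by linarith
        moreover have "?f t k - - d = (exp (- z) - 1 + z) * (k / t)"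
          using k0 t by (simp add: flat_def z_def field_simps)
        ultimately have "\<bar>?f t k - - d\<bar> \<le> z * z * (k / t)"
          using k0 t by (simp only: abs_mult) (intro mult_mono, auto)
        also have "\<dots> = z * d" using k0 t by (simp add: z_def)
        finally have "k * \<bar>?f t k - - d\<bar> \<le> k * (z * d)" using k0 by (intro mult_left_mono) auto
        also have "\<dots> = d * (t * d)" using k0 by (simp add: z_def)
        finally show ?thesis .
      qed (use t d in simp)
    qed simp
    show "((%t. d * (t * d)) \<longlongrightarrow> 0) (at_right 0)" by (auto intro!: tendsto_eq_intros)
  qed (intro continuous_intros)
  moreover have "\<forall>\<^sub>F t in at_right 0. Phi (?f t) g = (1 / t) *\<^sub>R (semi d t (B g) - B g)"
  proof (rule eventually_at_rightI[of 0 1])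
    fix t :: real assume t: "t \<in> {0<..<1}"
    have c: "continuous_on {0..1} (%k. flat 1 (t * d) k - 1)" "continuous_on {0..1} (%k::real. k)"
      using fc t by (auto intro!: continuous_intros)
    have "Phi (?f t) g = Phi (%k. (1 / t) * ((flat 1 (t * d) k - 1) * k)) g" by (rule Phi_cong) simp
    also have "\<dots> = (1 / t) *\<^sub>R Phi (%k. flat 1 (t * d) k - 1) (B g)"
      by (subst Phi_scale, intro continuous_intros c, subst Phi_mult[OF c]) (simp add: Phi_ident)
    also have "Phi (%k. flat 1 (t * d) k - 1) (B g) = Phi (flat 1 (t * d)) (B g) - B g"
      using fc t by (subst Phi_diff) (auto intro!: continuous_intros simp: Phi_1)
    finally show "Phi (?f t) g = (1 / t) *\<^sub>R (semi d t (B g) - B g)" using t by (simp add: semi_def)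
  qed simp
  moreover have "Phi (%k. - d) g = - (d *\<^sub>R g)"
    using Phi_scale[of "%k. 1" "- d" g] by (simp add: Phi_1)
  ultimately have "((%t. (1 / t) *\<^sub>R (semi d t (B g) - B g)) \<longlongrightarrow> - (d *\<^sub>R g)) (at_right 0)"
    by (auto intro: Lim_transform_eventually)
  then show ?thesis .
  qed
  have Bb: "bounded_linear B" using Phi_bounded_linear[of "%t. t"] by (simp add: Phi_ident[abs_def] continuous_on_id)
  have comm: "B (semi d t x) = semi d t (B x)" if "0 \<le> t" for t x
    using Phi_commute[OF continuous_on_id fc, of t x] that by (auto simp: semi_def Phi_ident)
  show ?thesis
  proof (intro equalityI subsetI)
    fix p assume "p \<in> (%g. (B g, - (d *\<^sub>R g))) ` H"
    then show "p \<in> generator_on H (semi d)" using B_gen by (auto simp: generator_on_def B_in_H)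
  next
    fix p assume "p \<in> generator_on H (semi d)"
    then obtain x y where p: "p = (x, y)" "x \<in> H" and lim: "((%t. (1 / t) *\<^sub>R (semi d t x - x)) \<longlongrightarrow> y) (at_right 0)"
      by (auto simp: generator_on_def)
    have "\<forall>\<^sub>F t in at_right 0. (1 / t) *\<^sub>R (semi d t x - x) \<in> H"
      by (rule eventually_at_rightI[of 0 1])
        (auto simp: semi_def p intro!: subspace_scale[OF subspace_H] subspace_diff[OF subspace_H] Phi_in_H fc)
    then have y: "y \<in> H" using lim by (intro Lim_in_closed_set[OF closed_H]) auto
    have "((%t. B ((1 / t) *\<^sub>R (semi d t x - x))) \<longlongrightarrow> B y) (at_right 0)"
      by (rule bounded_linear.tendsto[OF Bb lim])
    moreover have "\<forall>\<^sub>F t in at_right 0. B ((1 / t) *\<^sub>R (semi d t x - x)) = (1 / t) *\<^sub>R (semi d t (B x) - B x)"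
      by (rule eventually_at_rightI[of 0 1]) (auto simp: linear_scale[OF lin] linear_diff[OF lin] comm)
    ultimately have "((%t. (1 / t) *\<^sub>R (semi d t (B x) - B x)) \<longlongrightarrow> B y) (at_right 0)"
      by (rule Lim_transform_eventually)
    with B_gen[OF p(2)] have "B y = - (d *\<^sub>R x)" by (intro tendsto_unique[of "at_right 0"]) auto
    then have "B (- (1 / d) *\<^sub>R y) = x" using d by (simp only: linear_scale[OF lin]) simp
    moreover have "y = - (d *\<^sub>R (- (1 / d) *\<^sub>R y))" using d by simp
    ultimately have "p = (%g. (B g, - (d *\<^sub>R g))) (- (1 / d) *\<^sub>R y)" unfolding p(1) by simp
    then show "p \<in> (%g. (B g, - (d *\<^sub>R g))) ` H" using subspace_scale[OF subspace_H y] by (rule image_eqI)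
  qed
qed

text \<open>For initial data in the domain the difference \<open>w\<close> of two orbits satisfies
  \<open>w' = - A w\<close> with \<open>A\<close> nonnegative, so its norm is nonincreasing.\<close>

lemma semi_unique:
  assumes d: "d > 0" and S: "c0_semigroup_on H S" "generator_on H S = (%g. (B g, - (d *\<^sub>R g))) ` H"
    and x: "x \<in> H" and t: "0 \<le> t"
  shows "S t x = semi d t x"
proof -
  interpret S: c0_semigroup H S by (rule c0_semigroup.intro[OF subspace_H closed_H S(1)])
  interpret T: c0_semigroup H "semi d" by (rule c0_semigroup.intro[OF subspace_H closed_H semi_c0[OF d]])
  have eq: "S t (B g) = semi d t (B g)" if g: "g \<in> H" for g
  proof -
    define y where "y = - (d *\<^sub>R g)"
    define w where "w s = S s (B g) - semi d s (B g)" for s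
    have y: "y \<in> H" unfolding y_def by (intro subspace_neg subspace_scale subspace_H g)
    have xy: "(B g, y) \<in> generator_on H S" "(B g, y) \<in> generator_on H (semi d)"
      unfolding S(2) semi_generator[OF d] y_def using g by auto
    have D: "(w has_vector_derivative (S s y - semi d s y)) (at s within {0..})" if "0 \<le> s" for s :: real
      unfolding w_def by (intro has_vector_derivative_diff S.orbit_derivative T.orbit_derivative xy y that)
    have neg: "inner (w s) (S s y - semi d s y) \<le> 0" if s: "0 \<le> s" for s
    proof -
      obtain a b where "S s (B g) = B a" "S s y = - (d *\<^sub>R a)" "semi d s (B g) = B b" "semi d s y = - (d *\<^sub>R b)"
        using S.generator_invariant[OF xy(1) y s] T.generator_invariant[OF xy(2) y s] unfolding S(2) semi_generator[OF d] by auto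
      then have "w s = B (a - b)" "S s y - semi d s y = - (d *\<^sub>R (a - b))"
        by (simp_all add: w_def linear_diff[OF lin] scaleR_diff_right)
      then show ?thesis using d nonneg[of "a - b"] by simp
    qed
    have Df: "((%s. inner (w s) (w s)) has_real_derivative 2 * inner (w s) (S s y - semi d s y)) (at s within {0..})" if "0 \<le> s" for s :: real
      using bounded_bilinear.has_vector_derivative[OF bounded_bilinear_inner D[OF that] D[OF that]]
      by (simp add: has_real_derivative_iff_has_vector_derivative inner_commute)
    have "inner (w t) (w t) \<le> inner (w 0) (w 0)"
    proof (rule DERIV_nonpos_imp_decreasing_open[OF t])
      fix s :: real assume s: "0 < s"
      then have "at s within {0..} = at s" by (intro at_within_interior) (simp add: interior_real_atLeast)
      then show "\<exists>z. DERIV (%s. inner (w s) (w s)) s :> z \<and> z \<le> 0" using Df[of s] neg[of s] s by auto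
    next
      have "continuous_on {0..} (%s. inner (w s) (w s))" by (rule DERIV_continuous_on[OF Df]) simp
      then show "continuous_on {0..t} (%s. inner (w s) (w s))" by (rule continuous_on_subset) auto
    qed
    moreover have "w 0 = 0" using S.S_0[OF B_in_H] T.S_0[OF B_in_H] by (simp add: w_def)
    ultimately have "w t = 0" by (metis inner_gt_zero_iff inner_zero_left not_less)
    then show ?thesis by (simp add: w_def)
  qed
  \<comment> \<open>\<open>B\<close> annihilates the orthogonal complement of \<open>H\<close>, so
    its whole range is already reached from \<open>H\<close>; hence the initial data in the domain
    are dense.\<close>
  have "range B \<subseteq> closure (B ` H)"
  proof
    fix z assume "z \<in> range B"
    then obtain v where v: "z = B v" by blast
    obtain p where p: "p \<in> H" "\<forall>y\<in>H. inner (v - p) y = 0" using orthogonal_projection[OF closed_H subspace_H] by blast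
    have "inner (B (v - p)) (B (v - p)) = 0" using p(2) B_in_H by (simp add: sym)
    then have "B v = B p" by (simp add: linear_diff[OF lin])
    then show "z \<in> closure (B ` H)" using v p(1) closure_subset[of "B ` H"] by auto
  qed
  then have "x \<in> closure (B ` H)" using x closure_minimal[of "range B" "closure (B ` H)"] unfolding H_def by auto
  then obtain u where u: "\<And>n. u n \<in> B ` H" "u \<longlonglongrightarrow> x" unfolding closure_sequential by blast
  have uH: "u n \<in> H" for n using u(1)[of n] B_in_H by auto
  have "(%n. S t (u n)) \<longlonglongrightarrow> S t x" "(%n. semi d t (u n)) \<longlonglongrightarrow> semi d t x"
    by (intro S.S_continuous T.S_continuous u t x always_eventually allI uH)+
  moreover have "S t (u n) = semi d t (u n)" for n using u(1)[of n] eq by force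
  ultimately show ?thesis by (simp add: LIMSEQ_unique)
qed

end

context bounded_open_set
begin

lemma solve_eq: "solve g = inv_op ((1 / gap) *\<^sub>R g)"
  using gap_nz by (simp add: inv_op_def linear_scale[OF linear_solve])

lemma stokes_graph: "(%u. (u, - stokes \<Omega> u)) ` stokes_domain \<Omega> = (%g. (inv_op g, - (gap *\<^sub>R g))) ` fc.H"
proof -
  have "(%u. (u, - stokes \<Omega> u)) ` stokes_domain \<Omega> = (%g. (solve g, - g)) ` H"
    unfolding stokes_domain_eq image_image by (rule image_cong) (auto simp: stokes_solve)
  also have "H = (*\<^sub>R) gap ` H"
  proof (intro equalityI subsetI)
    fix g assume "g \<in> H"
    then show "g \<in> (*\<^sub>R) gap ` H"
      using gap_nz by (intro image_eqI[of _ _ "(1 / gap) *\<^sub>R g"]) (auto intro: subspace_scale[OF subspace_L2_sigma])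
  qed (auto intro: subspace_scale[OF subspace_L2_sigma])
  also have "(%g. (solve g, - g)) ` (*\<^sub>R) gap ` H = (%g. (inv_op g, - (gap *\<^sub>R g))) ` H"
    using gap_nz by (simp add: image_image solve_eq)
  finally show ?thesis by (simp add: H_eq)
qed

text \<open>The explicit semigroup shows that the choice in the definition is not vacuous, and
  uniqueness identifies whichever semigroup was chosen.\<close>

lemma stokes_semigroup_eq:
  assumes "x \<in> H" "0 \<le> t"
  shows "stokes_semigroup \<Omega> t x = fc.semi gap t x"
proof (rule fc.semi_unique[OF gap(1)])
  have "\<exists>S. c0_semigroup_on H S \<and> generator_on H S = (%u. (u, - stokes \<Omega> u)) ` stokes_domain \<Omega>"
    unfolding stokes_graph using fc.semi_c0[OF gap(1)] fc.semi_generator[OF gap(1)] unfolding H_eq by blast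
  from someI_ex[OF this] show "c0_semigroup_on fc.H (stokes_semigroup \<Omega>)"
    "generator_on fc.H (stokes_semigroup \<Omega>) = (%g. (inv_op g, - (gap *\<^sub>R g))) ` fc.H"
    unfolding stokes_graph[symmetric] unfolding H_eq stokes_semigroup_def[symmetric] by blast+
qed (use assms in \<open>simp_all add: H_eq\<close>)

end

section \<open>Contour integrals\<close>

abbreviation arc_int :: "real => real => real => (complex => complex) => complex" where
  "arc_int r a b h \<equiv> LINT x:{a..b}|lborel. \<i> * rcis r x * h (rcis r x)"

abbreviation ray_int :: "real => real => (complex => complex) => complex" where
  "ray_int r x h \<equiv> LINT s:{r..}|lborel. cis x * h (rcis s x)"

text \<open>Scalar counterpart of \<open>contour_int\<close>: what remains of it once the integral
  has been moved inside the functional calculus.\<close>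

definition cint :: "real => real => (complex => complex) => complex" where
  "cint \<rho> \<eta> h = arc_int \<rho> (-\<eta>) \<eta> h + ray_int \<rho> \<eta> h - ray_int \<rho> (-\<eta>) h"

lemma rcis_slit: "0 < r ==> \<bar>\<theta>\<bar> < pi ==> rcis r \<theta> \<notin> \<real>\<^sub>\<le>\<^sub>0"
proof
  assume r: "0 < r" and \<theta>: "\<bar>\<theta>\<bar> < pi" and "rcis r \<theta> \<in> \<real>\<^sub>\<le>\<^sub>0"
  then have *: "r * cos \<theta> \<le> 0" "r * sin \<theta> = 0" by (auto simp: complex_nonpos_Reals_iff)
  then have "sin \<theta> = 0" using r by simp
  then have "\<theta> = 0" using \<theta> sin_gt_zero[of \<theta>] sin_gt_zero[of "- \<theta>"] by (cases "\<theta> > 0"; cases "\<theta> < 0") auto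
  then show False using * r by simp
qed

lemma starlike_slit: "starlike (- \<real>\<^sub>\<le>\<^sub>0 :: complex set)"
proof -
  have "(\<real>\<^sub>\<le>\<^sub>0 :: complex set) = complex_of_real ` {..0}" by (auto simp: nonpos_Reals_def image_def)
  then show ?thesis using starlike_slotted_complex_plane_left[of 0] by simp
qed

lemma exp_tail:
  fixes a \<rho> :: real
  assumes "a > 0"
  shows "has_bochner_integral lborel (%s. indicator {\<rho>..} s * exp (- (a * s))) (exp (- (a * \<rho>)) / a)"
proof (rule has_bochner_integral_nn_integral)
  have lim: "((%s. - exp (- (a * s)) / a) \<longlongrightarrow> - 0 / a) at_top"
  proof -
    have "filterlim (%s. a * s) at_top at_top"
      using assms by (intro filterlim_tendsto_pos_mult_at_top[OF tendsto_const] filterlim_ident) auto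
    then have "((%s. exp (- (a * s))) \<longlongrightarrow> 0) at_top"
      by (intro filterlim_compose[OF exp_at_bot]) (simp add: filterlim_uminus_at_bot)
    then show ?thesis by (intro tendsto_intros) (use assms in auto)
  qed
  have "(\<integral>\<^sup>+s. ennreal (exp (- (a * s))) * indicator {\<rho>..} s \<partial>lborel) = ennreal (- 0 / a - (- exp (- (a * \<rho>)) / a))"
    using assms lim by (intro nn_integral_FTC_atLeast) (auto intro!: derivative_eq_intros)
  moreover have "(\<integral>\<^sup>+s. ennreal (indicator {\<rho>..} s * exp (- (a * s))) \<partial>lborel) = (\<integral>\<^sup>+s. ennreal (exp (- (a * s))) * indicator {\<rho>..} s \<partial>lborel)"
    by (intro nn_integral_cong) (auto simp: indicator_def)
  ultimately show "(\<integral>\<^sup>+s. ennreal (indicator {\<rho>..} s * exp (- (a * s))) \<partial>lborel) = ennreal (exp (- (a * \<rho>)) / a)"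
    by simp
qed (use assms in auto)

lemma ray_integrable:
  fixes f :: "real => 'b::{banach, second_countable_topology}"
  assumes "continuous_on {\<rho>..} f" "a > 0" "\<And>s. \<rho> \<le> s ==> norm (f s) \<le> M * exp (- (a * s))"
  shows "set_integrable lborel {\<rho>..} f"
    and "norm (LINT s:{\<rho>..}|lborel. f s) \<le> M * (exp (- (a * \<rho>)) / a)"
proof -
  let ?w = "%s. M * (indicator {\<rho>..} s * exp (- (a * s)))"
  note t = exp_tail[OF assms(2), of \<rho>]
  have w: "integrable lborel ?w" by (intro integrable_mult_right integrable.intros[OF t])
  have M0: "0 \<le> M"
  proof -
    have "0 \<le> M * exp (- (a * \<rho>))" using assms(3)[of \<rho>] by (auto intro: order_trans[OF norm_ge_zero])
    then show ?thesis by (simp add: zero_le_mult_iff)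
  qed
  show i: "set_integrable lborel {\<rho>..} f"
    unfolding set_integrable_def
  proof (rule Bochner_Integration.integrable_bound[OF w])
    show "(%s. indicator {\<rho>..} s *\<^sub>R f s) \<in> borel_measurable lborel"
      using borel_measurable_continuous_on_indicator[OF _ assms(1)] by simp
  qed (use assms(3) M0 in \<open>auto simp: indicator_def\<close>)
  have "norm (LINT s:{\<rho>..}|lborel. f s) \<le> (LINT s|lborel. norm (indicator {\<rho>..} s *\<^sub>R f s))"
    unfolding set_lebesgue_integral_def by (rule integral_norm_bound)
  also have "\<dots> \<le> (LINT s|lborel. ?w s)"
    by (rule integral_mono[OF integrable_norm[OF i[unfolded set_integrable_def]] w])
      (use assms(3) in \<open>auto simp: indicator_def\<close>)
  also have "\<dots> = M * (exp (- (a * \<rho>)) / a)"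
    by (rule has_bochner_integral_integral_eq) (intro has_bochner_integral_mult_right t)
  finally show "norm (LINT s:{\<rho>..}|lborel. f s) \<le> M * (exp (- (a * \<rho>)) / a)" .
qed

lemma arc_integrable:
  fixes f :: "real => 'b::{banach, second_countable_topology}"
  assumes "continuous_on {a..b} f" "a \<le> b" "\<And>s. a \<le> s ==> s \<le> b ==> norm (f s) \<le> M"
  shows "set_integrable lborel {a..b} f"
    and "norm (LINT s:{a..b}|lborel. f s) \<le> M * (b - a)"
proof -
  show i: "set_integrable lborel {a..b} f" by (rule borel_integrable_atLeastAtMost'[OF assms(1)])
  have w: "integrable lborel (%s. M * indicator {a..b} s)"
    by (intro integrable_mult_right integrable_real_indicator) (auto simp: emeasure_lborel_Icc_eq)
  have "norm (LINT s:{a..b}|lborel. f s) \<le> (LINT s|lborel. norm (indicator {a..b} s *\<^sub>R f s))"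
    unfolding set_lebesgue_integral_def by (rule integral_norm_bound)
  also have "\<dots> \<le> (LINT s|lborel. M * indicator {a..b} s)"
    by (rule integral_mono[OF integrable_norm[OF i[unfolded set_integrable_def]] w])
      (use assms(3) in \<open>auto simp: indicator_def\<close>)
  also have "\<dots> = M * (b - a)" using assms(2) by simp
  finally show "norm (LINT s:{a..b}|lborel. f s) \<le> M * (b - a)" .
qed

locale sector =
  fixes \<eta> :: real
  assumes \<eta>: "pi / 2 < \<eta>" "\<eta> < pi"
begin

text \<open>On both rays the modulus of exp(z t) at radius s is exp(-t \<open>decay\<close> s),
  since the cosine of the angle is negative there.\<close>

definition decay :: real where "decay = - cos \<eta>"

lemma decay: "0 < decay"
  unfolding decay_def using cos_monotone_0_pi[of "pi / 2" \<eta>] \<eta> by simp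

lemma eta_pos: "0 < \<eta>"
  using \<eta> pi_gt_zero by linarith

lemma cos_ray: "\<bar>x\<bar> = \<eta> ==> cos x = - decay"
  by (metis cos_abs_real decay_def minus_minus)

definition ray_bound :: "real => real => real => (complex => complex) => bool" where
  "ray_bound r a M h \<longleftrightarrow> (\<forall>s x. r \<le> s \<longrightarrow> \<bar>x\<bar> = \<eta> \<longrightarrow> cmod (h (rcis s x)) \<le> M * exp (- (a * s)))"

lemma cint_bound:
  assumes r: "0 < r" and h: "continuous_on (- \<real>\<^sub>\<le>\<^sub>0) h" and a: "a > 0" and ray: "ray_bound r a M h"
  shows "set_integrable lborel {-\<eta>..\<eta>} (%x. \<i> * rcis r x * h (rcis r x))"
    and "\<bar>x\<bar> = \<eta> ==> set_integrable lborel {r..} (%s. cis x * h (rcis s x))"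
    and "\<bar>x\<bar> = \<eta> ==> cmod (ray_int r x h) \<le> M * (exp (- (a * r)) / a)"
    and "(\<And>x. \<bar>x\<bar> \<le> \<eta> ==> cmod (h (rcis r x)) \<le> m) ==> cmod (cint r \<eta> h) \<le> 2 * \<eta> * r * m + 2 * M * (exp (- (a * r)) / a)"
proof -
  have c: "continuous_on {-\<eta>..\<eta>} (%x. \<i> * rcis r x * h (rcis r x))"
    by (intro continuous_intros continuous_on_compose2[OF h]) (use r \<eta> in \<open>auto simp: rcis_slit\<close>)
  then show "set_integrable lborel {-\<eta>..\<eta>} (%x. \<i> * rcis r x * h (rcis r x))" by (rule borel_integrable_atLeastAtMost')
  have c2: "continuous_on {r..} (%s. cis x * h (rcis s x))" if "\<bar>x\<bar> = \<eta>" for x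
    by (intro continuous_intros continuous_on_compose2[OF h]) (use r \<eta> that in \<open>auto simp: rcis_slit\<close>)
  show R: "\<bar>x\<bar> = \<eta> ==> set_integrable lborel {r..} (%s. cis x * h (rcis s x))"
    "\<bar>x\<bar> = \<eta> ==> cmod (ray_int r x h) \<le> M * (exp (- (a * r)) / a)" for x
    using ray_integrable[OF c2[of x] a, of M] ray by (simp_all add: ray_bound_def norm_mult)
  assume m: "\<And>x. \<bar>x\<bar> \<le> \<eta> ==> cmod (h (rcis r x)) \<le> m"
  have "cmod (arc_int r (-\<eta>) \<eta> h) \<le> r * m * (\<eta> - - \<eta>)"
    by (rule arc_integrable(2)[OF c]) (use m r eta_pos in \<open>auto simp: norm_mult abs_le_iff\<close>)
  moreover have "cmod (cint r \<eta> h) \<le> cmod (arc_int r (-\<eta>) \<eta> h) + cmod (ray_int r \<eta> h) + cmod (ray_int r (-\<eta>) h)"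
    unfolding cint_def by (rule order_trans[OF norm_triangle_ineq4]) (simp add: norm_triangle_ineq)
  moreover have "r * m * (\<eta> - - \<eta>) = 2 * \<eta> * r * m" "\<bar>\<eta>\<bar> = \<eta>" "\<bar>- \<eta>\<bar> = \<eta>" using eta_pos by auto
  ultimately show "cmod (cint r \<eta> h) \<le> 2 * \<eta> * r * m + 2 * M * (exp (- (a * r)) / a)"
    using R(2)[of \<eta>] R(2)[of "-\<eta>"] by linarith
qed

lemma cint_diff:
  assumes "0 < r" "continuous_on (- \<real>\<^sub>\<le>\<^sub>0) h" "continuous_on (- \<real>\<^sub>\<le>\<^sub>0) g" "a > 0" "ray_bound r a M h" "ray_bound r a N g"
  shows "cint r \<eta> (%z. h z - g z) = cint r \<eta> h - cint r \<eta> g"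
proof -
  have e: "\<bar>\<eta>\<bar> = \<eta>" "\<bar>- \<eta>\<bar> = \<eta>" using eta_pos by auto
  note H = cint_bound(1,2)[OF assms(1,2,4,5)] and G = cint_bound(1,2)[OF assms(1,3,4,6)]
  show ?thesis
    unfolding cint_def right_diff_distrib
    by (simp only: set_integral_diff(2)[OF H(1) G(1)] set_integral_diff(2)[OF H(2)[OF e(1)] G(2)[OF e(1)]]
      set_integral_diff(2)[OF H(2)[OF e(2)] G(2)[OF e(2)]]) simp
qed

lemma arc_FTC:
  assumes F: "\<And>z. z \<in> A ==> (F has_field_derivative h z) (at z)" and h: "continuous_on A h"
    and ab: "a \<le> b" "\<And>\<theta>. a \<le> \<theta> ==> \<theta> \<le> b ==> rcis \<rho> \<theta> \<in> A"
  shows "arc_int \<rho> a b h = F (rcis \<rho> b) - F (rcis \<rho> a)"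
  unfolding set_lebesgue_integral_def
proof (rule integral_FTC_Icc[OF ab(1)])
  fix \<theta> assume \<theta>: "a \<le> \<theta>" "\<theta> \<le> b"
  have "((%\<theta>. rcis \<rho> \<theta>) has_vector_derivative \<i> * rcis \<rho> \<theta>) (at \<theta> within {a..b})"
    unfolding rcis_def cis_conv_exp
    by (auto intro!: derivative_eq_intros has_vector_derivative_real_field simp: algebra_simps)
  from field_vector_diff_chain_within[OF this, of F "h (rcis \<rho> \<theta>)"] F[OF ab(2)[OF \<theta>]]
  show "((%\<theta>. F (rcis \<rho> \<theta>)) has_vector_derivative \<i> * rcis \<rho> \<theta> * h (rcis \<rho> \<theta>)) (at \<theta> within {a..b})"
    by (simp add: o_def has_field_derivative_at_within)
next
  show "continuous_on {a..b} (%\<theta>. \<i> * rcis \<rho> \<theta> * h (rcis \<rho> \<theta>))"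
    by (intro continuous_intros continuous_on_compose2[OF h]) (use ab in auto)
qed

lemma ray_FTC:
  assumes F: "\<And>z. z \<in> A ==> (F has_field_derivative h z) (at z)" and h: "continuous_on A h"
    and ab: "a \<le> b" "\<And>s. a \<le> s ==> s \<le> b ==> rcis s \<theta> \<in> A"
  shows "(LINT s:{a..b}|lborel. cis \<theta> * h (rcis s \<theta>)) = F (rcis b \<theta>) - F (rcis a \<theta>)"
  unfolding set_lebesgue_integral_def
proof (rule integral_FTC_Icc[OF ab(1)])
  fix s assume s: "a \<le> s" "s \<le> b"
  have "((%s. rcis s \<theta>) has_vector_derivative cis \<theta>) (at s within {a..b})"
    unfolding rcis_def by (auto intro!: derivative_eq_intros simp: has_vector_derivative_def scaleR_conv_of_real)
  from field_vector_diff_chain_within[OF this, of F "h (rcis s \<theta>)"] F[OF ab(2)[OF s]]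
  show "((%s. F (rcis s \<theta>)) has_vector_derivative cis \<theta> * h (rcis s \<theta>)) (at s within {a..b})"
    by (simp add: o_def has_field_derivative_at_within)
next
  show "continuous_on {a..b} (%s. cis \<theta> * h (rcis s \<theta>))"
    by (intro continuous_intros continuous_on_compose2[OF h]) (use ab in auto)
qed

text \<open>The slit plane is starlike, so h has a primitive F on it. The arcs and the pieces of the
  rays between the two radii become differences of F that cancel.\<close>

lemma cint_radius:
  assumes h: "h holomorphic_on (- \<real>\<^sub>\<le>\<^sub>0)" and r: "0 < r" "r \<le> r'" and a: "a > 0" and ray: "ray_bound r a M h"
  shows "cint r \<eta> h = cint r' \<eta> h"
proof -
  let ?S = "- \<real>\<^sub>\<le>\<^sub>0 :: complex set"
  have hc: "continuous_on ?S h" by (rule holomorphic_on_imp_continuous_on[OF h])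
  have op: "open ?S" by (simp add: open_Compl closed_nonpos_Reals_complex)
  obtain F where F: "\<And>z. z \<in> ?S ==> (F has_field_derivative h z) (at z)"
    using holomorphic_starlike_primitive[OF hc starlike_slit op, of "{}"] h op
    by (auto simp: holomorphic_on_open field_differentiable_def)
  have sl: "rcis s x \<in> ?S" if "0 < s" "\<bar>x\<bar> \<le> \<eta>" for s x using rcis_slit[of s x] that \<eta> by auto
  have arcs: "arc_int s (-\<eta>) \<eta> h = F (rcis s \<eta>) - F (rcis s (-\<eta>))" if "0 < s" for s
    using that eta_pos by (intro arc_FTC[OF F hc] sl) auto
  have split: "ray_int r x h = (F (rcis r' x) - F (rcis r x)) + ray_int r' x h" if x: "\<bar>x\<bar> = \<eta>" for x
  proof -
    have i: "set_integrable lborel {r..} (%s. cis x * h (rcis s x))" by (rule cint_bound(2)[OF r(1) hc a ray x])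
    have "AE s in lborel. \<not> (s \<in> {r..r'} \<and> s \<in> {r'..})" using AE_lborel_singleton[of r'] by eventually_elim auto
    then have "(LINT s:{r..r'} \<union> {r'..}|lborel. cis x * h (rcis s x)) = (LINT s:{r..r'}|lborel. cis x * h (rcis s x)) + ray_int r' x h"
      by (rule set_integral_Un_AE[OF _ _ _ set_integrable_subset[OF i] set_integrable_subset[OF i]]) (use r in auto)
    moreover have "{r..r'} \<union> {r'..} = {r..}" using r by auto
    moreover have "(LINT s:{r..r'}|lborel. cis x * h (rcis s x)) = F (rcis r' x) - F (rcis r x)"
      using r x by (intro ray_FTC[OF F hc] sl) auto
    ultimately show ?thesis by (simp only:)
  qed
  show ?thesis unfolding cint_def using arcs[of r] arcs[of r'] split[of \<eta>] split[of "- \<eta>"] r eta_pos by simp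
qed

text \<open>Moving the arc to radius \<open>1 / t\<close> makes the estimate scale correctly in \<open>t\<close>.\<close>

lemma cint_scaled:
  assumes h: "h holomorphic_on (- \<real>\<^sub>\<le>\<^sub>0)" and \<rho>: "0 < \<rho>" and t: "0 < t" and q: "0 \<le> q" and K: "0 \<le> K"
    and le: "\<And>r \<theta>. 0 < r ==> \<bar>\<theta>\<bar> \<le> \<eta> ==> cmod (h (rcis r \<theta>)) \<le> K * exp (t * (r * cos \<theta>)) * r powr (- q)"
  shows "cmod (cint \<rho> \<eta> h) \<le> K * (2 * \<eta> * exp 1 + 2 / decay) * t powr (q - 1)"
    and "0 < \<rho>' ==> cint \<rho> \<eta> h = cint \<rho>' \<eta> h"
proof -
  have a: "t * decay > 0" using t decay by simp
  have ray: "ray_bound r (t * decay) (K * r powr (- q)) h" if "0 < r" for r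
    unfolding ray_bound_def
  proof (intro allI impI)
    fix s \<theta> assume *: "r \<le> s" "\<bar>\<theta>\<bar> = \<eta>"
    have "t * (s * cos \<theta>) = - (t * decay * s)" using cos_ray[OF *(2)] by simp
    moreover have "s powr (- q) \<le> r powr (- q)" using * that q by (intro powr_mono2') auto
    ultimately show "cmod (h (rcis s \<theta>)) \<le> K * r powr (- q) * exp (- (t * decay * s))"
      using le[of s \<theta>] * that K mult_left_mono[of "s powr (- q)" "r powr (- q)" "K * exp (- (t * decay * s))"] by (simp add: ac_simps)
  qed
  have rad: "cint r \<eta> h = cint r' \<eta> h" if "0 < r" "r \<le> r'" for r r'
    by (rule cint_radius[OF h that a ray[OF that(1)]])
  show eq: "cint \<rho> \<eta> h = cint \<rho>' \<eta> h" if "0 < \<rho>'" for \<rho>'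
  proof (cases "\<rho> \<le> \<rho>'")
    case False
    then show ?thesis by (intro rad[symmetric] that) simp
  qed (rule rad[OF \<rho>])
  let ?r = "1 / t"
  have r: "0 < ?r" using t by simp
  have "cmod (cint ?r \<eta> h) \<le> 2 * \<eta> * ?r * (K * exp 1 * ?r powr (- q)) + 2 * (K * ?r powr (- q)) * (exp (- (t * decay * ?r)) / (t * decay))"
  proof (rule cint_bound(4)[OF r holomorphic_on_imp_continuous_on[OF h] a ray[OF r]])
    fix \<theta> assume \<theta>: "\<bar>\<theta>\<bar> \<le> \<eta>"
    show "cmod (h (rcis ?r \<theta>)) \<le> K * exp 1 * ?r powr (- q)"
      using t K by (intro order_trans[OF le[OF r \<theta>]] mult_right_mono mult_left_mono) auto
  qed
  also have "\<dots> \<le> K * (2 * \<eta> * exp 1 + 2 / decay) * t powr (q - 1)"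
  proof -
    have p: "?r powr (- q) = t * t powr (q - 1)" using t by (simp add: powr_minus_divide powr_divide powr_diff field_simps)
    have "exp (- (t * decay * ?r)) / (t * decay) \<le> 1 / (t * decay)" using a decay t by (intro divide_right_mono) auto
    then have "2 * (K * ?r powr (- q)) * (exp (- (t * decay * ?r)) / (t * decay)) \<le> 2 * (K * ?r powr (- q)) * (1 / (t * decay))"
      using K by (intro mult_left_mono) auto
    also have "\<dots> = K * (2 / decay) * t powr (q - 1)" using t unfolding p by simp
    finally show ?thesis using t unfolding p by (simp add: algebra_simps)
  qed
  finally show "cmod (cint \<rho> \<eta> h) \<le> K * (2 * \<eta> * exp 1 + 2 / decay) * t powr (q - 1)"
    using eq[OF r] by simp
qed

text \<open>The punctured exponential \<open>(exp (z t) - 1) / z\<close> extends to an entire function. Its primitive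
  is single-valued across the cut, so the value of the integral comes from the logarithm alone.\<close>

lemma hankel_integral:
  assumes \<rho>: "0 < \<rho>" and t: "0 < t"
  shows "cint \<rho> \<eta> (%z. exp (z * of_real t) / z) = 2 * of_real pi * \<i>"
proof -
  let ?h = "%z. exp (z * of_real t) / z" and ?S = "- \<real>\<^sub>\<le>\<^sub>0 :: complex set"
  define f where "f z = (if z = 0 then of_real t else (exp (z * of_real t) - 1) / z)" for z :: complex
  have "((%z. exp (z * of_real t)) has_field_derivative of_real t) (at (0::complex))" by (auto intro!: derivative_eq_intros)
  then have "((%z::complex. (exp (z * of_real t) - 1) / z) \<longlongrightarrow> of_real t) (at 0)" by (simp add: DERIV_def)
  then have "(f \<longlongrightarrow> of_real t) (at 0)"
    by (rule Lim_transform_eventually) (auto simp: eventually_at_filter f_def)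
  then have cont0: "isCont f 0" by (simp add: isCont_def f_def)
  have "(%z. (exp (z * of_real t) - 1) / z) holomorphic_on - {0}" by (auto intro!: holomorphic_intros)
  then have "f holomorphic_on - {0}" by (rule holomorphic_transform) (auto simp: f_def)
  then have diff: "f field_differentiable at z" if "z \<noteq> 0" for z using that by (auto intro: holomorphic_on_imp_differentiable_at)
  have cont: "continuous_on UNIV f"
    using cont0 diff by (intro continuous_at_imp_continuous_on ballI) (metis field_differentiable_imp_continuous_at)
  obtain F where F: "\<And>z. (F has_field_derivative f z) (at z)"
    using holomorphic_starlike_primitive[OF cont starlike_UNIV open_UNIV, of "{0}"] diff by auto
  have hol: "?h holomorphic_on ?S" by (auto intro!: holomorphic_intros)
  have hle: "cmod (?h (rcis r x)) = exp (t * (r * cos x)) / r" if "0 < r" for r x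
    using that by (simp add: norm_divide mult.commute)
  have indep: "cint \<rho> \<eta> ?h = cint R \<eta> ?h" if "0 < R" for R
    by (rule cint_scaled(2)[OF hol \<rho> t, of 1 1]) (use that hle in \<open>auto simp: powr_minus_divide\<close>)
  have a: "t * decay > 0" using t decay by simp
  let ?e = "%R. exp (- (t * decay * R))" and ?J = "%R a b. LINT x:{a..b}|lborel. \<i> * exp (rcis R x * of_real t)"
  \<comment> \<open>Two complementary arcs of angle \<pi> - \<eta> and the tails of the two
    rays.\<close>
  define C where "C = 2 * (pi - \<eta>) + 2 / (t * decay)"
  have est: "cmod (cint \<rho> \<eta> ?h - 2 * of_real pi * \<i>) \<le> C * ?e R" if R: "1 \<le> R" for R
  proof -
    have ci: "continuous_on {a..b} (%x. \<i> * rcis R x * f (rcis R x))" for a b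
      by (intro continuous_intros continuous_on_compose2[OF cont]) auto
    have J: "?J R a b = F (rcis R b) - F (rcis R a) + \<i> * of_real (b - a)" if "a \<le> b" for a b
    proof -
      have "(%x. \<i> * exp (rcis R x * of_real t)) = (%x. \<i> * rcis R x * f (rcis R x) + \<i>)"
        using R by (auto simp: f_def fun_eq_iff field_simps)
      then have "?J R a b = arc_int R a b f + (LINT x:{a..b}|lborel. \<i>)"
        by (simp only: set_integral_add(2)[OF borel_integrable_atLeastAtMost'[OF ci] borel_integrable_atLeastAtMost'[OF continuous_on_const]])
      moreover have "arc_int R a b f = F (rcis R b) - F (rcis R a)" by (rule arc_FTC[OF F cont that]) simp
      moreover have "(LINT x:{a..b}|lborel. \<i>) = \<i> * of_real (b - a)"
        using that unfolding set_lebesgue_integral_def by (simp add: scaleR_conv_of_real)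
      ultimately show ?thesis by (simp only:)
    qed
    have A: "arc_int R (-\<eta>) \<eta> ?h = (F (rcis R \<eta>) + Ln (rcis R \<eta>)) - (F (rcis R (-\<eta>)) + Ln (rcis R (-\<eta>)))"
    proof (rule arc_FTC[of ?S "%z. F z + Ln z"])
      show "((%z. F z + Ln z) has_field_derivative ?h z) (at z)" if "z \<in> ?S" for z
        using DERIV_add[OF F[of z] has_field_derivative_Ln[of z]] that
        by (cases "z = 0") (auto simp: f_def diff_divide_distrib inverse_eq_divide)
    qed (use rcis_slit R \<eta> eta_pos holomorphic_on_imp_continuous_on[OF hol] in auto)
    have p: "\<eta> \<in> {-pi<..pi}" "-\<eta> \<in> {-pi<..pi}" "-pi \<le> -\<eta>" "\<eta> \<le> pi" "0 < R" "rcis R (-pi) = rcis R pi"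
      using \<eta> eta_pos R by (auto simp: rcis_def cis_conv_exp exp_minus)
    \<comment> \<open>The arc integral minus 2 \<pi> i equals minus the integral over the two
      complementary arcs: on the full circle the primitive of the entire part returns to its value,
      and the angles add up to 2 \<pi>. On the complementary arcs exp(z t) is exponentially small in
      R.\<close>
    have eq: "cint \<rho> \<eta> ?h - 2 * of_real pi * \<i> = ray_int R \<eta> ?h - ray_int R (-\<eta>) ?h - ?J R (-pi) (-\<eta>) - ?J R \<eta> pi"
      unfolding indep[OF p(5)] unfolding cint_def A J[OF p(3)] J[OF p(4)] Ln_rcis[OF p(5,1)] Ln_rcis[OF p(5,2)] p(6)
      by (simp add: Complex_eq algebra_simps)
    have g: "cmod (\<i> * exp (rcis R x * of_real t)) \<le> ?e R" if "\<eta> \<le> \<bar>x\<bar>" "\<bar>x\<bar> \<le> pi" for x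
    proof -
      have "cos x \<le> cos \<eta>" using cos_monotone_0_pi_le[of \<eta> "\<bar>x\<bar>"] that eta_pos by simp
      then have "t * (R * cos x) \<le> t * (R * cos \<eta>)" using t R by (intro mult_left_mono) auto
      then show ?thesis by (simp add: norm_mult decay_def ac_simps)
    qed
    have n: "cmod (?J R a b) \<le> ?e R * (pi - \<eta>)" if "a \<le> b" "b - a = pi - \<eta>" "\<And>x. a \<le> x ==> x \<le> b ==> \<eta> \<le> \<bar>x\<bar> \<and> \<bar>x\<bar> \<le> pi" for a b
      unfolding that(2)[symmetric]
      by (rule arc_integrable(2)) (use g that in \<open>auto intro!: continuous_intros simp del: norm_mult\<close>)
    have "ray_bound R (t * decay) 1 ?h"
      unfolding ray_bound_def
    proof (intro allI impI)
      fix s x assume s: "R \<le> s" "\<bar>x\<bar> = \<eta>"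
      then have "cmod (?h (rcis s x)) = ?e s / s" using hle[of s x] cos_ray[of x] R by (simp add: ac_simps)
      also have "\<dots> \<le> 1 * ?e s" using s R by (simp add: divide_le_eq)
      finally show "cmod (?h (rcis s x)) \<le> 1 * ?e s" .
    qed
    note ray = cint_bound(3)[OF p(5) holomorphic_on_imp_continuous_on[OF hol] a this]
    have "cmod (a - b - c - d) \<le> cmod a + cmod b + cmod c + cmod d" for a b c d :: complex
      using norm_triangle_ineq4[of "a - b - c" d] norm_triangle_ineq4[of "a - b" c] norm_triangle_ineq4[of a b] by linarith
    from this[of "ray_int R \<eta> ?h" "ray_int R (-\<eta>) ?h" "?J R (-pi) (-\<eta>)" "?J R \<eta> pi"]
    have "cmod (cint \<rho> \<eta> ?h - 2 * of_real pi * \<i>) \<le> ?e R / (t * decay) + ?e R / (t * decay) + ?e R * (pi - \<eta>) + ?e R * (pi - \<eta>)"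
      using ray[of \<eta>] ray[of "-\<eta>"] n[of "-pi" "-\<eta>"] n[of \<eta> pi] eta_pos \<eta> unfolding eq by (smt (verit))
    also have "\<dots> = C * ?e R" by (simp add: C_def algebra_simps)
    finally show ?thesis .
  qed
  \<comment> \<open>The estimated quantity does not depend on R, so letting R grow shows that it is
    0.\<close>
  have "((%R. C * ?e R) \<longlongrightarrow> C * 0) at_top"
  proof (intro tendsto_mult_left)
    have "filterlim (%s. t * decay * s) at_top at_top"
      using a by (intro filterlim_tendsto_pos_mult_at_top[OF tendsto_const] filterlim_ident) auto
    then show "(?e \<longlongrightarrow> 0) at_top"
      by (intro filterlim_compose[OF exp_at_bot]) (simp add: filterlim_uminus_at_bot)
  qed
  then have "cmod (cint \<rho> \<eta> ?h - 2 * of_real pi * \<i>) \<le> 0"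
    by (intro tendsto_lowerbound[of "%R. C * ?e R" _ at_top]) (auto intro!: eventually_at_top_linorderI[of 1] est)
  then show ?thesis by simp
qed

end

section \<open>Scalar kernels of the solution operators\<close>

lemma powr_rcis:
  assumes "0 < r" "\<bar>\<theta>\<bar> < pi"
  shows "rcis r \<theta> powr of_real a = rcis (r powr a) (a * \<theta>)"
proof -
  have "rcis r \<theta> \<noteq> 0" using assms by simp
  moreover have "Ln (rcis r \<theta>) = of_real (ln r) + \<i> * of_real \<theta>" using Ln_rcis[of r \<theta>] assms by (auto simp: Complex_eq abs_less_iff)
  ultimately have "rcis r \<theta> powr of_real a = exp (of_real (a * ln r)) * exp (\<i> * of_real (a * \<theta>))"
    by (simp add: powr_def algebra_simps flip: exp_add)
  also have "exp (of_real (a * ln r)) = complex_of_real (r powr a)"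
    unfolding exp_of_real using assms by (simp add: powr_def)
  finally show ?thesis by (simp add: rcis_def cis_conv_exp)
qed

text \<open>Mean value inequality along the real segment of times; the factor |z| is the price of a
  Lipschitz bound in time.\<close>

lemma exp_diff_le:
  fixes z :: complex
  assumes E: "\<And>\<tau>. \<tau> \<in> closed_segment s t ==> exp (\<tau> * Re z) \<le> E"
  shows "cmod (exp (z * of_real s) - exp (z * of_real t)) \<le> cmod z * E * \<bar>s - t\<bar>"
proof -
  have "cmod (exp (z * of_real s) - exp (z * of_real t)) \<le> (cmod z * E) * cmod (of_real s - of_real t)"
  proof (rule field_differentiable_bound[where S = "closed_segment (of_real s) (of_real t)" and f' = "%\<tau>. z * exp (z * \<tau>)"])
    fix \<tau> :: complex assume "\<tau> \<in> closed_segment (of_real s) (of_real t)"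
    then obtain x where x: "\<tau> = of_real x" "x \<in> closed_segment s t"
      unfolding closed_segment_of_real by auto
    show "((%\<tau>. exp (z * \<tau>)) has_field_derivative z * exp (z * \<tau>)) (at \<tau> within closed_segment (of_real s) (of_real t))"
      by (auto intro!: derivative_eq_intros)
    show "cmod (z * exp (z * \<tau>)) \<le> cmod z * E"
    proof -
      have "exp (Re z * x) \<le> E" using E[OF x(2)] by (simp add: mult.commute)
      then show ?thesis by (simp add: norm_mult x(1) mult_left_mono)
    qed
  qed auto
  then show ?thesis by (simp flip: of_real_diff)
qed

lemma abs_Re_prefactor: "\<bar>Re (w / (2 * of_real pi * \<i>))\<bar> \<le> cmod w"
proof -
  have "\<bar>Re (w / (2 * of_real pi * \<i>))\<bar> \<le> cmod w / (2 * pi)"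
    using abs_Re_le_cmod[of "w / (2 * of_real pi * \<i>)"] by (simp add: norm_mult norm_divide)
  also have "\<dots> \<le> cmod w / 1" using pi_gt3 by (intro divide_left_mono) auto
  finally show ?thesis by simp
qed

locale subdiffusion = sector +
  fixes \<alpha> \<delta> \<rho> :: real
  assumes \<alpha>: "0 < \<alpha>" "\<alpha> < 1" and \<delta>: "0 < \<delta>" and \<rho>: "0 < \<rho>"
begin

text \<open>Equal to cos(\<alpha> \<pi> / 2): if two complex numbers enclose an angle of at most
  \<alpha> \<pi>, the modulus of their sum is at least this multiple of the sum of their
  moduli.\<close>

definition angle :: real where "angle = sqrt ((1 + cos (\<alpha> * pi)) / 2)"

lemma cos_gt: "- 1 < cos (\<alpha> * pi)"
  using cos_monotone_0_pi[of "\<alpha> * pi" pi] \<alpha> by simp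

lemma angle_pos: "0 < angle"
  unfolding angle_def using cos_gt by simp

text \<open>Law of cosines; the slack is at least (1 - cos(\<alpha> \<pi>)) / 2 times (R -
  \<delta>)^2 with R = r^\<alpha> k. Keeping both summands in the lower bound allows interpolation
  between them later.\<close>

lemma denom_ge:
  assumes "0 < r" "\<bar>\<theta>\<bar> < pi" "0 \<le> k"
  shows "angle * (r powr \<alpha> * k + \<delta>) \<le> cmod (rcis r \<theta> powr of_real \<alpha> * of_real k + of_real \<delta>)"
proof (rule power2_le_imp_le)
  let ?R = "r powr \<alpha> * k" and ?c = "cos (\<alpha> * pi)"
  have "cos (\<alpha> * pi) \<le> cos \<bar>\<alpha> * \<theta>\<bar>"
    using \<alpha> assms by (intro cos_monotone_0_pi_le) (auto simp: abs_mult)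
  then have "?c \<le> cos (\<alpha> * \<theta>)" by simp
  then have "2 * ?R * \<delta> * ?c \<le> 2 * ?R * \<delta> * cos (\<alpha> * \<theta>)" using assms \<delta> by (intro mult_left_mono) auto
  moreover have "0 \<le> (1 - ?c) / 2 * (?R - \<delta>)\<^sup>2" by (intro mult_nonneg_nonneg) auto
  moreover have "(angle * (?R + \<delta>))\<^sup>2 = (1 + ?c) / 2 * (?R + \<delta>)\<^sup>2"
    unfolding angle_def using cos_gt by (simp add: power_mult_distrib)
  moreover have "(cmod (rcis r \<theta> powr of_real \<alpha> * of_real k + of_real \<delta>))\<^sup>2 = ?R\<^sup>2 + \<delta>\<^sup>2 + 2 * ?R * \<delta> * cos (\<alpha> * \<theta>)"
  proof -
    have "(cmod (rcis r \<theta> powr of_real \<alpha> * of_real k + of_real \<delta>))\<^sup>2 = (?R * cos (\<alpha> * \<theta>) + \<delta>)\<^sup>2 + (?R * sin (\<alpha> * \<theta>))\<^sup>2"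
      by (simp add: cmod_power2 powr_rcis[OF assms(1,2)] ac_simps)
    also have "\<dots> = ?R\<^sup>2 * ((cos (\<alpha> * \<theta>))\<^sup>2 + (sin (\<alpha> * \<theta>))\<^sup>2) + \<delta>\<^sup>2 + 2 * ?R * \<delta> * cos (\<alpha> * \<theta>)"
      by algebra
    finally show ?thesis by simp
  qed
  moreover have "(1 + c) / 2 * (R + d)\<^sup>2 = R\<^sup>2 + d\<^sup>2 + 2 * R * d * c - (1 - c) / 2 * (R - d)\<^sup>2" for c R d :: real
    by (simp add: power2_eq_square field_simps)
  ultimately show "(angle * (?R + \<delta>))\<^sup>2 \<le> (cmod (rcis r \<theta> powr of_real \<alpha> * of_real k + of_real \<delta>))\<^sup>2"
    by (smt (verit))
qed simp

lemma denom_pos: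
  assumes "0 < r" "0 \<le> k"
  shows "0 < r powr \<alpha> * k + \<delta>" "0 < angle * (r powr \<alpha> * k + \<delta>)"
  using assms \<delta> angle_pos by (auto intro!: add_nonneg_pos mult_pos_pos)

text \<open>With A = \<delta> / k the resolvent (z^\<alpha> + A)^(-1) is k / (z^\<alpha> k +
  \<delta>); the factor k is split off here. The exponent b is 0 for T_\<alpha> and \<alpha> - 1 for
  S_\<alpha>.\<close>

definition symb :: "real => real => real => complex => complex" where
  "symb b t k z = exp (z * of_real t) * z powr of_real b / (z powr of_real \<alpha> * of_real k + of_real \<delta>)"

definition ker :: "real => real => real => real" where
  "ker b t k = Re (cint \<rho> \<eta> (symb b t k) / (2 * of_real pi * \<i>))"

lemma slit_rcis: "(z::complex) \<in> - \<real>\<^sub>\<le>\<^sub>0 ==> \<exists>r \<theta>. z = rcis r \<theta> \<and> 0 < r \<and> \<bar>\<theta>\<bar> < pi"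
proof -
  assume z: "z \<in> - \<real>\<^sub>\<le>\<^sub>0"
  then have nz: "z \<noteq> 0" by auto
  have "Arg z \<noteq> pi" using z Arg_eq_pi_iff[of z] by (auto simp: complex_nonpos_Reals_iff complex_is_Real_iff)
  moreover have "- pi < Arg z" "Arg z \<le> pi" using Arg_bounded[of z] by auto
  ultimately have "\<bar>Arg z\<bar> < pi" by auto
  then show ?thesis using nz by (intro exI[of _ "cmod z"] exI[of _ "Arg z"]) (auto simp: rcis_cmod_Arg)
qed

lemma symb_holomorphic:
  assumes "0 \<le> k"
  shows "symb b t k holomorphic_on (- \<real>\<^sub>\<le>\<^sub>0)"
proof -
  have "z powr of_real \<alpha> * of_real k + of_real \<delta> \<noteq> 0" if "z \<in> - \<real>\<^sub>\<le>\<^sub>0" for z :: complex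
  proof -
    obtain r \<theta> where *: "z = rcis r \<theta>" "0 < r" "\<bar>\<theta>\<bar> < pi" using slit_rcis[OF \<open>z \<in> - \<real>\<^sub>\<le>\<^sub>0\<close>] by auto
    show ?thesis using denom_ge[OF *(2,3) assms] denom_pos(2)[OF *(2) assms] unfolding *(1) by auto
  qed
  then show ?thesis unfolding symb_def by (intro holomorphic_intros) auto
qed

lemma symb_cont: "0 \<le> k ==> continuous_on (- \<real>\<^sub>\<le>\<^sub>0) (symb b t k)"
  by (rule holomorphic_on_imp_continuous_on[OF symb_holomorphic])

lemma norm_symb:
  assumes "0 < r" "\<bar>\<theta>\<bar> \<le> \<eta>" "0 \<le> k"
  shows "cmod (symb b t k (rcis r \<theta>)) \<le> exp (t * (r * cos \<theta>)) * r powr b / (angle * (r powr \<alpha> * k + \<delta>))"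
proof -
  have \<theta>: "\<bar>\<theta>\<bar> < pi" using assms \<eta> by simp
  have "cmod (symb b t k (rcis r \<theta>)) = exp (t * (r * cos \<theta>)) * r powr b / cmod (rcis r \<theta> powr of_real \<alpha> * of_real k + of_real \<delta>)"
    unfolding symb_def norm_divide norm_mult using assms by (simp add: norm_powr_real_powr' mult.commute)
  also have "\<dots> \<le> exp (t * (r * cos \<theta>)) * r powr b / (angle * (r powr \<alpha> * k + \<delta>))"
    using denom_ge[OF assms(1) \<theta> assms(3)] denom_pos(2)[OF assms(1,3)] by (intro frac_le) auto
  finally show ?thesis .
qed

lemma norm_symb_K:
  assumes "0 < r" "\<bar>\<theta>\<bar> \<le> \<eta>" "0 \<le> k" and le: "r powr b \<le> C * (r powr \<alpha> * k + \<delta>) * r powr (- q)"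
  shows "cmod (symb b t k (rcis r \<theta>)) \<le> (C / angle) * exp (t * (r * cos \<theta>)) * r powr (- q)"
proof -
  have "exp (t * (r * cos \<theta>)) * r powr b / (angle * (r powr \<alpha> * k + \<delta>))
      \<le> exp (t * (r * cos \<theta>)) * (C * (r powr \<alpha> * k + \<delta>) * r powr (- q)) / (angle * (r powr \<alpha> * k + \<delta>))"
    using denom_pos(2)[OF assms(1,3)] by (intro divide_right_mono mult_left_mono le) auto
  also have "\<dots> = (C / angle) * exp (t * (r * cos \<theta>)) * r powr (- q)"
    using denom_pos(1)[OF assms(1,3)] angle_pos by simp
  finally show ?thesis using norm_symb[OF assms(1-3), of b t] by simp
qed

lemma symb_outside:
  assumes b: "b \<le> 0" and r: "\<rho> \<le> r" "\<bar>\<theta>\<bar> \<le> \<eta>" and k: "0 \<le> k"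
  shows "cmod (symb b t k (rcis r \<theta>)) \<le> (\<rho> powr b / \<delta> / angle) * exp (t * (r * cos \<theta>))"
proof -
  have r0: "0 < r" using r \<rho> by simp
  have "r powr b \<le> \<rho> powr b" using b r \<rho> by (intro powr_mono2') auto
  also have "\<dots> = \<rho> powr b / \<delta> * \<delta>" using \<delta> by simp
  also have "\<dots> \<le> \<rho> powr b / \<delta> * (r powr \<alpha> * k + \<delta>)" using k \<delta> by (intro mult_left_mono) auto
  finally show ?thesis using norm_symb_K[OF r0 r(2) k, of b "\<rho> powr b / \<delta>" 0 t] r0 by simp
qed

lemma symb_ray: "b \<le> 0 ==> 0 \<le> k ==> ray_bound \<rho> (t * decay) (\<rho> powr b / \<delta> / angle) (symb b t k)"
  using symb_outside[of b _ _ k t] cos_ray unfolding ray_bound_def by (fastforce simp: ac_simps)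

text \<open>The constant of \<open>cint_scaled\<close> together with the loss 1 /
  \<open>angle\<close> from the denominator.\<close>

definition CK :: real where "CK = (2 * \<eta> * exp 1 + 2 / decay) / angle"

lemma CK_nonneg: "0 \<le> CK"
  unfolding CK_def using eta_pos decay angle_pos by simp

text \<open>Power counting: a symbol of size r^(-q) at radius r gives a kernel of size t^(q-1). The
  assumption on the size is stated with the denominator multiplied out.\<close>

lemma ker_bound:
  assumes t: "0 < t" and q: "0 \<le> q" and k: "0 \<le> k" and C: "0 \<le> C"
    and le: "\<And>r. 0 < r ==> r powr b \<le> C * (r powr \<alpha> * k + \<delta>) * r powr (- q)"
  shows "\<bar>ker b t k\<bar> \<le> CK * C * t powr (q - 1)"
proof -
  have "\<bar>ker b t k\<bar> \<le> cmod (cint \<rho> \<eta> (symb b t k))"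
    unfolding ker_def by (rule abs_Re_prefactor)
  also have "\<dots> \<le> (C / angle) * (2 * \<eta> * exp 1 + 2 / decay) * t powr (q - 1)"
  proof (rule cint_scaled(1)[OF symb_holomorphic[OF k] \<rho> t q])
    show "0 \<le> C / angle" using C angle_pos by simp
  qed (rule norm_symb_K[OF _ _ k le])
  finally show ?thesis unfolding CK_def by (simp add: ac_simps)
qed

text \<open>The denominator is interpolated between its summands: X^(1-\<gamma>) \<delta>^\<gamma>
  \<le> X + \<delta> with X = r^\<alpha> k. This produces the power k^(1-\<gamma>) that the symbol
  of A^\<gamma> T_\<alpha>(t) carries, and the decay r^(-\<alpha>(1-\<gamma>)) fixes the exponent of
  t.\<close>

lemma ker_0_bound:
  assumes "0 < t" "0 < k" "0 \<le> \<gamma>" "\<gamma> \<le> 1"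
  shows "k powr (1 - \<gamma>) * \<bar>ker 0 t k\<bar> \<le> CK * \<delta> powr (- \<gamma>) * t powr (\<alpha> * (1 - \<gamma>) - 1)"
proof -
  have "\<bar>ker 0 t k\<bar> \<le> CK * (k powr (\<gamma> - 1) * \<delta> powr (- \<gamma>)) * t powr (\<alpha> * (1 - \<gamma>) - 1)"
  proof (rule ker_bound)
    fix r :: real assume r: "0 < r"
    let ?X = "r powr \<alpha> * k"
    have X: "0 < ?X" using r assms by simp
    have "?X powr (1 - \<gamma>) * \<delta> powr \<gamma> \<le> (?X + \<delta>) powr (1 - \<gamma>) * (?X + \<delta>) powr \<gamma>"
      using X \<delta> assms by (intro mult_mono powr_mono2) auto
    also have "\<dots> = ?X + \<delta>" using X \<delta> by (simp flip: powr_add)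
    finally have "k powr (\<gamma> - 1) * \<delta> powr (- \<gamma>) * (?X powr (1 - \<gamma>) * \<delta> powr \<gamma>) * r powr (- (\<alpha> * (1 - \<gamma>)))
        \<le> k powr (\<gamma> - 1) * \<delta> powr (- \<gamma>) * (?X + \<delta>) * r powr (- (\<alpha> * (1 - \<gamma>)))"
      by (intro mult_right_mono mult_left_mono) auto
    moreover have "k powr (\<gamma> - 1) * \<delta> powr (- \<gamma>) * (?X powr (1 - \<gamma>) * \<delta> powr \<gamma>) * r powr (- (\<alpha> * (1 - \<gamma>))) = 1"
      using r assms \<delta> by (simp add: powr_mult powr_powr powr_minus powr_diff field_simps)
    ultimately show "r powr 0 \<le> k powr (\<gamma> - 1) * \<delta> powr (- \<gamma>) * (r powr \<alpha> * k + \<delta>) * r powr (- (\<alpha> * (1 - \<gamma>)))"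
      using r by simp
  qed (use assms \<alpha> in auto)
  then have "k powr (1 - \<gamma>) * \<bar>ker 0 t k\<bar> \<le> k powr (1 - \<gamma>) * (CK * (k powr (\<gamma> - 1) * \<delta> powr (- \<gamma>)) * t powr (\<alpha> * (1 - \<gamma>) - 1))"
    by (intro mult_left_mono) auto
  also have "\<dots> = (k powr (1 - \<gamma>) * k powr (\<gamma> - 1)) * (CK * \<delta> powr (- \<gamma>) * t powr (\<alpha> * (1 - \<gamma>) - 1))" by (simp only: ac_simps)
  also have "k powr (1 - \<gamma>) * k powr (\<gamma> - 1) = 1" using assms by (simp flip: powr_add)
  finally show ?thesis by simp
qed

lemma ker_1_bound:
  assumes "0 < t" "0 < k"
  shows "k * \<bar>ker (\<alpha> - 1) t k\<bar> \<le> CK"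
proof -
  have "\<bar>ker (\<alpha> - 1) t k\<bar> \<le> CK * (1 / k) * t powr (1 - 1)"
  proof (rule ker_bound)
    fix r :: real assume r: "0 < r"
    have "r powr (\<alpha> - 1) = (1 / k) * (r powr \<alpha> * k) * r powr (- 1)"
      using r assms by (simp add: powr_diff powr_minus divide_inverse)
    also have "\<dots> \<le> (1 / k) * (r powr \<alpha> * k + \<delta>) * r powr (- 1)"
      using assms \<delta> by (intro mult_right_mono mult_left_mono) auto
    finally show "r powr (\<alpha> - 1) \<le> (1 / k) * (r powr \<alpha> * k + \<delta>) * r powr (- 1)" .
  qed (use assms in auto)
  then show ?thesis using assms by (simp add: field_simps)
qed

lemma cint_scale: "cint r \<eta> (%z. c * h z) = c * cint r \<eta> h"
  unfolding cint_def right_diff_distrib distrib_left set_integral_mult_right[symmetric] by (simp only: ac_simps)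

text \<open>Subtracting exp(z t) / z, whose contour integral is known, leaves -\<delta> exp(z t) /
  (z (z^\<alpha> k + \<delta>)). Bounding the denominator below by its first summand gains
  |z|^(-\<alpha>), hence t^\<alpha>, at the cost of 1 / k; the outer factor k is the weight of
  \<open>Phi_tendsto\<close>.\<close>

lemma ker_1_limit:
  assumes t: "0 < t" and k: "0 < k"
  shows "k * \<bar>k * ker (\<alpha> - 1) t k - 1\<bar> \<le> CK * \<delta> * t powr \<alpha>"
proof -
  let ?e = "%z. exp (z * of_real t) / z" and ?s = "%z. of_real k * symb (\<alpha> - 1) t k z" and ?S = "- \<real>\<^sub>\<le>\<^sub>0 :: complex set"
  let ?d = "%z. ?s z - ?e z"
  have he: "?e holomorphic_on ?S" by (auto intro!: holomorphic_intros)
  have hs: "?s holomorphic_on ?S" by (intro holomorphic_intros symb_holomorphic) (use k in auto)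
  have b: "cmod (?d (rcis r \<theta>)) \<le> (\<delta> / (k * angle)) * exp (t * (r * cos \<theta>)) * r powr (- (1 + \<alpha>))"
    if r: "0 < r" and \<theta>: "\<bar>\<theta>\<bar> \<le> \<eta>" for r \<theta>
  proof -
    let ?z = "rcis r \<theta>"
    let ?D = "?z powr of_real \<alpha> * of_real k + of_real \<delta>"
    have D: "angle * (r powr \<alpha> * k + \<delta>) \<le> cmod ?D" using denom_ge[OF r] \<theta> \<eta> k by simp
    have nz: "?z \<noteq> 0" "?D \<noteq> 0" using r D denom_pos(2)[OF r, of k] k by auto
    have p: "?z powr of_real (\<alpha> - 1) = ?z powr of_real \<alpha> / ?z" using nz(1) by (simp add: powr_diff)
    have "?d ?z = exp (?z * of_real t) * (of_real k * ?z powr of_real \<alpha> - ?D) / (?z * ?D)"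
      unfolding symb_def p using nz by (simp add: divide_simps) (simp add: algebra_simps)
    also have "\<dots> = - exp (?z * of_real t) * of_real \<delta> / (?z * ?D)" by simp
    finally have "cmod (?d ?z) = exp (t * (r * cos \<theta>)) * \<delta> / (r * cmod ?D)"
      using r \<delta> by (simp add: norm_mult norm_divide mult.commute)
    also have "\<dots> \<le> exp (t * (r * cos \<theta>)) * \<delta> / (r * (angle * (r powr \<alpha> * k)))"
    proof -
      have "angle * (r powr \<alpha> * k) \<le> cmod ?D"
        by (rule order_trans[OF mult_left_mono D]) (use \<delta> angle_pos in auto)
      then show ?thesis using r k angle_pos \<delta> by (intro frac_le mult_left_mono) auto
    qed
    also have "\<dots> = (\<delta> / (k * angle)) * exp (t * (r * cos \<theta>)) * r powr (- (1 + \<alpha>))"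
    proof -
      have "r powr (- (1 + \<alpha>)) = 1 / (r * r powr \<alpha>)" using r unfolding powr_minus_divide powr_add by simp
      then show ?thesis by (simp only:) (simp add: ac_simps)
    qed
    finally show ?thesis .
  qed
  have "ray_bound \<rho> (t * decay) (k * (\<rho> powr (\<alpha> - 1) / \<delta> / angle)) ?s"
    unfolding ray_bound_def norm_mult norm_of_real abs_of_pos[OF k] mult.assoc[of k] using symb_ray[of "\<alpha> - 1" k t] \<alpha> k
    by (auto simp: ray_bound_def intro!: mult_left_mono simp del: times_divide_eq_left times_divide_eq_right)
  moreover have "ray_bound \<rho> (t * decay) (1 / \<rho>) ?e"
    unfolding ray_bound_def
  proof (intro allI impI)
    fix s \<theta> assume "\<rho> \<le> s" "\<bar>\<theta>\<bar> = \<eta>"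
    then show "cmod (?e (rcis s \<theta>)) \<le> 1 / \<rho> * exp (- (t * decay * s))"
      using \<rho> cos_ray[of \<theta>] by (simp add: norm_divide ac_simps divide_left_mono)
  qed
  ultimately have "cint \<rho> \<eta> ?d = of_real k * cint \<rho> \<eta> (symb (\<alpha> - 1) t k) - 2 * of_real pi * \<i>"
    using t decay unfolding cint_scale[symmetric] hankel_integral[OF \<rho> t, symmetric]
    by (intro cint_diff[OF \<rho> holomorphic_on_imp_continuous_on[OF hs] holomorphic_on_imp_continuous_on[OF he], of "t * decay"]) auto
  moreover have "Re (of_real k * w / c) = k * Re (w / c)" for w c
    unfolding times_divide_eq_right[symmetric] by (simp only: times_complex.sel Re_complex_of_real Im_complex_of_real mult_zero_left diff_zero)
  ultimately have "k * ker (\<alpha> - 1) t k - 1 = Re (cint \<rho> \<eta> ?d / (2 * of_real pi * \<i>))"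
    unfolding ker_def by (simp add: diff_divide_distrib)
  then have "\<bar>k * ker (\<alpha> - 1) t k - 1\<bar> \<le> cmod (cint \<rho> \<eta> ?d)"
    using abs_Re_prefactor[of "cint \<rho> \<eta> ?d"] by (simp only:)
  also have "\<dots> \<le> (\<delta> / (k * angle)) * (2 * \<eta> * exp 1 + 2 / decay) * t powr (1 + \<alpha> - 1)"
  proof (rule cint_scaled(1)[OF holomorphic_on_diff[OF hs he] \<rho> t])
    show "0 \<le> \<delta> / (k * angle)" using \<delta> k angle_pos by simp
  qed (use b \<alpha> in auto)
  finally have "k * \<bar>k * ker (\<alpha> - 1) t k - 1\<bar> \<le> k * ((\<delta> / (k * angle)) * (2 * \<eta> * exp 1 + 2 / decay) * t powr (1 + \<alpha> - 1))"
    using k by (intro mult_left_mono) auto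
  also have "\<dots> = CK * \<delta> * t powr \<alpha>" unfolding CK_def using k by simp
  finally show ?thesis .
qed

text \<open>Uniformity in k is what passes from symbols to operators; it holds because the
  denominator never falls below \<open>angle\<close> \<delta>. The distance a from t = 0 provides
  the decay along the rays.\<close>

lemma ker_lipschitz:
  assumes a: "0 < a" and b: "b \<le> 0"
  shows "\<exists>M. \<forall>s\<in>{a..T}. \<forall>t\<in>{a..T}. \<forall>k\<in>{0..1}. \<bar>ker b s k - ker b t k\<bar> \<le> M * \<bar>s - t\<bar>"
proof -
  define N where "N = \<rho> powr b / \<delta> / angle"
  \<comment> \<open>Half of the decay rate is spent on the factor |z| that differentiation of exp(z
    t) in t produces.\<close>
  define c where "c = a * decay / 2"
  have N: "0 \<le> N" and c: "0 < c" "0 < 2 * c" using \<delta> angle_pos a decay by (auto simp: N_def c_def)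
  define M where "M = 2 * \<eta> * \<rho> * (\<rho> * exp (\<bar>T\<bar> * \<rho>) * N) + 2 * (N / c) * (exp (- (c * \<rho>)) / c)"
  have "\<bar>ker b s k - ker b t k\<bar> \<le> M * \<bar>s - t\<bar>" if st: "s \<in> {a..T}" "t \<in> {a..T}" and k: "0 \<le> k" for s t k
  proof -
    let ?h = "symb b s k" and ?g = "symb b t k"
    have pt: "cmod (?h (rcis r \<theta>) - ?g (rcis r \<theta>)) \<le> r * E * \<bar>s - t\<bar> * N"
      if r: "\<rho> \<le> r" "\<bar>\<theta>\<bar> \<le> \<eta>" and E: "\<And>\<tau>. \<tau> \<in> {a..T} ==> exp (\<tau> * (r * cos \<theta>)) \<le> E" for r \<theta> E
    proof -
      let ?z = "rcis r \<theta>"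
      have "?h ?z - ?g ?z = (exp (?z * of_real s) - exp (?z * of_real t)) * symb b 0 k ?z"
        by (simp add: symb_def diff_divide_distrib algebra_simps)
      moreover have "cmod (exp (?z * of_real s) - exp (?z * of_real t)) \<le> cmod ?z * E * \<bar>s - t\<bar>"
      proof (rule exp_diff_le)
        fix \<tau> assume "\<tau> \<in> closed_segment s t"
        then have "\<tau> \<in> {a..T}" using st by (auto simp: closed_segment_eq_real_ivl split: if_splits)
        then show "exp (\<tau> * Re ?z) \<le> E" using E by simp
      qed
      moreover have "cmod (symb b 0 k ?z) \<le> N" using symb_outside[OF b r k, of 0] by (simp add: N_def)
      ultimately show ?thesis using r \<rho> N by (simp only: norm_mult) (auto intro!: mult_mono order_trans[OF norm_ge_zero])
    qed
    have ex: "exp (\<tau> * (r * cos \<theta>)) \<le> exp (- (2 * c * r))" if "\<rho> \<le> r" "\<bar>\<theta>\<bar> = \<eta>" "\<tau> \<in> {a..T}" for \<tau> r \<theta>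
    proof -
      have "a * (r * decay) \<le> \<tau> * (r * decay)" using that decay \<rho> by (intro mult_right_mono) auto
      then show ?thesis using cos_ray[OF that(2)] by (simp add: c_def ac_simps)
    qed
    have "ray_bound \<rho> (2 * c) N (symb b \<tau> k)" if "\<tau> \<in> {a..T}" for \<tau>
      unfolding ray_bound_def
      using order_trans[OF symb_outside[OF b _ _ k, of _ _ \<tau>, folded N_def] mult_left_mono[OF ex[OF _ _ that] N]] by auto
    note eq = cint_diff[OF \<rho> symb_cont[OF k] symb_cont[OF k] c(2) this[OF st(1)] this[OF st(2)]]
    have "ray_bound \<rho> c (N / c * \<bar>s - t\<bar>) (%z. ?h z - ?g z)"
      unfolding ray_bound_def
    proof (intro allI impI)
      fix r \<theta> assume r: "\<rho> \<le> r" "\<bar>\<theta>\<bar> = \<eta>"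
      have "c * r \<le> exp (c * r)" using exp_ge_add_one_self[of "c * r"] by linarith
      then have "c * r * exp (- (2 * c * r)) \<le> exp (c * r) * exp (- (2 * c * r))" by (intro mult_right_mono) auto
      also have "\<dots> = exp (- (c * r))" by (simp flip: exp_add)
      finally have "r * exp (- (2 * c * r)) \<le> exp (- (c * r)) / c" using c by (simp add: field_simps)
      then have "r * exp (- (2 * c * r)) * \<bar>s - t\<bar> * N \<le> exp (- (c * r)) / c * \<bar>s - t\<bar> * N"
        using N by (intro mult_right_mono) auto
      then show "cmod (?h (rcis r \<theta>) - ?g (rcis r \<theta>)) \<le> N / c * \<bar>s - t\<bar> * exp (- (c * r))"
        using order_trans[OF pt[OF r(1) _ ex[OF r]]] r(2) by (simp add: ac_simps)
    qed
    then have "cmod (cint \<rho> \<eta> (%z. ?h z - ?g z)) \<le> 2 * \<eta> * \<rho> * (\<rho> * exp (\<bar>T\<bar> * \<rho>) * \<bar>s - t\<bar> * N) + 2 * (N / c * \<bar>s - t\<bar>) * (exp (- (c * \<rho>)) / c)"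
    proof (rule cint_bound(4)[OF \<rho> continuous_on_diff[OF symb_cont[OF k] symb_cont[OF k]] c(1)])
      fix \<theta> assume \<theta>: "\<bar>\<theta>\<bar> \<le> \<eta>"
      show "cmod (?h (rcis \<rho> \<theta>) - ?g (rcis \<rho> \<theta>)) \<le> \<rho> * exp (\<bar>T\<bar> * \<rho>) * \<bar>s - t\<bar> * N"
      proof (rule pt[OF order_refl \<theta>])
        fix \<tau> assume "\<tau> \<in> {a..T}"
        then have "\<tau> * (\<rho> * cos \<theta>) \<le> \<tau> * (\<rho> * 1)" "\<tau> * (\<rho> * 1) \<le> \<bar>T\<bar> * (\<rho> * 1)"
          using a \<rho> by (auto intro!: mult_left_mono mult_right_mono)
        then show "exp (\<tau> * (\<rho> * cos \<theta>)) \<le> exp (\<bar>T\<bar> * \<rho>)" by simp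
      qed
    qed
    then have "cmod (cint \<rho> \<eta> (%z. ?h z - ?g z)) \<le> M * \<bar>s - t\<bar>" unfolding M_def by (simp add: algebra_simps)
    then show ?thesis
      using abs_Re_prefactor[of "cint \<rho> \<eta> (%z. ?h z - ?g z)"] unfolding ker_def eq diff_divide_distrib minus_complex.simps by linarith
  qed
  then show ?thesis by (intro exI[of _ M]) auto
qed

end

section \<open>Fractional powers and solution operators\<close>

lemma powr_continuous_01: "0 < b ==> 0 < d ==> continuous_on {0..1} (%k::real. (k / d) powr b)"
  by (intro continuous_on_powr' continuous_intros) auto

lemma integral_Pair:
  fixes f :: "'c => 'a::{banach, second_countable_topology}" and g :: "'c => 'b::{banach, second_countable_topology}"
  assumes "integrable M f" "integrable M g"
  shows "integrable M (%x. (f x, g x))" "integral\<^sup>L M (%x. (f x, g x)) = (integral\<^sup>L M f, integral\<^sup>L M g)"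
proof -
  have l: "bounded_linear (%a. (a, 0::'b))" "bounded_linear (%b. (0::'a, b))"
    by (intro bounded_linear_Pair bounded_linear_ident bounded_linear_zero)+
  show i: "integrable M (%x. (f x, g x))"
    using Bochner_Integration.integrable_add[OF integrable_bounded_linear[OF l(1) assms(1)] integrable_bounded_linear[OF l(2) assms(2)]]
    by simp
  have "fst (integral\<^sup>L M (%x. (f x, g x))) = integral\<^sup>L M f" "snd (integral\<^sup>L M (%x. (f x, g x))) = integral\<^sup>L M g"
    using integral_bounded_linear[OF bounded_linear_fst i] integral_bounded_linear[OF bounded_linear_snd i] by simp_all
  then show "integral\<^sup>L M (%x. (f x, g x)) = (integral\<^sup>L M f, integral\<^sup>L M g)" by (simp add: prod_eq_iff)
qed

context positive_contraction
begin

text \<open>A complex symbol acting on a real vector gives a real and an imaginary component,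
  matching the pairs on which \<open>cscale\<close> operates.\<close>

definition PhiC :: "(real => complex) => 'a => 'a \<times> 'a" where
  "PhiC h x = (Phi (%k. Re (h k)) x, Phi (%k. Im (h k)) x)"

lemma PhiC_cong: "(\<And>t. 0 \<le> t ==> t \<le> 1 ==> f t = g t) ==> PhiC f x = PhiC g x"
  unfolding PhiC_def by (intro prod_eqI) (auto intro!: Phi_cong)

lemma PhiC_cscale:
  assumes h: "continuous_on {0..1} h"
  shows "cscale c (PhiC h x) = PhiC (%k. c * h k) x"
proof -
  have c: "continuous_on {0..1} (%k. a * Re (h k))" "continuous_on {0..1} (%k. a * Im (h k))" for a
    by (intro continuous_intros h)+
  show ?thesis
    unfolding PhiC_def cscale_def
    by (simp add: Phi_diff[OF c(1) c(2)] Phi_add[OF c(2) c(1)] Phi_scale[OF continuous_on_Re[OF h]] Phi_scale[OF continuous_on_Im[OF h]])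
qed

lemma PhiC_add:
  assumes h: "continuous_on {0..1} h" and g: "continuous_on {0..1} g"
  shows "PhiC h x + PhiC g x = PhiC (%k. h k + g k) x"
  unfolding PhiC_def using Phi_add[OF continuous_on_Re[OF h] continuous_on_Re[OF g]] Phi_add[OF continuous_on_Im[OF h] continuous_on_Im[OF g]]
  by simp

lemma PhiC_diff:
  assumes h: "continuous_on {0..1} h" and g: "continuous_on {0..1} g"
  shows "PhiC h x - PhiC g x = PhiC (%k. h k - g k) x"
  unfolding PhiC_def using Phi_diff[OF continuous_on_Re[OF h] continuous_on_Re[OF g]] Phi_diff[OF continuous_on_Im[OF h] continuous_on_Im[OF g]]
  by simp

lemma PhiC_integral:
  fixes G :: "real => real => complex"
  assumes A: "A \<in> sets lborel" and G: "\<And>s. s \<in> A ==> continuous_on {0..1} (G s)"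
    and int: "\<And>k. 0 \<le> k ==> k \<le> 1 ==> set_integrable lborel A (%s. G s k)"
    and w: "set_integrable lborel A w" "\<And>s k. s \<in> A ==> 0 \<le> k ==> k \<le> 1 ==> cmod (G s k) \<le> w s"
    and g: "\<And>s. s \<in> A ==> g s = PhiC (G s) x"
  shows "continuous_on {0..1} (%k. LINT s:A|lborel. G s k)"
    and "(LINT s:A|lborel. g s) = PhiC (%k. LINT s:A|lborel. G s k) x"
proof -
  let ?g = "%p s k. indicator A s * p (G s k) :: real"
  have I: "(LINT s:A|lborel. G s k) = Complex (LINT s|lborel. ?g Re s k) (LINT s|lborel. ?g Im s k)" if "0 \<le> k" "k \<le> 1" for k
    using integral_bounded_linear[OF bounded_linear_Re int[OF that, unfolded set_integrable_def]]
      integral_bounded_linear[OF bounded_linear_Im int[OF that, unfolded set_integrable_def]]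
    by (simp add: set_lebesgue_integral_def complex_eq_iff)
  have c: "continuous_on {0..1} (?g p s)" if "p = Re \<or> p = Im" for p s
  proof (cases "s \<in> A")
    case True
    then show ?thesis using that G by (auto intro!: continuous_intros)
  qed simp
  have m: "(%s. ?g p s k) \<in> borel_measurable lborel" if "p = Re \<or> p = Im" "0 \<le> k" "k \<le> 1" for p k
    using borel_measurable_integrable[OF integrable_bounded_linear[OF bounded_linear_Re int[OF that(2,3), unfolded set_integrable_def]]]
      borel_measurable_integrable[OF integrable_bounded_linear[OF bounded_linear_Im int[OF that(2,3), unfolded set_integrable_def]]] that(1)
    by auto
  have b: "\<bar>?g p s k\<bar> \<le> indicator A s *\<^sub>R w s" if "p = Re \<or> p = Im" "0 \<le> k" "k \<le> 1" for p s k
    using w(2)[of s k] that abs_Re_le_cmod[of "G s k"] abs_Im_le_cmod[of "G s k"] by (auto simp: indicator_def)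
  note r = Phi_integral[OF c m w(1)[unfolded set_integrable_def] b]
  have cr: "continuous_on {0..1} (%k. LINT s|lborel. ?g Re s k)" by (rule r(1)) auto
  have ci: "continuous_on {0..1} (%k. LINT s|lborel. ?g Im s k)" by (rule r(1)) auto
  have "continuous_on {0..1} (%k. Complex (LINT s|lborel. ?g Re s k) (LINT s|lborel. ?g Im s k))"
    using cr ci by (intro continuous_on_Complex)
  then show "continuous_on {0..1} (%k. LINT s:A|lborel. G s k)"
    by (rule continuous_on_eq) (auto simp: I)
  have ir: "integrable lborel (%s. Phi (?g Re s) x)" "(LINT s|lborel. Phi (?g Re s) x) = Phi (%k. LINT s|lborel. ?g Re s k) x"
    by (rule r(2); auto) (rule r(3); auto)
  have ii: "integrable lborel (%s. Phi (?g Im s) x)" "(LINT s|lborel. Phi (?g Im s) x) = Phi (%k. LINT s|lborel. ?g Im s k) x"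
    by (rule r(2); auto) (rule r(3); auto)
  have "(LINT s:A|lborel. g s) = (LINT s|lborel. (Phi (?g Re s) x, Phi (?g Im s) x))"
    unfolding set_lebesgue_integral_def by (intro Bochner_Integration.integral_cong) (auto simp: indicator_def g PhiC_def Phi_0 zero_prod_def)
  also have "\<dots> = PhiC (%k. LINT s:A|lborel. G s k) x"
    unfolding integral_Pair(2)[OF ir(1) ii(1)] ir(2) ii(2) PhiC_def by (intro prod_eqI) (auto intro!: Phi_cong simp: I)
  finally show "(LINT s:A|lborel. g s) = PhiC (%k. LINT s:A|lborel. G s k) x" .
qed

end

section \<open>Negative powers and resolvents\<close>

context bounded_open_set
begin

lemma flat_eq_exp: "0 < k ==> flat 1 c k = exp (- (c / k))"
  by (simp add: flat_def)

abbreviation Q :: "l2 => l2" where "Q \<equiv> neg_pow \<Omega> (1/2)"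
abbreviation Q4 :: "l2 => l2" where "Q4 \<equiv> neg_pow \<Omega> (1/4)"

text \<open>For fixed k > 0 the integral of t^(\<beta>-1) exp(-t \<open>gap\<close> / k) is
  Gamma(\<beta>) (k / \<open>gap\<close>)^\<beta>, and at k = 0 both sides vanish. Since k \<le> 1,
  the integrand at k = 1 dominates all others.\<close>

lemma neg_pow_eq:
  assumes x: "x \<in> H" and \<beta>: "0 < \<beta>"
  shows "neg_pow \<Omega> \<beta> x = fc.Phi (%k. (k / gap) powr \<beta>) x"
proof -
  let ?g = "%t k. indicator {0<..} t * (t powr (\<beta> - 1) * flat 1 (t * gap) k) :: real"
  let ?w = "%t. indicator {0..} t * (t powr (\<beta> - 1) * exp (- (gap * t))) :: real"
  have w: "integrable lborel ?w" by (rule integrable.intros[OF Gamma_exp_integral[OF \<beta> gap(1)]])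
  have c: "continuous_on {0..1} (?g t)" for t
    using fc.flat_continuous[of "t * gap"] gap(1) by (cases "0 < t") (auto intro!: continuous_intros)
  have b: "\<bar>?g t k\<bar> \<le> ?w t" if "0 \<le> k" "k \<le> 1" for t k
  proof (cases "0 < t \<and> 0 < k")
    case True
    have "gap * t \<le> t * gap / k" using True that gap(1) by (simp add: le_divide_eq mult.commute mult_left_le_one_le)
    then show ?thesis using True by (auto simp: flat_eq_exp indicator_def intro!: mult_left_mono)
  qed (use that in \<open>auto simp: flat_def indicator_def\<close>)
  have ev: "?g t k = indicator {0..} t * (t powr (\<beta> - 1) * exp (- (gap / k * t)))" if "0 < k" "t \<noteq> 0" for t k
    using that by (auto simp: flat_eq_exp indicator_def mult.commute)
  have hb: "has_bochner_integral lborel (%t. ?g t k) (Gamma \<beta> * (k / gap) powr \<beta>)" if "0 \<le> k" "k \<le> 1" for k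
  proof (cases "k = 0")
    case False
    then have k: "0 < k" using that by simp
    have ae: "AE t in lborel. ?g t k = indicator {0..} t * (t powr (\<beta> - 1) * exp (- (gap / k * t)))"
      using AE_lborel_singleton[of 0] by eventually_elim (rule ev[OF k])
    have "(%t. ?g t k) \<in> borel_measurable borel"
      unfolding flat_eq_exp[OF k] by measurable
    then have "has_bochner_integral lborel (%t. ?g t k) (Gamma \<beta> * (gap / k) powr - \<beta>)"
      by (subst has_bochner_integral_cong_AE[OF _ _ ae]) (use Gamma_exp_integral[OF \<beta>, of "gap / k"] k gap(1) in auto)
    moreover have "(gap / k) powr - \<beta> = (k / gap) powr \<beta>"
      using k gap(1) by (simp add: powr_minus_divide powr_divide)
    ultimately show ?thesis by simp
  qed (simp add: flat_def has_bochner_integral_zero)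
  note P = fc.Phi_integral[of lborel ?g ?w, OF c borel_measurable_integrable[OF integrable.intros[OF hb]] w b]
  have "(LINT t:{0<..}|lborel. (t powr (\<beta> - 1)) *\<^sub>R stokes_semigroup \<Omega> t x) = (LINT t|lborel. fc.Phi (?g t) x)"
    unfolding set_lebesgue_integral_def
  proof (rule Bochner_Integration.integral_cong)
    fix t :: real
    show "indicator {0<..} t *\<^sub>R (t powr (\<beta> - 1)) *\<^sub>R stokes_semigroup \<Omega> t x = fc.Phi (?g t) x"
      using gap(1) by (cases "0 < t") (simp_all add: stokes_semigroup_eq[OF x] fc.semi_def fc.Phi_scale fc.flat_continuous fc.Phi_0)
  qed simp
  also have "\<dots> = fc.Phi (%k. LINT t|lborel. ?g t k) x" by (rule P(3)) auto
  also have "\<dots> = fc.Phi (%k. Gamma \<beta> * (k / gap) powr \<beta>) x"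
    by (rule fc.Phi_cong) (rule has_bochner_integral_integral_eq[OF hb])
  also have "\<dots> = Gamma \<beta> *\<^sub>R fc.Phi (%k. (k / gap) powr \<beta>) x"
    by (rule fc.Phi_scale[OF powr_continuous_01[OF \<beta> gap(1)]])
  finally show ?thesis using Gamma_real_pos[OF \<beta>] unfolding neg_pow_def by simp
qed

lemma neg_pow_in: "x \<in> H ==> 0 < \<beta> ==> neg_pow \<Omega> \<beta> x \<in> H"
  using fc.Phi_in_H[OF powr_continuous_01[OF _ gap(1)]] by (simp add: neg_pow_eq H_eq)

lemma neg_pow_Phi:
  assumes x: "x \<in> H" and \<beta>: "0 < \<beta>" and f: "continuous_on {0..1} f"
  shows "neg_pow \<Omega> \<beta> (fc.Phi f x) = fc.Phi (%k. (k / gap) powr \<beta> * f k) x"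
  using fc.Phi_in_H[OF f, of x] x fc.Phi_mult[OF powr_continuous_01[OF \<beta> gap(1)] f] by (simp add: neg_pow_eq[OF _ \<beta>] H_eq)

lemma neg_pow_linear:
  assumes "x \<in> H" "y \<in> H" "0 < \<beta>"
  shows "neg_pow \<Omega> \<beta> (x - y) = neg_pow \<Omega> \<beta> x - neg_pow \<Omega> \<beta> y"
    "neg_pow \<Omega> \<beta> (x + y) = neg_pow \<Omega> \<beta> x + neg_pow \<Omega> \<beta> y"
    "neg_pow \<Omega> \<beta> (c *\<^sub>R x) = c *\<^sub>R neg_pow \<Omega> \<beta> x"
proof -
  note l = fc.Phi_linear[OF powr_continuous_01[OF assms(3) gap(1)]]
  note s = subspace_diff[OF subspace_L2_sigma assms(1,2)] subspace_add[OF subspace_L2_sigma assms(1,2)] subspace_mul[OF subspace_L2_sigma assms(1), of c]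
  show "neg_pow \<Omega> \<beta> (x - y) = neg_pow \<Omega> \<beta> x - neg_pow \<Omega> \<beta> y"
    "neg_pow \<Omega> \<beta> (x + y) = neg_pow \<Omega> \<beta> x + neg_pow \<Omega> \<beta> y"
    "neg_pow \<Omega> \<beta> (c *\<^sub>R x) = c *\<^sub>R neg_pow \<Omega> \<beta> x"
    using assms s by (simp_all add: neg_pow_eq linear_diff[OF l] linear_add[OF l] linear_scale[OF l])
qed

lemma neg_pow_inj:
  assumes \<beta>: "0 < \<beta>" "\<beta> \<le> 1"
  shows "inj_on (neg_pow \<Omega> \<beta>) H"
proof (rule inj_onI)
  fix x y assume xy: "x \<in> H" "y \<in> H" and eq: "neg_pow \<Omega> \<beta> x = neg_pow \<Omega> \<beta> y"
  have d: "x - y \<in> H" by (rule subspace_diff[OF subspace_L2_sigma xy])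
  have "fc.Phi (%k. (k / gap) powr \<beta>) (x - y) = 0"
    using neg_pow_linear(1)[OF xy \<beta>(1)] eq neg_pow_eq[OF d \<beta>(1)] by simp
  moreover have "fc.Phi (%k. (k / gap) powr \<beta>) (x - y) = fc.Phi (%k. gap powr (- \<beta>) * k powr \<beta>) (x - y)"
    using gap(1) by (intro fc.Phi_cong) (simp add: powr_divide powr_minus_divide)
  moreover have "\<dots> = gap powr (- \<beta>) *\<^sub>R fc.Phi (%k. k powr \<beta>) (x - y)"
    using powr_continuous_01[OF \<beta>(1), of 1] by (intro fc.Phi_scale) simp
  ultimately have "fc.Phi (%k. k powr \<beta>) (x - y) = 0" using gap(1) by simp
  then show "x = y" using fc.Phi_powr_inj[of "x - y" \<beta>] d \<beta> by (simp add: H_eq)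
qed

lemma frac_pow_neg_pow: "0 < \<beta> ==> \<beta> \<le> 1 ==> x \<in> H ==> frac_pow \<Omega> \<beta> (neg_pow \<Omega> \<beta> x) = x"
  unfolding frac_pow_def by (intro inv_into_f_f neg_pow_inj)

lemma frac_domainE:
  assumes "u \<in> frac_domain \<Omega> \<beta>" "0 < \<beta>" "\<beta> \<le> 1"
  shows "frac_pow \<Omega> \<beta> u \<in> H" "neg_pow \<Omega> \<beta> (frac_pow \<Omega> \<beta> u) = u"
  using assms frac_pow_neg_pow unfolding frac_domain_def by auto

lemma stokes_inv_op:
  assumes "a \<in> H"
  shows "inv_op a \<in> stokes_domain \<Omega>" "stokes \<Omega> (inv_op a) = gap *\<^sub>R a"
  using stokes_solve[of "gap *\<^sub>R a"] subspace_mul[OF subspace_L2_sigma assms]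
  by (simp_all add: inv_op_def linear_scale[OF linear_solve])

lemma stokes_domain_rep:
  assumes "u \<in> stokes_domain \<Omega>"
  obtains a where "a \<in> H" "u = inv_op a" "stokes \<Omega> u = gap *\<^sub>R a"
proof -
  obtain g where g: "g \<in> H" "u = solve g" using assms unfolding stokes_domain_eq by auto
  show ?thesis
    by (rule that[of "(1 / gap) *\<^sub>R g"]) (use g gap_nz stokes_solve[OF g(1)] subspace_mul[OF subspace_L2_sigma g(1)] in \<open>auto simp: solve_eq\<close>)
qed

text \<open>Pairing the complex equation with a + i b gives \<mu> q + \<open>gap\<close> s = 0,
  where q / s lies in [0,1] because of 0 \<le> \<open>inv_op\<close> \<le> 1. The nonvanishing of
  \<mu> k + \<open>gap\<close> on [0,1] excludes this unless s = 0.\<close>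

lemma resolvent_injective:
  assumes nz: "\<And>k. 0 \<le> k ==> k \<le> 1 ==> \<mu> * of_real k + of_real gap \<noteq> 0"
    and e: "Re \<mu> *\<^sub>R inv_op a - Im \<mu> *\<^sub>R inv_op b + gap *\<^sub>R a = 0" "Re \<mu> *\<^sub>R inv_op b + Im \<mu> *\<^sub>R inv_op a + gap *\<^sub>R b = 0"
  shows "a = 0" "b = 0"
proof -
  let ?q = "inner (inv_op a) a + inner (inv_op b) b" and ?s = "inner a a + inner b b"
  have sy: "inner (inv_op a) b = inner (inv_op b) a" using fc.sym[of a b] by (simp add: inner_commute)
  have 1: "Re \<mu> * ?q + gap * ?s = 0"
    using arg_cong[OF e(1), of "%v. inner v a"] arg_cong[OF e(2), of "%v. inner v b"] sy
    by (simp add: inner_add_left inner_diff_left algebra_simps)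
  have 2: "Im \<mu> * ?q = 0"
    using arg_cong[OF e(1), of "%v. inner v b"] arg_cong[OF e(2), of "%v. inner v a"] sy
    by (simp add: inner_add_left inner_diff_left inner_commute[of b a] algebra_simps)
  have q: "0 \<le> ?q" "?q \<le> ?s" using fc.nonneg fc.le_one by (simp_all add: add_mono)
  have "?s = 0"
  proof (rule ccontr)
    assume "?s \<noteq> 0"
    then have s: "0 < ?s" by (simp add: add_nonneg_nonneg less_le)
    then have "?q \<noteq> 0" using 1 gap(1) by auto
    then have "Im \<mu> = 0" using 2 by simp
    moreover have "Re \<mu> * (?q / ?s) + gap = (Re \<mu> * ?q + gap * ?s) / ?s"
      unfolding add_divide_distrib[of "Re \<mu> * ?q"] using s by simp
    ultimately have "\<mu> * of_real (?q / ?s) + of_real gap = 0" using 1 by (simp add: complex_eq_iff)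
    then show False using nz[of "?q / ?s"] q s by (simp add: divide_le_eq)
  qed
  then show "a = 0" "b = 0" by (simp_all add: add_nonneg_eq_0_iff)
qed

text \<open>Every element of the domain is \<open>inv_op\<close> of some a, and A maps it to
  \<open>gap\<close> a. In terms of a the resolvent equation reads (\<mu> k + \<open>gap\<close>) a
  = x, which the calculus solves; uniqueness identifies the preimage chosen by
  \<open>inv_into\<close>.\<close>

lemma stokes_resolvent_eq:
  assumes x: "x \<in> H" and nz: "\<And>k. 0 \<le> k ==> k \<le> 1 ==> \<mu> * of_real k + of_real gap \<noteq> 0"
  shows "stokes_resolvent \<Omega> \<mu> (x, 0) = fc.PhiC (%k. 1 / (\<mu> * of_real k + of_real gap)) (inv_op x)"
proof -
  let ?A = "stokes_domain \<Omega> \<times> stokes_domain \<Omega>" and ?G = "%z. cscale \<mu> z + map_prod (stokes \<Omega>) (stokes \<Omega>) z"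
  define q where "q k = 1 / (\<mu> * of_real k + of_real gap)" for k
  have qc: "continuous_on {0..1} q" unfolding q_def by (intro continuous_intros) (use nz in auto)
  have pc: "continuous_on {0..1} (%k. Re (q k))" "continuous_on {0..1} (%k. Im (q k))" by (intro continuous_intros qc)+
  define a where "a = fc.Phi (%k. Re (q k)) x"
  define b where "b = fc.Phi (%k. Im (q k)) x"
  have ab: "a \<in> H" "b \<in> H" unfolding a_def b_def using fc.Phi_in_H[of _ x] pc x by (auto simp: H_eq)
  have com: "inv_op (fc.Phi f x) = fc.Phi (%k. k * f k) x" "fc.Phi f (inv_op x) = inv_op (fc.Phi f x)" if "continuous_on {0..1} f" for f
    using fc.Phi_mult[OF continuous_on_id that, of x] fc.Phi_commute[OF continuous_on_id that, of x] by (simp_all add: fc.Phi_ident)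
  have z: "fc.PhiC q (inv_op x) = (inv_op a, inv_op b)" by (simp add: fc.PhiC_def a_def b_def com(2)[OF pc(1)] com(2)[OF pc(2)])
  have Gz: "?G (inv_op a, inv_op b) = (x, 0)"
  proof -
    have "?G (inv_op a, inv_op b) = cscale \<mu> (fc.PhiC (%k. of_real k * q k) x) + fc.PhiC (%k. of_real gap * q k) x"
      using pc by (simp add: stokes_inv_op(2) ab fc.PhiC_def com(1)[symmetric] fc.Phi_scale a_def[symmetric] b_def[symmetric])
    also have "\<dots> = fc.PhiC (%k. \<mu> * (of_real k * q k) + of_real gap * q k) x"
      by (subst fc.PhiC_cscale, intro continuous_intros qc, rule fc.PhiC_add) (intro continuous_intros qc)+
    also have "\<dots> = fc.PhiC (%k. 1) x"
      by (rule fc.PhiC_cong) (use nz in \<open>simp add: q_def divide_simps\<close>)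
    finally show ?thesis by (simp add: fc.PhiC_def fc.Phi_1 fc.Phi_0)
  qed
  have "y = (inv_op a, inv_op b)" if y: "y \<in> ?A" "?G y = (x, 0)" for y
  proof -
    from y have yd: "fst y \<in> stokes_domain \<Omega>" "snd y \<in> stokes_domain \<Omega>" by auto
    obtain c where c: "fst y = inv_op c" "stokes \<Omega> (fst y) = gap *\<^sub>R c" by (rule stokes_domain_rep[OF yd(1)])
    obtain d where d: "snd y = inv_op d" "stokes \<Omega> (snd y) = gap *\<^sub>R d" by (rule stokes_domain_rep[OF yd(2)])
    have E: "Re \<mu> *\<^sub>R inv_op a - Im \<mu> *\<^sub>R inv_op b + gap *\<^sub>R a = x" "Re \<mu> *\<^sub>R inv_op b + Im \<mu> *\<^sub>R inv_op a + gap *\<^sub>R b = 0"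
      using Gz by (simp_all add: cscale_def stokes_inv_op(2) ab)
    have E': "Re \<mu> *\<^sub>R inv_op c - Im \<mu> *\<^sub>R inv_op d + gap *\<^sub>R c = x" "Re \<mu> *\<^sub>R inv_op d + Im \<mu> *\<^sub>R inv_op c + gap *\<^sub>R d = 0"
      using y(2) c d by (auto simp: cscale_def prod_eq_iff)
    have "Re \<mu> *\<^sub>R inv_op (c - a) - Im \<mu> *\<^sub>R inv_op (d - b) + gap *\<^sub>R (c - a) = 0"
      "Re \<mu> *\<^sub>R inv_op (d - b) + Im \<mu> *\<^sub>R inv_op (c - a) + gap *\<^sub>R (d - b) = 0"
      unfolding linear_diff[OF fc.lin] using arg_cong2[OF E'(1) E(1), of "(-)"] arg_cong2[OF E'(2) E(2), of "(-)"]
      by (simp_all add: algebra_simps)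
    from resolvent_injective[OF nz this] show ?thesis using c d by (simp add: prod_eq_iff)
  qed
  then have "stokes_resolvent \<Omega> \<mu> (x, 0) = (inv_op a, inv_op b)"
    unfolding stokes_resolvent_def inv_into_def
    by (intro some_equality) (use stokes_inv_op(1) ab Gz in blast)+
  then show ?thesis unfolding z[symmetric] q_def .
qed

end

section \<open>The solution operators inside the calculus\<close>

locale fractional_stokes = bounded_open_set \<Omega> + sector \<eta> for \<Omega> \<eta> +
  fixes \<alpha> \<rho> :: real
  assumes \<alpha>01: "0 < \<alpha>" "\<alpha> < 1" and \<rho>0: "0 < \<rho>"
begin

sublocale subdiffusion \<eta> \<alpha> gap \<rho>
  by unfold_locales (use \<alpha>01 \<rho>0 gap(1) in auto)

text \<open>Each of the three pieces of the contour is moved inside the calculus separately, with a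
  majorant uniform in k: a constant on the arc, an exponential on the rays.\<close>

lemma contour_int_PhiC:
  assumes t: "0 < t" and b: "b \<le> 0"
    and g: "\<And>r \<theta>. 0 < r ==> \<bar>\<theta>\<bar> \<le> \<eta> ==> g (rcis r \<theta>) = fc.PhiC (%k. symb b t k (rcis r \<theta>)) y"
  shows "continuous_on {0..1} (%k. cint \<rho> \<eta> (symb b t k))"
    and "contour_int \<rho> \<eta> g = fc.PhiC (%k. cint \<rho> \<eta> (symb b t k)) y"
proof -
  let ?N = "\<rho> powr b / gap / angle" and ?h = "symb b t"
  have a: "0 < t * decay" using t decay by simp
  have e: "\<bar>\<eta>\<bar> = \<eta>" "\<bar>- \<eta>\<bar> = \<eta>" using eta_pos by auto
  have N: "0 \<le> ?N" using gap(1) angle_pos by simp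
  have hc: "continuous_on {0..1} (%k. ?h k (rcis r \<theta>))" if "0 < r" "\<bar>\<theta>\<bar> \<le> \<eta>" for r \<theta>
  proof -
    have "rcis r \<theta> powr of_real \<alpha> * of_real k + of_real gap \<noteq> (0::complex)" if "0 \<le> k" for k
      using denom_ge[of r \<theta> k] denom_pos(2)[of r k] \<open>0 < r\<close> \<open>\<bar>\<theta>\<bar> \<le> \<eta>\<close> that \<eta> by auto
    then show ?thesis unfolding symb_def by (intro continuous_intros) auto
  qed
  have G: "continuous_on {0..1} (%k. d * ?h k (rcis r \<theta>))" "cscale d (g (rcis r \<theta>)) = fc.PhiC (%k. d * ?h k (rcis r \<theta>)) y"
    if "0 < r" "\<bar>\<theta>\<bar> \<le> \<eta>" for d r \<theta>
    unfolding g[OF that] by (intro continuous_on_mult continuous_on_const hc fc.PhiC_cscale that)+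
  note I = cint_bound(1,2)[OF \<rho>0 symb_cont a symb_ray[OF b]]
  have wA: "cmod (\<i> * rcis \<rho> \<theta> * ?h k (rcis \<rho> \<theta>)) \<le> \<rho> * (?N * exp (t * \<rho>))" if "\<theta> \<in> {-\<eta>..\<eta>}" "0 \<le> k" for \<theta> k
  proof -
    have "t * (\<rho> * cos \<theta>) \<le> t * (\<rho> * 1)" using t \<rho>0 by (intro mult_left_mono) auto
    then have "?N * exp (t * (\<rho> * cos \<theta>)) \<le> ?N * exp (t * \<rho>)" using N by (intro mult_left_mono) auto
    moreover have "cmod (?h k (rcis \<rho> \<theta>)) \<le> ?N * exp (t * (\<rho> * cos \<theta>))" using that by (intro symb_outside b) auto
    ultimately have "\<rho> * cmod (?h k (rcis \<rho> \<theta>)) \<le> \<rho> * (?N * exp (t * \<rho>))" using \<rho>0 by (intro mult_left_mono) auto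
    then show ?thesis using \<rho>0 by (simp add: norm_mult)
  qed
  have wR: "cmod (cis \<theta> * ?h k (rcis s \<theta>)) \<le> ?N * exp (- (t * decay * s))" if "s \<in> {\<rho>..}" "\<bar>\<theta>\<bar> = \<eta>" "0 \<le> k" for s k \<theta>
    using symb_ray[OF b that(3), of t] that unfolding ray_bound_def by (auto simp: norm_mult)
  have wa: "set_integrable lborel {-\<eta>..\<eta>} (%\<theta>. \<rho> * (?N * exp (t * \<rho>)))"
    by (rule borel_integrable_atLeastAtMost'[OF continuous_on_const])
  have wr: "set_integrable lborel {\<rho>..} (%s. ?N * exp (- (t * decay * s)))"
    by (rule ray_integrable(1)[OF _ a, where M = ?N]) (use N gap(1) angle_pos in \<open>auto simp: abs_mult intro!: continuous_intros\<close>)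
  have A: "continuous_on {0..1} (%k. arc_int \<rho> (-\<eta>) \<eta> (?h k))"
    "(LINT \<theta>:{-\<eta>..\<eta>}|lborel. cscale (\<i> * rcis \<rho> \<theta>) (g (rcis \<rho> \<theta>))) = fc.PhiC (%k. arc_int \<rho> (-\<eta>) \<eta> (?h k)) y"
    by (rule fc.PhiC_integral[OF _ G(1) I(1) wa wA G(2)]; use \<rho>0 in auto)+
  have Ray: "continuous_on {0..1} (%k. ray_int \<rho> \<theta> (?h k))"
    "(LINT s:{\<rho>..}|lborel. cscale (cis \<theta>) (g (rcis s \<theta>))) = fc.PhiC (%k. ray_int \<rho> \<theta> (?h k)) y" if "\<bar>\<theta>\<bar> = \<eta>" for \<theta>
    by (rule fc.PhiC_integral[OF _ G(1) I(2) wr wR G(2)]; use \<rho>0 that in auto)+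
  note R = Ray[OF e(1)] Ray[OF e(2)]
  show "continuous_on {0..1} (%k. cint \<rho> \<eta> (?h k))"
    unfolding cint_def by (intro continuous_on_diff continuous_on_add A(1) R(1,3))
  show "contour_int \<rho> \<eta> g = fc.PhiC (%k. cint \<rho> \<eta> (?h k)) y"
    unfolding contour_int_def A(2) R(2,4) fc.PhiC_add[OF A(1) R(1)] fc.PhiC_diff[OF continuous_on_add[OF A(1) R(1)] R(3)] cint_def ..
qed

lemma cint_continuous: "0 < t ==> b \<le> 0 ==> continuous_on {0..1} (%k. cint \<rho> \<eta> (symb b t k))"
  using contour_int_PhiC(1)[of t b "%z. fc.PhiC (%k. symb b t k z) 0" 0] by simp

lemma ker_continuous: "0 < t ==> b \<le> 0 ==> continuous_on {0..1} (ker b t)"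
  unfolding ker_def[abs_def] by (intro continuous_intros cint_continuous) auto

text \<open>The factor k of the resulting symbol comes from \<open>inv_op x\<close>, to which the
  integrated symbol is applied. The multiplier \<open>c\<close> is prescribed at nonzero points
  only, because z powr 0 is 1 there but 0 at the origin.\<close>

lemma contour_op:
  assumes x: "x \<in> H" and t: "0 < t" and b: "b \<le> 0"
    and c: "\<And>r \<theta>. 0 < r ==> c (rcis r \<theta>) = exp (rcis r \<theta> * of_real t) * rcis r \<theta> powr of_real b"
  shows "fst (cscale (1 / (2 * of_real pi * \<i>)) (contour_int \<rho> \<eta> (%l. cscale (c l) (stokes_resolvent \<Omega> (l powr of_real \<alpha>) (x, 0)))))
      = fc.Phi (%k. k * ker b t k) x"
proof -
  let ?g = "%l. cscale (c l) (stokes_resolvent \<Omega> (l powr of_real \<alpha>) (x, 0))"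
  have g: "?g (rcis r \<theta>) = fc.PhiC (%k. symb b t k (rcis r \<theta>)) (inv_op x)" if r: "0 < r" "\<bar>\<theta>\<bar> \<le> \<eta>" for r \<theta>
  proof -
    have nz: "rcis r \<theta> powr of_real \<alpha> * of_real k + of_real gap \<noteq> (0::complex)" if "0 \<le> k" for k
      using denom_ge[of r \<theta> k] denom_pos(2)[of r k] r that \<eta> by auto
    have "continuous_on {0..1} (%k. 1 / (rcis r \<theta> powr of_real \<alpha> * of_real k + of_real gap))"
      by (intro continuous_intros) (use nz in auto)
    moreover have "stokes_resolvent \<Omega> (rcis r \<theta> powr of_real \<alpha>) (x, 0)
        = fc.PhiC (%k. 1 / (rcis r \<theta> powr of_real \<alpha> * of_real k + of_real gap)) (inv_op x)"
      by (rule stokes_resolvent_eq[OF x nz])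
    ultimately show ?thesis unfolding c[OF r(1)] by (simp add: fc.PhiC_cscale symb_def)
  qed
  have P: "contour_int \<rho> \<eta> ?g = fc.PhiC (%k. cint \<rho> \<eta> (symb b t k)) (inv_op x)"
    by (rule contour_int_PhiC(2)[OF t b]) (rule g)
  have "fst (cscale (1 / (2 * of_real pi * \<i>)) (contour_int \<rho> \<eta> ?g)) = fc.Phi (ker b t) (inv_op x)"
    unfolding P fc.PhiC_cscale[OF cint_continuous[OF t b]] unfolding fc.PhiC_def fst_conv
    by (rule fc.Phi_cong) (simp add: ker_def)
  also have "\<dots> = fc.Phi (%k. ker b t k * k) x"
    using fc.Phi_mult[OF ker_continuous[OF t b] continuous_on_id, of x] by (simp add: fc.Phi_ident)
  finally show ?thesis by (simp add: mult.commute)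
qed

lemma S_op_eq: "x \<in> H ==> 0 < t ==> S_op \<Omega> \<rho> \<eta> \<alpha> t x = fc.Phi (%k. k * ker (\<alpha> - 1) t k) x"
  unfolding S_op_def using \<alpha>01 by (intro contour_op) auto

lemma T_op_eq: "x \<in> H ==> 0 < t ==> T_op \<Omega> \<rho> \<eta> \<alpha> t x = fc.Phi (%k. k * ker 0 t k) x"
  unfolding T_op_def by (intro contour_op) auto

end

context positive_contraction
begin

text \<open>A change of t is controlled in operator norm by the Lipschitz bound on the symbols, a
  change of x by continuity of one fixed operator.\<close>

lemma Phi_jointly_continuous:
  assumes f: "\<And>t. 0 < t ==> continuous_on {0..1} (f t)"
    and lip: "\<And>a T. 0 < a ==> \<exists>M. \<forall>s\<in>{a..T}. \<forall>t\<in>{a..T}. \<forall>k\<in>{0..1}. \<bar>f s k - f t k\<bar> \<le> M * \<bar>s - t\<bar>"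
  shows "continuous_on ({0<..} \<times> UNIV) (%(t, x). Phi (f t) x)"
proof (rule continuous_at_imp_continuous_on, intro ballI)
  fix z :: "real \<times> 'a" assume "z \<in> {0<..} \<times> UNIV"
  then obtain t0 x0 where z: "z = (t0, x0)" "0 < t0" by auto
  let ?N = "at (t0, x0)"
  obtain M where M: "\<forall>s\<in>{t0/2..2*t0}. \<forall>t\<in>{t0/2..2*t0}. \<forall>k\<in>{0..1}. \<bar>f s k - f t k\<bar> \<le> M * \<bar>s - t\<bar>"
    using lip[of "t0/2" "2*t0"] z by auto
  have fst: "((%p. fst p) \<longlongrightarrow> t0) ?N" and snd: "((%p. snd p) \<longlongrightarrow> x0) ?N"
    using tendsto_fst[OF tendsto_ident_at, of "(t0, x0)" UNIV] tendsto_snd[OF tendsto_ident_at, of "(t0, x0)" UNIV] by simp_all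
  have ev: "\<forall>\<^sub>F p in ?N. t0/2 < fst p \<and> fst p < 2 * t0"
    using order_tendstoD(1)[OF fst, of "t0/2"] order_tendstoD(2)[OF fst, of "2*t0"] z by (auto intro: eventually_conj)
  have "((%p. Phi (%k. f (fst p) k - f t0 k) (snd p)) \<longlongrightarrow> 0) ?N"
  proof (rule Lim_null_comparison)
    show "((%p. M * \<bar>fst p - t0\<bar> * norm (snd p)) \<longlongrightarrow> 0) ?N"
      using fst snd by (auto intro!: tendsto_eq_intros)
    show "\<forall>\<^sub>F p in ?N. norm (Phi (%k. f (fst p) k - f t0 k) (snd p)) \<le> M * \<bar>fst p - t0\<bar> * norm (snd p)"
      using ev
    proof eventually_elim
      case (elim p)
      then have p: "0 < fst p" using z by linarith
      show ?case
      proof (rule norm_Phi_le)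
        show "continuous_on {0..1} (%k. f (fst p) k - f t0 k)" by (intro continuous_on_diff f p z)
        show "\<bar>f (fst p) k - f t0 k\<bar> \<le> M * \<bar>fst p - t0\<bar>" if "0 \<le> k" "k \<le> 1" for k
          using M elim that z by simp
      qed
    qed
  qed
  moreover have "((%p. Phi (f t0) (snd p)) \<longlongrightarrow> Phi (f t0) x0) ?N"
    by (rule bounded_linear.tendsto[OF Phi_bounded_linear[OF f[OF z(2)]] snd])
  ultimately have "((%p. Phi (%k. f (fst p) k - f t0 k) (snd p) + Phi (f t0) (snd p)) \<longlongrightarrow> 0 + Phi (f t0) x0) ?N"
    by (rule tendsto_add)
  moreover have "\<forall>\<^sub>F p in ?N. Phi (%k. f (fst p) k - f t0 k) (snd p) + Phi (f t0) (snd p) = (case p of (t, x) => Phi (f t) x)"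
    using ev
  proof eventually_elim
    case (elim p)
    then have p: "0 < fst p" using z by linarith
    show ?case by (simp add: Phi_diff[OF f[OF p] f[OF z(2)]] split_beta)
  qed
  ultimately have "((%(t, x). Phi (f t) x) \<longlongrightarrow> 0 + Phi (f t0) x0) ?N"
    by (rule Lim_transform_eventually)
  then show "isCont (%(t, x). Phi (f t) x) z" by (simp add: isCont_def z)
qed

end

section \<open>Fractional kernels and the free evolution\<close>

context fractional_stokes
begin

abbreviation "T_a \<equiv> T_op \<Omega> \<rho> \<eta> \<alpha>"
abbreviation "S_a \<equiv> S_op \<Omega> \<rho> \<eta> \<alpha>"

text \<open>This is A^\<gamma> T_\<alpha>(t): the symbol of A^\<gamma> is (\<open>gap\<close> /
  k)^\<gamma>, that of T_\<alpha>(t) is k times the scalar kernel, and merging the powers of k keeps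
  the product continuous at 0 for \<gamma> < 1.\<close>

definition frac_kernel :: "real => real => l2 => l2" where
  "frac_kernel \<gamma> t x = fc.Phi (%k. gap powr \<gamma> * (k powr (1 - \<gamma>) * ker 0 t k)) x"

text \<open>S_\<alpha>(t) x on L^2_sigma, completed at t = 0 by its limit x.\<close>

definition evolution :: "l2 => real => l2" where
  "evolution x t = (if t = 0 then x else fc.Phi (%k. k * ker (\<alpha> - 1) t k) x)"

lemma powr_cont: "0 < b ==> continuous_on {0..1} (%k::real. k powr b)"
  by (intro continuous_on_powr' continuous_intros) auto

lemma frac_kernel_continuous: "0 < t ==> \<gamma> < 1 ==> continuous_on {0..1} (%k. gap powr \<gamma> * (k powr (1 - \<gamma>) * ker 0 t k))"
  by (intro continuous_on_mult continuous_on_const powr_cont ker_continuous) auto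

lemma ker_lipschitz_time:
  assumes "0 < a" "b \<le> 0" and m: "\<And>k. 0 \<le> k ==> k \<le> 1 ==> \<bar>m k\<bar> \<le> c"
  shows "\<exists>M. \<forall>s\<in>{a..T}. \<forall>t\<in>{a..T}. \<forall>k\<in>{0..1}. \<bar>m k * ker b s k - m k * ker b t k\<bar> \<le> M * \<bar>s - t\<bar>"
proof -
  obtain M where M: "\<forall>s\<in>{a..T}. \<forall>t\<in>{a..T}. \<forall>k\<in>{0..1}. \<bar>ker b s k - ker b t k\<bar> \<le> M * \<bar>s - t\<bar>"
    using ker_lipschitz[OF assms(1,2), of T] by auto
  have "\<bar>m k\<bar> * \<bar>ker b s k - ker b t k\<bar> \<le> c * (M * \<bar>s - t\<bar>)" if "s \<in> {a..T}" "t \<in> {a..T}" "k \<in> {0..1}" for s t k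
    using M m[of k] that by (intro mult_mono) auto
  then show ?thesis
    by (intro exI[of _ "c * M"]) (auto simp: abs_mult mult.assoc simp flip: right_diff_distrib)
qed

text \<open>The power \<open>gap\<close>^\<gamma> cancels the \<delta>^(-\<gamma>) of
  \<open>ker_0_bound\<close>, so one constant serves every \<gamma>.\<close>

lemma frac_kernel_singular:
  assumes \<gamma>: "0 \<le> \<gamma>" "\<gamma> < 1"
  shows "singular_kernel (frac_kernel \<gamma>) (\<alpha> * (1 - \<gamma>)) CK T"
proof (rule singular_kernel.intro)
  show "0 < \<alpha> * (1 - \<gamma>)" using \<gamma> \<alpha>01 by simp
  show "0 \<le> CK" by (rule CK_nonneg)
  show "linear (frac_kernel \<gamma> t)" if "0 < t" for t
    unfolding frac_kernel_def[abs_def] by (rule fc.Phi_linear[OF frac_kernel_continuous[OF that \<gamma>(2)]])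
  show "norm (frac_kernel \<gamma> t x) \<le> CK * t powr (\<alpha> * (1 - \<gamma>) - 1) * norm x" if "0 < t" for t x
    unfolding frac_kernel_def
  proof (rule fc.norm_Phi_le[OF frac_kernel_continuous[OF that \<gamma>(2)]])
    fix k :: real assume k: "0 \<le> k" "k \<le> 1"
    show "\<bar>gap powr \<gamma> * (k powr (1 - \<gamma>) * ker 0 t k)\<bar> \<le> CK * t powr (\<alpha> * (1 - \<gamma>) - 1)"
    proof (cases "k = 0")
      case False
      then have "gap powr \<gamma> * (k powr (1 - \<gamma>) * \<bar>ker 0 t k\<bar>) \<le> gap powr \<gamma> * (CK * gap powr (- \<gamma>) * t powr (\<alpha> * (1 - \<gamma>) - 1))"
        using k \<gamma> that by (intro mult_left_mono ker_0_bound) auto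
      also have "\<dots> = CK * t powr (\<alpha> * (1 - \<gamma>) - 1)" using gap(1) by (simp add: powr_minus)
      finally show ?thesis by (simp add: abs_mult)
    qed (simp add: CK_nonneg)
  qed
  show "continuous_on ({0<..} \<times> UNIV) (%(t, x). frac_kernel \<gamma> t x)"
    unfolding frac_kernel_def
  proof (rule fc.Phi_jointly_continuous)
    fix a T :: real assume a: "0 < a"
    have "\<bar>gap powr \<gamma> * k powr (1 - \<gamma>)\<bar> \<le> gap powr \<gamma>" if "0 \<le> k" "k \<le> 1" for k
      using that \<gamma> powr_le1[of "1 - \<gamma>" k] by (auto simp: abs_mult intro!: mult_left_le)
    from ker_lipschitz_time[OF a order_refl this]
    show "\<exists>M. \<forall>s\<in>{a..T}. \<forall>t\<in>{a..T}. \<forall>k\<in>{0..1}. \<bar>gap powr \<gamma> * (k powr (1 - \<gamma>) * ker 0 s k) - gap powr \<gamma> * (k powr (1 - \<gamma>) * ker 0 t k)\<bar> \<le> M * \<bar>s - t\<bar>"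
      by (simp only: mult.assoc)
  qed (rule frac_kernel_continuous[OF _ \<gamma>(2)])
qed

lemma frac_kernel_in: "x \<in> H ==> 0 < t ==> \<gamma> < 1 ==> frac_kernel \<gamma> t x \<in> H"
  unfolding frac_kernel_def using fc.Phi_in_H[OF frac_kernel_continuous] by (simp add: H_eq)

lemma neg_pow_frac_kernel:
  assumes x: "x \<in> H" and t: "0 < t" and \<gamma>: "0 < \<beta>" "\<gamma> < 1"
  shows "neg_pow \<Omega> \<beta> (frac_kernel \<gamma> t x) = frac_kernel (\<gamma> - \<beta>) t x"
  unfolding frac_kernel_def neg_pow_Phi[OF x \<gamma>(1) frac_kernel_continuous[OF t \<gamma>(2)]]
proof (rule fc.Phi_cong)
  fix k :: real assume k: "0 \<le> k" "k \<le> 1"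
  show "(k / gap) powr \<beta> * (gap powr \<gamma> * (k powr (1 - \<gamma>) * ker 0 t k)) = gap powr (\<gamma> - \<beta>) * (k powr (1 - (\<gamma> - \<beta>)) * ker 0 t k)"
  proof (cases "k = 0")
    case False
    have p: "k powr (1 - (\<gamma> - \<beta>)) = k powr \<beta> * k powr (1 - \<gamma>)" by (simp add: algebra_simps flip: powr_add)
    show ?thesis using k gap(1) unfolding p by (simp add: powr_divide powr_diff)
  qed simp
qed

lemma T_op_frac_kernel: "x \<in> H ==> 0 < t ==> T_a t x = frac_kernel 0 t x"
  unfolding T_op_eq frac_kernel_def using gap(1) by (intro fc.Phi_cong) simp

lemma T_op_half: "x \<in> H ==> 0 < t ==> T_a t x = Q (frac_kernel (1/2) t x)"
  by (simp add: T_op_frac_kernel neg_pow_frac_kernel)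

text \<open>Writing A^(1/4) T_\<alpha>(t) as A^(-1/2) A^(3/4) T_\<alpha>(t) lets the outer A^(-1/2)
  be stripped off when the equation is rewritten for A^(1/2) u.\<close>

lemma T_op_quarter:
  assumes x: "x \<in> H" and t: "0 < t"
  shows "frac_pow \<Omega> (1/4) (T_a t x) = Q (frac_kernel (3/4) t x)"
proof -
  have "T_a t x = Q4 (frac_kernel (1/4) t x)"
    using x t by (simp add: T_op_frac_kernel neg_pow_frac_kernel)
  moreover have "frac_pow \<Omega> (1/4) (Q4 (frac_kernel (1/4) t x)) = frac_kernel (1/4) t x"
    by (rule frac_pow_neg_pow) (use frac_kernel_in[OF x t] in auto)
  moreover have "Q (frac_kernel (3/4) t x) = frac_kernel (1/4) t x"
    using x t by (simp add: neg_pow_frac_kernel)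
  ultimately show ?thesis by simp
qed

lemma S_ker_continuous: "0 < t ==> continuous_on {0..1} (%k. k * ker (\<alpha> - 1) t k)"
  using \<alpha>01 by (intro continuous_on_mult continuous_on_id ker_continuous) auto

lemma S_op_evolution:
  assumes x: "x \<in> H" and t: "0 < t"
  shows "S_a t (Q x) = Q (evolution x t)"
proof -
  note c = powr_continuous_01[of "1/2", OF _ gap(1)]
  have "S_a t (Q x) = fc.Phi (%k. k * ker (\<alpha> - 1) t k) (fc.Phi (%k. (k / gap) powr (1/2)) x)"
    using neg_pow_in[OF x, of "1/2"] t by (simp add: S_op_eq neg_pow_eq[OF x])
  also have "\<dots> = fc.Phi (%k. (k / gap) powr (1/2)) (fc.Phi (%k. k * ker (\<alpha> - 1) t k) x)"
    by (rule fc.Phi_commute[OF S_ker_continuous[OF t] c]) simp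
  finally show ?thesis
    using t fc.Phi_in_H[OF S_ker_continuous[OF t], of x] x by (simp add: evolution_def neg_pow_eq H_eq)
qed

lemma evolution_in: "x \<in> H ==> 0 \<le> t ==> evolution x t \<in> H"
  unfolding evolution_def using fc.Phi_in_H[OF S_ker_continuous] by (simp add: H_eq)

text \<open>For t > 0 this is joint continuity; at 0 the symbols tend to 1 only in the weighted
  sense of \<open>ker_1_limit\<close>, which is enough on L^2_sigma.\<close>

lemma evolution_continuous:
  assumes x: "x \<in> H"
  shows "continuous_on {0..} (evolution x)"
proof -
  have b: "\<alpha> - 1 \<le> 0" using \<alpha>01 by simp
  have j: "continuous_on ({0<..} \<times> UNIV) (%(t, x). fc.Phi (%k. k * ker (\<alpha> - 1) t k) x)"
    by (rule fc.Phi_jointly_continuous[OF S_ker_continuous ker_lipschitz_time[OF _ b, of _ _ 1]]) auto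
  have "continuous_on {0<..} (%t. fc.Phi (%k. k * ker (\<alpha> - 1) t k) x)"
  proof -
    have "continuous_on {0<..} (%t::real. (t, x))" by (intro continuous_intros)
    from continuous_on_compose2[OF j this] show ?thesis by auto
  qed
  then have pos: "continuous_on {0<..} (evolution x)"
    by (rule continuous_on_eq) (simp add: evolution_def)
  have zero: "(evolution x \<longlongrightarrow> evolution x 0) (at_right 0)"
  proof -
    have "((%t. fc.Phi (%k. k * ker (\<alpha> - 1) t k) x) \<longlongrightarrow> fc.Phi (%k. 1) x) (at_right 0)"
    proof (rule fc.Phi_tendsto)
      show "\<forall>\<^sub>F t in at_right 0. continuous_on {0..1} (%k. k * ker (\<alpha> - 1) t k) \<and>
          (\<forall>k\<in>{0..1}. \<bar>k * ker (\<alpha> - 1) t k\<bar> \<le> CK \<and> k * \<bar>k * ker (\<alpha> - 1) t k - 1\<bar> \<le> CK * gap * t powr \<alpha>)"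
        using eventually_at_right_less
      proof eventually_elim
        case (elim t)
        have "\<bar>k * ker (\<alpha> - 1) t k\<bar> \<le> CK \<and> k * \<bar>k * ker (\<alpha> - 1) t k - 1\<bar> \<le> CK * gap * t powr \<alpha>" if "k \<in> {0..1}" for k
        proof (cases "k = 0")
          case False
          then show ?thesis using that elim ker_1_bound[of t k] ker_1_limit[of t k] by (simp add: abs_mult)
        qed (use CK_nonneg gap(1) in auto)
        then show ?case using S_ker_continuous[OF elim] by blast
      qed
      have "((%t. t powr \<alpha>) \<longlongrightarrow> 0 powr \<alpha>) (at_right 0)"
        using \<alpha>01 by (intro tendsto_powr' tendsto_intros) (auto simp: eventually_at_filter)
      then have "((%t. CK * gap * t powr \<alpha>) \<longlongrightarrow> CK * gap * 0 powr \<alpha>) (at_right 0)"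
        by (rule tendsto_mult_left)
      then show "((%t. CK * gap * t powr \<alpha>) \<longlongrightarrow> 0) (at_right 0)" by simp
    qed (use x H_eq in auto)
    moreover have "\<forall>\<^sub>F t in at_right 0. fc.Phi (%k. k * ker (\<alpha> - 1) t k) x = evolution x t"
      using eventually_at_right_less by eventually_elim (simp add: evolution_def)
    ultimately show ?thesis
      by (simp add: evolution_def[of x 0] fc.Phi_1 tendsto_cong)
  qed
  show ?thesis
    unfolding continuous_on_def
  proof
    fix t :: real assume t: "t \<in> {0..}"
    show "(evolution x \<longlongrightarrow> evolution x t) (at t within {0..})"
    proof (cases "t = 0")
      case True
      have "at (0::real) within {0..} = at_right 0" by (rule at_within_Ici_at_right)
      then show ?thesis using zero True by simp
    next
      case False
      then have "isCont (evolution x) t" using pos t by (simp add: continuous_on_eq_continuous_at)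
      then show ?thesis by (simp add: isCont_def Lim_at_imp_Lim_at_within)
    qed
  qed
qed

end

section \<open>The convective term\<close>

lemma rep_l2_lincomb: "AE x in lborel. rep_l2 (a *\<^sub>R u + b *\<^sub>R v) x = a *\<^sub>R rep_l2 u x + b *\<^sub>R rep_l2 v x"
proof -
  note q = sq_integrable_scaleR[OF sq_integrable_rep_l2]
  show ?thesis
    using rep_abs_l2[OF sq_integrable_add[OF q q], of a u b v]
    by (simp add: abs_rep_l2 flip: abs_l2_add[OF q q] abs_l2_scaleR[OF sq_integrable_rep_l2])
qed

lemma measurable_rep_l2 [measurable]: "rep_l2 u \<in> borel_measurable borel"
  by (rule sq_integrable_measurable[OF sq_integrable_rep_l2])

lemma nn_integral_rep_l2: "(\<integral>\<^sup>+x. ennreal ((norm (rep_l2 u x))\<^sup>2) \<partial>lborel) = ennreal ((norm u)\<^sup>2)"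
  using nn_integral_sq[OF sq_integrable_rep_l2, of u] by (simp add: abs_rep_l2)

text \<open>The increments of \<open>y / (1 + y)\<close> over dyadic steps dominate \<open>y / (1 + y\<^sup>2)\<close>, so the latter
  has uniformly bounded dyadic sums.\<close>

lemma dyadic_sum_bound:
  fixes y :: real
  assumes "0 \<le> y"
  shows "(\<Sum>n<N. 2^n * y / (1 + (2^n * y)\<^sup>2)) \<le> 4"
proof -
  let ?p = "%n. 2^n * y / (1 + 2^n * y)"
  have step: "x / (1 + x\<^sup>2) \<le> 4 * (2 * x / (1 + 2 * x) - x / (1 + x))" if "0 \<le> x" for x :: real
  proof -
    have "2 * x / (1 + 2 * x) - x / (1 + x) = x / ((1 + 2 * x) * (1 + x))"
      using that by (simp add: field_simps)
    moreover have "(1 + 2 * x) * (1 + x) \<le> 4 * (1 + x\<^sup>2)"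
    proof -
      have "0 \<le> 2 * (x - 3/4)\<^sup>2 + 15/8" by (intro add_nonneg_nonneg) auto
      then show ?thesis by (simp add: power2_eq_square algebra_simps)
    qed
    moreover have "x / (1 + x\<^sup>2) = 4 * x / (4 * (1 + x\<^sup>2))" by (rule mult_divide_mult_cancel_left[symmetric]) simp
    moreover have "4 * x / (4 * (1 + x\<^sup>2)) \<le> 4 * x / ((1 + 2 * x) * (1 + x))"
      using that calculation(2) by (intro frac_le) auto
    ultimately show ?thesis by (simp only: times_divide_eq_right)
  qed
  have "(\<Sum>n<N. 2^n * y / (1 + (2^n * y)\<^sup>2)) \<le> (\<Sum>n<N. 4 * (?p (Suc n) - ?p n))"
    using assms step[of "2^_ * y"] by (intro sum_mono) (simp add: mult.assoc)
  also have "\<dots> = 4 * (?p N - ?p 0)"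
    by (subst sum_distrib_left[symmetric], subst sum_lessThan_telescope) simp
  also have "\<dots> \<le> 4 * (1 - 0)"
  proof -
    have "0 < 1 + 2^N * y" using assms by (simp add: add_pos_nonneg)
    then show ?thesis using assms by (intro mult_left_mono diff_mono) (auto simp: divide_le_eq)
  qed
  finally show ?thesis by simp
qed

section \<open>Images of A^(-1/2) and A^(-1/4)\<close>

context bounded_open_set
begin

lemma half_square: "fc.Phi (%k. (k / gap) powr (1/2)) (fc.Phi (%k. (k / gap) powr (1/2)) y) = solve y"
proof -
  note c = powr_continuous_01[of "1/2", OF _ gap(1)]
  have "fc.Phi (%k. (k / gap) powr (1/2)) (fc.Phi (%k. (k / gap) powr (1/2)) y) = fc.Phi (%k. (k / gap) powr (1/2) * (k / gap) powr (1/2)) y"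
    by (rule fc.Phi_mult[symmetric]; rule c) simp_all
  also have "\<dots> = fc.Phi (%k. (1 / gap) * k) y"
    using gap(1) by (intro fc.Phi_cong) (simp flip: powr_add)
  also have "\<dots> = (1 / gap) *\<^sub>R inv_op y"
    by (subst fc.Phi_scale) (auto simp: fc.Phi_ident intro!: continuous_intros)
  finally show ?thesis using gap_nz by (simp add: inv_op_def)
qed

text \<open>For x = A^(-1/2) y the isometry holds because the squared gradient norm of
  \<open>solve y\<close> is inner (solve y) y, the squared norm of A^(-1/2) y. Such x are dense, and
  closedness of the space of gradients carries membership and isometry to every x.\<close>

lemma neg_half_V:
  assumes x: "x \<in> H"
  shows "Q x \<in> V" "norm (grad (Q x)) = norm x"
proof -
  define W where "W = fc.Phi (%k. (k / gap) powr (1/2))"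
  note c = powr_continuous_01[of "1/2", OF _ gap(1)]
  have bl: "bounded_linear W" unfolding W_def by (rule fc.Phi_bounded_linear[OF c]) simp
  have lin: "linear W" using bl by (rule bounded_linear.linear)
  have WW: "W (W y) = solve y" for y unfolding W_def by (rule half_square)
  have Wx: "Q x = W x" unfolding W_def by (rule neg_pow_eq[OF x]) simp
  have iso: "norm (grad (W (W y))) = norm (W y)" for y
  proof -
    have "inner (grad (solve y)) (grad (solve y)) = inner (W (W y)) y" unfolding WW by (simp add: inner_solve)
    also have "\<dots> = inner (W y) (W y)" unfolding W_def by (rule fc.Phi_sym[OF c]) simp
    finally show ?thesis unfolding WW norm_eq_sqrt_inner by simp
  qed
  have diff: "grad (W (W y)) - grad (W (W y')) = grad (W (W (y - y')))" for y y'
    unfolding WW linear_diff[OF linear_solve] by (simp add: grad_linear(2) V_H1 solve(1))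
  obtain b where b: "\<forall>n. b n \<in> range inv_op" "b \<longlonglongrightarrow> x"
    using x unfolding H_eq[symmetric] fc.H_def closure_sequential by blast
  have "\<forall>n. \<exists>y. b n = W y"
  proof
    fix n
    obtain z where "b n = inv_op z" using b(1) by blast
    then have "b n = W (gap *\<^sub>R W z)" by (simp add: linear_scale[OF lin] WW inv_op_def)
    then show "\<exists>y. b n = W y" by blast
  qed
  from choice[OF this] obtain y where y: "\<And>n. b n = W (y n)" by blast
  have V: "W (b n) \<in> V" for n unfolding y WW by (rule solve(1))
  have dist: "dist (grad (W (b m))) (grad (W (b n))) = dist (b m) (b n)" for m n
    unfolding dist_norm y diff iso linear_diff[OF lin, symmetric] ..
  have "Cauchy (%n. grad (W (b n)))"
    using LIMSEQ_imp_Cauchy[OF b(2)] unfolding Cauchy_def dist .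
  then obtain l where l: "(%n. grad (W (b n))) \<longlonglongrightarrow> l" using Cauchy_convergent_iff unfolding convergent_def by blast
  have "l \<in> grad ` V"
    by (rule closed_sequentially[OF closed_grad_V _ l]) (use V in blast)
  then obtain v where v: "v \<in> V" "l = grad v" by blast
  obtain C where C: "C > 0" "\<And>u. u \<in> V ==> norm u \<le> C * norm (grad u)" by (rule poincare) (rule that)
  have "(%n. W (b n)) \<longlonglongrightarrow> v"
  proof (rule LIM_zero_cancel, rule Lim_null_comparison)
    show "\<forall>\<^sub>F n in sequentially. norm (W (b n) - v) \<le> C * norm (grad (W (b n)) - l)"
      using C(2)[OF subspace_diff[OF subspace_V V v(1)]] v by (simp add: grad_linear(2) V_H1 V)
    have "(%n. C * norm (grad (W (b n)) - l)) \<longlonglongrightarrow> C * norm (l - l)" by (intro tendsto_intros l)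
    then show "(%n. C * norm (grad (W (b n)) - l)) \<longlonglongrightarrow> 0" by simp
  qed
  moreover have "(%n. W (b n)) \<longlonglongrightarrow> W x" by (rule bounded_linear.tendsto[OF bl b(2)])
  ultimately have vx: "v = W x" by (rule LIMSEQ_unique)
  show "Q x \<in> V" unfolding Wx using v(1) vx by simp
  have "(%n. norm (grad (W (b n)))) \<longlonglongrightarrow> norm l" by (intro tendsto_norm l)
  moreover have "(%n. norm (grad (W (b n)))) \<longlonglongrightarrow> norm x"
    using tendsto_norm[OF b(2)] by (simp only: y iso)
  ultimately show "norm (grad (Q x)) = norm x"
    unfolding Wx vx[symmetric] v(2)[symmetric] by (rule LIMSEQ_unique)
qed

text \<open>Each weighted squared norm is a quadratic form of the calculus, so the sum is the form
  of a single symbol, and a pointwise bound on that symbol suffices.\<close>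

lemma weighted_multiplier_sum:
  assumes f: "\<And>n. continuous_on {0..1} (f n)" and c: "\<And>n::nat. 0 \<le> c n"
    and le: "\<And>k. 0 \<le> k ==> k \<le> 1 ==> (\<Sum>n<N. c n * (f n k)\<^sup>2) \<le> C"
  shows "(\<Sum>n<N. c n * (norm (fc.Phi (f n) w))\<^sup>2) \<le> C * (norm w)\<^sup>2"
proof -
  have cf: "continuous_on {0..1} (%k. c n * (f n k)\<^sup>2)" for n by (intro continuous_intros f)
  have "c n * (norm (fc.Phi (f n) w))\<^sup>2 = inner (fc.Phi (%k. c n * (f n k)\<^sup>2) w) w" for n
  proof -
    have "(norm (fc.Phi (f n) w))\<^sup>2 = inner (fc.Phi (f n) (fc.Phi (f n) w)) w"
      unfolding power2_norm_eq_inner by (rule fc.Phi_sym[OF f, symmetric])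
    also have "fc.Phi (f n) (fc.Phi (f n) w) = fc.Phi (%k. (f n k)\<^sup>2) w"
      unfolding power2_eq_square by (rule fc.Phi_mult[OF f f, symmetric])
    finally show ?thesis by (subst fc.Phi_scale) (auto intro!: continuous_intros f)
  qed
  then have "(\<Sum>n<N. c n * (norm (fc.Phi (f n) w))\<^sup>2) = inner (\<Sum>n<N. fc.Phi (%k. c n * (f n k)\<^sup>2) w) w"
    by (simp add: inner_sum_left)
  also have "(\<Sum>n<N. fc.Phi (%k. c n * (f n k)\<^sup>2) w) = fc.Phi (%k. \<Sum>n<N. c n * (f n k)\<^sup>2) w"
    using fc.Phi_sum[of "{..<N}" "%n k. c n * (f n k)\<^sup>2" w] cf by simp
  also have "inner \<dots> w \<le> norm (fc.Phi (%k. \<Sum>n<N. c n * (f n k)\<^sup>2) w) * norm w"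
    by (rule norm_cauchy_schwarz)
  also have "\<dots> \<le> (C * norm w) * norm w"
  proof (intro mult_right_mono fc.norm_Phi_le)
    show "continuous_on {0..1} (%k. \<Sum>n<N. c n * (f n k)\<^sup>2)" by (intro continuous_on_sum cf)
    show "\<bar>\<Sum>n<N. c n * (f n k)\<^sup>2\<bar> \<le> C" if "0 \<le> k" "k \<le> 1" for k
      using le[OF that] by (subst abs_of_nonneg) (auto intro!: sum_nonneg mult_nonneg_nonneg c)
  qed simp
  finally show ?thesis by (simp add: power2_eq_square)
qed

text \<open>At every level 2^n the field v = A^(-1/4) w is split into a part a_n measured in L^2 and
  a part b_n = A^(-1/2) X_n measured in L^6. Where |v| lies between 2^n and 2^(n+1), one of the two
  is at least 2^n / 2, and Chebyshev-type bounds are summed over n. This is real interpolation at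
  the midpoint between L^2 and L^6.\<close>

lemma quarter_L3:
  obtains C where "0 \<le> C" "\<And>w. w \<in> H ==>
    (\<integral>\<^sup>+x. ennreal (norm (rep_l2 (Q4 w) x) ^ 3) \<partial>lborel) \<le> ennreal (C * ((norm w)\<^sup>2 + norm w ^ 6))"
proof -
  define p where "p k = (k / gap) powr (1/4)" for k
  \<comment> \<open>In y = 2^n p^2 this is 1 + y^2, which puts the transition between the two parts
    at y = 1. After weighting, the squared symbols are y / (1 + y^2)^2 and y^3 / (1 + y^2)^2, both
    below y / (1 + y^2), whose dyadic sums are bounded.\<close>
  define D where "D n k = 1 + 4^n * p k ^ 4" for n :: nat and k
  define f where "f n k = 4^n * p k ^ 3 / D n k" for n :: nat and k
  define g where "g n k = p k / D n k" for n :: nat and k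
  have p0: "0 \<le> p k" for k by (simp add: p_def)
  have D1: "1 \<le> D n k" for n k by (simp add: D_def)
  have Dnz: "D n k \<noteq> 0" for n k using D1[of n k] by auto
  have pc: "continuous_on {0..1} p" unfolding p_def by (rule powr_continuous_01[OF _ gap(1)]) simp
  have fc: "continuous_on {0..1} (f n)" and gc: "continuous_on {0..1} (g n)" for n
    unfolding f_def[abs_def] g_def[abs_def] D_def[abs_def]
    by (intro continuous_intros pc; use D1 in \<open>auto simp: D_def intro!: add_pos_nonneg less_imp_neq[symmetric] p0\<close>)+
  have half: "(k / gap) powr (1/2) = (p k)\<^sup>2" for k
    unfolding p_def power2_eq_square by (simp flip: powr_add)
  define y where "y n k = 2^n * (p k)\<^sup>2" for n :: nat and k
  have y0: "0 \<le> y n k" for n k by (simp add: y_def)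
  have Dy: "D n k = 1 + (y n k)\<^sup>2" for n k
  proof -
    have "(4::real)^n = (2^n)\<^sup>2" by (simp add: power2_eq_square flip: power_mult_distrib)
    then show ?thesis by (simp add: D_def y_def power_mult_distrib flip: power_mult)
  qed
  have f2: "(f n k)\<^sup>2 = 2^n * (y n k ^ 3 / (D n k)\<^sup>2)" for n k
  proof -
    have "(4::real)^n = 2^n * 2^n" by (simp flip: power_mult_distrib)
    then show ?thesis unfolding f_def y_def power_divide power_mult_distrib
      by (simp add: power2_eq_square power3_eq_cube mult.assoc)
  qed
  have g2: "2^n * (g n k)\<^sup>2 = y n k / (D n k)\<^sup>2" for n k
    unfolding g_def y_def by (simp add: power_divide)
  have frac: "t / (1 + t\<^sup>2)\<^sup>2 \<le> t / (1 + t\<^sup>2)" "t ^ 3 / (1 + t\<^sup>2)\<^sup>2 \<le> t / (1 + t\<^sup>2)" "t ^ 3 / (1 + t\<^sup>2)\<^sup>2 \<le> 1" if "0 \<le> t" for t :: real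
  proof -
    have pos: "0 < 1 + t\<^sup>2" by (simp add: add_pos_nonneg)
    have "t / (1 + t\<^sup>2) = (t * (1 + t\<^sup>2)) / ((1 + t\<^sup>2) * (1 + t\<^sup>2))" using pos by simp
    then have "t / (1 + t\<^sup>2)\<^sup>2 + t ^ 3 / (1 + t\<^sup>2)\<^sup>2 = t / (1 + t\<^sup>2)"
      by (simp add: power2_eq_square power3_eq_cube distrib_left add_divide_distrib)
    moreover have "0 \<le> t / (1 + t\<^sup>2)\<^sup>2" "0 \<le> t ^ 3 / (1 + t\<^sup>2)\<^sup>2" using that by auto
    ultimately show 1: "t / (1 + t\<^sup>2)\<^sup>2 \<le> t / (1 + t\<^sup>2)" "t ^ 3 / (1 + t\<^sup>2)\<^sup>2 \<le> t / (1 + t\<^sup>2)" by linarith+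
    have "0 \<le> (t - 1/2)\<^sup>2 + 3/4" by (intro add_nonneg_nonneg) auto
    then have "t / (1 + t\<^sup>2) \<le> 1" using pos by (simp add: divide_le_eq power2_eq_square algebra_simps)
    with 1 show "t ^ 3 / (1 + t\<^sup>2)\<^sup>2 \<le> 1" by linarith
  qed
  have y4: "(\<Sum>n<N. y n k / (1 + (y n k)\<^sup>2)) \<le> 4" for N k unfolding y_def by (rule dyadic_sum_bound) simp
  have sums: "(\<Sum>n<N. 2^n * (g n k)\<^sup>2) \<le> 4" "(\<Sum>n<N. (1/2^n) * (f n k)\<^sup>2) \<le> 4" for N k
    unfolding g2 f2 Dy using frac(1,2)[OF y0] by (auto intro!: order_trans[OF sum_mono y4])
  obtain c0 where "0 < c0" and c0': "\<And>t. 0 \<le> t ==> t \<le> 1 ==> \<bar>p t\<bar> \<le> c0"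
    by (rule fc.continuous_bounded_01[OF pc]) (rule that)
  then have c0: "0 \<le> c0" "\<And>t. 0 \<le> t ==> t \<le> 1 ==> \<bar>p t\<bar> \<le> c0" by auto
  \<comment> \<open>The product 8 * 64 is the factor 512 of the pointwise bound, 4096 is the Sobolev
    constant and 4 the bound of the dyadic sums.\<close>
  define K where "K = 8 * 64 * 4096 * (4::real)"
  have main: "(\<integral>\<^sup>+x. ennreal (norm (rep_l2 (Q4 w) x) ^ 3) \<partial>lborel) \<le> ennreal ((c0\<^sup>2 + K) * ((norm w)\<^sup>2 + norm w ^ 6))"
    if w: "w \<in> H" for w
  proof -
    let ?s = "(norm w)\<^sup>2"
    define v where "v = Q4 w"
    define a where "a n = fc.Phi (g n) w" for n
    define X where "X n = fc.Phi (f n) w" for n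
    define b where "b n = Q (X n)" for n
    have vP: "v = fc.Phi p w" unfolding v_def p_def by (rule neg_pow_eq[OF w]) simp
    have XH: "X n \<in> H" for n unfolding X_def using fc.Phi_in_H[OF fc, of w] w by (simp add: H_eq)
    have split: "v = a n + b n" for n
    proof -
      have "b n = fc.Phi (%k. (k / gap) powr (1/2) * f n k) w"
        unfolding b_def X_def by (rule neg_pow_Phi[OF w _ fc]) simp
      then have b: "b n = fc.Phi (%k. (p k)\<^sup>2 * f n k) w" unfolding half .
      have "a n + b n = fc.Phi (%k. g n k + (p k)\<^sup>2 * f n k) w"
        unfolding a_def b by (rule fc.Phi_add[symmetric]) (intro continuous_intros gc fc pc)+
      also have "\<dots> = fc.Phi p w"
      proof (rule fc.Phi_cong)
        fix k :: real
        have "g n k + (p k)\<^sup>2 * f n k = (p k + (p k)\<^sup>2 * (4^n * p k ^ 3)) / D n k"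
          unfolding f_def g_def by (simp only: add_divide_distrib times_divide_eq_right)
        also have "p k + (p k)\<^sup>2 * (4^n * p k ^ 3) = p k * D n k"
          unfolding D_def by algebra
        finally show "g n k + (p k)\<^sup>2 * f n k = p k" using Dnz by simp
      qed
      finally show ?thesis unfolding vP ..
    qed
    have vn: "(norm v)\<^sup>2 \<le> c0\<^sup>2 * ?s"
      using power_mono[OF fc.norm_Phi_le[OF pc c0(2), of w]] unfolding vP by (simp add: power_mult_distrib)
    have Xn: "(norm (X n))\<^sup>2 \<le> 2^n * ?s" for n
    proof -
      have "norm (X n) \<le> sqrt (2^n) * norm w"
        unfolding X_def
      proof (rule fc.norm_Phi_le[OF fc])
        fix k :: real
        have "(f n k)\<^sup>2 \<le> 2^n" unfolding f2 Dy using frac(3)[OF y0[of n k]] by (intro mult_left_le) auto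
        then show "\<bar>f n k\<bar> \<le> sqrt (2^n)" using real_sqrt_le_mono by fastforce
      qed
      then have "(norm (X n))\<^sup>2 \<le> (sqrt (2^n) * norm w)\<^sup>2" by (intro power_mono) auto
      then show ?thesis by (simp add: power_mult_distrib)
    qed
    let ?a = "%n x. norm (rep_l2 (a n) x)" and ?b = "%n x. norm (rep_l2 (b n) x)"
    \<comment> \<open>The constants 32 and 512 make the respective term equal to 8 * 8^n, the cube
      of 2^(n+1), when its field has the size 2^n / 2.\<close>
    let ?T = "%n x. 32 * (2^n * (?a n x)\<^sup>2) + 512 * (?b n x ^ 6 / 8^n)"
    have pw: "AE x in lborel. ennreal (norm (rep_l2 v x) ^ 3) \<le> ennreal ((norm (rep_l2 v x))\<^sup>2) + (\<Sum>n. ennreal (?T n x))"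
    proof -
      have "AE x in lborel. \<forall>n. rep_l2 v x = rep_l2 (a n) x + rep_l2 (b n) x"
        unfolding AE_all_countable
        using rep_l2_lincomb[of 1 "a n" 1 "b n" for n] by (simp flip: split)
      then show ?thesis
      proof eventually_elim
        case (elim x)
        define r where "r = norm (rep_l2 v x)"
        show ?case
        proof (cases "r \<le> 1")
          case True
          then have "r ^ 3 \<le> r\<^sup>2" using power_decreasing[of 2 3 r] by (simp add: r_def)
          then have "ennreal (r ^ 3) \<le> ennreal (r\<^sup>2)" by (rule ennreal_leI)
          also have "\<dots> \<le> ennreal (r\<^sup>2) + (\<Sum>n. ennreal (?T n x))" by simp
          finally show ?thesis unfolding r_def .
        next
          case False
          \<comment> \<open>Since r > 1 this exponent is a successor n + 1, which places r between
            2^n and 2^(n+1).\<close>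
          define m where "m = (LEAST m. r \<le> 2^m)"
          have ex: "\<exists>m. r \<le> 2^m" using real_arch_pow[of 2 r] by (auto intro: less_imp_le)
          have m: "r \<le> 2^m" unfolding m_def using ex by (rule LeastI_ex)
          have "m \<noteq> 0" using m False by (intro notI) simp
          then obtain n where n: "m = Suc n" by (cases m) auto
          have rn: "2^n < r" using not_less_Least[of n "%m. r \<le> 2^m"] n unfolding m_def by auto
          have tri: "r \<le> ?a n x + ?b n x"
            unfolding r_def elim[rule_format, of n] by (rule norm_triangle_ineq)
          have e8: "(8::real)^n = 2^n * (2^n)\<^sup>2" by (simp add: power2_eq_square flip: power_mult_distrib)
          have "r ^ 3 \<le> (2 * 2^n) ^ 3" using m n by (intro power_mono) (auto simp: r_def)
          also have "(2 * 2^n) ^ 3 = 8 * (8::real)^n" unfolding e8 by (simp add: power2_eq_square power3_eq_cube)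
          also have "\<dots> \<le> ?T n x"
          proof (cases "2^n / 2 \<le> ?a n x")
            case True
            then have "(2^n / 2)\<^sup>2 \<le> (?a n x)\<^sup>2" by (intro power_mono) auto
            then have "32 * (2^n * (2^n / 2)\<^sup>2) \<le> 32 * (2^n * (?a n x)\<^sup>2)" by simp
            moreover have "32 * (2^n * (2^n / 2)\<^sup>2) = 8 * (8::real)^n" unfolding e8 by (simp add: power_divide)
            moreover have "0 \<le> 512 * (?b n x ^ 6 / 8^n)" by simp
            ultimately show ?thesis by linarith
          next
            case False
            then have "2^n / 2 \<le> ?b n x" using tri rn by linarith
            then have "(2^n / 2) ^ 6 \<le> ?b n x ^ 6" by (intro power_mono) auto
            then have "512 * ((2^n / 2) ^ 6 / 8^n) \<le> 512 * (?b n x ^ 6 / 8^n)" by (intro mult_left_mono divide_right_mono) auto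
            moreover have "512 * ((2^n / 2) ^ 6 / 8^n) = 8 * (8::real)^n"
            proof -
              have "((2::real)^n) ^ 6 = 8^n * 8^n" unfolding e8 by (simp add: power2_eq_square eval_nat_numeral)
              then show ?thesis by (simp add: power_divide)
            qed
            moreover have "0 \<le> 32 * (2^n * (?a n x)\<^sup>2)" by simp
            ultimately show ?thesis by linarith
          qed
          finally have "ennreal (r ^ 3) \<le> ennreal (?T n x)" by (rule ennreal_leI)
          also have "\<dots> \<le> (\<Sum>n. ennreal (?T n x))"
            using sum_le_suminf[of "%n. ennreal (?T n x)" "{n}"] by simp
          also have "\<dots> \<le> ennreal (r\<^sup>2) + (\<Sum>n. ennreal (?T n x))" by simp
          finally show ?thesis unfolding r_def .
        qed
      qed
    qed
    let ?X = "%n. (norm (X n))\<^sup>2"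
    let ?I = "%n. 32 * (2^n * (norm (a n))\<^sup>2) + 8 * 64 * 4096 * ?s\<^sup>2 * ((1/2^n) * ?X n)"
    have Tn: "(\<integral>\<^sup>+x. ennreal (?T n x) \<partial>lborel) \<le> ennreal (?I n)" for n
    proof -
      have "(\<integral>\<^sup>+x. ennreal (?T n x) \<partial>lborel)
          = (\<integral>\<^sup>+x. ennreal (32 * 2^n) * ennreal ((?a n x)\<^sup>2) + ennreal (512 / 8^n) * ennreal (?b n x ^ 6) \<partial>lborel)"
        by (intro nn_integral_cong) (simp add: mult.assoc flip: ennreal_plus ennreal_mult)
      also have "\<dots> = ennreal (32 * 2^n) * (\<integral>\<^sup>+x. ennreal ((?a n x)\<^sup>2) \<partial>lborel) + ennreal (512 / 8^n) * (\<integral>\<^sup>+x. ennreal (?b n x ^ 6) \<partial>lborel)"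
        by (simp add: nn_integral_add nn_integral_cmult)
      also have "\<dots> \<le> ennreal (32 * 2^n) * ennreal ((norm (a n))\<^sup>2) + ennreal (512 / 8^n) * ennreal (4096 * norm (X n) ^ 6)"
        using V_sobolev[OF neg_half_V(1)[OF XH[of n]], unfolded neg_half_V(2)[OF XH], folded b_def] unfolding nn_integral_rep_l2
        by (intro add_mono mult_left_mono order_refl) auto
      also have "\<dots> = ennreal (32 * 2^n * (norm (a n))\<^sup>2 + 512 / 8^n * (4096 * norm (X n) ^ 6))"
        by (simp flip: ennreal_plus ennreal_mult)
      also have "\<dots> \<le> ennreal (?I n)"
      proof (rule ennreal_leI)
        \<comment> \<open>Four of the six powers are spent on the bound of the squared norm of X n
          by 2^n times that of w; the remaining square is summable with weight 2^(-n).\<close>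
        have "norm (X n) ^ 6 = ?X n * (?X n)\<^sup>2" by (simp add: eval_nat_numeral)
        also have "\<dots> \<le> ?X n * (2^n * ?s)\<^sup>2" by (intro mult_left_mono power_mono Xn) auto
        finally have "512 / 8^n * (4096 * norm (X n) ^ 6) \<le> 512 / 8^n * (4096 * (?X n * (2^n * ?s)\<^sup>2))"
          by (intro mult_left_mono) auto
        also have "\<dots> = 8 * 64 * 4096 * ?s\<^sup>2 * ((1/2^n) * ?X n)"
        proof -
          have "(8::real)^n = 2^n * (2^n)\<^sup>2" by (simp add: power2_eq_square flip: power_mult_distrib)
          then show ?thesis by (simp add: power_mult_distrib)
        qed
        finally show "32 * 2^n * (norm (a n))\<^sup>2 + 512 / 8^n * (4096 * norm (X n) ^ 6) \<le> ?I n" by simp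
      qed
      finally show ?thesis .
    qed
    have sumI: "(\<Sum>n<N. ?I n) \<le> K * (?s + norm w ^ 6)" for N
    proof -
      have "(\<Sum>n<N. 2^n * (norm (a n))\<^sup>2) \<le> 4 * ?s"
        unfolding a_def by (rule weighted_multiplier_sum[OF gc _ sums(1)]) simp
      moreover have "(\<Sum>n<N. (1/2^n) * ?X n) \<le> 4 * ?s"
        unfolding X_def by (rule weighted_multiplier_sum[OF fc _ sums(2)]) simp
      ultimately have "(\<Sum>n<N. ?I n) \<le> 32 * (4 * ?s) + 8 * 64 * 4096 * ?s\<^sup>2 * (4 * ?s)"
        unfolding sum.distrib sum_distrib_left[symmetric] by (intro add_mono mult_left_mono) auto
      also have "8 * 64 * 4096 * ?s\<^sup>2 * (4 * ?s) = K * norm w ^ 6" by (simp add: K_def eval_nat_numeral)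
      also have "32 * (4 * ?s) + K * norm w ^ 6 \<le> K * (?s + norm w ^ 6)" by (simp add: K_def)
      finally show ?thesis .
    qed
    have "(\<integral>\<^sup>+x. ennreal (norm (rep_l2 v x) ^ 3) \<partial>lborel) \<le> (\<integral>\<^sup>+x. ennreal ((norm (rep_l2 v x))\<^sup>2) + (\<Sum>n. ennreal (?T n x)) \<partial>lborel)"
      by (rule nn_integral_mono_AE[OF pw])
    also have "\<dots> = ennreal ((norm v)\<^sup>2) + (\<Sum>n. \<integral>\<^sup>+x. ennreal (?T n x) \<partial>lborel)"
      by (subst nn_integral_add, measurable) (subst nn_integral_suminf, measurable, simp only: nn_integral_rep_l2)
    also have "\<dots> \<le> ennreal (c0\<^sup>2 * ?s) + ennreal (K * (?s + norm w ^ 6))"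
    proof (intro add_mono ennreal_leI vn suminf_le_const)
      fix N
      have "(\<Sum>n<N. \<integral>\<^sup>+x. ennreal (?T n x) \<partial>lborel) \<le> (\<Sum>n<N. ennreal (?I n))" by (intro sum_mono Tn)
      also have "\<dots> = ennreal (\<Sum>n<N. ?I n)" by (rule sum_ennreal) simp
      also have "\<dots> \<le> ennreal (K * (?s + norm w ^ 6))" by (intro ennreal_leI sumI)
      finally show "(\<Sum>n<N. \<integral>\<^sup>+x. ennreal (?T n x) \<partial>lborel) \<le> ennreal (K * (?s + norm w ^ 6))" .
    qed simp
    also have "\<dots> = ennreal (c0\<^sup>2 * ?s + K * (?s + norm w ^ 6))" by (rule ennreal_plus[symmetric]) (auto simp: K_def)
    also have "\<dots> \<le> ennreal ((c0\<^sup>2 + K) * (?s + norm w ^ 6))" by (rule ennreal_leI) (simp add: algebra_simps)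
    finally show ?thesis unfolding v_def .
  qed
  show thesis by (rule that[OF _ main]) (simp add: K_def)
qed

text \<open>The first two arguments are A^(1/2) of the transporting and of the transported field.
  Equal arguments give the form that defines A^(-1/4) F; keeping them apart makes Lipschitz bounds a
  matter of linearity.\<close>

definition trilinear_density :: "l2 => l2 => l2 => real^3 => real" where
  "trilinear_density x y w z = inner (\<Sum>j\<in>UNIV. (rep_l2 (Q x) z $ j) *\<^sub>R rep_l2 (D_weak \<Omega> j (Q y)) z)
     (rep_l2 (Q4 w) z)"

definition trilinear :: "l2 => l2 => l2 => real" where
  "trilinear x y w = (LINT z:\<Omega>|lborel. trilinear_density x y w z)"

text \<open>Young's inequality for the exponents 6, 2, 3 with crude constants. The case distinction
  compares c with a^2, the two sides having equal size when c = a^2.\<close>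

lemma young_6_2_3:
  fixes a b c :: real
  assumes "0 \<le> a" "0 \<le> b" "0 \<le> c"
  shows "a * b * c \<le> a ^ 6 + b\<^sup>2 + c ^ 3"
proof -
  have "(a * c)\<^sup>2 \<le> a ^ 6 + c ^ 3"
  proof (cases "c \<le> a\<^sup>2")
    case True
    have "(a * c)\<^sup>2 \<le> (a * a\<^sup>2)\<^sup>2" using assms True by (intro power_mono mult_left_mono) auto
    also have "\<dots> = a ^ 6" by (simp add: eval_nat_numeral)
    finally show ?thesis using assms by (simp add: add_increasing2)
  next
    case False
    have "(a * c)\<^sup>2 = a\<^sup>2 * c\<^sup>2" by (simp add: power_mult_distrib)
    also have "\<dots> \<le> c * c\<^sup>2" using False by (intro mult_right_mono) auto
    also have "\<dots> = c ^ 3" by (simp add: eval_nat_numeral)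
    finally show ?thesis using assms by (simp add: add_increasing)
  qed
  moreover have "b * (a * c) \<le> b\<^sup>2 + (a * c)\<^sup>2"
    using sum_squares_bound[of b "a * c"] assms mult_nonneg_nonneg[of b "a * c"] mult_nonneg_nonneg[of a c] unfolding mult.assoc[of 2] by linarith
  ultimately show ?thesis by (simp add: ac_simps)
qed

lemma trilinear_density_bound:
  "\<bar>trilinear_density x y w z\<bar> \<le> 3 * norm (rep_l2 (Q x) z) ^ 6
    + (\<Sum>j\<in>UNIV. (norm (rep_l2 (D_weak \<Omega> j (Q y)) z))\<^sup>2) + 3 * norm (rep_l2 (Q4 w) z) ^ 3"
proof -
  let ?a = "norm (rep_l2 (Q x) z)" and ?c = "norm (rep_l2 (Q4 w) z)"
  let ?b = "%j. norm (rep_l2 (D_weak \<Omega> j (Q y)) z)"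
  have "\<bar>trilinear_density x y w z\<bar> \<le> norm (\<Sum>j\<in>UNIV. (rep_l2 (Q x) z $ j) *\<^sub>R rep_l2 (D_weak \<Omega> j (Q y)) z) * ?c"
    unfolding trilinear_density_def by (rule Cauchy_Schwarz_ineq2)
  also have "\<dots> \<le> (\<Sum>j\<in>UNIV. ?a * ?b j) * ?c"
    by (intro mult_right_mono order_trans[OF norm_sum] sum_mono) (auto simp: component_le_norm_cart intro!: mult_right_mono)
  also have "\<dots> = (\<Sum>j\<in>UNIV. ?a * ?b j * ?c)" by (rule sum_distrib_right)
  also have "\<dots> \<le> (\<Sum>j\<in>UNIV. ?a ^ 6 + (?b j)\<^sup>2 + ?c ^ 3)" by (intro sum_mono young_6_2_3) auto
  also have "\<dots> = 3 * ?a ^ 6 + (\<Sum>j\<in>UNIV. (?b j)\<^sup>2) + 3 * ?c ^ 3" by (simp add: sum.distrib)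
  finally show ?thesis .
qed

lemma measurable_trilinear_density [measurable]: "trilinear_density x y w \<in> borel_measurable borel"
proof -
  have "(%z. rep_l2 u z $ j) \<in> borel_measurable borel" for u and j :: 3
    by (rule measurable_compose[OF measurable_rep_l2 borel_measurable_continuous_onI]) (intro continuous_intros)
  then show ?thesis
    unfolding trilinear_density_def[abs_def]
    by (intro borel_measurable_inner borel_measurable_sum borel_measurable_scaleR measurable_rep_l2)
qed

text \<open>Neither the L^3 bound nor the Young inequality is used in homogeneous form, so the
  conclusion is restricted to unit balls; scaling restores homogeneity in
  \<open>trilinear_bound\<close>.\<close>

lemma trilinear_estimate:
  obtains C where "0 \<le> C"
    "\<And>x y w. x \<in> H ==> y \<in> H ==> w \<in> H ==> set_integrable lborel \<Omega> (trilinear_density x y w)"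
    "\<And>x y w. x \<in> H ==> y \<in> H ==> w \<in> H ==> norm x \<le> 1 ==> norm y \<le> 1 ==> norm w \<le> 1 ==> \<bar>trilinear x y w\<bar> \<le> C"
proof -
  obtain C where C: "0 \<le> C" "\<And>w. w \<in> H ==>
    (\<integral>\<^sup>+x. ennreal (norm (rep_l2 (Q4 w) x) ^ 3) \<partial>lborel) \<le> ennreal (C * ((norm w)\<^sup>2 + norm w ^ 6))"
    by (rule quarter_L3) (rule that)
  let ?c = "%w::l2. (norm w)\<^sup>2 + norm w ^ 6"
  let ?K = "%x y w. 3 * (4096 * norm x ^ 6) + (norm y)\<^sup>2 + 3 * (C * ?c w)"
  have fin: "(\<integral>\<^sup>+z. ennreal \<bar>trilinear_density x y w z\<bar> \<partial>lborel) \<le> ennreal (?K x y w)"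
    if H: "x \<in> H" "y \<in> H" "w \<in> H" for x y w
  proof -
    let ?a = "%z. norm (rep_l2 (Q x) z) ^ 6" and ?d = "%z. norm (rep_l2 (Q4 w) z) ^ 3"
    let ?D = "%j. D_weak \<Omega> j (Q y)"
    let ?b = "%j z. (norm (rep_l2 (?D j) z))\<^sup>2"
    have "(\<integral>\<^sup>+z. ennreal \<bar>trilinear_density x y w z\<bar> \<partial>lborel)
        \<le> (\<integral>\<^sup>+z. 3 * ennreal (?a z) + (\<Sum>j\<in>UNIV. ennreal (?b j z)) + 3 * ennreal (?d z) \<partial>lborel)"
    proof (rule nn_integral_mono)
      fix z
      have "ennreal \<bar>trilinear_density x y w z\<bar> \<le> ennreal (3 * ?a z + (\<Sum>j\<in>UNIV. ?b j z) + 3 * ?d z)"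
        by (rule ennreal_leI[OF trilinear_density_bound])
      also have "\<dots> = 3 * ennreal (?a z) + (\<Sum>j\<in>UNIV. ennreal (?b j z)) + 3 * ennreal (?d z)"
        by (simp add: ennreal_plus ennreal_mult sum_nonneg sum_ennreal)
      finally show "ennreal \<bar>trilinear_density x y w z\<bar> \<le> 3 * ennreal (?a z) + (\<Sum>j\<in>UNIV. ennreal (?b j z)) + 3 * ennreal (?d z)" .
    qed
    also have "\<dots> = 3 * (\<integral>\<^sup>+z. ennreal (?a z) \<partial>lborel) + (\<Sum>j\<in>UNIV. \<integral>\<^sup>+z. ennreal (?b j z) \<partial>lborel) + 3 * (\<integral>\<^sup>+z. ennreal (?d z) \<partial>lborel)"
      by (simp add: nn_integral_add nn_integral_cmult nn_integral_sum del: sum_ennreal)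
    also have "\<dots> \<le> 3 * ennreal (4096 * norm x ^ 6) + (\<Sum>j\<in>UNIV. ennreal ((norm (?D j))\<^sup>2)) + 3 * ennreal (C * ?c w)"
      using V_sobolev[OF neg_half_V(1)[OF H(1)]] C(2)[OF H(3)] unfolding neg_half_V(2)[OF H(1)] nn_integral_rep_l2
      by (intro add_mono mult_left_mono order_refl) auto
    also have "(\<Sum>j\<in>UNIV. ennreal ((norm (?D j))\<^sup>2)) = ennreal ((norm y)\<^sup>2)"
      unfolding neg_half_V(2)[OF H(2), symmetric] norm_grad by (rule sum_ennreal) simp
    also have "3 * ennreal (4096 * norm x ^ 6) + ennreal ((norm y)\<^sup>2) + 3 * ennreal (C * ?c w) = ennreal (?K x y w)"
      using C(1) by (simp add: ennreal_plus ennreal_mult)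
    finally show ?thesis .
  qed
  have int: "integrable lborel (trilinear_density x y w)"
    if H: "x \<in> H" "y \<in> H" "w \<in> H" for x y w
    using le_less_trans[OF fin[OF H] ennreal_less_top] by (intro integrableI_bounded) auto
  have sint: "set_integrable lborel \<Omega> (trilinear_density x y w)"
    if H: "x \<in> H" "y \<in> H" "w \<in> H" for x y w
    unfolding set_integrable_def using int[OF H] borel_\<Omega> by (intro integrable_mult_indicator) auto
  show thesis
  proof (rule that[of "3 * 4096 + 1 + 6 * C"])
    fix x y w assume H: "x \<in> H" "y \<in> H" "w \<in> H" and n: "norm x \<le> 1" "norm y \<le> 1" "norm w \<le> 1"
    have "ennreal \<bar>trilinear x y w\<bar> \<le> (\<integral>\<^sup>+z. ennreal (norm (indicator \<Omega> z *\<^sub>R trilinear_density x y w z)) \<partial>lborel)"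
      unfolding trilinear_def set_lebesgue_integral_def
      using integral_norm_bound_ennreal[OF sint[OF H, unfolded set_integrable_def]] by simp
    also have "\<dots> \<le> (\<integral>\<^sup>+z. ennreal \<bar>trilinear_density x y w z\<bar> \<partial>lborel)"
      by (intro nn_integral_mono) (auto simp: indicator_def)
    also have "\<dots> \<le> ennreal (?K x y w)" by (rule fin[OF H])
    also have "\<dots> \<le> ennreal (3 * 4096 + 1 + 6 * C)"
    proof (rule ennreal_leI)
      have "norm x ^ 6 \<le> 1" "(norm y)\<^sup>2 \<le> 1" "?c w \<le> 2"
        using n power_le_one[OF norm_ge_zero n(3)] add_mono[of "(norm w)\<^sup>2" 1 "norm w ^ 6" 1] by (simp_all add: power_le_one)
      moreover from mult_left_mono[OF this(3) C(1)] have "C * ?c w \<le> C * 2" .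
      ultimately show "?K x y w \<le> 3 * 4096 + 1 + 6 * C" by simp
    qed
    finally show "\<bar>trilinear x y w\<bar> \<le> 3 * 4096 + 1 + 6 * C" using C(1) by (subst (asm) ennreal_le_iff) auto
  qed (use sint C(1) in auto)
qed

lemma trilinear_integrable:
  "x \<in> H ==> y \<in> H ==> w \<in> H ==> set_integrable lborel \<Omega> (trilinear_density x y w)"
  by (rule trilinear_estimate) blast

lemma neg_pow_lincomb:
  assumes "x \<in> H" "y \<in> H" "0 < \<beta>"
  shows "a *\<^sub>R x + b *\<^sub>R y \<in> H" "neg_pow \<Omega> \<beta> (a *\<^sub>R x + b *\<^sub>R y) = a *\<^sub>R neg_pow \<Omega> \<beta> x + b *\<^sub>R neg_pow \<Omega> \<beta> y"
proof -
  note s = subspace_mul[OF subspace_L2_sigma assms(1), of a] subspace_mul[OF subspace_L2_sigma assms(2), of b]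
  show "a *\<^sub>R x + b *\<^sub>R y \<in> H" by (rule subspace_add[OF subspace_L2_sigma s])
  show "neg_pow \<Omega> \<beta> (a *\<^sub>R x + b *\<^sub>R y) = a *\<^sub>R neg_pow \<Omega> \<beta> x + b *\<^sub>R neg_pow \<Omega> \<beta> y"
    using assms s by (simp add: neg_pow_linear)
qed

text \<open>Common step for linearity in each argument: linear combinations of classes have
  representatives that combine almost everywhere, and integrability of both densities splits the
  integral.\<close>

lemma trilinear_cong:
  assumes "AE z in lborel. trilinear_density x y w z = a * trilinear_density x1 y1 w1 z + b * trilinear_density x2 y2 w2 z"
    and H: "x1 \<in> H" "y1 \<in> H" "w1 \<in> H" "x2 \<in> H" "y2 \<in> H" "w2 \<in> H"
  shows "trilinear x y w = a * trilinear x1 y1 w1 + b * trilinear x2 y2 w2"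
proof -
  have "trilinear x y w = (LINT z:\<Omega>|lborel. a * trilinear_density x1 y1 w1 z + b * trilinear_density x2 y2 w2 z)"
    unfolding trilinear_def using borel_\<Omega> assms(1) by (intro set_lebesgue_integral_cong_AE) (auto elim!: eventually_mono)
  then show ?thesis
    unfolding trilinear_def using set_integral_add(2)[of lborel \<Omega> "%z. a * trilinear_density x1 y1 w1 z" "%z. b * trilinear_density x2 y2 w2 z"]
      trilinear_integrable[OF H(1-3)] trilinear_integrable[OF H(4-6)] by simp
qed

lemma trilinear_lin3:
  assumes H: "x \<in> H" "y \<in> H" "w \<in> H" "w' \<in> H"
  shows "trilinear x y (a *\<^sub>R w + b *\<^sub>R w') = a * trilinear x y w + b * trilinear x y w'"
  by (rule trilinear_cong[OF _ H(1-3) H(1,2,4)])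
    (use rep_l2_lincomb[of a "Q4 w" b "Q4 w'"] in
      \<open>auto simp: trilinear_density_def neg_pow_lincomb[OF H(3,4)] inner_add_right elim!: eventually_mono\<close>)

lemma trilinear_lin1:
  assumes H: "x \<in> H" "x' \<in> H" "y \<in> H" "w \<in> H"
  shows "trilinear (a *\<^sub>R x + b *\<^sub>R x') y w = a * trilinear x y w + b * trilinear x' y w"
  by (rule trilinear_cong[OF _ H(1,3,4) H(2,3,4)])
    (use rep_l2_lincomb[of a "Q x" b "Q x'"] in
      \<open>auto simp: trilinear_density_def neg_pow_lincomb[OF H(1,2)] inner_sum_left inner_add_left scaleR_left_distrib
        sum.distrib sum_distrib_left algebra_simps elim!: eventually_mono\<close>)

lemma trilinear_lin2:
  assumes H: "x \<in> H" "y \<in> H" "y' \<in> H" "w \<in> H"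
  shows "trilinear x (a *\<^sub>R y + b *\<^sub>R y') w = a * trilinear x y w + b * trilinear x y' w"
proof (rule trilinear_cong[OF _ H(1,2,4) H(1,3,4)])
    have H1: "Q y \<in> H1 \<Omega>" "Q y' \<in> H1 \<Omega>" using V_H1[OF neg_half_V(1)] H by auto
  have D: "D_weak \<Omega> j (Q (a *\<^sub>R y + b *\<^sub>R y')) = a *\<^sub>R D_weak \<Omega> j (Q y) + b *\<^sub>R D_weak \<Omega> j (Q y')" for j
    using H1_scaleR[OF H1(1)] H1_scaleR[OF H1(2)] H1_add by (simp add: neg_pow_lincomb[OF H(2,3)])
  have "AE z in lborel. \<forall>j. rep_l2 (D_weak \<Omega> j (Q (a *\<^sub>R y + b *\<^sub>R y'))) z = a *\<^sub>R rep_l2 (D_weak \<Omega> j (Q y)) z + b *\<^sub>R rep_l2 (D_weak \<Omega> j (Q y')) z"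
    unfolding D AE_all_countable using rep_l2_lincomb by blast
  then show "AE z in lborel. trilinear_density x (a *\<^sub>R y + b *\<^sub>R y') w z = a * trilinear_density x y w z + b * trilinear_density x y' w z"
    by eventually_elim (simp add: trilinear_density_def inner_sum_left inner_add_left sum.distrib sum_distrib_left algebra_simps)
qed

lemma trilinear_diff:
  assumes H: "x \<in> H" "y \<in> H" "w \<in> H"
  shows "trilinear (x - y) x w + trilinear y (x - y) w = trilinear x x w - trilinear y y w"
  using trilinear_lin1[OF H(1,2,1,3), of 1 "-1"] trilinear_lin2[OF H(2,1,2,3), of 1 "-1"] by simp

lemma trilinear_scale:
  assumes H: "x \<in> H" "y \<in> H" "w \<in> H"
  shows "trilinear (a *\<^sub>R x) (b *\<^sub>R y) (c *\<^sub>R w) = a * b * c * trilinear x y w"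
proof -
  have S: "b *\<^sub>R y \<in> H" "c *\<^sub>R w \<in> H" by (intro subspace_mul subspace_L2_sigma H)+
  show ?thesis
    using trilinear_lin1[OF H(1,1) S, of a 0] trilinear_lin2[OF H(1,2,2) S(2), of b 0] trilinear_lin3[OF H H(3), of c 0] by simp
qed

text \<open>Normalising each argument reduces to unit balls; for a zero argument the convention 1 /
  0 = 0 keeps the scaling identity valid.\<close>

lemma trilinear_bound:
  obtains C where "0 \<le> C"
    "\<And>x y w. x \<in> H ==> y \<in> H ==> w \<in> H ==> \<bar>trilinear x y w\<bar> \<le> C * norm x * norm y * norm w"
proof -
  obtain C where C: "0 \<le> C"
    "\<And>x y w. x \<in> H ==> y \<in> H ==> w \<in> H ==> norm x \<le> 1 ==> norm y \<le> 1 ==> norm w \<le> 1 ==> \<bar>trilinear x y w\<bar> \<le> C"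
    by (rule trilinear_estimate) (rule that)
  have "\<bar>trilinear x y w\<bar> \<le> C * norm x * norm y * norm w"
    if H: "x \<in> H" "y \<in> H" "w \<in> H" for x y w
  proof -
    let ?e = "%x::l2. (1 / norm x) *\<^sub>R x"
    have e: "?e v \<in> H" "norm (?e v) \<le> 1" "norm v *\<^sub>R ?e v = v" if "v \<in> H" for v
      using that by (auto intro!: subspace_scale subspace_L2_sigma)
    have "trilinear x y w = norm x * norm y * norm w * trilinear (?e x) (?e y) (?e w)"
      using trilinear_scale[OF e(1)[OF H(1)] e(1)[OF H(2)] e(1)[OF H(3)], of "norm x" "norm y" "norm w"] e(3)[OF H(1)] e(3)[OF H(2)] e(3)[OF H(3)]
      by simp
    also have "\<bar>\<dots>\<bar> = norm x * norm y * norm w * \<bar>trilinear (?e x) (?e y) (?e w)\<bar>" by (simp add: abs_mult)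
    also have "\<dots> \<le> norm x * norm y * norm w * C" by (intro mult_left_mono C(2) e H) auto
    finally show ?thesis by (simp add: ac_simps)
  qed
  then show thesis by (rule that[OF C(1)])
qed

section \<open>The convective map\<close>

definition convective :: "l2 => l2" where
  "convective x = A_quarter_F \<Omega> (Q x)"

text \<open>The trilinear bound makes w -> - trilinear x x w a bounded functional, and its Riesz
  representative is the unique element that the definition of \<open>A_quarter_F\<close>
  describes.\<close>

lemma convective:
  assumes x: "x \<in> H"
  shows "convective x \<in> H" "w \<in> H ==> inner (convective x) w = - trilinear x x w"
proof -
  obtain C where C: "0 \<le> C"
    "\<And>x y w. x \<in> H ==> y \<in> H ==> w \<in> H ==> \<bar>trilinear x y w\<bar> \<le> C * norm x * norm y * norm w"
    by (rule trilinear_bound) (rule that)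
  let ?P = "%z. z \<in> H \<and> (\<forall>w\<in>H. inner z w = - trilinear x x w)"
  have "\<exists>h\<in>H. \<forall>w\<in>H. - trilinear x x w = inner h w"
  proof (rule riesz_representation[OF closed_L2_sigma subspace_L2_sigma, where C = "C * norm x * norm x"])
    show "- trilinear x x (v + w) = - trilinear x x v + - trilinear x x w" if "v \<in> H" "w \<in> H" for v w
      using trilinear_lin3[OF x x that, of 1 1] by simp
    show "- trilinear x x (c *\<^sub>R w) = c * - trilinear x x w" if "w \<in> H" for c w
      using trilinear_scale[OF x x that, of 1 1 c] by simp
  qed (use C(2)[OF x x] in simp)
  then obtain h where "h \<in> H" "\<forall>w\<in>H. - trilinear x x w = inner h w" by blast
  then have h: "?P h" by simp
  have "convective x = (THE z. ?P z)"
    unfolding convective_def A_quarter_F_def trilinear_def trilinear_density_def convection_def ..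
  also have "(THE z. ?P z) = h"
  proof (rule the_equality[where P = ?P, OF h])
    fix z assume z: "?P z"
    have "z - h \<in> H" using z h by (intro subspace_diff subspace_L2_sigma) auto
    then have "inner (z - h) (z - h) = 0" using z h by (simp add: inner_diff_left)
    then show "z = h" by simp
  qed
  finally have "?P (convective x)" using h by simp
  then show "convective x \<in> H" "w \<in> H ==> inner (convective x) w = - trilinear x x w" by auto
qed

text \<open>The difference is tested against itself, with the difference of the two diagonal values
  split into one term for each changed argument.\<close>

lemma convective_lipschitz:
  obtains C where "0 \<le> C" "\<And>x y. x \<in> H ==> y \<in> H ==>
    norm (convective x - convective y) \<le> C * (norm x + norm y) * norm (x - y)"
proof -
  obtain C where C: "0 \<le> C"
    "\<And>x y w. x \<in> H ==> y \<in> H ==> w \<in> H ==> \<bar>trilinear x y w\<bar> \<le> C * norm x * norm y * norm w"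
    by (rule trilinear_bound) (rule that)
  have "norm (convective x - convective y) \<le> C * (norm x + norm y) * norm (x - y)"
    if H: "x \<in> H" "y \<in> H" for x y
  proof -
    define d where "d = convective x - convective y"
    have d: "d \<in> H" unfolding d_def by (intro subspace_diff subspace_L2_sigma convective H)
    have xy: "x - y \<in> H" by (intro subspace_diff subspace_L2_sigma H)
    have "(norm d)\<^sup>2 = trilinear y y d - trilinear x x d"
      unfolding power2_norm_eq_inner by (subst d_def) (simp add: inner_diff_left convective(2) H d)
    also have "\<dots> = - trilinear (x - y) x d - trilinear y (x - y) d"
      using trilinear_diff[OF H d] by simp
    also have "\<dots> \<le> C * norm (x - y) * norm x * norm d + C * norm y * norm (x - y) * norm d"
      using C(2)[OF xy H(1) d] C(2)[OF H(2) xy d] by linarith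
    also have "\<dots> = (C * (norm x + norm y) * norm (x - y)) * norm d" by (simp add: algebra_simps)
    finally have "norm d * norm d \<le> (C * (norm x + norm y) * norm (x - y)) * norm d" by (simp add: power2_eq_square)
    then have "norm d \<le> C * (norm x + norm y) * norm (x - y)"
      using C(1) by (cases "norm d = 0") (auto dest: mult_right_le_imp_le)
    then show ?thesis unfolding d_def .
  qed
  then show thesis by (rule that[OF C(1)])
qed

end

section \<open>Mild solutions\<close>

definition retract :: "real => 'a::real_normed_vector => 'a" where
  "retract R x = (R / max R (norm x)) *\<^sub>R x"

lemma retract_id: "0 < R ==> norm x \<le> R ==> retract R x = x"
  by (simp add: retract_def max_absorb1)

lemma norm_retract: "0 < R ==> norm (retract R x) \<le> R"
  by (simp add: retract_def divide_le_eq)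

text \<open>The difference splits into a change of the point with fixed scaling and a change of the
  scaling at a fixed point, each at most the distance; this gives the factor 2.\<close>

lemma retract_lipschitz:
  assumes R: "0 < R"
  shows "norm (retract R x - retract R y) \<le> 2 * norm (x - y)"
proof -
  let ?m = "%z. max R (norm z)"
  have m: "0 < ?m z" "R / ?m z \<le> 1" for z :: 'a using R by (auto simp: divide_le_eq max_def)
  have "retract R x - retract R y = (R / ?m x) *\<^sub>R (x - y) + (R / ?m x - R / ?m y) *\<^sub>R y"
    by (simp add: retract_def algebra_simps)
  then have "norm (retract R x - retract R y) \<le> (R / ?m x) * norm (x - y) + \<bar>R / ?m x - R / ?m y\<bar> * norm y"
    using R m by (auto intro!: order_trans[OF norm_triangle_ineq])
  also have "(R / ?m x) * norm (x - y) \<le> 1 * norm (x - y)" using m by (intro mult_right_mono) auto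
  also have "\<bar>R / ?m x - R / ?m y\<bar> * norm y \<le> norm (x - y)"
  proof -
    have "R / ?m x - R / ?m y = (R / ?m x) * ((?m y - ?m x) / ?m y)"
      using m(1)[of x] m(1)[of y] by (simp add: field_simps)
    then have "\<bar>R / ?m x - R / ?m y\<bar> * norm y = (R / ?m x) * (\<bar>?m y - ?m x\<bar> * (norm y / ?m y))"
      using R m(1)[of x] m(1)[of y] by (simp add: abs_mult)
    also have "\<dots> \<le> 1 * (norm (x - y) * 1)"
    proof (intro mult_mono m)
      have "\<bar>?m y - ?m x\<bar> \<le> \<bar>norm x - norm y\<bar>" by (simp add: max_def abs_if)
      also have "\<dots> \<le> norm (x - y)" by (rule norm_triangle_ineq3)
      finally show "\<bar>?m y - ?m x\<bar> \<le> norm (x - y)" .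
      show "norm y / ?m y \<le> 1" using m(1)[of y] by (simp add: divide_le_eq)
    qed (use R m(1)[of x] m(1)[of y] in auto)
    finally show ?thesis by simp
  qed
  finally show ?thesis by simp
qed

section \<open>Passing to the variable A^(1/2) u\<close>

context bounded_open_set
begin

abbreviation root_A :: "l2 => l2" where "root_A \<equiv> frac_pow \<Omega> (1/2)"

lemma root_A_Q: "x \<in> H ==> root_A (Q x) = x"
  by (rule frac_pow_neg_pow) auto

lemma Q_diff: "x \<in> H ==> y \<in> H ==> Q (x - y) = Q x - Q y"
  by (rule neg_pow_linear(1)) auto

lemma Q_frac_domain: "x \<in> H ==> Q x \<in> frac_domain \<Omega> (1/2)"
  by (auto simp: frac_domain_def)

lemma frac_norm_Q_diff: "x \<in> H ==> y \<in> H ==> frac_norm \<Omega> (1/2) (Q x - Q y) = norm (x - y)"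
  unfolding frac_norm_def using root_A_Q[OF subspace_diff[OF subspace_L2_sigma]] by (simp add: Q_diff)

text \<open>In the variable x = A^(1/2) u the norm of D(A^(1/2)) is the norm of L^2_sigma, so the
  problem can be posed for norm-continuous paths in a closed subspace.\<close>

lemma continuous_half_iff:
  "continuous_half \<Omega> I u \<longleftrightarrow> (\<exists>X. continuous_on I X \<and> (\<forall>t\<in>I. X t \<in> H \<and> u t = Q (X t)))"
proof
  assume u: "continuous_half \<Omega> I u"
  have X: "root_A (u t) \<in> H" "u t = Q (root_A (u t))" if "t \<in> I" for t
    using u that frac_domainE[of "u t" "1/2"] by (auto simp: continuous_half_def)
  have "continuous_on I (%t. root_A (u t))"
    unfolding continuous_on_def
  proof
    fix t assume t: "t \<in> I"
    have "((%s. norm (root_A (u s) - root_A (u t))) \<longlongrightarrow> 0) (at t within I)"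
    proof (rule Lim_transform_eventually)
      show "((%s. frac_norm \<Omega> (1/2) (u s - u t)) \<longlongrightarrow> 0) (at t within I)" using u t by (simp add: continuous_half_def)
      have "frac_norm \<Omega> (1/2) (u s - u t) = norm (root_A (u s) - root_A (u t))" if "s \<in> I" for s
        using frac_norm_Q_diff[OF X(1)[OF that] X(1)[OF t]] X(2)[OF that] X(2)[OF t] by simp
      then show "\<forall>\<^sub>F s in at t within I. frac_norm \<Omega> (1/2) (u s - u t) = norm (root_A (u s) - root_A (u t))"
        by (simp add: eventually_at_filter)
    qed
    then show "((%s. root_A (u s)) \<longlongrightarrow> root_A (u t)) (at t within I)"
      by (rule LIM_zero_cancel[OF tendsto_norm_zero_cancel])
  qed
  then show "\<exists>X. continuous_on I X \<and> (\<forall>t\<in>I. X t \<in> H \<and> u t = Q (X t))"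
    using X by blast
next
  assume "\<exists>X. continuous_on I X \<and> (\<forall>t\<in>I. X t \<in> H \<and> u t = Q (X t))"
  then obtain X where X: "continuous_on I X" "\<And>t. t \<in> I ==> X t \<in> H" "\<And>t. t \<in> I ==> u t = Q (X t)" by blast
  show "continuous_half \<Omega> I u"
    unfolding continuous_half_def
  proof (intro conjI ballI)
    fix t assume t: "t \<in> I"
    show "u t \<in> frac_domain \<Omega> (1/2)" using X t Q_frac_domain by simp
    have "((%s. X s - X t) \<longlongrightarrow> 0) (at t within I)" by (rule LIM_zero) (use X(1) t in \<open>simp add: continuous_on_def\<close>)
    then have "((%s. norm (X s - X t)) \<longlongrightarrow> 0) (at t within I)" by (rule tendsto_norm_zero)
    moreover have "\<forall>\<^sub>F s in at t within I. norm (X s - X t) = frac_norm \<Omega> (1/2) (u s - u t)"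
      using X t by (simp add: eventually_at_filter frac_norm_Q_diff)
    ultimately show "((%s. frac_norm \<Omega> (1/2) (u s - u t)) \<longlongrightarrow> 0) (at t within I)" by (rule Lim_transform_eventually)
  qed
qed

lemma continuous_half_root:
  assumes "continuous_half \<Omega> I u"
  shows "continuous_on I (%t. root_A (u t))" "\<And>t. t \<in> I ==> root_A (u t) \<in> H" "\<And>t. t \<in> I ==> u t = Q (root_A (u t))"
proof -
  obtain X where X: "continuous_on I X" "\<And>t. t \<in> I ==> X t \<in> H" "\<And>t. t \<in> I ==> u t = Q (X t)"
    using assms unfolding continuous_half_iff by blast
  have eq: "root_A (u t) = X t" if "t \<in> I" for t using X that by (simp add: root_A_Q)
  show "continuous_on I (%t. root_A (u t))" using X(1) by (rule continuous_on_eq) (simp add: eq)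
  show "\<And>t. t \<in> I ==> root_A (u t) \<in> H" "\<And>t. t \<in> I ==> u t = Q (root_A (u t))" using X eq by auto
qed

text \<open>The path X is in the variable A^(1/2) u, whereas the force expects the history of u
  itself.\<close>

definition hist :: "real => (real => l2) => real => real => l2" where
  "hist r X s = history r (%t. Q (X t)) s"

lemma hist_in_Y_half:
  assumes X: "continuous_on {-r..t} X" "\<And>s. s \<in> {-r..t} ==> X s \<in> H" and s: "0 \<le> s" "s \<le> t"
  shows "hist r X s \<in> Y_half \<Omega> r"
proof -
  have "continuous_on {-r..0} (%\<theta>. X (s + \<theta>))"
    by (rule continuous_on_compose2[OF X(1)]) (use s in \<open>auto intro!: continuous_intros\<close>)
  then have "continuous_half \<Omega> {-r..0} (hist r X s)"
    unfolding continuous_half_iff using X(2) s by (intro exI[of _ "%\<theta>. X (s + \<theta>)"]) (auto simp: hist_def history_def)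
  then show ?thesis by (simp add: Y_half_def hist_def history_def)
qed

lemma Y_norm_hist_diff:
  assumes r: "0 \<le> r" and "\<And>\<theta>. \<theta> \<in> {-r..0} ==> X (s + \<theta>) \<in> H" "\<And>\<theta>. \<theta> \<in> {-r..0} ==> Y (s' + \<theta>) \<in> H"
    and "\<And>\<theta>. \<theta> \<in> {-r..0} ==> norm (X (s + \<theta>) - Y (s' + \<theta>)) \<le> d"
  shows "Y_norm \<Omega> r (%\<theta>. hist r X s \<theta> - hist r Y s' \<theta>) \<le> d"
  unfolding Y_norm_def
proof (rule cSUP_least)
  show "{-r..0} \<noteq> {}" using r by simp
  fix \<theta> assume "\<theta> \<in> {-r..0}"
  then show "frac_norm \<Omega> (1/2) (hist r X s \<theta> - hist r Y s' \<theta>) \<le> d"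
    using assms by (simp add: hist_def history_def frac_norm_Q_diff)
qed

lemma convective_local_lipschitz:
  assumes R: "0 < R"
  obtains K where "0 \<le> K" "\<And>x y. x \<in> H ==> y \<in> H ==>
    norm (convective (retract R x) - convective (retract R y)) \<le> K * norm (x - y)"
proof -
  obtain C where C: "0 \<le> C" "\<And>x y. x \<in> H ==> y \<in> H ==>
    norm (convective x - convective y) \<le> C * (norm x + norm y) * norm (x - y)"
    by (rule convective_lipschitz) (rule that)
  have "norm (convective (retract R x) - convective (retract R y)) \<le> C * (R + R) * 2 * norm (x - y)"
    if H: "x \<in> H" "y \<in> H" for x y
  proof -
    have rH: "retract R x \<in> H" "retract R y \<in> H" unfolding retract_def by (intro subspace_scale subspace_L2_sigma H)+
    have "norm (convective (retract R x) - convective (retract R y)) \<le> C * (norm (retract R x) + norm (retract R y)) * norm (retract R x - retract R y)"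
      by (rule C(2)[OF rH])
    also have "\<dots> \<le> C * (R + R) * (2 * norm (x - y))"
      using C(1) R by (intro mult_mono add_mono norm_retract retract_lipschitz order_refl) auto
    finally show ?thesis by (simp add: mult.assoc)
  qed
  then show thesis by (rule that[rotated]) (use C(1) R in auto)
qed

end

section \<open>The delay problem as a Volterra equation\<close>

locale delay_problem = fractional_stokes \<Omega> \<eta> \<alpha> \<rho> for \<Omega> \<eta> \<alpha> \<rho> +
  fixes r L :: real and f :: "real => (real => l2) => l2" and \<phi> :: "real => l2"
  assumes r: "0 < r" and L: "0 < L"
    and force_in: "\<And>t \<psi>. 0 \<le> t ==> \<psi> \<in> Y_half \<Omega> r ==> helmholtz_proj \<Omega> (f t \<psi>) \<in> H"
    and force_measurable: "\<And>\<psi>. \<psi> \<in> Y_half \<Omega> r ==> (%t. helmholtz_proj \<Omega> (f t \<psi>)) \<in> borel_measurable (lebesgue_on {0..})"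
    and force_zero: "\<And>t. 0 \<le> t ==> helmholtz_proj \<Omega> (f t (hist r (%s. 0) 0)) = 0"
    and force_lipschitz: "\<And>t \<psi> \<xi>. 0 \<le> t ==> \<psi> \<in> Y_half \<Omega> r ==> \<xi> \<in> Y_half \<Omega> r ==>
      norm (helmholtz_proj \<Omega> (f t \<psi>) - helmholtz_proj \<Omega> (f t \<xi>)) \<le> L * Y_norm \<Omega> r (%\<theta>. \<psi> \<theta> - \<xi> \<theta>)"
    and \<phi>: "\<phi> \<in> Y_half \<Omega> r"
begin

definition initial :: "real => l2" where "initial t = root_A (\<phi> t)"

lemma initial: "continuous_on {-r..0} initial" "\<And>t. t \<in> {-r..0} ==> initial t \<in> H" "\<And>t. t \<in> {-r..0} ==> \<phi> t = Q (initial t)"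
  using continuous_half_root[of "{-r..0}" \<phi>] \<phi> unfolding initial_def[abs_def] Y_half_def by auto

definition force :: "real => (real => l2) => l2" where
  "force s X = helmholtz_proj \<Omega> (f s (hist r X s))"

text \<open>Composing with the retraction makes the locally Lipschitz convective map globally
  Lipschitz, as the contraction requires; along paths within radius R nothing is changed.\<close>

definition truncated :: "real => real => (real => l2) => l2" where
  "truncated R s X = convective (retract R (X s))"

definition admissible :: "real => (real => l2) set" where
  "admissible t = {X. continuous_on {-r..t} X \<and> (\<forall>s\<in>{-r..t}. X s \<in> H) \<and> (\<forall>s\<in>{-r..0}. X s = initial s)}"

lemma admissible_mono: "X \<in> admissible t ==> s \<le> t ==> X \<in> admissible s"
  unfolding admissible_def by (auto intro: continuous_on_subset)

lemma admissible_hist: "X \<in> admissible t ==> 0 \<le> s ==> s \<le> t ==> hist r X s \<in> Y_half \<Omega> r"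
  by (rule hist_in_Y_half[of r t]) (auto simp: admissible_def)

lemma admissible_in: "X \<in> admissible t ==> -r \<le> s ==> s \<le> t ==> X s \<in> H"
  by (auto simp: admissible_def)

lemma admissible_bounded:
  assumes "X \<in> admissible t"
  obtains M where "0 < M" "\<And>s. -r \<le> s ==> s \<le> t ==> norm (X s) \<le> M"
proof -
  have "bounded (X ` {-r..t})"
    using assms by (intro compact_imp_bounded compact_continuous_image) (auto simp: admissible_def)
  then obtain M where "0 < M" "\<forall>x\<in>X ` {-r..t}. norm x \<le> M" unfolding bounded_pos by blast
  then show thesis by (intro that[of M]) auto
qed

lemma truncated_lipschitz:
  assumes R: "0 < R"
  obtains K where "0 \<le> K" "\<And>s t X Y. X \<in> admissible t ==> Y \<in> admissible t ==> 0 \<le> s ==> s \<le> t ==>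
    norm (truncated R s X - truncated R s Y) \<le> K * norm (X s - Y s)"
    "\<And>t X. X \<in> admissible t ==> continuous_on {0..t} (%s. truncated R s X)"
proof -
  obtain K where K: "0 \<le> K" "\<And>x y. x \<in> H ==> y \<in> H ==>
    norm (convective (retract R x) - convective (retract R y)) \<le> K * norm (x - y)"
    by (rule convective_local_lipschitz[OF R]) (rule that)
  show thesis
  proof (rule that[OF K(1)])
    show "norm (truncated R s X - truncated R s Y) \<le> K * norm (X s - Y s)"
      if "X \<in> admissible t" "Y \<in> admissible t" "0 \<le> s" "s \<le> t" for s t X Y
      unfolding truncated_def using admissible_in[OF that(1)] admissible_in[OF that(2)] that r by (intro K(2)) auto
    fix t X assume X: "X \<in> admissible t"
    have "K-lipschitz_on H (%x. convective (retract R x))"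
      using K by (intro lipschitz_onI) (auto simp: dist_norm)
    then have c: "continuous_on H (%x. convective (retract R x))" by (rule lipschitz_on_continuous_on)
    have cX: "continuous_on {0..t} X"
      by (rule continuous_on_subset[of "{-r..t}"]) (use X r in \<open>auto simp: admissible_def\<close>)
    have "X ` {0..t} \<subseteq> H" using admissible_in[OF X] r by auto
    from continuous_on_compose2[OF c cX this] show "continuous_on {0..t} (%s. truncated R s X)"
      unfolding truncated_def .
  qed
qed

lemma force_diff:
  assumes "X \<in> admissible t" "Y \<in> admissible t" "0 \<le> s" "s \<le> t" "\<And>\<tau>. \<tau> \<in> {-r..s} ==> norm (X \<tau> - Y \<tau>) \<le> d"
  shows "norm (force s X - force s Y) \<le> L * d"
proof -
  have "norm (force s X - force s Y) \<le> L * Y_norm \<Omega> r (%\<theta>. hist r X s \<theta> - hist r Y s \<theta>)"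
    unfolding force_def by (intro force_lipschitz admissible_hist[of _ t] assms)
  also have "\<dots> \<le> L * d"
    using L r assms(3-) admissible_in[OF assms(1)] admissible_in[OF assms(2)]
    by (intro mult_left_mono Y_norm_hist_diff) auto
  finally show ?thesis .
qed

text \<open>The zero history, at which the force vanishes, is the reference point for the Lipschitz
  bound, so the force grows at most linearly in the path.\<close>

lemma force_bound:
  assumes X: "X \<in> admissible t" and s: "0 \<le> s" "s \<le> t" and M: "\<And>\<tau>. \<tau> \<in> {-r..s} ==> norm (X \<tau>) \<le> M"
  shows "norm (force s X) \<le> L * M"
proof -
  let ?z = "hist r (%s. 0) 0"
  have z: "?z \<in> Y_half \<Omega> r" by (rule hist_in_Y_half[of r 0]) (auto intro: subspace_0 subspace_L2_sigma)
  have "norm (force s X) = norm (helmholtz_proj \<Omega> (f s (hist r X s)) - helmholtz_proj \<Omega> (f s ?z))"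
    by (simp add: force_def force_zero s)
  also have "\<dots> \<le> L * Y_norm \<Omega> r (%\<theta>. hist r X s \<theta> - ?z \<theta>)"
    by (intro force_lipschitz admissible_hist[OF X] s z)
  also have "\<dots> \<le> L * M"
    using L r s M admissible_in[OF X] by (intro mult_left_mono Y_norm_hist_diff) (auto intro: subspace_0 subspace_L2_sigma)
  finally show ?thesis .
qed

lemma force_in_L2_sigma: "X \<in> admissible t ==> 0 \<le> s ==> s \<le> t ==> force s X \<in> H"
  unfolding force_def by (intro force_in admissible_hist)

text \<open>The history is frozen on a grid of mesh \<open>1 / n\<close>; the resulting functions are measurable and
  converge pointwise.\<close>

lemma force_measurable_admissible:
  assumes X: "X \<in> admissible t" and t: "0 \<le> t"
  shows "(%s. force s X) \<in> borel_measurable (lebesgue_on {0..t})"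
proof (rule borel_measurable_LIMSEQ_metric)
  define g where "g n s = nat \<lfloor>real (Suc n) * s\<rfloor>" for n and s :: real
  \<comment> \<open>Clipping at t keeps every grid time, whatever its index, in the range where the
    path is admissible.\<close>
  define c where "c n i = min t (real i / real (Suc n))" for n i :: nat
  have c: "0 \<le> c n i" "c n i \<le> t" for n i using t by (auto simp: c_def)
  show "(%s. helmholtz_proj \<Omega> (f s (hist r X (c n (g n s))))) \<in> borel_measurable (lebesgue_on {0..t})" for n
  proof (rule measurable_compose_countable[where f = "%i s. helmholtz_proj \<Omega> (f s (hist r X (c n i)))" and g = "g n"])
    show "(%s. helmholtz_proj \<Omega> (f s (hist r X (c n i)))) \<in> borel_measurable (lebesgue_on {0..t})" for i
      using force_measurable[OF admissible_hist[OF X c]]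
      by (rule measurable_restrict_mono) auto
    have "g n \<in> borel \<rightarrow>\<^sub>M count_space UNIV" unfolding g_def[abs_def] by measurable
    then show "g n \<in> lebesgue_on {0..t} \<rightarrow>\<^sub>M count_space UNIV"
      by (intro measurable_restrict_space1 measurable_completion) simp
  qed
  fix s assume "s \<in> space (lebesgue_on {0..t})"
  then have s: "0 \<le> s" "s \<le> t" by auto
  have cn: "\<bar>c n (g n s) - s\<bar> \<le> 1 / real (Suc n)" "c n (g n s) \<le> s" for n
  proof -
    have "0 \<le> \<lfloor>real (Suc n) * s\<rfloor>" using s by simp
    then have gn: "real (g n s) = of_int \<lfloor>real (Suc n) * s\<rfloor>" by (simp add: g_def)
    then have "real (g n s) \<le> real (Suc n) * s" "real (Suc n) * s \<le> real (g n s) + 1" by linarith+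
    then have "real (g n s) / real (Suc n) \<le> s" "s \<le> real (g n s) / real (Suc n) + 1 / real (Suc n)"
      by (auto simp: divide_le_eq field_simps)
    then show "\<bar>c n (g n s) - s\<bar> \<le> 1 / real (Suc n)" "c n (g n s) \<le> s" using s by (auto simp: c_def min_def abs_if)
  qed
  have uc: "uniformly_continuous_on {-r..t} X"
    using X by (intro compact_uniformly_continuous) (auto simp: admissible_def)
  show "(%n. helmholtz_proj \<Omega> (f s (hist r X (c n (g n s))))) \<longlonglongrightarrow> force s X"
  proof (rule LIMSEQ_I)
    fix e :: real assume e: "0 < e"
    obtain d where d: "0 < d" "\<And>x y. x \<in> {-r..t} ==> y \<in> {-r..t} ==> dist x y < d ==> dist (X x) (X y) < e / (2 * L)"
      using uc e L unfolding uniformly_continuous_on_def by (metis dist_commute divide_pos_pos mult_pos_pos zero_less_numeral)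
    obtain N where N: "1 / real (Suc N) < d" using d(1) by (meson nat_approx_posE)
    show "\<exists>no. \<forall>n\<ge>no. norm (helmholtz_proj \<Omega> (f s (hist r X (c n (g n s)))) - force s X) < e"
    proof (intro exI[of _ N] allI impI)
      fix n assume n: "N \<le> n"
      have "1 / real (Suc n) \<le> 1 / real (Suc N)" using n by (intro divide_left_mono) auto
      then have cd: "\<bar>c n (g n s) - s\<bar> < d" using cn(1)[of n] N by linarith
      have "norm (helmholtz_proj \<Omega> (f s (hist r X (c n (g n s)))) - force s X)
          \<le> L * Y_norm \<Omega> r (%\<theta>. hist r X (c n (g n s)) \<theta> - hist r X s \<theta>)"
        unfolding force_def by (intro force_lipschitz admissible_hist[OF X] s c)
      also have "\<dots> \<le> L * (e / (2 * L))"
      proof (intro mult_left_mono Y_norm_hist_diff)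
        fix \<theta> assume \<theta>: "\<theta> \<in> {-r..0}"
        have m: "c n (g n s) + \<theta> \<in> {-r..t}" "s + \<theta> \<in> {-r..t}" using \<theta> s c[of n "g n s"] by auto
        show "X (c n (g n s) + \<theta>) \<in> H" "X (s + \<theta>) \<in> H" using admissible_in[OF X] m by auto
        show "norm (X (c n (g n s) + \<theta>) - X (s + \<theta>)) \<le> e / (2 * L)"
          using d(2)[OF m] cd by (simp add: dist_norm dist_real_def)
      qed (use r L in auto)
      also have "\<dots> < e" using L e by simp
      finally show "norm (helmholtz_proj \<Omega> (f s (hist r X (c n (g n s)))) - force s X) < e" .
    qed
  qed
qed

abbreviation K1 :: "real => l2 => l2" where "K1 \<equiv> frac_kernel (3/4)"
abbreviation K2 :: "real => l2 => l2" where "K2 \<equiv> frac_kernel (1/2)"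

lemma truncated_in: "X \<in> admissible t ==> 0 \<le> s ==> s \<le> t ==> truncated R s X \<in> H"
  unfolding truncated_def retract_def using r by (intro convective(1) subspace_scale subspace_L2_sigma admissible_in) auto

text \<open>The orders 3/4 for the convective term and 1/2 for the force give the exponents
  \<alpha>/4 and \<alpha>/2, which is why the abstract equation carries two convolutions.\<close>

lemma volterra_setting:
  assumes T: "0 \<le> T" and L': "0 \<le> L'"
  shows "volterra K1 K2 (\<alpha> * (1 - 3/4)) CK (\<alpha> * (1 - 1/2)) CK T H r L' initial (evolution (initial 0))"
proof -
  have z: "initial 0 \<in> H" using initial(2) r by simp
  show ?thesis
  proof (rule volterra.intro)
    show "singular_kernel K1 (\<alpha> * (1 - 3/4)) CK T" by (rule frac_kernel_singular) auto
    show "singular_kernel K2 (\<alpha> * (1 - 1/2)) CK T" by (rule frac_kernel_singular) auto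
    show "volterra_axioms K1 K2 T H r L' initial (evolution (initial 0))"
    proof (rule volterra_axioms.intro)
      show "continuous_on {0..T} (evolution (initial 0))" by (rule continuous_on_subset[OF evolution_continuous[OF z]]) auto
      show "evolution (initial 0) 0 = initial 0" by (simp add: evolution_def)
      show "evolution (initial 0) t \<in> H" if "0 \<le> t" for t by (rule evolution_in[OF z that])
      show "K1 t x \<in> H" "K2 t x \<in> H" if "0 < t" "x \<in> H" for t x
        using frac_kernel_in[OF that(2,1)] by simp_all
      show "initial t \<in> H" if "-r \<le> t" "t \<le> 0" for t using initial(2) that by simp
    qed (use T L' r initial(1) closed_L2_sigma subspace_L2_sigma in simp_all)
  qed
qed

text \<open>The convective term depends on the present value only and the force on the whole
  history; the maximum of their Lipschitz constants serves both.\<close>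

lemma truncated_volterra:
  assumes R: "0 < R" and T: "0 \<le> T"
  obtains L' where "lipschitz_volterra K1 K2 (\<alpha> * (1 - 3/4)) CK (\<alpha> * (1 - 1/2)) CK T H r L' initial (evolution (initial 0)) (truncated R) force"
    "volterra.adm H r initial = admissible"
proof -
  obtain K where K: "0 \<le> K" "\<And>s t X Y. X \<in> admissible t ==> Y \<in> admissible t ==> 0 \<le> s ==> s \<le> t ==>
    norm (truncated R s X - truncated R s Y) \<le> K * norm (X s - Y s)"
    "\<And>t X. X \<in> admissible t ==> continuous_on {0..t} (%s. truncated R s X)"
    by (rule truncated_lipschitz[OF R]) (rule that)
  define L' where "L' = max K L"
  have L': "0 \<le> L'" using K(1) by (simp add: L'_def)
  interpret volterra K1 K2 "\<alpha> * (1 - 3/4)" CK "\<alpha> * (1 - 1/2)" CK T "H" r L' initial "evolution (initial 0)" "truncated R" force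
    by (rule volterra_setting[OF T L'])
  have adm: "adm = admissible" by (intro ext) (simp add: adm_def admissible_def)
  have d0: "0 \<le> d" if "\<forall>\<tau>\<in>{-r..s}. norm (X \<tau> - Y \<tau>) \<le> d" "0 \<le> s" for d s and X Y :: "real => l2"
    using that(1)[rule_format, of s] that(2) r by (auto intro: order_trans[OF norm_ge_zero])
  have g1: "good (truncated R)"
    unfolding good_def adm
  proof (intro ballI conjI allI impI)
    fix t X assume t: "t \<in> {0..T}" and X: "X \<in> admissible t"
    show "(%s. truncated R s X) \<in> borel_measurable (lebesgue_on {0..t})"
      by (rule continuous_imp_measurable_on_sets_lebesgue[OF K(3)[OF X]]) simp
    have "bounded ((%s. truncated R s X) ` {0..t})" by (intro compact_imp_bounded compact_continuous_image K(3) X) simp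
    then show "\<exists>M. \<forall>s\<in>{0..t}. norm (truncated R s X) \<le> M" unfolding bounded_iff by auto
    show "truncated R s X \<in> H" if "s \<in> {0..t}" for s using truncated_in[OF X] that by simp
    fix Y s d assume *: "Y \<in> admissible t" "s \<in> {0..t}" "\<forall>\<tau>\<in>{-r..s}. norm (X \<tau> - Y \<tau>) \<le> d"
    have "norm (truncated R s X - truncated R s Y) \<le> K * norm (X s - Y s)" using K(2)[OF X *(1)] *(2) by simp
    also have "\<dots> \<le> L' * d" using * r K(1) L' by (intro mult_mono) (auto simp: L'_def)
    finally show "norm (truncated R s X - truncated R s Y) \<le> L' * d" .
  qed
  have g2: "good force"
    unfolding good_def adm
  proof (intro ballI conjI allI impI)
    fix t X assume t: "t \<in> {0..T}" and X: "X \<in> admissible t"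
    show "(%s. force s X) \<in> borel_measurable (lebesgue_on {0..t})" using force_measurable_admissible[OF X] t by simp
    obtain M where M: "\<And>s. -r \<le> s ==> s \<le> t ==> norm (X s) \<le> M" by (rule admissible_bounded[OF X]) (rule that)
    show "\<exists>M. \<forall>s\<in>{0..t}. norm (force s X) \<le> M"
      using force_bound[OF X] M by (intro exI[of _ "L * M"]) auto
    show "force s X \<in> H" if "s \<in> {0..t}" for s using force_in_L2_sigma[OF X] that by simp
    fix Y s d assume *: "Y \<in> admissible t" "s \<in> {0..t}" "\<forall>\<tau>\<in>{-r..s}. norm (X \<tau> - Y \<tau>) \<le> d"
    have "norm (force s X - force s Y) \<le> L * d" by (rule force_diff[OF X *(1)]) (use * in auto)
    also have "\<dots> \<le> L' * d" using d0[OF *(3)] *(2) by (intro mult_right_mono) (auto simp: L'_def)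
    finally show "norm (force s X - force s Y) \<le> L' * d" .
  qed
  show thesis by (rule that[OF _ adm]) (unfold_locales; rule g1 g2)
qed

definition rhs_truncated :: "real => (real => l2) => real => l2" where
  "rhs_truncated R X t = evolution (initial 0) t + conv K1 (%s. truncated R s X) t + conv K2 (%s. force s X) t"

definition rhs :: "(real => l2) => real => l2" where
  "rhs X t = evolution (initial 0) t + conv K1 (%s. convective (X s)) t + conv K2 (%s. force s X) t"

text \<open>The equation without truncation in the variable A^(1/2) u. At t = 0 both integrals
  vanish and it reads X 0 = \<open>initial 0\<close>.\<close>

definition sol :: "real => (real => l2) => bool" where
  "sol T X \<longleftrightarrow> X \<in> admissible T \<and> (\<forall>t\<in>{0..T}. X t = rhs X t)"

lemma rhs_truncated_eq:
  assumes "0 < R" "\<And>s. 0 \<le> s ==> s \<le> t ==> norm (X s) \<le> R"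
  shows "rhs_truncated R X t = rhs X t"
proof -
  have "conv K1 (%s. truncated R s X) t = conv K1 (%s. convective (X s)) t"
    unfolding conv_def by (rule set_lebesgue_integral_cong) (auto simp: truncated_def retract_id assms)
  then show ?thesis by (simp add: rhs_truncated_def rhs_def)
qed

text \<open>Global Lipschitz bounds make the truncated equation solvable on every [0, T]; the weight
  of the norm takes the place of smallness of T.\<close>

lemma truncated_facts:
  assumes R: "0 < R" and T: "0 \<le> T"
  shows truncated_exists: "\<exists>X\<in>admissible T. \<forall>t\<in>{0..T}. X t = rhs_truncated R X t"
    and truncated_unique: "\<And>X Y s. X \<in> admissible T ==> Y \<in> admissible T ==> (\<And>t. t \<in> {0..T} ==> X t = rhs_truncated R X t) ==>
      (\<And>t. t \<in> {0..T} ==> Y t = rhs_truncated R Y t) ==> -r \<le> s ==> s \<le> T ==> X s = Y s"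
    and rhs_truncated_in: "\<And>X t. X \<in> admissible T ==> 0 \<le> t ==> t \<le> T ==> rhs_truncated R X t \<in> H"
proof -
  obtain L' where LV: "lipschitz_volterra K1 K2 (\<alpha> * (1 - 3/4)) CK (\<alpha> * (1 - 1/2)) CK T H r L' initial (evolution (initial 0)) (truncated R) force"
    and adm: "volterra.adm H r initial = admissible"
    by (rule truncated_volterra[OF R T]) (rule that)
  interpret V: lipschitz_volterra K1 K2 "\<alpha> * (1 - 3/4)" CK "\<alpha> * (1 - 1/2)" CK T "H" r L' initial "evolution (initial 0)" "truncated R" force
    by (rule LV)
  have rhs: "V.rhs X t = rhs_truncated R X t" for X t by (simp add: V.rhs_def rhs_truncated_def)
  show "\<exists>X\<in>admissible T. \<forall>t\<in>{0..T}. X t = rhs_truncated R X t" using V.existence unfolding adm rhs .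
  show "X s = Y s" if "X \<in> admissible T" "Y \<in> admissible T" "\<And>t. t \<in> {0..T} ==> X t = rhs_truncated R X t"
    "\<And>t. t \<in> {0..T} ==> Y t = rhs_truncated R Y t" "-r \<le> s" "s \<le> T" for X Y s
    by (rule V.unique[unfolded adm rhs, OF that(1,2) T order_refl that(3,4) that(5,6)]) auto
  show "rhs_truncated R X t \<in> H" if "X \<in> admissible T" "0 \<le> t" "t \<le> T" for X t
    by (rule V.rhs_continuous(2)[unfolded adm rhs, OF that])
qed

end

section \<open>Continuation, equivalence with mild solutions, and blow-up\<close>

context delay_problem
begin

abbreviation "G1 t u s \<equiv> T_op_F \<Omega> \<rho> \<eta> \<alpha> (t - s) (u s)"
abbreviation "G2 t u s \<equiv> T_a (t - s) (helmholtz_proj \<Omega> (f s (history r u s)))"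
abbreviation "mild \<equiv> mild_solution \<Omega> \<rho> \<eta> \<alpha> r f \<phi>"
abbreviation "maximal_mild \<equiv> maximal_mild_solution \<Omega> \<rho> \<eta> \<alpha> r f \<phi>"
abbreviation "mild_upto \<equiv> mild_solution_upto \<Omega> \<rho> \<eta> \<alpha> r f \<phi>"

lemma rhs_0: "rhs X 0 = initial 0"
  by (simp add: rhs_def conv_0 evolution_def)

lemma sol_mono: "sol T X ==> s \<le> T ==> sol s X"
  unfolding sol_def by (auto intro: admissible_mono)

lemma sol_initial: "sol 0 initial"
  using initial by (auto simp: sol_def admissible_def rhs_0)

lemma sol_bounded:
  assumes "sol T X"
  obtains M where "0 < M" "\<And>s. -r \<le> s ==> s \<le> T ==> norm (X s) \<le> M"
  using assms unfolding sol_def by (auto elim: admissible_bounded)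

lemma sol_truncated:
  assumes "sol T X" "0 < R" "\<And>s. 0 \<le> s ==> s \<le> T ==> norm (X s) \<le> R" "t \<in> {0..T}"
  shows "X t = rhs_truncated R X t"
proof -
  have "rhs_truncated R X t = rhs X t" using assms(4) by (intro rhs_truncated_eq assms) auto
  then show ?thesis using assms(1,4) by (simp add: sol_def)
qed

text \<open>A solution within radius R solves the truncated equation on its own interval, and so
  does the restriction of Y; uniqueness for the truncated equation compares them there.\<close>

lemma sol_eq_truncated:
  assumes X: "sol T X" and T: "0 \<le> T" "T \<le> T'" and R: "0 < R" "\<And>s. 0 \<le> s ==> s \<le> T ==> norm (X s) \<le> R"
    and Y: "Y \<in> admissible T'" "\<And>t. t \<in> {0..T'} ==> Y t = rhs_truncated R Y t" and s: "-r \<le> s" "s \<le> T"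
  shows "X s = Y s"
proof (rule truncated_unique[OF R(1) T(1)])
  show "X \<in> admissible T" "Y \<in> admissible T" using X Y(1) T admissible_mono by (auto simp: sol_def)
  show "X t = rhs_truncated R X t" "Y t = rhs_truncated R Y t" if "t \<in> {0..T}" for t
    using sol_truncated[OF X R that] Y(2) that T by auto
qed (use s in auto)

lemma sol_unique:
  assumes X: "sol T X" and Y: "sol T Y" and T: "0 \<le> T" and s: "-r \<le> s" "s \<le> T"
  shows "X s = Y s"
proof -
  obtain M where M: "0 < M" "\<And>s. -r \<le> s ==> s \<le> T ==> norm (X s) \<le> M" by (rule sol_bounded[OF X]) (rule that)
  obtain N where N: "0 < N" "\<And>s. -r \<le> s ==> s \<le> T ==> norm (Y s) \<le> N" by (rule sol_bounded[OF Y]) (rule that)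
  have R: "0 < M + N" using M N by simp
  have b: "norm (X s) \<le> M + N" "norm (Y s) \<le> M + N" if "0 \<le> s" "s \<le> T" for s
    using M(1) N(1) M(2)[of s] N(2)[of s] that r by auto
  have "Y \<in> admissible T" using Y by (simp add: sol_def)
  from sol_eq_truncated[OF X T order_refl R b(1) this sol_truncated[OF Y R b(2)] s] show ?thesis by simp
qed

lemma truncated_sol:
  assumes Y: "Y \<in> admissible T" "\<And>t. t \<in> {0..T} ==> Y t = rhs_truncated R Y t" and R: "0 < R"
    and b: "\<And>s. 0 \<le> s ==> s \<le> T ==> norm (Y s) \<le> R"
  shows "sol T Y"
  unfolding sol_def using Y rhs_truncated_eq[OF R, of _ Y] b by auto

text \<open>With one unit of room above the bound M, the truncated solution on [0, T + 1] continues
  X, is below M + 1 at T and hence shortly after T, and there the truncation is inactive.\<close>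

lemma sol_extend:
  assumes X: "sol T X" and T: "0 \<le> T"
  shows "\<exists>\<tau>>0. \<exists>Y. sol (T + \<tau>) Y"
proof -
  obtain M where M: "0 < M" "\<And>s. -r \<le> s ==> s \<le> T ==> norm (X s) \<le> M" by (rule sol_bounded[OF X]) (rule that)
  define R where "R = M + 1"
  have R: "0 < R" using M by (simp add: R_def)
  have b: "norm (X s) \<le> R" if "0 \<le> s" "s \<le> T" for s using M(2)[of s] that r by (simp add: R_def)
  have T1: "0 \<le> T + 1" using T by simp
  obtain Y where Y: "Y \<in> admissible (T + 1)" "\<forall>t\<in>{0..T + 1}. Y t = rhs_truncated R Y t"
    using truncated_exists[OF R T1] by blast
  have eq: "X s = Y s" if "-r \<le> s" "s \<le> T" for s
    by (rule sol_eq_truncated[OF X T _ R b Y(1) Y(2)[rule_format] that]) auto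
  have YT: "norm (Y T) < R" using M(2)[of T] eq[of T] T r by (simp add: R_def)
  have "continuous_on {-r..T + 1} (%s. norm (Y s))" using Y(1) by (auto simp: admissible_def intro: continuous_on_norm)
  moreover have "T \<in> {-r..T + 1}" using T r by simp
  ultimately have "((%s. norm (Y s)) \<longlongrightarrow> norm (Y T)) (at T within {-r..T + 1})" by (simp add: continuous_on_def)
  from order_tendstoD(2)[OF this YT] obtain d where d: "0 < d" "\<And>s. s \<in> {-r..T + 1} ==> s \<noteq> T ==> dist s T < d ==> norm (Y s) < R"
    unfolding eventually_at by blast
  define \<tau> where "\<tau> = min 1 (d / 2)"
  have \<tau>: "0 < \<tau>" "\<tau> \<le> 1" "\<tau> < d" using d(1) by (auto simp: \<tau>_def)
  have "sol (T + \<tau>) Y"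
  proof (rule truncated_sol[OF _ _ R])
    show "Y \<in> admissible (T + \<tau>)" using admissible_mono[OF Y(1)] \<tau> by simp
    show "Y t = rhs_truncated R Y t" if "t \<in> {0..T + \<tau>}" for t using Y(2) that \<tau> by auto
    show "norm (Y s) \<le> R" if s: "0 \<le> s" "s \<le> T + \<tau>" for s
    proof (cases "s \<le> T")
      case True
      then show ?thesis using eq[of s] b[of s] s r by simp
    next
      case False
      then have "norm (Y s) < R" using s \<tau> r by (intro d(2)) (auto simp: dist_real_def)
      then show ?thesis by simp
    qed
  qed
  then show ?thesis using \<tau>(1) by blast
qed

text \<open>A^(-1/2) as a bounded linear map on all of \<open>l2\<close>, so that it can be
  exchanged with Bochner integrals; \<open>neg_pow\<close> is controlled on L^2_sigma only, where
  the two agree.\<close>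

definition PQ :: "l2 => l2" where "PQ = fc.Phi (%k. (k / gap) powr (1/2))"

lemma bounded_linear_PQ: "bounded_linear PQ"
  unfolding PQ_def by (rule fc.Phi_bounded_linear[OF powr_continuous_01[OF _ gap(1)]]) simp

lemma PQ_eq: "x \<in> H ==> PQ x = Q x"
  unfolding PQ_def by (rule neg_pow_eq[symmetric]) auto

lemma integral_PQ_kernel:
  assumes \<gamma>: "0 \<le> \<gamma>" "\<gamma> < 1" and g: "g \<in> borel_measurable (lebesgue_on {0..t})" and t: "0 \<le> t"
    and M: "\<And>s. 0 \<le> s ==> s \<le> t ==> norm (g s) \<le> M"
    and h: "\<And>s. 0 \<le> s ==> s < t ==> h s = PQ (frac_kernel \<gamma> (t - s) (g s))"
  shows "set_integrable lebesgue {0..t} h" "(LINT s:{0..t}|lebesgue. h s) = PQ (conv (frac_kernel \<gamma>) g t)"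
proof -
  let ?k = "%s. indicator {0..t} s *\<^sub>R frac_kernel \<gamma> (t - s) (g s)"
  \<comment> \<open>At s = t the integrand involves a solution operator at time 0, whose value is
    arbitrary. The discrepancy is carried as a term supported on one point, so that measurability is
    retained.\<close>
  let ?c = "h t - PQ (frac_kernel \<gamma> 0 (g t))"
  interpret singular_kernel "frac_kernel \<gamma>" "\<alpha> * (1 - \<gamma>)" CK t by (rule frac_kernel_singular[OF \<gamma>])
  have i: "integrable lebesgue ?k" using conv_integrable[OF g t order_refl M] by (simp add: set_integrable_def)
  have iP: "integrable lebesgue (%s. PQ (?k s))" by (rule integrable_bounded_linear[OF bounded_linear_PQ i])
  have "integrable lebesgue (%s. indicator {t} s *\<^sub>R ?c)" by (simp add: integrable_indicator_iff)
  note ii = Bochner_Integration.integrable_add[OF iP this]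
  have eq: "PQ (?k s) + indicator {t} s *\<^sub>R ?c = indicator {0..t} s *\<^sub>R h s" for s
    using h[of s] t linear_0[OF bounded_linear.linear[OF bounded_linear_PQ]] by (cases "s = t") (auto simp: indicator_def)
  show "set_integrable lebesgue {0..t} h" unfolding set_integrable_def using ii unfolding eq .
  have "(LINT s:{0..t}|lebesgue. h s) = (LINT s|lebesgue. PQ (?k s))"
    unfolding set_lebesgue_integral_def
  proof (rule integral_cong_AE)
    show "AE s in lebesgue. indicator {0..t} s *\<^sub>R h s = PQ (?k s)"
      using AE_lebesgue_neq[of t] by eventually_elim (simp flip: eq)
    show "(%s. indicator {0..t} s *\<^sub>R h s) \<in> borel_measurable lebesgue" using borel_measurable_integrable[OF ii] unfolding eq .
  qed (rule borel_measurable_integrable[OF iP])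
  also have "\<dots> = PQ (conv (frac_kernel \<gamma>) g t)"
    unfolding conv_def set_lebesgue_integral_def by (rule integral_bounded_linear[OF bounded_linear_PQ i])
  finally show "(LINT s:{0..t}|lebesgue. h s) = PQ (conv (frac_kernel \<gamma>) g t)" .
qed

text \<open>Both integrals of the mild formulation are A^(-1/2) of convolutions with the fractional
  kernels, and the free term is A^(-1/2) of the evolution; the integrability that the definition
  demands comes out along the way.\<close>

lemma mild_rhs:
  assumes X: "X \<in> admissible T" and u: "\<And>t. t \<in> {-r..T} ==> u t = Q (X t)" and t: "0 < t" "t \<le> T"
  shows "set_integrable lebesgue {0..t} (G1 t u)"
    and "set_integrable lebesgue {0..t} (G2 t u)"
    and "rhs X t \<in> H"
    and "S_a t (\<phi> 0) + (LINT s:{0..t}|lebesgue. G1 t u s)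
      + (LINT s:{0..t}|lebesgue. G2 t u s) = Q (rhs X t)"
proof -
  obtain M where M: "0 < M" "\<And>s. -r \<le> s ==> s \<le> T ==> norm (X s) \<le> M" by (rule admissible_bounded[OF X]) (rule that)
  have Xt: "X \<in> admissible t" by (rule admissible_mono[OF X t(2)])
  have Mt: "norm (X s) \<le> M" if "-r \<le> s" "s \<le> t" for s using M(2) that t by simp
  have XH: "X s \<in> H" if "0 \<le> s" "s \<le> T" for s using admissible_in[OF X] that r by simp
  \<comment> \<open>Along a path bounded by M the convective term equals its truncation, whose
    continuity in time is known.\<close>
  have tr: "truncated M s X = convective (X s)" if "0 \<le> s" "s \<le> t" for s
    using Mt[of s] that r M(1) by (simp add: truncated_def retract_id)
  obtain K where K: "\<And>t X. X \<in> admissible t ==> continuous_on {0..t} (%s. truncated M s X)"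
    by (rule truncated_lipschitz[OF M(1)]) (rule that)
  have cc: "continuous_on {0..t} (%s. convective (X s))"
    using K[OF Xt] by (rule continuous_on_eq) (simp add: tr)
  have mc: "(%s. convective (X s)) \<in> borel_measurable (lebesgue_on {0..t})"
    by (rule continuous_imp_measurable_on_sets_lebesgue[OF cc]) simp
  have "bounded ((%s. convective (X s)) ` {0..t})" by (intro compact_imp_bounded compact_continuous_image cc) simp
  then obtain B where "\<forall>y\<in>(%s. convective (X s)) ` {0..t}. norm y \<le> B" unfolding bounded_iff by blast
  then have B: "norm (convective (X s)) \<le> B" if "0 \<le> s" "s \<le> t" for s using that by auto
  have mf: "(%s. force s X) \<in> borel_measurable (lebesgue_on {0..t})" by (rule force_measurable_admissible[OF Xt]) (use t in simp)
  have bf: "norm (force s X) \<le> L * M" if "0 \<le> s" "s \<le> t" for s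
    by (rule force_bound[OF Xt that]) (use Mt that in auto)
  have h1: "G1 t u s = PQ (K1 (t - s) (convective (X s)))" if s: "0 \<le> s" "s < t" for s
  proof -
    have "u s = Q (X s)" using u s t r by simp
    moreover have c: "convective (X s) \<in> H" using XH[of s] s t by (intro convective(1)) simp
    ultimately show ?thesis
      using T_op_quarter[OF c, of "t - s"] frac_kernel_in[OF c, of "t - s" "3/4"] s
      by (simp add: T_op_F_def PQ_eq flip: convective_def)
  qed
  have h2: "G2 t u s = PQ (K2 (t - s) (force s X))" if s: "0 \<le> s" "s < t" for s
  proof -
    have "history r u s = hist r X s"
      unfolding hist_def history_def using u s t by (intro restrict_ext) auto
    moreover have c: "force s X \<in> H" using force_in_L2_sigma[OF Xt] s by simp
    ultimately show ?thesis
      using T_op_half[OF c, of "t - s"] frac_kernel_in[OF c, of "t - s" "1/2"] s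
      by (simp add: PQ_eq force_def)
  qed
  have t0: "0 \<le> t" using t by simp
  note I1 = integral_PQ_kernel[OF _ _ mc t0 B h1]
  note I2 = integral_PQ_kernel[OF _ _ mf t0 bf h2]
  show "set_integrable lebesgue {0..t} (G1 t u)" by (rule I1(1)) auto
  show "set_integrable lebesgue {0..t} (G2 t u)" by (rule I2(1)) auto
  have e1: "(LINT s:{0..t}|lebesgue. G1 t u s) = PQ (conv K1 (%s. convective (X s)) t)" by (rule I1(2)) auto
  have e2: "(LINT s:{0..t}|lebesgue. G2 t u s) = PQ (conv K2 (%s. force s X) t)" by (rule I2(2)) auto
  have z: "initial 0 \<in> H" "\<phi> 0 = Q (initial 0)" using initial(2,3) r by simp_all
  have e0: "S_a t (\<phi> 0) = PQ (evolution (initial 0) t)"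
    unfolding z(2) using S_op_evolution[OF z(1) t(1)] evolution_in[OF z(1) t0] by (simp add: PQ_eq)
  show rH: "rhs X t \<in> H"
    using rhs_truncated_in[OF M(1) t0 Xt t0 order_refl] rhs_truncated_eq[OF M(1), of t X] Mt r by simp
  show "S_a t (\<phi> 0) + (LINT s:{0..t}|lebesgue. G1 t u s)
      + (LINT s:{0..t}|lebesgue. G2 t u s) = Q (rhs X t)"
    unfolding e0 e1 e2 PQ_eq[OF rH, symmetric] unfolding rhs_def
    by (simp add: linear_add[OF bounded_linear.linear[OF bounded_linear_PQ]])
qed

text \<open>Since A^(-1/2) is injective on L^2_sigma, the equations for u and for X = A^(1/2) u
  determine each other, and the remaining arguments can be carried out for X.\<close>

lemma mild_solution_iff:
  assumes T: "0 < T"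
  shows "mild T u \<longleftrightarrow> (\<exists>X. sol T X \<and> (\<forall>t\<in>{-r..T}. u t = Q (X t)))"
proof
  assume u: "mild T u"
  define X where "X t = root_A (u t)" for t
  have ch: "continuous_half \<Omega> {0..T} u" and u\<phi>: "\<And>t. t \<in> {-r..0} ==> u t = \<phi> t"
    using u by (auto simp: mild_solution_def)
  note c = continuous_half_root[OF ch, folded X_def]
  have X0: "X t = initial t" if "t \<in> {-r..0}" for t using u\<phi>[OF that] by (simp add: X_def initial_def)
  have un: "{-r..T} = {-r..0} \<union> {0..T}" using r T by auto
  have "continuous_on {-r..0} X" using initial(1) by (rule continuous_on_eq) (simp add: X0)
  then have "continuous_on {-r..T} X" unfolding un using c(1) by (intro continuous_on_closed_Un) auto
  moreover have "X t \<in> H" "u t = Q (X t)" if "t \<in> {-r..T}" for t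
    using that initial(2,3)[of t] u\<phi>[of t] X0[of t] c(2,3)[of t] unfolding un by auto
  ultimately have X: "X \<in> admissible T" "\<And>t. t \<in> {-r..T} ==> u t = Q (X t)"
    by (auto simp: admissible_def X0)
  have "X t = rhs X t" if t: "t \<in> {0..T}" for t
  proof (cases "t = 0")
    case True
    then show ?thesis using X0[of 0] r by (simp add: rhs_0)
  next
    case False
    then have t': "0 < t" "t \<le> T" using t by auto
    have "u t = Q (rhs X t)"
      using u t' mild_rhs(4)[OF X t'] by (simp add: mild_solution_def)
    then have "root_A (u t) = rhs X t" using root_A_Q[OF mild_rhs(3)[OF X t']] by simp
    then show ?thesis by (subst X_def)
  qed
  then show "\<exists>X. sol T X \<and> (\<forall>t\<in>{-r..T}. u t = Q (X t))" using X unfolding sol_def by blast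
next
  assume "\<exists>X. sol T X \<and> (\<forall>t\<in>{-r..T}. u t = Q (X t))"
  then obtain X where sX: "sol T X" and u: "\<And>t. t \<in> {-r..T} ==> u t = Q (X t)" by blast
  have X: "X \<in> admissible T" using sX by (simp add: sol_def)
  show "mild T u"
    unfolding mild_solution_def
  proof (intro conjI ballI)
    have "continuous_on {0..T} X" by (rule continuous_on_subset[of "{-r..T}"]) (use X r in \<open>auto simp: admissible_def\<close>)
    then show "continuous_half \<Omega> {0..T} u"
      unfolding continuous_half_iff using admissible_in[OF X] u r by (intro exI[of _ X]) auto
    show "u t = \<phi> t" if "t \<in> {-r..0}" for t using u[of t] X that T initial(3)[of t] by (simp add: admissible_def)
    fix t assume "t \<in> {0<..T}"
    then have t: "0 < t" "t \<le> T" by auto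
    note m = mild_rhs[OF X u t]
    show "set_integrable lebesgue {0..t} (G1 t u)"
      "set_integrable lebesgue {0..t} (G2 t u)"
      by (rule m(1,2); assumption)+
    have "u t = Q (rhs X t)" using u[of t] sX t r by (simp add: sol_def)
    then show "u t = S_a t (\<phi> 0) + (LINT s:{0..t}|lebesgue. G1 t u s)
      + (LINT s:{0..t}|lebesgue. G2 t u s)"
      using m(4) by simp
  qed
qed

definition times :: "real set" where "times = {T. 0 < T \<and> (\<exists>X. sol T X)}"

text \<open>By \<open>sol_unique\<close> the value does not depend on which solution is picked, so
  this glues all local solutions into one path.\<close>

definition Xmax :: "real => l2" where
  "Xmax t = (SOME x. \<exists>T\<in>times. \<exists>X. sol T X \<and> t \<le> T \<and> x = X t)"

definition tmax :: ereal where "tmax = (SUP T\<in>times. ereal T)"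

lemma Xmax_eq:
  assumes X: "sol T X" and T: "0 < T" and t: "-r \<le> t" "t \<le> T"
  shows "Xmax t = X t"
proof -
  have "\<exists>T\<in>times. \<exists>Y. sol T Y \<and> t \<le> T \<and> X t = Y t" using X T t by (auto simp: times_def)
  from someI[of "%x. \<exists>T\<in>times. \<exists>Y. sol T Y \<and> t \<le> T \<and> x = Y t", OF this, folded Xmax_def]
  obtain T' Y where Y: "T' \<in> times" "sol T' Y" "t \<le> T'" "Xmax t = Y t" by blast
  then have m: "0 \<le> min T T'" "t \<le> min T T'" using T t by (auto simp: times_def)
  have "X t = Y t"
    by (rule sol_unique[OF sol_mono[OF X] sol_mono[OF Y(2)] m(1) t(1) m(2)]) auto
  then show ?thesis using Y(4) by simp
qed

lemma times_nonempty: "\<exists>T. T \<in> times"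
  using sol_extend[OF sol_initial] by (auto simp: times_def)

text \<open>The set of solution times is closed downwards by restriction and open upwards by
  \<open>sol_extend\<close>, so its supremum is not attained.\<close>

lemma less_tmax_iff:
  assumes "0 < T"
  shows "ereal T < tmax \<longleftrightarrow> T \<in> times"
proof
  assume "ereal T < tmax"
  then obtain T' where "T' \<in> times" "T < T'" unfolding tmax_def less_SUP_iff by auto
  then show "T \<in> times" using assms sol_mono[of T' _ T] by (auto simp: times_def)
next
  assume "T \<in> times"
  then obtain X where "sol T X" by (auto simp: times_def)
  then obtain \<tau> Y where "0 < \<tau>" "sol (T + \<tau>) Y" using sol_extend[of T X] assms by auto
  then have "T + \<tau> \<in> times" using assms by (auto simp: times_def)
  then show "ereal T < tmax" unfolding tmax_def less_SUP_iff using \<open>0 < \<tau>\<close> by (intro bexI[of _ "T + \<tau>"]) auto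
qed

lemma tmax_pos: "0 < tmax"
proof -
  obtain T where "T \<in> times" using times_nonempty by blast
  moreover have "0 < T" using calculation by (simp add: times_def)
  ultimately have "ereal 0 < ereal T" "ereal T < tmax" using less_tmax_iff by auto
  then show ?thesis by (metis less_trans zero_ereal_def)
qed

lemma sol_Xmax:
  assumes "T \<in> times"
  shows "sol T Xmax"
proof -
  obtain X where X: "sol T X" "0 < T" using assms by (auto simp: times_def)
  have eq: "X t = Xmax t" if "t \<in> {-r..T}" for t using Xmax_eq[OF X] that by simp
  have "continuous_on {-r..T} Xmax"
    by (rule continuous_on_eq[of _ X]) (use X eq in \<open>auto simp: sol_def admissible_def\<close>)
  moreover have "Xmax s \<in> H" if "s \<in> {-r..T}" for s
    using eq[OF that] admissible_in[of X T s] X(1) that by (simp add: sol_def)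
  moreover have "Xmax s = initial s" if "s \<in> {-r..0}" for s
    using eq[of s] X that by (simp add: sol_def admissible_def)
  ultimately have adm: "Xmax \<in> admissible T" by (simp add: admissible_def)
  have "rhs Xmax t = rhs X t" if t: "t \<in> {0..T}" for t
  proof -
    have 1: "conv K1 (%s. convective (Xmax s)) t = conv K1 (%s. convective (X s)) t"
      unfolding conv_def by (rule set_lebesgue_integral_cong) (use t r eq in auto)
    have h: "hist r Xmax s = hist r X s" if "s \<in> {0..t}" for s
      unfolding hist_def history_def using that t eq by (intro restrict_ext) auto
    have 2: "conv K2 (%s. force s Xmax) t = conv K2 (%s. force s X) t"
      unfolding conv_def by (rule set_lebesgue_integral_cong) (auto simp: force_def h)
    show ?thesis by (simp add: rhs_def 1 2)
  qed
  then show ?thesis using adm X eq r by (auto simp: sol_def)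
qed

lemma mild_upto:
  assumes "0 < s" "s \<le> tmax"
  shows "mild_upto s (%t. Q (Xmax t))"
  unfolding mild_solution_upto_def
proof (intro conjI allI impI)
  fix T :: real assume T: "0 < T" "ereal T < s"
  then have "T \<in> times" using less_tmax_iff assms(2) by (metis less_le_trans)
  then show "mild T (%t. Q (Xmax t))"
    unfolding mild_solution_iff[OF T(1)] using sol_Xmax by blast
qed (rule assms)

lemma mild_eq_Xmax:
  assumes v: "mild T v" and T: "0 < T" and t: "-r \<le> t" "t \<le> T"
  shows "v t = Q (Xmax t)" "T \<in> times"
proof -
  obtain X where X: "sol T X" "\<forall>t\<in>{-r..T}. v t = Q (X t)" using v unfolding mild_solution_iff[OF T] by blast
  show "v t = Q (Xmax t)" using X(2) Xmax_eq[OF X(1) T t] t by simp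
  show "T \<in> times" using X T by (auto simp: times_def)
qed

lemma mild_upto_eq_Xmax:
  assumes v: "mild_upto s v" and t: "-r \<le> t" "ereal t < s"
  shows "v t = Q (Xmax t)"
proof -
  have s0: "0 < s" using v by (simp add: mild_solution_upto_def)
  then have "max 0 (ereal t) < s" using t by simp
  then obtain T where T: "max 0 (ereal t) < ereal T" "ereal T < s" using ereal_dense2 by blast
  then have "0 < T" "t \<le> T" by auto
  then show ?thesis using v T(2) t by (intro mild_eq_Xmax(1)[of T]) (auto simp: mild_solution_upto_def)
qed

text \<open>An extension reaching some T \<ge> \<open>tmax\<close> would make T a solution time,
  against \<open>less_tmax_iff\<close>.\<close>

lemma maximal_Xmax: "maximal_mild tmax (%t. Q (Xmax t))"
  unfolding maximal_mild_solution_def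
proof (intro conjI notI)
  show "mild_upto tmax (%t. Q (Xmax t))" by (rule mild_upto[OF tmax_pos order_refl])
  assume "\<exists>T v. tmax \<le> ereal T \<and> mild T v \<and> (\<forall>t\<ge>-r. ereal t < tmax \<longrightarrow> v t = Q (Xmax t))"
  then obtain T v where T: "tmax \<le> ereal T" "mild T v" by blast
  have T0: "0 < T" using less_le_trans[OF tmax_pos T(1)] by simp
  have "T \<in> times" by (rule mild_eq_Xmax(2)[OF T(2) T0, of T]) (use T0 r in auto)
  then show False using T(1) less_tmax_iff[OF T0] by simp
qed

text \<open>A longer interval would produce a solution time beyond the supremum; for a shorter one
  the glued solution is a proper extension.\<close>

lemma maximal_time_unique:
  assumes v: "maximal_mild s v"
  shows "s = tmax"
proof (rule antisym; rule leI; rule notI)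
  have up: "mild_upto s v" and mx: "\<And>T w. s \<le> ereal T ==> mild T w ==> \<not> (\<forall>t\<ge>-r. ereal t < s \<longrightarrow> w t = v t)"
    using v by (auto simp: maximal_mild_solution_def)
  have s0: "0 < s" using up by (simp add: mild_solution_upto_def)
  show False if lt: "tmax < s"
  proof -
    obtain T where T: "tmax < ereal T" "ereal T < s" using ereal_dense2[OF lt] by blast
    have T0: "0 < T" using less_trans[OF tmax_pos T(1)] by simp
    have "mild T v" using up T(2) T0 by (simp add: mild_solution_upto_def)
    from mild_eq_Xmax(2)[OF this T0, of T] have "T \<in> times" using T0 r by simp
    then show False using T(1) less_tmax_iff[OF T0] by simp
  qed
  show False if lt: "s < tmax"
  proof -
    obtain T where T: "s < ereal T" "ereal T < tmax" using ereal_dense2[OF lt] by blast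
    have T0: "0 < T" using less_trans[OF s0 T(1)] by simp
    have "mild T (%t. Q (Xmax t))"
      using mild_upto[OF tmax_pos order_refl] T T0 by (simp add: mild_solution_upto_def)
    moreover have "\<forall>t\<ge>-r. ereal t < s \<longrightarrow> Q (Xmax t) = v t" using mild_upto_eq_Xmax[OF up] by simp
    ultimately show False using mx[of T] T(1) by auto
  qed
qed

text \<open>If the limit superior were finite, some R would bound the path on all of [0, t0). The
  path then agrees on (0, t0) with the truncated solution, which exists up to t0 and inherits the
  bound there by continuity, so t0 becomes a solution time.\<close>

lemma blow_up:
  assumes fin: "tmax < \<infinity>"
  shows "Limsup (at_left (real_of_ereal tmax)) (%t. ereal (frac_norm \<Omega> (1/2) (Q (Xmax t)))) = \<infinity>"
proof (rule ccontr)
  define t0 where "t0 = real_of_ereal tmax"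
  have t0: "tmax = ereal t0" "0 < t0" using fin tmax_pos unfolding t0_def by (cases tmax; simp)+
  assume "Limsup (at_left (real_of_ereal tmax)) (%t. ereal (frac_norm \<Omega> (1/2) (Q (Xmax t)))) \<noteq> \<infinity>"
  then have "Limsup (at_left t0) (%t. ereal (frac_norm \<Omega> (1/2) (Q (Xmax t)))) < \<infinity>" unfolding t0_def by simp
  then obtain c :: real where "Limsup (at_left t0) (%t. ereal (frac_norm \<Omega> (1/2) (Q (Xmax t)))) < ereal c"
    using ereal_dense2 by blast
  then have "\<forall>\<^sub>F t in at_left t0. ereal (frac_norm \<Omega> (1/2) (Q (Xmax t))) < ereal c" by (rule Limsup_lessD)
  then obtain b where b: "b < t0" "\<And>t. b < t ==> t < t0 ==> frac_norm \<Omega> (1/2) (Q (Xmax t)) < c"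
    unfolding eventually_at_left_field by auto
  \<comment> \<open>Up to this midpoint the path is bounded as a solution on a compact interval;
    beyond it the bound c near t0 takes over.\<close>
  define b' where "b' = (max b 0 + t0) / 2"
  have b': "0 < b'" "b < b'" "b' < t0" using b(1) t0(2) by (auto simp: b'_def)
  have tm: "T \<in> times" if "0 < T" "T < t0" for T using less_tmax_iff[OF that(1)] that(2) t0(1) by simp
  obtain M where M: "0 < M" "\<And>s. -r \<le> s ==> s \<le> b' ==> norm (Xmax s) \<le> M"
    by (rule sol_bounded[OF sol_Xmax[OF tm[OF b'(1,3)]]]) (rule that)
  define R where "R = M + \<bar>c\<bar>"
  have R: "0 < R" using M(1) by (simp add: R_def)
  have bound: "norm (Xmax t) \<le> R" if t: "0 \<le> t" "t < t0" for t
  proof (cases "t \<le> b'")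
    case True
    then show ?thesis using M(2)[of t] t r by (simp add: R_def)
  next
    case False
    then have tb: "b < t" "0 < t" using b' by auto
    have "Xmax t \<in> H" using sol_Xmax[OF tm[OF tb(2) t(2)]] t r admissible_in[of Xmax t t] by (simp add: sol_def)
    then have "frac_norm \<Omega> (1/2) (Q (Xmax t)) = norm (Xmax t)" by (simp add: frac_norm_def root_A_Q)
    then show ?thesis using b(2)[OF tb(1) t(2)] M(1) by (simp add: R_def)
  qed
  have t0': "0 \<le> t0" using t0 by simp
  obtain Y where Y: "Y \<in> admissible t0" "\<forall>t\<in>{0..t0}. Y t = rhs_truncated R Y t"
    using truncated_exists[OF R t0'] by blast
  have eq: "Xmax s = Y s" if s: "0 < s" "s < t0" for s
    by (rule sol_eq_truncated[OF sol_Xmax[OF tm[OF s]] _ _ R bound Y(1) Y(2)[rule_format]]) (use s r in auto)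
  have Yb: "norm (Y s) \<le> R" if s: "0 < s" "s < t0" for s using eq[OF s] bound[of s] s by simp
  have cY: "continuous_on {0..t0} (%s. norm (Y s))"
    by (rule continuous_on_norm[OF continuous_on_subset[of "{-r..t0}"]]) (use Y(1) r in \<open>auto simp: admissible_def\<close>)
  have "closure {0<..<t0} = {0..t0}" using t0 by simp
  then have Yb': "norm (Y s) \<le> R" if "s \<in> {0..t0}" for s
    using continuous_le_on_closure[of "{0<..<t0}" "%s. norm (Y s)" s R] cY that Yb by simp
  have "sol t0 Y" by (rule truncated_sol[OF Y(1) Y(2)[rule_format] R Yb']) auto
  then have "t0 \<in> times" using t0 by (auto simp: times_def)
  then show False using less_tmax_iff[OF t0(2)] t0(1) by simp
qed

end

theorem theorem4p1:
  fixes \<Omega> :: "(real^3) set"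
    and \<alpha> r \<rho> \<eta> p L\<^sub>f :: real
    and f :: "real \<Rightarrow> (real \<Rightarrow> l2) \<Rightarrow> l2"
    and \<omega> :: "real \<Rightarrow> real"
    and \<phi> :: "real \<Rightarrow> l2"
  assumes \<Omega>: "C2_domain \<Omega>" "bounded \<Omega>"
    and \<alpha>: "0 < \<alpha>" "\<alpha> < 1"
    and r: "0 < r"
    and contour: "0 < \<rho>" "pi / 2 < \<eta>" "\<eta> < pi"
    and f: "\<And>t \<psi>. 0 \<le> t \<Longrightarrow> \<psi> \<in> Y_half \<Omega> r \<Longrightarrow> f t \<psi> \<in> L2_on \<Omega>"
    and Pf: "\<And>t \<psi>. 0 \<le> t \<Longrightarrow> \<psi> \<in> Y_half \<Omega> r \<Longrightarrow> helmholtz_proj \<Omega> (f t \<psi>) \<in> L2_sigma \<Omega>"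
    and measurable: "\<And>\<psi>. \<psi> \<in> Y_half \<Omega> r \<Longrightarrow>
      (\<lambda>t. helmholtz_proj \<Omega> (f t \<psi>)) \<in> borel_measurable (lebesgue_on {0..})"
    and \<omega>: "p > 2 / \<alpha>" "Lp_loc p \<omega>"
    and growth: "\<And>t \<psi>. 0 \<le> t \<Longrightarrow> \<psi> \<in> Y_half \<Omega> r \<Longrightarrow>
      norm (helmholtz_proj \<Omega> (f t \<psi>)) \<le> \<omega> t * Y_norm \<Omega> r \<psi>"
    and L\<^sub>f: "0 < L\<^sub>f"
    and lipschitz: "\<And>t \<psi> \<xi>. 0 \<le> t \<Longrightarrow> \<psi> \<in> Y_half \<Omega> r \<Longrightarrow> \<xi> \<in> Y_half \<Omega> r \<Longrightarrow>
      norm (helmholtz_proj \<Omega> (f t \<psi>) - helmholtz_proj \<Omega> (f t \<xi>))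
        \<le> L\<^sub>f * Y_norm \<Omega> r (\<lambda>\<theta>. \<psi> \<theta> - \<xi> \<theta>)"
    and \<phi>: "\<phi> \<in> Y_half \<Omega> r"
  shows "\<exists>tmax u.
    maximal_mild_solution \<Omega> \<rho> \<eta> \<alpha> r f \<phi> tmax u \<and>
    (\<forall>v. mild_solution_upto \<Omega> \<rho> \<eta> \<alpha> r f \<phi> tmax v \<longrightarrow>
       (\<forall>t\<ge>-r. ereal t < tmax \<longrightarrow> v t = u t)) \<and>
    (\<forall>s v. maximal_mild_solution \<Omega> \<rho> \<eta> \<alpha> r f \<phi> s v \<longrightarrow> s = tmax) \<and>
    (tmax < \<infinity> \<longrightarrow>
       Limsup (at_left (real_of_ereal tmax)) (\<lambda>t. ereal (frac_norm \<Omega> (1/2) (u t))) = \<infinity>)"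
proof -
  interpret fractional_stokes \<Omega> \<eta> \<alpha> \<rho>
    by unfold_locales (use \<Omega> \<alpha> contour in \<open>auto simp: C2_domain_def\<close>)
  have z: "(0::l2) \<in> L2_sigma \<Omega>" by (rule subspace_0[OF subspace_L2_sigma])
  interpret delay_problem \<Omega> \<eta> \<alpha> \<rho> r L\<^sub>f f \<phi>
  proof (unfold_locales; (rule r L\<^sub>f Pf measurable lipschitz \<phi>; assumption)?)
    \<comment> \<open>The zero history has norm 0, so the growth bound makes the projected force
      vanish there.\<close>
    fix t :: real assume t: "0 \<le> t"
    let ?z = "hist r (%s. 0) 0"
    have zY: "?z \<in> Y_half \<Omega> r" by (rule hist_in_Y_half[of r 0]) (auto simp: z)
    have "frac_norm \<Omega> (1/2) (?z \<theta>) = 0" if "\<theta> \<in> {-r..0}" for \<theta>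
      using that by (simp add: hist_def history_def frac_norm_def root_A_Q[OF z])
    then have "Y_norm \<Omega> r ?z = (SUP \<theta>\<in>{-r..0}. 0)" unfolding Y_norm_def by (intro SUP_cong) auto
    then have "Y_norm \<Omega> r ?z = 0" using r by simp
    then show "helmholtz_proj \<Omega> (f t ?z) = 0" using growth[OF t zY] by simp
  qed
  show ?thesis
    using maximal_Xmax mild_upto_eq_Xmax maximal_time_unique blow_up
    by (intro exI[of _ tmax] exI[of _ "%t. Q (Xmax t)"]) blast
qed

end
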